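(* Let $(\vec U^h,P^h,\vec X^h,\kappa^h)$ be a solution of the semidiscrete continuous-in-time scheme (a)--(d), and suppose that the characteristic function of the interior $\Omega^h_-(t)$ of $\Gamma^h(t)$ belongs to the pressure space, i.e. $\mathcal X_{\Omega^h_-(t)}\in\mathbb P^h(t)$. Then the volumes of the two phases are conserved: $$\frac{\rm d}{{\rm d}t}\,\mathcal L^d(\Omega^h_-(t))=0.$$
   Context: $d\in\{2,3\}$, $\Omega\subset\mathbb R^d$ is a polyhedral domain, $T>0$, $\mathcal L^d$ is Lebesgue measure. $(\cdot,\cdot)$ is the $L^2$ inner product on $\Omega$; $\underline{\underline D}(\vec u)=\frac12(\nabla\vec u+(\nabla\vec u)^T)$. For $t\in[0,T]$, $\mathcal T^h(t)$ is a regular partitioning of $\Omega$ into disjoint open simplices, $\mathbb U^h(t)\subset H^1_0(\Omega,\mathbb R^d)$ and $\mathbb P^h(t)\subset L^2(\Omega)$ are finite element spaces for velocity and pressure, and $\widehat{\mathbb P}^h(t)=\{\varphi\in\mathbb P^h(t):\int_\Omega\varphi=0\}$. (Typical pressure spaces are the piecewise constants, the continuous piecewise linears, or their sum on $\mathcal T^h(t)$, each possibly enriched by the single function $\mathcal X_{\Omega^h_-(t)}$.) $\Gamma^h(t)\subset\overline\Omega$, $t\in[0,T]$, is an evolving closed polyhedral surface without self-intersections, i.e. a union of closures of disjoint open non-degenerate $(d-1)$-simplices $\sigma_j(t)$ without hanging vertices, with fixed connectivity and vertices $\vec q_k(t)$ depending differentiably on $t$. $\Omega^h_-(t)$ and $\Omega^h_+(t)$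 are its interior and its exterior in $\Omega$, and $\vec\nu^h$ is the piecewise constant unit normal pointing into $\Omega^h_+(t)$. $W(\Gamma^h(t))$ is the space of continuous scalar functions on $\Gamma^h(t)$ that are affine on each $\sigma_j(t)$, and $\underline V(\Gamma^h(t))=[W(\Gamma^h(t))]^d$. $\vec X^h(t)\in\underline V(\Gamma^h(t))$ is the identity function on $\Gamma^h(t)$, and $\vec X^h_t\in\underline V(\Gamma^h(t))$ is the velocity with nodal values $\frac{\rm d}{{\rm d}t}\vec q_k(t)$ at $\vec q_k(t)$. $\nabla_s$ is the surface gradient on $\Gamma^h(t)$; $\langle v,w\rangle_{\Gamma^h(t)}=\int_{\Gamma^h(t)}v\cdot w\,d\mathcal H^{d-1}$; and $\langle v,w\rangle^h_{\Gamma^h(t)}=\frac1d\sum_j\mathcal H^{d-1}(\sigma_j(t))\sum_{\vec q\text{ vertex of }\sigma_j(t)}(v\cdot w)(\vec q^-)$, where $\vec q^-$ denotes the limit from within $\sigma_j(t)$. $\gamma>0$, $\mu_\pm>0$; $\mu^h(t)$ is piecewise constant on $\mathcal T^h(t)$, equal to $\mu_-$ on elements contained in $\Omega^h_-(t)$, $\mu_+$ on elements contained in $\Omega^h_+(t)$, $\frac12(\mu_-+\mu_+)$ on elements intersecting $\Gamma^h(t)$. $\vec f^h$ is the continuous piecewise quadratic nodal interpolant of the forcing $\vec f(t)$. Semidiscrete scheme: given $\Gamma^h(0)$, for $t\in(0,T]$ find $\vec U^h(t)\in\mathbb U^h(t)$, $P^h(t)\in\widehat{\mathbb P}^h(t)$,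 $\vec X^h(t)\in\underline V(\Gamma^h(t))$, $\kappa^h(t)\in W(\Gamma^h(t))$ with (a) $2(\mu^h\underline{\underline D}(\vec U^h),\underline{\underline D}(\vec\xi))-(P^h,\nabla\cdot\vec\xi)-\gamma\langle\kappa^h\vec\nu^h,\vec\xi\rangle_{\Gamma^h(t)}=(\vec f^h,\vec\xi)$ for all $\vec\xi\in\mathbb U^h(t)$; (b) $(\nabla\cdot\vec U^h,\varphi)=0$ for all $\varphi\in\widehat{\mathbb P}^h(t)$; (c) $\langle\vec X^h_t,\chi\vec\nu^h\rangle^h_{\Gamma^h(t)}-\langle\vec U^h,\chi\vec\nu^h\rangle_{\Gamma^h(t)}=0$ for all $\chi\in W(\Gamma^h(t))$; (d) $\langle\kappa^h\vec\nu^h,\vec\eta\rangle^h_{\Gamma^h(t)}+\langle\nabla_s\vec X^h,\nabla_s\vec\eta\rangle_{\Gamma^h(t)}=0$ for all $\vec\eta\in\underline V(\Gamma^h(t))$.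
   Formalization: The pressure space is additionally assumed to contain the constant functions (as all the typical ones do; the claim fails e.g. if it is spanned by the characteristic function alone), and the surface is assumed to admit the normal from interior to exterior, so components are not nested. *)

theory Defs
  imports "HOL-Analysis.Analysis"
begin

section \<open>Sobolev functions\<close>

primrec cont_diff :: "nat \<Rightarrow> ('a::euclidean_space \<Rightarrow> real) \<Rightarrow> bool" where
  "cont_diff 0 f \<longleftrightarrow> continuous_on UNIV f"
| "cont_diff (Suc m) f \<longleftrightarrow>
     (\<forall>x. f differentiable (at x)) \<and>
     (\<forall>b\<in>Basis. cont_diff m (\<lambda>x. frechet_derivative f (at x) b))"

definition test_functions :: "(real^'n) set \<Rightarrow> (real^'n \<Rightarrow> real) set" where
  "test_functions \<Omega> = {\<phi>. (\<forall>m. cont_diff m \<phi>) \<and>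
     compact (closure {x. \<phi> x \<noteq> 0}) \<and> closure {x. \<phi> x \<noteq> 0} \<subseteq> \<Omega>}"

definition partial_deriv :: "'n \<Rightarrow> (real^'n \<Rightarrow> real) \<Rightarrow> real^'n \<Rightarrow> real" where
  "partial_deriv k \<phi> x = frechet_derivative \<phi> (at x) (axis k 1)"

definition square_integrable :: "(real^'n) set \<Rightarrow> (real^'n \<Rightarrow> real) \<Rightarrow> bool" where
  "square_integrable \<Omega> f \<longleftrightarrow>
     f \<in> borel_measurable (lebesgue_on \<Omega>) \<and> integrable (lebesgue_on \<Omega>) (\<lambda>x. (f x)\<^sup>2)"

text \<open>Used for scalars, vectors and matrices; on matrices the inner product of the library is the
  Frobenius product.\<close>

definition L2_inner :: "(real^'n) set \<Rightarrow> (real^'n \<Rightarrow> 'b::real_inner) \<Rightarrow> (real^'n \<Rightarrow> 'b) \<Rightarrow> real" where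
  "L2_inner \<Omega> v w = (LINT x|lebesgue_on \<Omega>. v x \<bullet> w x)"

definition is_weak_partial ::
    "(real^'n) set \<Rightarrow> 'n \<Rightarrow> (real^'n \<Rightarrow> real) \<Rightarrow> (real^'n \<Rightarrow> real) \<Rightarrow> bool" where
  "is_weak_partial \<Omega> k u g \<longleftrightarrow> square_integrable \<Omega> g \<and>
     (\<forall>\<phi>\<in>test_functions \<Omega>. L2_inner \<Omega> u (partial_deriv k \<phi>) = - L2_inner \<Omega> g \<phi>)"

text \<open>The weak derivative is only determined up to null sets; a representative is chosen.\<close>

definition weak_partial :: "(real^'n) set \<Rightarrow> 'n \<Rightarrow> (real^'n \<Rightarrow> real) \<Rightarrow> real^'n \<Rightarrow> real" where
  "weak_partial \<Omega> k u = (SOME g. is_weak_partial \<Omega> k u g)"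

definition H1 :: "(real^'n) set \<Rightarrow> (real^'n \<Rightarrow> real) set" where
  "H1 \<Omega> = {u. square_integrable \<Omega> u \<and> (\<forall>k. \<exists>g. is_weak_partial \<Omega> k u g)}"

text \<open>The closure of the test functions in the \<open>H1\<close> norm.\<close>

definition H1_0 :: "(real^'n) set \<Rightarrow> (real^'n \<Rightarrow> real) set" where
  "H1_0 \<Omega> = {u \<in> H1 \<Omega>. \<exists>\<phi>. (\<forall>m::nat. \<phi> m \<in> test_functions \<Omega>) \<and>
     (\<lambda>m. (LINT x|lebesgue_on \<Omega>. (\<phi> m x - u x)\<^sup>2) +
          (\<Sum>k\<in>UNIV. LINT x|lebesgue_on \<Omega>. (partial_deriv k (\<phi> m) x - weak_partial \<Omega> k u x)\<^sup>2))
       \<longlonglongrightarrow> 0}"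

definition H1_0_vec :: "(real^'n) set \<Rightarrow> (real^'n \<Rightarrow> real^'n) set" where
  "H1_0_vec \<Omega> = {v. \<forall>i. (\<lambda>x. v x $ i) \<in> H1_0 \<Omega>}"

definition divergence :: "(real^'n) set \<Rightarrow> (real^'n \<Rightarrow> real^'n) \<Rightarrow> real^'n \<Rightarrow> real" where
  "divergence \<Omega> v x = (\<Sum>i\<in>UNIV. weak_partial \<Omega> i (\<lambda>y. v y $ i) x)"

definition sym_grad :: "(real^'n) set \<Rightarrow> (real^'n \<Rightarrow> real^'n) \<Rightarrow> real^'n \<Rightarrow> real^'n^'n" where
  "sym_grad \<Omega> v x = (\<chi> i j. (weak_partial \<Omega> j (\<lambda>y. v y $ i) x +
                             weak_partial \<Omega> i (\<lambda>y. v y $ j) x) / 2)"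


section \<open>Hausdorff measure\<close>

definition hausdorff_pre :: "nat \<Rightarrow> real \<Rightarrow> 'a::metric_space set \<Rightarrow> ennreal" where
  "hausdorff_pre m \<delta> A =
     (INF C\<in>{C :: nat \<Rightarrow> 'a set. A \<subseteq> (\<Union>i. C i) \<and> (\<forall>i. bounded (C i) \<and> diameter (C i) \<le> \<delta>)}.
        \<Sum>i. if C i = {} then 0
            else ennreal (unit_ball_vol (real m) * (diameter (C i) / 2) ^ m))"

definition hausdorff_outer :: "nat \<Rightarrow> 'a::metric_space set \<Rightarrow> ennreal" where
  "hausdorff_outer m A = (SUP \<delta>\<in>{0<..}. hausdorff_pre m \<delta> A)"

text \<open>The metric outer measure \<^const>\<open>hausdorff_outer\<close> is countably additive on Borel sets
  (Caratheodory's criterion), so it is the value of the following measure on every Borel set.\<close>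

definition hausdorff_measure :: "nat \<Rightarrow> 'a::metric_space measure" where
  "hausdorff_measure m = measure_of UNIV (sets borel) (hausdorff_outer m)"


section \<open>Polyhedral domains and finite element spaces\<close>

definition polyhedral_domain :: "(real^'n) set \<Rightarrow> bool" where
  "polyhedral_domain \<Omega> \<longleftrightarrow> open \<Omega> \<and> connected \<Omega> \<and> bounded \<Omega> \<and> \<Omega> \<noteq> {} \<and>
     (\<exists>\<F>. finite \<F> \<and> (\<forall>B\<in>\<F>. polytope B \<and> aff_dim B = int CARD('n) - 1) \<and> frontier \<Omega> = \<Union>\<F>)"

text \<open>A mesh is given by its closed simplices; the open elements are their interiors. Regularity
  (no hanging nodes) is part of \<^const>\<open>triangulation\<close>.\<close>

definition mesh_of :: "(real^'n) set \<Rightarrow> (real^'n) set set \<Rightarrow> bool" where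
  "mesh_of \<Omega> \<T> \<longleftrightarrow> triangulation \<T> \<and> (\<forall>S\<in>\<T>. int CARD('n) simplex S \<and> interior S \<subseteq> \<Omega>) \<and>
     \<Union>\<T> = closure \<Omega>"

definition finite_span :: "('a \<Rightarrow> 'b::real_vector) set \<Rightarrow> bool" where
  "finite_span V \<longleftrightarrow> (\<exists>B. finite B \<and> V = {(\<lambda>x. \<Sum>b\<in>B. c b *\<^sub>R b x) | c. True})"

text \<open>Conforming velocity spaces. Their elements are represented by the continuous function in
  their \<open>L2\<close> class, which is what is integrated over the surface.\<close>

definition velocity_space ::
    "(real^'n) set \<Rightarrow> (real^'n) set set \<Rightarrow> (real^'n \<Rightarrow> real^'n) set \<Rightarrow> bool" where
  "velocity_space \<Omega> \<T> V \<longleftrightarrow> finite_span V \<and> V \<subseteq> H1_0_vec \<Omega> \<and>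
     (\<forall>v\<in>V. continuous_on (closure \<Omega>) v \<and> (\<forall>x\<in>frontier \<Omega>. v x = 0) \<and>
        (\<forall>S\<in>\<T>. \<exists>p. polynomial_function p \<and> (\<forall>x\<in>S. v x = p x)))"

definition L2_mem :: "(real^'n) set \<Rightarrow> (real^'n \<Rightarrow> real) \<Rightarrow> (real^'n \<Rightarrow> real) set \<Rightarrow> bool" where
  "L2_mem \<Omega> \<phi> P \<longleftrightarrow> (\<exists>\<psi>\<in>P. AE x in lebesgue_on \<Omega>. \<phi> x = \<psi> x)"

text \<open>Pressure spaces consist of piecewise polynomials, possibly enriched by the characteristic
  function of \<open>A\<close>, and contain the constants.\<close>

definition pressure_space ::
    "(real^'n) set \<Rightarrow> (real^'n) set set \<Rightarrow> (real^'n) set \<Rightarrow> (real^'n \<Rightarrow> real) set \<Rightarrow> bool" where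
  "pressure_space \<Omega> \<T> A P \<longleftrightarrow> finite_span P \<and> (\<forall>p\<in>P. square_integrable \<Omega> p) \<and>
     L2_mem \<Omega> (\<lambda>x. 1) P \<and>
     (\<forall>p\<in>P. \<exists>a. \<forall>S\<in>\<T>. \<exists>g. real_polynomial_function g \<and>
        (AE x in lebesgue_on (interior S). p x = g x + a * indicator A x))"

definition zero_mean :: "(real^'n) set \<Rightarrow> (real^'n \<Rightarrow> real) set \<Rightarrow> (real^'n \<Rightarrow> real) set" where
  "zero_mean \<Omega> P = {\<phi>\<in>P. (LINT x|lebesgue_on \<Omega>. \<phi> x) = 0}"

definition quadratic_interpolant ::
    "(real^'n) set set \<Rightarrow> (real^'n \<Rightarrow> real^'n) \<Rightarrow> (real^'n \<Rightarrow> real^'n) \<Rightarrow> bool" where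
  "quadratic_interpolant \<T> f f\<^sub>h \<longleftrightarrow> continuous_on (\<Union>\<T>) f\<^sub>h \<and>
     (\<forall>S\<in>\<T>. (\<forall>i. \<exists>c b (A :: real^'n^'n). \<forall>x\<in>S. f\<^sub>h x $ i = c + b \<bullet> x + x \<bullet> (A *v x)) \<and>
        (\<forall>a b. a extreme_point_of S \<and> b extreme_point_of S \<longrightarrow>
               f\<^sub>h (midpoint a b) = f (midpoint a b)))"


section \<open>Polyhedral surfaces\<close>

text \<open>A surface is given by its connectivity \<open>F\<close>, a set of sets of vertex labels, and the positions
  \<open>p\<close> of the vertices.\<close>

definition facet :: "('k \<Rightarrow> real^'n) \<Rightarrow> 'k set \<Rightarrow> (real^'n) set" where
  "facet p s = convex hull (p ` s)"

definition surface :: "'k set set \<Rightarrow> ('k \<Rightarrow> real^'n) \<Rightarrow> (real^'n) set" where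
  "surface F p = (\<Union>s\<in>F. facet p s)"

text \<open>The last conjunct says that the surface is a topological manifold of dimension \<open>d - 1\<close>
  without boundary.\<close>

definition closed_polyhedral_surface :: "'k set set \<Rightarrow> ('k \<Rightarrow> real^'n) \<Rightarrow> bool" where
  "closed_polyhedral_surface F p \<longleftrightarrow> finite F \<and> F \<noteq> {} \<and> inj_on p (\<Union>F) \<and>
     (\<forall>s\<in>F. card s = CARD('n) \<and> (int CARD('n) - 1) simplex (facet p s)) \<and>
     triangulation (facet p ` F) \<and>
     (\<forall>x\<in>surface F p. \<exists>N i. openin (top_of_set (surface F p)) N \<and> x \<in> N \<and>
        N homeomorphic {v :: real^'n. v $ i = 0})"

definition inner_phase :: "(real^'n) set \<Rightarrow> 'k set set \<Rightarrow> ('k \<Rightarrow> real^'n) \<Rightarrow> (real^'n) set" where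
  "inner_phase \<Omega> F p = inside (surface F p) \<inter> \<Omega>"

definition outer_phase :: "(real^'n) set \<Rightarrow> 'k set set \<Rightarrow> ('k \<Rightarrow> real^'n) \<Rightarrow> (real^'n) set" where
  "outer_phase \<Omega> F p = outside (surface F p) \<inter> \<Omega>"

text \<open>The direction refers to the interior and exterior of the surface in the whole space, since
  parts of the surface may lie on the boundary of the domain. The value on lower-dimensional faces,
  where there is no normal, is immaterial and set to 0.\<close>

definition unit_normal :: "'k set set \<Rightarrow> ('k \<Rightarrow> real^'n) \<Rightarrow> (real^'n \<Rightarrow> real^'n) \<Rightarrow> bool" where
  "unit_normal F p \<nu> \<longleftrightarrow>
     (\<forall>s\<in>F. \<exists>n. norm n = 1 \<and> (\<forall>x\<in>facet p s. \<forall>y\<in>facet p s. n \<bullet> (x - y) = 0) \<and>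
        (\<forall>x\<in>rel_interior (facet p s). \<nu> x = n \<and>
           (\<forall>\<^sub>F \<epsilon> in at_right 0. x + \<epsilon> *\<^sub>R n \<in> outside (surface F p) \<and>
                               x - \<epsilon> *\<^sub>R n \<in> inside (surface F p)))) \<and>
     (\<forall>x. x \<notin> (\<Union>s\<in>F. rel_interior (facet p s)) \<longrightarrow> \<nu> x = 0)"

definition W_space :: "'k set set \<Rightarrow> ('k \<Rightarrow> real^'n) \<Rightarrow> (real^'n \<Rightarrow> real) set" where
  "W_space F p = {w. continuous_on (surface F p) w \<and>
     (\<forall>s\<in>F. \<exists>a c. \<forall>x\<in>facet p s. w x = a \<bullet> x + c)}"

definition V_space :: "'k set set \<Rightarrow> ('k \<Rightarrow> real^'n) \<Rightarrow> (real^'n \<Rightarrow> real^'n) set" where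
  "V_space F p = {v. \<forall>i. (\<lambda>x. v x $ i) \<in> W_space F p}"

definition surface_inner ::
    "'k set set \<Rightarrow> ('k \<Rightarrow> real^'n) \<Rightarrow> (real^'n \<Rightarrow> 'b::real_inner) \<Rightarrow> (real^'n \<Rightarrow> 'b) \<Rightarrow> real" where
  "surface_inner F p v w = (LINT x:surface F p|hausdorff_measure (CARD('n) - 1). v x \<bullet> w x)"

definition lumped_inner ::
    "'k set set \<Rightarrow> ('k \<Rightarrow> real^'n) \<Rightarrow> (real^'n \<Rightarrow> 'b::real_inner) \<Rightarrow> (real^'n \<Rightarrow> 'b) \<Rightarrow> real" where
  "lumped_inner F p v w = 1 / real CARD('n) *
     (\<Sum>s\<in>F. measure (hausdorff_measure (CARD('n) - 1)) (facet p s) *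
        (\<Sum>k\<in>s. Lim (at (p k) within rel_interior (facet p s)) (\<lambda>x. v x \<bullet> w x)))"

text \<open>The gradient along the facet containing \<open>x\<close> in its relative interior, as a vector in the
  tangent space of that facet; 0 on lower-dimensional faces.\<close>

definition surface_grad ::
    "'k set set \<Rightarrow> ('k \<Rightarrow> real^'n) \<Rightarrow> (real^'n \<Rightarrow> real) \<Rightarrow> real^'n \<Rightarrow> real^'n" where
  "surface_grad F p f x =
     (if \<exists>s\<in>F. x \<in> rel_interior (facet p s)
      then THE g. \<exists>s\<in>F. x \<in> rel_interior (facet p s) \<and>
             g \<in> span {y - z | y z. y \<in> facet p s \<and> z \<in> facet p s} \<and>
             (f has_derivative (\<lambda>h. g \<bullet> h)) (at x within facet p s)
      else 0)"

definition surface_grad_vec ::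
    "'k set set \<Rightarrow> ('k \<Rightarrow> real^'n) \<Rightarrow> (real^'n \<Rightarrow> real^'n) \<Rightarrow> real^'n \<Rightarrow> real^'n^'n" where
  "surface_grad_vec F p v x = (\<chi> i. surface_grad F p (\<lambda>y. v y $ i) x)"


section \<open>Viscosity\<close>

definition viscosity ::
    "(real^'n) set set \<Rightarrow> (real^'n) set \<Rightarrow> (real^'n) set \<Rightarrow> real \<Rightarrow> real \<Rightarrow> real^'n \<Rightarrow> real" where
  "viscosity \<T> A\<^sub>m A\<^sub>p \<mu>\<^sub>m \<mu>\<^sub>p x =
     (if \<exists>S\<in>\<T>. x \<in> interior S \<and> interior S \<subseteq> A\<^sub>m then \<mu>\<^sub>m
      else if \<exists>S\<in>\<T>. x \<in> interior S \<and> interior S \<subseteq> A\<^sub>p then \<mu>\<^sub>p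
      else (\<mu>\<^sub>m + \<mu>\<^sub>p) / 2)"

end

theory Submission
  imports Defs
begin

text \<open>Testing (c) with the constant 1 equates the flux of the mesh velocity through the surface, computed
  by the lumped product, with the flux of the fluid velocity. On a facet the normal component of the
  mesh velocity is affine, so the vertex rule is exact and the lumped flux is the rate of change of
  the volume of the bounded region. The flux of the fluid velocity is the integral of its divergence
  over the interior, by the divergence theorem. Testing (b) with the characteristic function of the
  interior minus its mean, and using that functions in \<open>H1_0\<close> have divergence of mean zero, this
  integral vanishes.

  Both fluxes are reduced to Lebesgue measure. For almost every \<open>x\<close>, the indicator of the interior at
  \<open>x\<close> is the signed number of facets hit by the ray from \<open>x\<close> in a fixed direction \<open>v\<close>. Applied to the
  direction in which a single vertex moves, this gives the change of volume; applied to a coordinate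
  direction and a difference quotient, it gives the divergence theorem. On a hyperplane Hausdorff
  measure is a constant multiple of the Lebesgue measure of a slab of width 1. The constant cancels
  and is never computed.

  The interiors of nearby surfaces correspond under a Lipschitz perturbation of the identity that
  interpolates the motion of the vertices. It also shows that the part of the interior outside the
  closed domain does not depend on time.\<close>

section \<open>Translation invariant measures\<close>

text \<open>Several vertices moving at once give no simple formula for the enclosed volume, whereas
  one vertex moving along v changes the column of each adjacent facet by exactly one simplex. The
  vertices are therefore moved one after another, and the derivative uses only that the normals of
  the intermediate configurations converge. For these configurations just the notion
  \<open>sided\<close> is propagated, which is stable under maps close to the identity and is all
  that the crossing count requires. The sign of a determinant depends on how the vertices of a facet
  are numbered; \<sigma> corrects it. Exactness of the vertex rule appears as the equality of two
  weights, without integrating an affine function. A moving vertex enters the volume with a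
  determinant divided by d!, and the lumped product gives it one d-th of the area of the facet,
  where the area is the length of \<open>facet_normal\<close> divided by (d - 1)!. The region
  enclosed by the surface can reach beyond the domain if the domain has holes. Hence the volume of
  all of \<open>inside\<close> is differentiated, and the passage to the phases is made at the
  end.\<close>

lemma translation_invariant_measure_unique:
  fixes M N :: "'a::euclidean_space measure" and G :: "'a set"
  assumes sets: "sets M = sets borel" "sets N = sets borel"
    and sf: "sigma_finite_measure M" "sigma_finite_measure N"
    and carrier: "AE x in M. x \<in> G" "AE x in N. x \<in> G"
    and inv: "\<And>h. h \<in> G \<Longrightarrow> distr M borel ((+) h) = M" "\<And>h. h \<in> G \<Longrightarrow> distr N borel ((+) h) = N"
    and neg: "\<And>h. h \<in> G \<Longrightarrow> - h \<in> G" and refl: "distr N borel uminus = N"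
    and AQ: "A \<in> sets borel" "Q \<in> sets borel"
  shows "emeasure M A * emeasure N Q = emeasure N A * emeasure M Q"
proof -
  interpret M: sigma_finite_measure M by fact
  interpret N: sigma_finite_measure N by fact
  interpret pair_sigma_finite M N ..
  have [measurable_cong]: "sets M = sets borel" "sets N = sets borel" by fact+
  have [measurable]: "A \<in> sets borel" "Q \<in> sets borel" by fact+
  have trM: "(\<integral>\<^sup>+x. f (h + x) \<partial>M) = (\<integral>\<^sup>+x. f x \<partial>M)" if "h \<in> G" "f \<in> borel_measurable borel" for h f
    using that by (subst (2) inv(1)[OF that(1), symmetric]) (simp add: nn_integral_distr)
  have trN: "(\<integral>\<^sup>+x. f (h + x) \<partial>N) = (\<integral>\<^sup>+x. f x \<partial>N)" if "h \<in> G" "f \<in> borel_measurable borel" for h f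
    using that by (subst (2) inv(2)[OF that(1), symmetric]) (simp add: nn_integral_distr)
  have rfN: "(\<integral>\<^sup>+x. f (- x) \<partial>N) = (\<integral>\<^sup>+x. f x \<partial>N)" if "f \<in> borel_measurable borel" for f
    using that by (subst (2) refl[symmetric]) (simp add: nn_integral_distr)
  have "emeasure M A * emeasure N Q = (\<integral>\<^sup>+x. indicator A x * (\<integral>\<^sup>+y. indicator Q y \<partial>N) \<partial>M)"
    by (simp add: nn_integral_multc sets)
  also have "\<dots> = (\<integral>\<^sup>+x. (\<integral>\<^sup>+y. indicator A x * indicator Q (x + y) \<partial>N) \<partial>M)"
  proof (rule nn_integral_cong_AE, use carrier(1) in eventually_elim)
    fix x assume "x \<in> G"
    then show "indicator A x * (\<integral>\<^sup>+y. indicator Q y \<partial>N) = (\<integral>\<^sup>+y. indicator A x * indicator Q (x + y) \<partial>N)"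
      using trN[of x "indicator Q"] by (simp add: nn_integral_cmult)
  qed
  also have "\<dots> = (\<integral>\<^sup>+y. (\<integral>\<^sup>+x. indicator A x * indicator Q (x + y) \<partial>M) \<partial>N)"
    by (rule Fubini'[symmetric]) measurable
  also have "\<dots> = (\<integral>\<^sup>+y. (\<integral>\<^sup>+x. indicator A (x - y) * indicator Q x \<partial>M) \<partial>N)"
  proof (rule nn_integral_cong_AE, use carrier(2) in eventually_elim)
    fix y assume "y \<in> G"
    then show "(\<integral>\<^sup>+x. indicator A x * indicator Q (x + y) \<partial>M) = (\<integral>\<^sup>+x. indicator A (x - y) * indicator Q x \<partial>M)"
      using trM[of y "\<lambda>x. indicator A (x - y) * indicator Q x"] by (simp add: add.commute)
  qed
  also have "\<dots> = (\<integral>\<^sup>+x. (\<integral>\<^sup>+y. indicator A (x - y) * indicator Q x \<partial>N) \<partial>M)"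
    by (rule Fubini') measurable
  also have "\<dots> = (\<integral>\<^sup>+x. emeasure N A * indicator Q x \<partial>M)"
  proof (rule nn_integral_cong_AE, use carrier(1) in eventually_elim)
    fix x assume x: "x \<in> G"
    have "(\<integral>\<^sup>+y. indicator A (x - y) \<partial>N) = (\<integral>\<^sup>+y. indicator A (x + y) \<partial>N)"
      using rfN[of "\<lambda>y. indicator A (x + y)"] by simp
    also have "\<dots> = emeasure N A" using trN[OF x, of "indicator A"] by (simp add: sets)
    finally show "(\<integral>\<^sup>+y. indicator A (x - y) * indicator Q x \<partial>N) = emeasure N A * indicator Q x"
      by (simp add: nn_integral_multc)
  qed
  also have "\<dots> = emeasure N A * emeasure M Q" by (simp add: nn_integral_cmult sets)
  finally show ?thesis .
qed

section \<open>Lebesgue measure under linear maps\<close>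

lemma lborel_distr_translation: "distr lborel borel ((+) h) = (lborel :: 'a::euclidean_space measure)"
  using lborel_affine[of 1 h] by (simp add: density_1)

lemma lborel_distr_uminus_eq: "distr lborel borel uminus = (lborel :: 'a::euclidean_space measure)"
  using lborel_affine[of "-1" "0::'a"] by (simp add: density_1)

text \<open>The push-forward under the linear part is translation invariant, because a translation
  by h comes from the translation by the preimage of h under g. Uniqueness makes it a multiple of
  Lebesgue measure, with the factor read off on the unit box; the shift by b is absorbed
  afterwards.\<close>

lemma distr_lborel_affine_bij:
  fixes g :: "'a::euclidean_space \<Rightarrow> 'a"
  assumes g: "linear g" "inj g"
  shows "\<exists>c\<ge>0. distr lborel borel (\<lambda>x. b + g x) = density lborel (\<lambda>_. ennreal c)"
proof -
  have cont: "continuous_on S g" for S by (intro linear_continuous_on linear_conv_bounded_linear[THEN iffD1] g)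
  have [measurable]: "g \<in> borel_measurable borel" by (intro borel_measurable_continuous_onI cont)
  obtain f where f: "linear f" "\<And>x. f (g x) = x" "\<And>x. g (f x) = x"
    using linear_injective_isomorphism[OF g] by metis
  define M where "M = distr lborel borel g"
  have im: "g -` A = f ` A" for A using f by (auto simp: image_iff) (metis f(2))
  have M: "emeasure M A = emeasure lborel (f ` A)" if "A \<in> sets borel" for A
    using that by (simp add: M_def emeasure_distr im)
  have fin: "emeasure M S < \<infinity>" if "bounded S" "S \<in> sets borel" for S
    unfolding M[OF that(2)]
    by (intro emeasure_bounded_finite bounded_linear_image that linear_conv_bounded_linear[THEN iffD1] f)
  have sf: "sigma_finite_measure M"
  proof (unfold_locales, intro exI[of _ "range (\<lambda>n::nat. cball 0 (real n))"] conjI)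
    show "\<Union> (range (\<lambda>n. cball 0 (real n))) = space M" by (auto simp: M_def real_arch_simple)
    show "\<forall>a\<in>range (\<lambda>n::nat. cball 0 (real n)). emeasure M a \<noteq> \<infinity>" using fin by (auto simp: less_top)
  qed (auto simp: M_def)
  have tr: "distr M borel ((+) h) = M" for h
  proof -
    have "distr M borel ((+) h) = distr lborel borel (\<lambda>x. h + g x)"
      by (simp add: M_def distr_distr o_def)
    also have "\<dots> = distr (distr lborel borel ((+) (f h))) borel g"
      by (subst distr_distr) (auto simp: o_def linear_add[OF g(1)] f)
    finally show ?thesis by (simp add: lborel_distr_translation M_def)
  qed
  define c where "c = enn2real (emeasure M (cbox 0 One))"
  have "emeasure M A * emeasure lborel (cbox 0 One :: 'a set) = emeasure lborel A * emeasure M (cbox 0 One)"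
    if "A \<in> sets borel" for A
    using that by (intro translation_invariant_measure_unique[where G=UNIV])
      (auto simp: sf tr lborel_distr_translation lborel_distr_uminus_eq, simp_all add: M_def lborel.sigma_finite_measure_axioms)
  moreover have "emeasure M (cbox 0 One) = ennreal c"
    using fin[of "cbox 0 One"] by (simp add: c_def less_top)
  moreover have "emeasure lborel (cbox 0 One :: 'a set) = 1" by (simp add: emeasure_lborel_cbox_eq inner_Basis)
  ultimately have Mc: "emeasure M A = emeasure lborel A * ennreal c" if "A \<in> sets borel" for A using that by simp
  have "M = density lborel (\<lambda>_. ennreal c)"
  proof (rule measure_eqI)
    show "sets M = sets (density lborel (\<lambda>_. ennreal c))" by (simp add: M_def)
    fix A assume "A \<in> sets M"
    then have A: "A \<in> sets borel" by (simp add: M_def)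
    then show "emeasure M A = emeasure (density lborel (\<lambda>_. ennreal c)) A"
      by (simp add: Mc emeasure_density_const mult.commute)
  qed
  moreover have "distr lborel borel (\<lambda>x. b + g x) = distr M borel ((+) b)"
    by (simp add: M_def distr_distr o_def)
  ultimately show ?thesis using tr by (intro exI[of _ c]) (simp add: c_def)
qed

lemma linear_bij_measure_factor:
  fixes f :: "'a::euclidean_space \<Rightarrow> 'a"
  assumes "linear f" "inj f"
  shows "measure lebesgue (f ` cbox a b) = measure lebesgue (f ` cbox 0 One) * measure lebesgue (cbox a b)"
proof -
  obtain g where g: "linear g" "\<And>x. g (f x) = x" "\<And>x. f (g x) = x"
    using linear_injective_isomorphism[OF assms] by metis
  have gm: "g \<in> borel_measurable borel"
    by (intro borel_measurable_continuous_onI linear_continuous_on linear_conv_bounded_linear[THEN iffD1] g)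
  have "inj g" using g(3) by (metis injI)
  then obtain c where c: "0 \<le> c" "distr lborel borel g = density lborel (\<lambda>_. ennreal c)"
    using distr_lborel_affine_bij[OF g(1), of 0] by auto
  have im: "g -` A = f ` A" for A by (auto simp: image_iff g) (metis g(3))
  have fb: "f ` cbox a b \<in> sets borel" for a b
    by (intro borel_compact compact_continuous_image linear_continuous_on linear_conv_bounded_linear[THEN iffD1] assms compact_cbox)
  have "emeasure lborel (f ` cbox a b) = ennreal c * emeasure lborel (cbox a b)" for a b
    using gm by (simp add: im[symmetric] c(2)[symmetric] emeasure_distr flip: emeasure_density_const)
  from arg_cong[OF this, of enn2real] have "measure lebesgue (f ` cbox a b) = c * measure lebesgue (cbox a b)" for a b
    using fb c(1) by (simp add: measure_def enn2real_mult)
  then show ?thesis by (simp add: content_cbox)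
qed

text \<open>Induction over elementary maps. For transpositions and shears the factor is checked on
  the unit box alone, and \<open>one\<close> extends it to all measurable sets. A transposition is
  an involution that preserves the box, so its determinant has modulus 1.\<close>

lemma
  fixes f :: "real^'n \<Rightarrow> real^'n"
  assumes "linear f" "S \<in> lmeasurable"
  shows lmeasurable_linear_image_cart: "f ` S \<in> lmeasurable"
    and measure_linear_image_cart: "measure lebesgue (f ` S) = \<bar>det (matrix f)\<bar> * measure lebesgue S"
proof -
  let ?Q = "\<lambda>f::real^'n \<Rightarrow> real^'n. \<lambda>S. f ` S \<in> lmeasurable \<and> measure lebesgue (f ` S) = \<bar>det (matrix f)\<bar> * measure lebesgue S"
  have one: "?Q f S" if "linear f" "inj f" "measure lebesgue (f ` cbox 0 One) = \<bar>det (matrix f)\<bar>" "S \<in> lmeasurable" for f S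
  proof -
    have "measure lebesgue (f ` cbox a b) = \<bar>det (matrix f)\<bar> * measure lebesgue (cbox a b)" for a b
      using linear_bij_measure_factor[OF that(1,2), of a b] unfolding that(3) .
    from measure_linear_sufficient[OF that(1,4) this] show ?thesis by simp
  qed
  have One1: "(One::real^'n) $ i = 1" for i by (simp add: cart_eq_inner_axis axis_in_Basis_iff)
  have sq1: "x = 1" if "x * x = 1" "0 \<le> x" for x :: real
    using that square_eq_1_iff[of x] by auto
  have "\<forall>S\<in>lmeasurable. ?Q f S"
  proof (rule induct_linear_elementary[OF \<open>linear f\<close>]; intro ballI)
    fix f g :: "real^'n \<Rightarrow> real^'n" and S :: "(real^'n) set"
    assume *: "linear f" "linear g" "\<forall>S\<in>lmeasurable. ?Q f S" "\<forall>S\<in>lmeasurable. ?Q g S" "S \<in> lmeasurable"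
    have "?Q g S" using *(4,5) by (rule bspec)
    moreover from this have "?Q f (g ` S)" using bspec[OF *(3), of "g ` S"] by simp
    ultimately show "?Q (f \<circ> g) S"
      by (simp add: matrix_compose[OF *(2,1)] det_mul abs_mult image_comp)
  next
    fix f :: "real^'n \<Rightarrow> real^'n" and i :: 'n and S :: "(real^'n) set"
    assume *: "linear f" "\<And>x. f x $ i = 0" "S \<in> lmeasurable"
    have "\<not> surj f" using *(2) by (metis surj_def axis_nth zero_neq_one)
    then have "\<not> inj f" using *(1) linear_injective_imp_surjective by blast
    then show "?Q f S" using negligible_linear_singular_image[OF *(1)] det_nz_iff_inj[OF *(1)]
      by (auto simp: negligible_imp_measure0 negligible_imp_measurable)
  next
    fix c and S :: "(real^'n) set" assume S: "S \<in> lmeasurable"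
    show "?Q (\<lambda>x. \<chi> i. c i * x $ i) S"
      by (simp add: measure_stretch[OF S, of c] measurable_stretch[OF S, of c] axis_def matrix_def det_diagonal)
  next
    fix m n :: 'n and S :: "(real^'n) set" assume mn: "m \<noteq> n" and S: "S \<in> lmeasurable"
    let ?h = "\<lambda>x::real^'n. \<chi> i. x $ Transposition.transpose m n i"
    have lin: "linear ?h" by (rule linearI) (simp_all add: vec_eq_iff)
    have hh: "?h (?h x) = x" for x by (simp add: vec_eq_iff)
    have inj: "inj ?h" by (rule inj_on_inverseI[where g="?h"]) (rule hh)
    have "\<bar>det (matrix ?h)\<bar> * \<bar>det (matrix ?h)\<bar> = \<bar>det (matrix (?h \<circ> ?h))\<bar>"
      by (simp add: matrix_compose[OF lin lin] det_mul abs_mult)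
    also have "?h \<circ> ?h = id" using hh by (simp add: o_def id_def)
    finally have "\<bar>det (matrix ?h)\<bar> * \<bar>det (matrix ?h)\<bar> = 1" by (simp add: matrix_id_mat_1)
    then have det: "\<bar>det (matrix ?h)\<bar> = 1" using sq1[of "\<bar>det (matrix ?h)\<bar>"] by simp
    have sub: "?h ` cbox 0 One \<subseteq> cbox 0 One" by (auto simp: mem_box_cart One1 simp del: sum_component)
    have "cbox 0 One = ?h ` ?h ` cbox 0 One" by (simp add: image_image hh)
    also have "\<dots> \<subseteq> ?h ` cbox 0 One" by (rule image_mono[OF sub])
    finally have "?h ` cbox 0 One = cbox 0 One" using sub by blast
    then have "measure lebesgue (?h ` cbox 0 One) = 1" by (simp add: content_cbox)
    then show "?Q ?h S" using one[OF lin inj _ S] det by simp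
  next
    fix m n :: 'n and S :: "(real^'n) set" assume mn: "m \<noteq> n" and S: "S \<in> lmeasurable"
    let ?h = "\<lambda>x::real^'n. \<chi> i. if i = m then x $ m + x $ n else x $ i"
    have lin: "linear ?h" by (rule linearI) (simp_all add: vec_eq_iff algebra_simps)
    have "matrix ?h = (\<chi> k. if k = m then row m (mat 1) + 1 *s row n (mat 1) else row k (mat 1))"
      by (simp add: matrix_def vec_eq_iff row_def mat_def axis_def)
    then have det: "det (matrix ?h) = 1" using det_row_operation[OF mn, of "mat 1" 1] by simp
    then have inj: "inj ?h" using det_nz_iff_inj[OF lin] by simp
    have "measure lebesgue (?h ` cbox 0 One) = measure lebesgue (cbox 0 (One::real^'n))"
      using mn by (intro measure_shear_interval) auto
    then show "?Q ?h S" using one[OF lin inj _ S] det by (simp add: content_cbox)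
  qed
  with assms(2) show "f ` S \<in> lmeasurable" "measure lebesgue (f ` S) = \<bar>det (matrix f)\<bar> * measure lebesgue S" by blast+
qed

section \<open>Hausdorff measure on hyperplanes\<close>

text \<open>The separate case of the empty set matters for m = 0, where the power is 1 even for
  diameter 0.\<close>

abbreviation diam_weight :: "nat \<Rightarrow> 'a::metric_space set \<Rightarrow> ennreal" where
  "diam_weight m S \<equiv> (if S = {} then 0 else ennreal (unit_ball_vol (real m) * (diameter S / 2) ^ m))"

section \<open>The Hausdorff outer measure is a metric outer measure\<close>

lemma hausdorff_pre_mono: "A \<subseteq> B \<Longrightarrow> hausdorff_pre m \<delta> A \<le> hausdorff_pre m \<delta> B"
  unfolding hausdorff_pre_def by (rule INF_superset_mono) auto

lemma hausdorff_pre_antimono: "\<delta> \<le> \<delta>' \<Longrightarrow> hausdorff_pre m \<delta>' A \<le> hausdorff_pre m \<delta> A"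
  unfolding hausdorff_pre_def by (rule INF_superset_mono) (auto intro: order_trans)

lemma hausdorff_pre_le:
  "A \<subseteq> (\<Union>i. C i) \<Longrightarrow> (\<And>i. bounded (C i)) \<Longrightarrow> (\<And>i. diameter (C i) \<le> \<delta>) \<Longrightarrow>
    hausdorff_pre m \<delta> A \<le> (\<Sum>i. diam_weight m (C i))"
  unfolding hausdorff_pre_def by (rule INF_lower) auto

lemma hausdorff_pre_empty: "0 \<le> \<delta> \<Longrightarrow> hausdorff_pre m \<delta> {} = 0"
  using hausdorff_pre_le[of "{}" "\<lambda>_. {}" \<delta> m] by auto

lemma hausdorff_pre_close:
  assumes "hausdorff_pre m \<delta> A < c"
  shows "\<exists>C. A \<subseteq> (\<Union>i. C i) \<and> (\<forall>i. bounded (C i)) \<and> (\<forall>i. diameter (C i) \<le> \<delta>) \<and> (\<Sum>i. diam_weight m (C i)) < c"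
  using assms unfolding hausdorff_pre_def INF_less_iff by auto

lemma hausdorff_pre_countably_subadditive:
  "hausdorff_pre m \<delta> (\<Union>i. A i) \<le> (\<Sum>n. hausdorff_pre m \<delta> (A n))"
proof (rule ennreal_le_epsilon)
  let ?O = "hausdorff_pre m \<delta>"
  fix e :: real assume e: "0 < e" "(\<Sum>n. ?O (A n)) < top"
  then have *: "?O (A n) < ?O (A n) + e * (1/2)^Suc n" for n
    by (auto simp add: less_top dest!: ennreal_suminf_lessD)
  have "\<exists>C. A n \<subseteq> (\<Union>i. C i) \<and> (\<forall>i. bounded (C i)) \<and> (\<forall>i. diameter (C i) \<le> \<delta>) \<and>
      (\<Sum>i. diam_weight m (C i)) < ?O (A n) + e * (1/2)^Suc n" for n
    using hausdorff_pre_close[OF *[of n]] .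
  then have "\<exists>B. \<forall>n. A n \<subseteq> (\<Union>i. B n i) \<and> (\<forall>i. bounded (B n i)) \<and> (\<forall>i. diameter (B n i) \<le> \<delta>) \<and>
      (\<Sum>i. diam_weight m (B n i)) < ?O (A n) + e * (1/2)^Suc n"
    by (intro choice allI)
  then obtain B where B0: "\<forall>n. A n \<subseteq> (\<Union>i. B n i) \<and> (\<forall>i. bounded (B n i)) \<and> (\<forall>i. diameter (B n i) \<le> \<delta>) \<and>
      (\<Sum>i. diam_weight m (B n i)) < ?O (A n) + e * (1/2)^Suc n" ..
  have B: "A n \<subseteq> (\<Union>i. B n i)" "bounded (B n i)" "diameter (B n i) \<le> \<delta>"
    and Ble: "(\<Sum>i. diam_weight m (B n i)) < ?O (A n) + e * (1/2)^Suc n" for n i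
    using spec[OF B0, of n] by simp_all
  define C where "C j = B (fst (prod_decode j)) (snd (prod_decode j))" for j
  have "(\<Union>i. A i) \<subseteq> (\<Union>i. C i)"
  proof
    fix x assume "x \<in> (\<Union>i. A i)"
    then obtain n i where "x \<in> B n i" using B(1) by blast
    then have "x \<in> C (prod_encode (n, i))" by (simp add: C_def)
    then show "x \<in> (\<Union>i. C i)" by blast
  qed
  then have "?O (\<Union>i. A i) \<le> (\<Sum>i. diam_weight m (C i))"
    by (rule hausdorff_pre_le) (auto simp: C_def B split: prod.split)
  also have "\<dots> = (\<Sum>n. \<Sum>i. diam_weight m (B n i))"
    unfolding C_def
    by (rule suminf_ennreal_2dimen[where f="\<lambda>p. diam_weight m (B (fst p) (snd p))"]) (simp only: fst_conv snd_conv)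
  also have "\<dots> \<le> (\<Sum>n. ?O (A n) + e * (1/2) ^ Suc n)"
    using Ble by (intro suminf_le less_imp_le) auto
  also have "\<dots> = (\<Sum>n. ?O (A n)) + (\<Sum>n. ennreal e * ennreal ((1/2) ^ Suc n))"
    using e by (subst suminf_add[symmetric]) (auto simp del: ennreal_suminf_cmult simp add: ennreal_mult[symmetric])
  also have "\<dots> = (\<Sum>n. ?O (A n)) + e"
    unfolding ennreal_suminf_cmult
    by (subst suminf_ennreal_eq[OF zero_le_power power_half_series]) auto
  finally show "?O (\<Union>i. A i) \<le> (\<Sum>n. ?O (A n)) + e" .
qed

lemma hausdorff_outer_SUP: "hausdorff_outer m A = (SUP n. hausdorff_pre m (1 / Suc n) A)"
  unfolding hausdorff_outer_def
proof (rule antisym)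
  show "(SUP \<delta>\<in>{0<..}. hausdorff_pre m \<delta> A) \<le> (SUP n. hausdorff_pre m (1 / Suc n) A)"
  proof (rule SUP_least)
    fix \<delta> :: real assume "\<delta> \<in> {0<..}"
    then obtain n where "1 / Suc n < \<delta>" using reals_Archimedean[of \<delta>] by (auto simp: inverse_eq_divide)
    then have "hausdorff_pre m \<delta> A \<le> hausdorff_pre m (1 / Suc n) A" by (intro hausdorff_pre_antimono) simp
    then show "hausdorff_pre m \<delta> A \<le> (SUP n. hausdorff_pre m (1 / Suc n) A)" by (rule SUP_upper2[OF UNIV_I])
  qed
qed (auto intro!: SUP_least SUP_upper)

lemma hausdorff_outer_mono: "A \<subseteq> B \<Longrightarrow> hausdorff_outer m A \<le> hausdorff_outer m B"
  unfolding hausdorff_outer_def by (intro SUP_mono) (auto intro: hausdorff_pre_mono)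

lemma hausdorff_pre_le_outer: "0 < \<delta> \<Longrightarrow> hausdorff_pre m \<delta> A \<le> hausdorff_outer m A"
  unfolding hausdorff_outer_def by (rule SUP_upper) auto

lemma hausdorff_outer_empty: "hausdorff_outer m {} = 0"
  by (simp add: hausdorff_outer_SUP hausdorff_pre_empty)

lemma hausdorff_outer_countably_subadditive:
  "hausdorff_outer m (\<Union>i. A i) \<le> (\<Sum>n. hausdorff_outer m (A n))"
  unfolding hausdorff_outer_def[of m "\<Union>i. A i"]
proof (rule SUP_least)
  fix \<delta> :: real assume "\<delta> \<in> {0<..}"
  then have "(\<Sum>n. hausdorff_pre m \<delta> (A n)) \<le> (\<Sum>n. hausdorff_outer m (A n))"
    by (intro suminf_le hausdorff_pre_le_outer) auto
  then show "hausdorff_pre m \<delta> (\<Union>i. A i) \<le> (\<Sum>n. hausdorff_outer m (A n))"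
    using hausdorff_pre_countably_subadditive order_trans by blast
qed

lemma outer_measure_space_hausdorff_outer: "outer_measure_space (Pow UNIV) (hausdorff_outer m)"
  unfolding outer_measure_space_def positive_def increasing_def countably_subadditive_def
  by (auto simp: hausdorff_outer_empty intro: hausdorff_outer_mono hausdorff_outer_countably_subadditive)

lemma hausdorff_outer_Un: "hausdorff_outer m (A \<union> B) \<le> hausdorff_outer m A + hausdorff_outer m B"
proof -
  let ?f = "\<lambda>i. if i = 0 then A else if i = (1::nat) then B else {}"
  have "(\<Union>i. ?f i) = A \<union> B" by (auto split: if_splits)
  moreover have "(\<Sum>i. hausdorff_outer m (?f i)) = (\<Sum>i\<in>{0,1}. hausdorff_outer m (?f i))"
    by (rule suminf_finite) (auto simp: hausdorff_outer_empty)
  ultimately show ?thesis using hausdorff_outer_countably_subadditive[of m ?f] by simp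
qed

text \<open>A cover by sets of diameter below d splits into the sets meeting A and the sets meeting
  B, and no set is in both groups. So the premeasures are superadditive at every scale below d, and
  the scale is refined for both sets together.\<close>

lemma hausdorff_outer_metric:
  assumes "d > 0" "\<And>x y. x \<in> A \<Longrightarrow> y \<in> B \<Longrightarrow> d \<le> dist x y"
  shows "hausdorff_outer m A + hausdorff_outer m B \<le> hausdorff_outer m (A \<union> B)"
proof -
  have *: "hausdorff_pre m \<delta> A + hausdorff_pre m \<delta> B \<le> hausdorff_pre m \<delta> (A \<union> B)" if "\<delta> < d" "0 \<le> \<delta>" for \<delta>
    unfolding hausdorff_pre_def[of m \<delta> "A \<union> B"]
  proof (rule INF_greatest, safe)
    fix C :: "nat \<Rightarrow> 'a set" assume C: "A \<union> B \<subseteq> \<Union> (range C)" "\<forall>i. bounded (C i) \<and> diameter (C i) \<le> \<delta>"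
    define CA where "CA i = (if C i \<inter> A \<noteq> {} then C i else {})" for i
    define CB where "CB i = (if C i \<inter> B \<noteq> {} then C i else {})" for i
    have "hausdorff_pre m \<delta> A \<le> (\<Sum>i. diam_weight m (CA i))"
    proof (rule hausdorff_pre_le)
      show "A \<subseteq> \<Union> (range CA)"
      proof
        fix x assume "x \<in> A"
        with C(1) obtain i where "x \<in> C i" by blast
        with \<open>x \<in> A\<close> have "x \<in> CA i" by (auto simp: CA_def)
        then show "x \<in> \<Union> (range CA)" by blast
      qed
    qed (use C(2) \<open>0 \<le> \<delta>\<close> in \<open>auto simp: CA_def\<close>)
    moreover have "hausdorff_pre m \<delta> B \<le> (\<Sum>i. diam_weight m (CB i))"
    proof (rule hausdorff_pre_le)
      show "B \<subseteq> \<Union> (range CB)"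
      proof
        fix x assume "x \<in> B"
        with C(1) obtain i where "x \<in> C i" by blast
        with \<open>x \<in> B\<close> have "x \<in> CB i" by (auto simp: CB_def)
        then show "x \<in> \<Union> (range CB)" by blast
      qed
    qed (use C(2) \<open>0 \<le> \<delta>\<close> in \<open>auto simp: CB_def\<close>)
    moreover have "(\<Sum>i. diam_weight m (CA i)) + (\<Sum>i. diam_weight m (CB i)) = (\<Sum>i. diam_weight m (CA i) + diam_weight m (CB i))"
      by (rule suminf_add) auto
    moreover have "\<dots> \<le> (\<Sum>i. diam_weight m (C i))"
    proof (rule suminf_le)
      fix i
      have "\<not> (C i \<inter> A \<noteq> {} \<and> C i \<inter> B \<noteq> {})"
      proof (rule notI)
        assume "C i \<inter> A \<noteq> {} \<and> C i \<inter> B \<noteq> {}"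
        then obtain x y where "x \<in> C i" "x \<in> A" "y \<in> C i" "y \<in> B" by blast
        then have "d \<le> dist x y" "dist x y \<le> diameter (C i)"
          using assms(2) C(2) diameter_bounded_bound by blast+
        then show False using C(2)[rule_format, of i] \<open>\<delta> < d\<close> by linarith
      qed
      then show "diam_weight m (CA i) + diam_weight m (CB i) \<le> diam_weight m (C i)"
        by (cases "C i \<inter> A = {}"; cases "C i \<inter> B = {}") (simp_all add: CA_def CB_def)
    qed auto
    ultimately show "hausdorff_pre m \<delta> A + hausdorff_pre m \<delta> B \<le> (\<Sum>i. diam_weight m (C i))"
      by (metis (no_types, lifting) add_mono order_trans)
  qed
  have inc: "incseq (\<lambda>n. hausdorff_pre m (1 / Suc n) S)" for S :: "'a set"
    by (rule incseq_SucI) (auto intro!: hausdorff_pre_antimono simp: field_simps)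
  have "hausdorff_outer m A + hausdorff_outer m B = (SUP n. hausdorff_pre m (1 / Suc n) A + hausdorff_pre m (1 / Suc n) B)"
    unfolding hausdorff_outer_SUP by (rule ennreal_SUP_add[OF inc inc, symmetric])
  also have "\<dots> \<le> hausdorff_outer m (A \<union> B)"
  proof (rule SUP_least)
    fix n
    define \<delta> where "\<delta> = min (1 / Suc n) (d/2)"
    have \<delta>: "0 < \<delta>" "\<delta> < d" "\<delta> \<le> 1 / Suc n" using \<open>d > 0\<close> by (auto simp: \<delta>_def)
    have "hausdorff_pre m (1 / Suc n) A + hausdorff_pre m (1 / Suc n) B \<le> hausdorff_pre m \<delta> A + hausdorff_pre m \<delta> B"
      by (intro add_mono hausdorff_pre_antimono \<delta>)
    also have "\<dots> \<le> hausdorff_pre m \<delta> (A \<union> B)" using \<delta> by (intro *) auto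
    also have "\<dots> \<le> hausdorff_outer m (A \<union> B)" by (rule hausdorff_pre_le_outer[OF \<delta>(1)])
    finally show "hausdorff_pre m (1 / Suc n) A + hausdorff_pre m (1 / Suc n) B \<le> hausdorff_outer m (A \<union> B)" .
  qed
  finally show ?thesis .
qed

text \<open>Caratheodory's criterion. \<open>D n\<close> keeps the distance 1/(n+1) from C, so it
  and the part of A in C are additive by separation. The rest of A - C consists of the rings
  \<open>R k\<close>. Rings with indices of equal parity are separated from each other, which bounds
  the sum of all ring measures by twice the measure of A and lets the remainder disappear in the
  limit.\<close>

lemma hausdorff_outer_closed_caratheodory:
  assumes "closed C"
  shows "hausdorff_outer m (A \<inter> C) + hausdorff_outer m (A - C) \<le> hausdorff_outer m A"
proof (cases "C = {} \<or> hausdorff_outer m A = \<infinity>")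
  case True then show ?thesis by (auto simp: hausdorff_outer_empty)
next
  case False
  then have ne: "C \<noteq> {}" and fin: "hausdorff_outer m A \<noteq> \<infinity>" by auto
  let ?H = "hausdorff_outer m"
  define D where "D n = {x\<in>A. 1 / real (Suc n) \<le> infdist x C}" for n
  define R where "R n = D (Suc n) - D n" for n
  have Dmono: "D n \<subseteq> D n'" if "n \<le> n'" for n n'
  proof -
    have "1 / real (Suc n') \<le> 1 / real (Suc n)" using that by (intro frac_le) auto
    then show ?thesis by (auto simp: D_def)
  qed
  \<comment> \<open>Between two different rings of equal parity lies a whole ring. The earlier ones
    have distance at least 1/(2N+j) from C, the new one less than 1/(2N+j+1); the difference of
    these numbers bounds the gap from below.\<close>
  have par: "(\<Sum>k<N. ?H (R (2 * k + j))) \<le> ?H (\<Union>k<N. R (2 * k + j))" for N j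
  proof (induction N)
    case (Suc N)
    have "?H (\<Union>k<N. R (2 * k + j)) + ?H (R (2 * N + j)) \<le> ?H ((\<Union>k<N. R (2 * k + j)) \<union> R (2 * N + j))"
    proof (cases "N = 0")
      case True then show ?thesis by (simp add: hausdorff_outer_empty)
    next
      case False
      show ?thesis
      proof (rule hausdorff_outer_metric)
        show "0 < 1 / real (2 * N + j) - 1 / real (Suc (2 * N + j))"
        proof -
          have "1 / real (Suc (2 * N + j)) < 1 / real (2 * N + j)"
            using False by (intro divide_strict_left_mono) auto
          then show ?thesis by simp
        qed
        fix x y assume x: "x \<in> (\<Union>k<N. R (2 * k + j))" and y: "y \<in> R (2 * N + j)"
        obtain k where "k < N" "x \<in> D (Suc (2 * k + j))" using x by (auto simp: R_def)
        moreover have "Suc (2 * k + j) \<le> 2 * N + j - 1" using \<open>k < N\<close> by linarith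
        ultimately have "x \<in> D (2 * N + j - 1)" using Dmono by blast
        then have "1 / real (2 * N + j) \<le> infdist x C" using False by (simp add: D_def)
        moreover have "infdist y C < 1 / real (Suc (2 * N + j))" using y by (auto simp: R_def D_def)
        ultimately show "1 / real (2 * N + j) - 1 / real (Suc (2 * N + j)) \<le> dist x y"
          using infdist_triangle[of x C y] by linarith
      qed
    qed
    also have "(\<Union>k<N. R (2 * k + j)) \<union> R (2 * N + j) = (\<Union>k<Suc N. R (2 * k + j))"
      by (auto simp: lessThan_Suc)
    finally have "?H (\<Union>k<N. R (2 * k + j)) + ?H (R (2 * N + j)) \<le> ?H (\<Union>k<Suc N. R (2 * k + j))" .
    with add_right_mono[OF Suc, of "?H (R (2 * N + j))"]
    have "(\<Sum>k<N. ?H (R (2 * k + j))) + ?H (R (2 * N + j)) \<le> ?H (\<Union>k<Suc N. R (2 * k + j))"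
      by (rule order_trans)
    then show ?case by (simp only: sum.lessThan_Suc)
  qed (simp add: hausdorff_outer_empty)
  have parA: "(\<Sum>k<N. ?H (R (2 * k + j))) \<le> ?H A" for N j
    using par[of j N] hausdorff_outer_mono[of "\<Union>k<N. R (2 * k + j)" A m]
    by (auto simp: R_def D_def intro: order_trans)
  have "(\<Sum>k<n. ?H (R k)) \<le> ?H A + ?H A" for n
  proof -
    have "(\<Sum>k<n. ?H (R k)) \<le> (\<Sum>k<2*n. ?H (R k))" by (rule sum_mono2) auto
    also have "\<dots> = (\<Sum>k<n. ?H (R (2 * k + 0))) + (\<Sum>k<n. ?H (R (2 * k + 1)))"
      by (induction n) (simp_all add: algebra_simps)
    also have "\<dots> \<le> ?H A + ?H A" by (intro add_mono parA)
    finally show ?thesis .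
  qed
  then have tot: "(\<Sum>k. ?H (R k)) \<le> ?H A + ?H A"
    unfolding suminf_eq_SUP by (rule SUP_least)
  \<comment> \<open>The partial sum of ring measures is added on both sides. It completes the
    remainder behind \<open>D n\<close> to the full sum, which does not depend on n and is cancelled
    at the end because it is finite.\<close>
  have le: "?H (A \<inter> C) + ?H (A - C) + (\<Sum>k<n. ?H (R k)) \<le> ?H A + (\<Sum>k. ?H (R k))" for n
  proof -
    have "A - C \<subseteq> D n \<union> (\<Union>k. R (k + n))"
    proof
      fix x assume x: "x \<in> A - C"
      then have "infdist x C > 0" using assms ne by (metis DiffD2 infdist_pos_not_in_closed)
      then obtain l where l: "1 / Suc l < infdist x C" using reals_Archimedean by (auto simp: inverse_eq_divide)
      then have ex: "x \<in> D l" using x by (simp add: D_def)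
      define k where "k = (LEAST k. x \<in> D k)"
      have k: "x \<in> D k" "\<And>l. l < k \<Longrightarrow> x \<notin> D l"
        unfolding k_def using LeastI[of "\<lambda>k. x \<in> D k" l] ex not_less_Least by auto
      show "x \<in> D n \<union> (\<Union>k. R (k + n))"
      proof (cases "k \<le> n")
        case True then show ?thesis using k Dmono by blast
      next
        case False
        then have "x \<in> R ((k - 1 - n) + n)" using k(1) k(2)[of "k-1"] by (simp add: R_def)
        then show ?thesis by blast
      qed
    qed
    then have "?H (A - C) \<le> ?H (D n) + ?H (\<Union>k. R (k + n))"
      using hausdorff_outer_mono hausdorff_outer_Un order_trans by blast
    also have "\<dots> \<le> ?H (D n) + (\<Sum>k. ?H (R (k + n)))"
      by (intro add_left_mono hausdorff_outer_countably_subadditive)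
    finally have 1: "?H (A - C) \<le> ?H (D n) + (\<Sum>k. ?H (R (k + n)))" .
    have "?H (A \<inter> C) + ?H (D n) \<le> ?H ((A \<inter> C) \<union> D n)"
    proof (rule hausdorff_outer_metric)
      show "0 < 1 / real (Suc n)" by simp
      fix x y assume "x \<in> A \<inter> C" "y \<in> D n"
      then show "1 / real (Suc n) \<le> dist x y"
        using infdist_le[of x C y] by (auto simp: D_def dist_commute)
    qed
    also have "\<dots> \<le> ?H A" by (rule hausdorff_outer_mono) (auto simp: D_def)
    finally have 2: "?H (A \<inter> C) + ?H (D n) \<le> ?H A" .
    have "?H (A \<inter> C) + ?H (A - C) + (\<Sum>k<n. ?H (R k))
        \<le> ?H (A \<inter> C) + (?H (D n) + (\<Sum>k. ?H (R (k + n)))) + (\<Sum>k<n. ?H (R k))"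
      by (intro add_mono 1 order_refl)
    also have "\<dots> = (?H (A \<inter> C) + ?H (D n)) + ((\<Sum>k. ?H (R (k + n))) + (\<Sum>k<n. ?H (R k)))"
      by (simp add: add_ac)
    also have "(\<Sum>k. ?H (R (k + n))) + (\<Sum>k<n. ?H (R k)) = (\<Sum>k. ?H (R k))"
      by (subst (2) suminf_offset[of _ n]) (auto simp: add.commute)
    also have "(?H (A \<inter> C) + ?H (D n)) + (\<Sum>k. ?H (R k)) \<le> ?H A + (\<Sum>k. ?H (R k))"
      by (intro add_right_mono 2)
    finally show ?thesis .
  qed
  have "?H (A \<inter> C) + ?H (A - C) + (\<Sum>k. ?H (R k)) = (SUP n. ?H (A \<inter> C) + ?H (A - C) + (\<Sum>k<n. ?H (R k)))"
    unfolding suminf_eq_SUP by (rule ennreal_SUP_add_right) simp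
  also have "\<dots> \<le> ?H A + (\<Sum>k. ?H (R k))" by (rule SUP_least) (rule le)
  finally have "(\<Sum>k. ?H (R k)) + (?H (A \<inter> C) + ?H (A - C)) \<le> (\<Sum>k. ?H (R k)) + ?H A"
    by (simp add: add.commute)
  moreover have "(\<Sum>k. ?H (R k)) \<noteq> \<infinity>" using tot fin by (auto simp: top_unique)
  ultimately show ?thesis by (simp add: ennreal_add_left_cancel_le)
qed

text \<open>Without this fact \<open>measure_of\<close> would return the zero measure. Closed sets
  satisfy Caratheodory's condition, and they generate the Borel sets.\<close>

lemma measure_space_hausdorff_outer:
  "measure_space UNIV (sets borel) (hausdorff_outer m :: 'a::metric_space set \<Rightarrow> ennreal)"
proof -
  interpret P: sigma_algebra "UNIV :: 'a set" "Pow UNIV" by (rule sigma_algebra_Pow)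
  let ?L = "lambda_system UNIV (Pow UNIV) (hausdorff_outer m :: 'a set \<Rightarrow> ennreal)"
  have L: "measure_space UNIV ?L (hausdorff_outer m)"
    by (rule P.caratheodory_lemma[OF outer_measure_space_hausdorff_outer])
  then interpret L: sigma_algebra UNIV ?L unfolding measure_space_def by (rule conjunct1)
  have closedL: "S \<in> ?L" if "closed S" for S :: "'a set"
  proof -
    have "hausdorff_outer m x \<le> hausdorff_outer m (x \<inter> S) + hausdorff_outer m (x - S)" for x
      using hausdorff_outer_Un[of m "x \<inter> S" "x - S"] by (simp add: Un_Diff_Int Un_commute)
    then show ?thesis
      unfolding P.lambda_system_eq using hausdorff_outer_closed_caratheodory[OF that] by (intro CollectI conjI ballI antisym) auto
  qed
  have "Collect closed \<subseteq> ?L"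
  proof
    fix S :: "'a set" assume "S \<in> Collect closed"
    then have "closed S" by simp
    then show "S \<in> ?L" by (rule closedL)
  qed
  from L.sigma_sets_subset[OF this] have "sets borel \<subseteq> ?L"
    by (simp only: borel_eq_closed sets_measure_of subset_UNIV Pow_UNIV)
  with measure_down[OF L] show ?thesis
    using sets.sigma_algebra_axioms[of borel] by simp
qed

lemma sets_hausdorff_measure [measurable_cong, simp]: "sets (hausdorff_measure m :: 'a::metric_space measure) = sets borel"
  unfolding hausdorff_measure_def using sets.sets_measure_of_eq[of "borel :: 'a measure"] by simp

lemma space_hausdorff_measure [simp]: "space (hausdorff_measure m) = UNIV"
  unfolding hausdorff_measure_def by (simp add: space_measure_of_conv)

lemma emeasure_hausdorff_measure: "A \<in> sets borel \<Longrightarrow> emeasure (hausdorff_measure m) A = hausdorff_outer m A"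
  using measure_space_hausdorff_outer[of m] unfolding hausdorff_measure_def
  by (intro emeasure_measure_of_sigma) (auto simp: measure_space_def)

section \<open>Hausdorff measure and Lebesgue measure on a hyperplane\<close>

lemma hausdorff_outer_contraction_le:
  assumes "\<And>x y. dist (f x) (f y) \<le> dist x y"
  shows "hausdorff_outer m (f ` A) \<le> hausdorff_outer m A"
  unfolding hausdorff_outer_def
proof (rule SUP_mono, intro bexI)
  fix \<delta> :: real
  show "hausdorff_pre m \<delta> (f ` A) \<le> hausdorff_pre m \<delta> A"
    unfolding hausdorff_pre_def[of m \<delta> A]
  proof (rule INF_greatest, safe)
    fix C :: "nat \<Rightarrow> 'a set" assume C: "A \<subseteq> \<Union> (range C)" "\<forall>i. bounded (C i) \<and> diameter (C i) \<le> \<delta>"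
    have im: "bounded (f ` C i) \<and> diameter (f ` C i) \<le> diameter (C i)" for i
    proof
      have bd: "dist (f x) (f y) \<le> diameter (C i)" if "x \<in> C i" "y \<in> C i" for x y
        using assms[of x y] diameter_bounded_bound[of "C i" x y] C(2) that by force
      show "bounded (f ` C i)"
      proof (cases "C i = {}")
        case False
        then obtain x where "x \<in> C i" by blast
        then show ?thesis using bd unfolding bounded_def by blast
      qed simp
      show "diameter (f ` C i) \<le> diameter (C i)"
      proof (cases "C i = {}")
        case False
        then show ?thesis unfolding diameter_def[of "f ` C i"]
          using bd by (auto intro!: cSUP_least)
      qed simp
    qed
    have "hausdorff_pre m \<delta> (f ` A) \<le> (\<Sum>i. diam_weight m (f ` C i))"
    proof (rule hausdorff_pre_le)
      show "f ` A \<subseteq> (\<Union>i. f ` C i)" using C(1) by blast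
      show "diameter (f ` C i) \<le> \<delta>" for i using im C(2) order_trans by blast
    qed (use im in blast)
    also have "\<dots> \<le> (\<Sum>i. diam_weight m (C i))"
    proof (rule suminf_le)
      fix i
      have "0 \<le> diameter (f ` C i)" using im diameter_ge_0 by blast
      then have "unit_ball_vol m * (diameter (f ` C i) / 2) ^ m \<le> unit_ball_vol m * (diameter (C i) / 2) ^ m"
        using im by (intro mult_left_mono power_mono divide_right_mono) auto
      then show "diam_weight m (f ` C i) \<le> diam_weight m (C i)" by (auto intro: ennreal_leI)
    qed auto
    finally show "hausdorff_pre m \<delta> (f ` A) \<le> (\<Sum>i. diam_weight m (C i))" .
  qed
qed

lemma hausdorff_outer_isometry:
  assumes "\<And>x y. dist (f x) (f y) = dist x y" "bij f"
  shows "hausdorff_outer m (f ` A) = hausdorff_outer m A"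
proof (rule antisym)
  show "hausdorff_outer m (f ` A) \<le> hausdorff_outer m A"
    by (rule hausdorff_outer_contraction_le) (simp add: assms)
  have "dist (inv f x) (inv f y) = dist x y" for x y
    using assms(1)[of "inv f x" "inv f y"] assms(2) by (simp add: bij_is_surj surj_f_inv_f)
  then have "hausdorff_outer m (inv f ` f ` A) \<le> hausdorff_outer m (f ` A)"
    by (intro hausdorff_outer_contraction_le) simp
  then show "hausdorff_outer m A \<le> hausdorff_outer m (f ` A)"
    using assms(2) by (simp add: image_inv_f_f bij_is_inj)
qed

lemma hausdorff_pre_finite_UN_le:
  assumes "finite K" "0 \<le> \<delta>" "\<And>k. k \<in> K \<Longrightarrow> bounded (C k)" "\<And>k. k \<in> K \<Longrightarrow> diameter (C k) \<le> \<delta>"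
  shows "hausdorff_pre m \<delta> (\<Union>k\<in>K. C k) \<le> (\<Sum>k\<in>K. diam_weight m (C k))"
  using assms
proof (induction K)
  case empty then show ?case by (simp add: hausdorff_pre_empty)
next
  case (insert k K)
  let ?f = "\<lambda>i. if i = 0 then C k else if i = (1::nat) then (\<Union>k\<in>K. C k) else {}"
  have "(\<Union>i. ?f i) = (\<Union>k\<in>insert k K. C k)" by (auto split: if_splits)
  then have "hausdorff_pre m \<delta> (\<Union>k\<in>insert k K. C k) \<le> (\<Sum>i. hausdorff_pre m \<delta> (?f i))"
    using hausdorff_pre_countably_subadditive[of m \<delta> ?f] by simp
  also have "\<dots> = (\<Sum>i\<in>{0,1}. hausdorff_pre m \<delta> (?f i))"
    by (rule suminf_finite) (auto simp: hausdorff_pre_empty insert)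
  also have "\<dots> = hausdorff_pre m \<delta> (C k) + hausdorff_pre m \<delta> (\<Union>k\<in>K. C k)" by simp
  also have "hausdorff_pre m \<delta> (C k) \<le> diam_weight m (C k)"
  proof -
    let ?g = "\<lambda>i. if i = (0::nat) then C k else {}"
    have "hausdorff_pre m \<delta> (C k) \<le> (\<Sum>i. diam_weight m (?g i))"
      by (rule hausdorff_pre_le) (use insert.prems in \<open>auto split: if_splits\<close>)
    also have "\<dots> = (\<Sum>i\<in>{0}. diam_weight m (?g i))" by (rule suminf_finite) auto
    finally show ?thesis by (cases "C k = {}") simp_all
  qed
  also have "hausdorff_pre m \<delta> (\<Union>k\<in>K. C k) \<le> (\<Sum>k\<in>K. diam_weight m (C k))"
    using insert by simp
  finally show ?case using insert(1,2) by (simp add: add_mono)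
qed

text \<open>The cube is divided into N^(d-1) cells of side 2R/N, whose diameters are at most d *
  2R/N. In the sum of their weights the powers of N cancel, so the same bound holds at every
  scale.\<close>

lemma hausdorff_outer_hyperplane_cube_finite:
  fixes i :: "'a::euclidean_space"
  assumes i: "i \<in> Basis" and R: "R > 0"
  shows "hausdorff_outer (DIM('a) - 1) {x. x \<bullet> i = 0 \<and> (\<forall>j\<in>Basis. \<bar>x \<bullet> j\<bar> \<le> R)} < \<infinity>"
proof -
  let ?m = "DIM('a) - 1"
  let ?Q = "{x::'a. x \<bullet> i = 0 \<and> (\<forall>j\<in>Basis. \<bar>x \<bullet> j\<bar> \<le> R)}"
  let ?c = "unit_ball_vol (real ?m) * (real DIM('a) * R) ^ ?m"
  have "hausdorff_pre ?m (1 / Suc n) ?Q \<le> ennreal ?c" for n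
  proof -
    obtain N :: nat where N: "2 * real DIM('a) * R * Suc n < real N" using reals_Archimedean2 by blast
    have "0 \<le> 2 * real DIM('a) * R * Suc n" using R by (intro mult_nonneg_nonneg) auto
    with N have N0: "N > 0" by linarith
    define K where "K = (Basis - {i}) \<rightarrow>\<^sub>E {..<N}"
    have cK: "finite K" "card K = N ^ ?m" using i by (auto simp: K_def card_PiE intro: finite_PiE)
    define C where "C k = {x::'a. x \<bullet> i = 0 \<and> (\<forall>j\<in>Basis - {i}. - R + 2 * R * real (k j) / N \<le> x \<bullet> j \<and> x \<bullet> j \<le> - R + 2 * R * (real (k j) + 1) / N)}" for k
    have dist: "dist x y \<le> real DIM('a) * (2 * R / N)" if "x \<in> C k" "y \<in> C k" for x y k
    proof -
      have "norm (x - y) \<le> (\<Sum>j\<in>Basis. \<bar>(x - y) \<bullet> j\<bar>)" by (rule norm_le_l1)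
      also have "\<dots> \<le> (\<Sum>j\<in>(Basis::'a set). 2 * R / N)"
      proof (rule sum_mono)
        fix j :: 'a assume j: "j \<in> Basis"
        show "\<bar>(x - y) \<bullet> j\<bar> \<le> 2 * R / N"
        proof (cases "j = i")
          case True then show ?thesis using that R by (simp add: C_def inner_diff_left)
        next
          case False
          have "- R + 2 * R * (real (k j) + 1) / N = - R + 2 * R * real (k j) / N + 2 * R / N"
            by (simp add: field_simps add_divide_distrib)
          moreover have "- R + 2 * R * real (k j) / N \<le> x \<bullet> j" "x \<bullet> j \<le> - R + 2 * R * (real (k j) + 1) / N"
            "- R + 2 * R * real (k j) / N \<le> y \<bullet> j" "y \<bullet> j \<le> - R + 2 * R * (real (k j) + 1) / N"
            using that j False by (auto simp: C_def)
          ultimately show ?thesis by (simp add: inner_diff_left abs_le_iff)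
        qed
      qed
      finally show ?thesis by (simp add: dist_norm)
    qed
    have small: "real DIM('a) * (2 * R / N) \<le> 1 / Suc n"
      using N N0 by (simp add: field_simps)
    have bd: "bounded (C k)" for k
    proof (cases "C k = {}")
      case False
      then obtain x where "x \<in> C k" by blast
      then show ?thesis using dist unfolding bounded_def by blast
    qed simp
    have dm: "diameter (C k) \<le> real DIM('a) * (2 * R / N)" for k
    proof (cases "C k = {}")
      case True then show ?thesis using R by simp
    next
      case False then show ?thesis using dist by (intro diameter_le) (auto simp: dist_norm)
    qed
    have "?Q \<subseteq> (\<Union>k\<in>K. C k)"
    proof
      fix x assume x: "x \<in> ?Q"
      \<comment> \<open>The minimum with N - 1 puts the points with x \<bullet> j = R into the last
        cell.\<close>
      define k where "k = restrict (\<lambda>j. min (N - 1) (nat \<lfloor>(x \<bullet> j + R) * N / (2 * R)\<rfloor>)) (Basis - {i})"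
      have "k \<in> K" using N0 by (auto simp: k_def K_def)
      moreover have "x \<in> C k"
      proof -
        have "- R + 2 * R * real (k j) / N \<le> x \<bullet> j \<and> x \<bullet> j \<le> - R + 2 * R * (real (k j) + 1) / N"
          if j: "j \<in> Basis" "j \<noteq> i" for j
        proof -
          define z where "z = (x \<bullet> j + R) * N / (2 * R)"
          have "\<bar>x \<bullet> j\<bar> \<le> R" using x j by blast
          then have "0 \<le> x \<bullet> j + R" "(x \<bullet> j + R) * N \<le> (2 * R) * N" by (auto intro!: mult_right_mono)
          then have z: "0 \<le> z" "z \<le> N" using R N0 by (auto simp: z_def pos_divide_le_eq mult.commute)
          have kj: "k j = min (N - 1) (nat \<lfloor>z\<rfloor>)" using j by (simp add: k_def z_def)
          have f: "real (nat \<lfloor>z\<rfloor>) \<le> z" "z < real (nat \<lfloor>z\<rfloor>) + 1" using z by (auto simp: of_nat_nat)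
          have "k j \<le> nat \<lfloor>z\<rfloor>" using kj by simp
          then have "real (k j) \<le> z" using f(1) by linarith
          moreover have "z \<le> real (k j) + 1"
            using f z N0 unfolding kj by (cases "N - 1 \<le> nat \<lfloor>z\<rfloor>") (auto simp: min_def of_nat_diff)
          moreover have "x \<bullet> j = - R + 2 * R * z / N" using R N0 by (simp add: z_def)
          ultimately show ?thesis using R N0 by (auto intro!: divide_right_mono mult_left_mono)
        qed
        then show ?thesis using x by (auto simp: C_def)
      qed
      ultimately show "x \<in> (\<Union>k\<in>K. C k)" by blast
    qed
    then have "hausdorff_pre ?m (1 / Suc n) ?Q \<le> hausdorff_pre ?m (1 / Suc n) (\<Union>k\<in>K. C k)"
      by (rule hausdorff_pre_mono)
    also have "\<dots> \<le> (\<Sum>k\<in>K. diam_weight ?m (C k))"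
      using cK bd dm small by (intro hausdorff_pre_finite_UN_le) (auto intro: order_trans)
    also have "\<dots> \<le> (\<Sum>k\<in>K. ennreal (unit_ball_vol (real ?m) * (real DIM('a) * R / N) ^ ?m))"
    proof (rule sum_mono)
      fix k
      have "(diameter (C k) / 2) ^ ?m \<le> (real DIM('a) * R / N) ^ ?m"
        using dm[of k] diameter_ge_0[OF bd[of k]] by (intro power_mono) (auto simp: mult_ac)
      then have "unit_ball_vol (real ?m) * (diameter (C k) / 2) ^ ?m \<le> unit_ball_vol (real ?m) * (real DIM('a) * R / N) ^ ?m"
        by (intro mult_left_mono) auto
      then show "diam_weight ?m (C k) \<le> ennreal (unit_ball_vol (real ?m) * (real DIM('a) * R / N) ^ ?m)"
        by (auto intro: ennreal_leI)
    qed
    also have "\<dots> = of_nat (N ^ ?m) * ennreal (unit_ball_vol (real ?m) * (real DIM('a) * R / N) ^ ?m)"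
      by (simp add: cK)
    also have "\<dots> = ennreal (real (N ^ ?m) * (unit_ball_vol (real ?m) * (real DIM('a) * R / N) ^ ?m))"
      using R by (subst ennreal_mult) (auto simp: ennreal_of_nat_eq_real_of_nat)
    also have "real (N ^ ?m) * (unit_ball_vol (real ?m) * (real DIM('a) * R / N) ^ ?m) = ?c"
      using N0 by (simp add: power_divide)
    finally show ?thesis .
  qed
  then have "hausdorff_outer ?m ?Q \<le> ennreal ?c" unfolding hausdorff_outer_SUP by (rule SUP_least)
  then show ?thesis by (rule order.strict_trans1) simp
qed

text \<open>The prism of height 1 erected in direction n on a subset B of the hyperplane n \<bullet>
  x = a, for a unit vector n. Its volume stands for the (d-1)-dimensional Lebesgue measure of B, so
  that every integral can be taken in the full space.\<close>

definition slab_over :: "'a::real_inner \<Rightarrow> real \<Rightarrow> 'a set \<Rightarrow> 'a set" where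
  "slab_over n a B = {x. a \<le> n \<bullet> x \<and> n \<bullet> x \<le> a + 1 \<and> x - (n \<bullet> x - a) *\<^sub>R n \<in> B}"

text \<open>Each covering set is enlarged to a box \<open>E k\<close> that extends by its diameter
  in the tangential directions and has height 1 in direction i. These boxes cover the unit box, so
  subadditivity of Lebesgue measure bounds the total weight from below.\<close>

lemma hausdorff_outer_unit_cube_pos:
  fixes i :: "'a::euclidean_space"
  assumes i: "i \<in> Basis"
  shows "hausdorff_outer (DIM('a) - 1) {x. x \<bullet> i = 0 \<and> (\<forall>j\<in>Basis. 0 \<le> x \<bullet> j \<and> x \<bullet> j \<le> 1)} > 0"
proof -
  let ?m = "DIM('a) - 1"
  let ?Q = "{x::'a. x \<bullet> i = 0 \<and> (\<forall>j\<in>Basis. 0 \<le> x \<bullet> j \<and> x \<bullet> j \<le> 1)}"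
  \<comment> \<open>The base of \<open>E k\<close> has volume (2 diam)^m = 4^m (diam/2)^m, which is
    K times the weight of the covering set.\<close>
  define K where "K = 4 ^ ?m / unit_ball_vol (real ?m)"
  have K: "K > 0" by (simp add: K_def)
  have "ennreal (1 / K) \<le> hausdorff_pre ?m 1 ?Q"
    unfolding hausdorff_pre_def
  proof (rule INF_greatest, safe)
    fix C :: "nat \<Rightarrow> 'a set" assume C: "?Q \<subseteq> \<Union> (range C)" "\<forall>k. bounded (C k) \<and> diameter (C k) \<le> 1"
    define p where "p k = (SOME x. x \<in> C k)" for k
    define d where "d k = diameter (C k)" for k
    define E where "E k = (if C k = {} then {} else cbox ((\<Sum>j\<in>Basis - {i}. (p k \<bullet> j - d k) *\<^sub>R j)) ((\<Sum>j\<in>Basis - {i}. (p k \<bullet> j + d k) *\<^sub>R j) + i))" for k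
    have d0: "0 \<le> d k" for k using C(2) by (simp add: d_def diameter_ge_0)
    have co: "(\<Sum>l\<in>Basis - {i}. g l *\<^sub>R l) \<bullet> j = (if j = i then 0 else g j)" if "j \<in> Basis" for g and j :: 'a
    proof -
      have "(\<Sum>l\<in>Basis - {i}. g l *\<^sub>R l) \<bullet> j = (\<Sum>l\<in>Basis - {i}. if l = j then g l else 0)"
        unfolding inner_sum_left using that by (intro sum.cong) (auto simp: inner_Basis)
      then show ?thesis using that by simp
    qed
    have "cbox 0 One \<subseteq> (\<Union>k. E k)"
    proof
      fix x :: 'a assume x: "x \<in> cbox 0 One"
      define y where "y = x - (x \<bullet> i) *\<^sub>R i"
      have yj: "y \<bullet> j = (if j = i then 0 else x \<bullet> j)" if "j \<in> Basis" for j
        using that i by (auto simp: y_def inner_diff_left inner_Basis)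
      have "y \<in> ?Q" using x i yj by (auto simp: mem_box)
      then obtain k where k: "y \<in> C k" using C(1) by blast
      then have "p k \<in> C k" unfolding p_def by (rule someI)
      then have "dist y (p k) \<le> d k" using k C(2) diameter_bounded_bound unfolding d_def by blast
      then have "\<bar>y \<bullet> j - p k \<bullet> j\<bar> \<le> d k" if "j \<in> Basis" for j
        using Basis_le_norm[OF that, of "y - p k"] by (simp add: dist_norm inner_diff_left)
      then have "\<bar>x \<bullet> j - p k \<bullet> j\<bar> \<le> d k" if "j \<in> Basis" "j \<noteq> i" for j
        using that yj by metis
      moreover have "(\<Sum>j\<in>Basis - {i}. (p k \<bullet> j - d k) *\<^sub>R j) \<bullet> j \<le> x \<bullet> j \<and>
          x \<bullet> j \<le> ((\<Sum>j\<in>Basis - {i}. (p k \<bullet> j + d k) *\<^sub>R j) + i) \<bullet> j" if "j \<in> Basis" for j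
        using calculation[OF that] x i that
        by (cases "j = i") (auto simp: mem_box inner_add_left co inner_Basis abs_le_iff)
      ultimately have "x \<in> E k" using k by (auto simp: E_def mem_box)
      then show "x \<in> (\<Union>k. E k)" by blast
    qed
    then have "emeasure lborel (cbox 0 One :: 'a set) \<le> emeasure lborel (\<Union>k. E k)"
      by (rule emeasure_mono) (auto simp: E_def)
    also have "\<dots> \<le> (\<Sum>k. emeasure lborel (E k))"
      by (rule emeasure_subadditive_countably) (auto simp: E_def)
    also have "\<dots> \<le> (\<Sum>k. ennreal K * diam_weight ?m (C k))"
    proof (rule suminf_le)
      fix k
      show "emeasure lborel (E k) \<le> ennreal K * diam_weight ?m (C k)"
      proof (cases "C k = {}")
        case False
        have "emeasure lborel (E k) = ennreal (\<Prod>j\<in>Basis. if j = i then 1 else 2 * d k)"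
        proof -
          let ?l = "\<Sum>j\<in>Basis - {i}. (p k \<bullet> j - d k) *\<^sub>R j" and ?u = "(\<Sum>j\<in>Basis - {i}. (p k \<bullet> j + d k) *\<^sub>R j) + i"
          have *: "(?u - ?l) \<bullet> j = (if j = i then 1 else 2 * d k)" if "j \<in> Basis" for j
            using that i by (cases "j = i") (simp_all add: inner_diff_left inner_add_left co inner_Basis)
          have "0 \<le> (?u - ?l) \<bullet> j" if "j \<in> Basis" for j
            unfolding *[OF that] using d0[of k] by simp
          then have "\<forall>j\<in>Basis. ?l \<bullet> j \<le> ?u \<bullet> j"
            by (simp only: inner_diff_left diff_ge_0_iff_ge) blast
          then have "emeasure lborel (E k) = ennreal (\<Prod>j\<in>Basis. (?u - ?l) \<bullet> j)"
            using False by (simp add: E_def emeasure_lborel_cbox_eq)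
          then show ?thesis using * by simp
        qed
        also have "(\<Prod>j\<in>Basis. if j = i then 1 else 2 * d k) = (2 * d k) ^ ?m"
          using i by (subst prod.remove[of _ i]) auto
        also have "\<dots> = K * (unit_ball_vol (real ?m) * (d k / 2) ^ ?m)"
        proof -
          have "(2 * d k) ^ ?m = (4 * (d k / 2)) ^ ?m" by simp
          also have "\<dots> = 4 ^ ?m * (d k / 2) ^ ?m" by (rule power_mult_distrib)
          finally have "(2 * d k) ^ ?m = 4 ^ ?m * (d k / 2) ^ ?m" .
          moreover have "unit_ball_vol (real ?m) \<noteq> 0" by (metis less_irrefl of_nat_0_le_iff unit_ball_vol_pos)
          ultimately show ?thesis by (simp add: K_def)
        qed
        finally show ?thesis using False K d0[of k] by (simp add: ennreal_mult d_def)
      qed (simp add: E_def)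
    qed auto
    also have "\<dots> = ennreal K * (\<Sum>k. diam_weight ?m (C k))" by simp
    finally have "1 \<le> ennreal K * (\<Sum>k. diam_weight ?m (C k))"
      by (simp add: emeasure_lborel_cbox_eq inner_Basis)
    then have "ennreal (1 / K) * 1 \<le> ennreal (1 / K) * (ennreal K * (\<Sum>k. diam_weight ?m (C k)))"
      by (rule mult_left_mono) simp
    also have "\<dots> = (\<Sum>k. diam_weight ?m (C k))"
      using K by (simp add: mult.assoc[symmetric] ennreal_mult[symmetric])
    finally show "ennreal (1 / K) \<le> (\<Sum>k. diam_weight ?m (C k))" by simp
  qed
  also have "\<dots> \<le> hausdorff_outer ?m ?Q" by (rule hausdorff_pre_le_outer) simp
  finally show ?thesis by (rule order.strict_trans2[rotated]) (simp add: K)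
qed

lemma slab_over_borel [measurable]: "B \<in> sets borel \<Longrightarrow> slab_over n a B \<in> sets (borel :: 'a::euclidean_space measure)"
proof -
  assume B: "B \<in> sets borel"
  have "(\<lambda>x. x - (n \<bullet> x - a) *\<^sub>R n) -` B \<in> sets borel"
    using measurable_sets[OF _ B, of "\<lambda>x. x - (n \<bullet> x - a) *\<^sub>R n" borel] by simp
  then have "{x. a \<le> n \<bullet> x} \<inter> {x. n \<bullet> x \<le> a + 1} \<inter> (\<lambda>x. x - (n \<bullet> x - a) *\<^sub>R n) -` B \<in> sets borel"
    by measurable
  then show ?thesis by (simp add: slab_over_def Collect_conj_eq vimage_def Int_assoc)
qed

text \<open>Both sides are measures carried by the hyperplane and invariant under its translations,
  hence proportional. The slab over the unit cube of the hyperplane has volume 1, so c is the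
  Hausdorff measure of this cube; it is positive by \<open>hausdorff_outer_unit_cube_pos\<close> and
  finite by \<open>hausdorff_outer_hyperplane_cube_finite\<close>.\<close>

lemma hausdorff_coordinate_hyperplane:
  fixes i :: "'a::euclidean_space"
  assumes i: "i \<in> Basis"
  shows "\<exists>c>0. \<forall>B\<in>sets borel. hausdorff_outer (DIM('a) - 1) (B \<inter> {x. x \<bullet> i = 0}) = ennreal c * emeasure lborel (slab_over i 0 B)"
proof -
  let ?m = "DIM('a) - 1"
  let ?H = "hausdorff_outer ?m :: 'a set \<Rightarrow> ennreal"
  define G where "G = {x::'a. x \<bullet> i = 0}"
  have Gb [measurable]: "G \<in> sets borel" by (auto simp: G_def intro!: borel_closed closed_hyperplane simp: inner_commute closed_Collect_eq continuous_intros)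
  define M where "M = density (hausdorff_measure ?m :: 'a measure) (indicator G)"
  define S where "S = {x::'a. 0 \<le> i \<bullet> x \<and> i \<bullet> x \<le> 1}"
  have Sb [measurable]: "S \<in> sets borel" unfolding S_def by measurable
  define \<pi> where "\<pi> x = x - (i \<bullet> x) *\<^sub>R i" for x :: 'a
  have [measurable]: "\<pi> \<in> borel_measurable borel" unfolding \<pi>_def by measurable
  define N where "N = distr (density lborel (indicator S)) borel \<pi>"
  have sM: "sets M = sets borel" by (simp add: M_def)
  have sN: "sets N = sets borel" by (simp add: N_def)
  have M: "emeasure M B = ?H (B \<inter> G)" if "B \<in> sets borel" for B
    using that by (simp add: M_def emeasure_restricted emeasure_hausdorff_measure Int_commute)
  have N: "emeasure N B = emeasure lborel (slab_over i 0 B)" if [measurable]: "B \<in> sets borel" for B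
  proof -
    have "S \<inter> \<pi> -` B = slab_over i 0 B" by (auto simp: S_def \<pi>_def slab_over_def)
    then show ?thesis using measurable_sets[of \<pi> borel borel B]
      by (simp add: N_def emeasure_distr emeasure_restricted)
  qed
  let ?Q = "{x::'a. x \<bullet> i = 0 \<and> (\<forall>j\<in>Basis. 0 \<le> x \<bullet> j \<and> x \<bullet> j \<le> 1)}"
  have Qb: "?Q \<in> sets borel" by measurable
  have ii: "i \<bullet> i = 1" using i by simp
  have "slab_over i 0 ?Q = cbox 0 One"
  proof -
    have "x \<in> slab_over i 0 ?Q \<longleftrightarrow> x \<in> cbox 0 One" for x
    proof -
      have cj: "(x - (i \<bullet> x) *\<^sub>R i) \<bullet> j = (if j = i then 0 else x \<bullet> j)" if "j \<in> Basis" for j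
        using that i by (auto simp: inner_diff_left inner_Basis inner_commute[of i x])
      then show ?thesis using i by (auto simp: slab_over_def mem_box inner_commute[of i x])
    qed
    then show ?thesis by blast
  qed
  then have NQ: "emeasure N ?Q = 1" by (simp add: N[OF Qb] emeasure_lborel_cbox_eq inner_Basis)
  have QG: "?Q \<inter> G = ?Q" by (auto simp: G_def)
  have MQ: "0 < emeasure M ?Q" using hausdorff_outer_unit_cube_pos[OF i] by (simp add: M[OF Qb] QG)
  have fin: "?H (cball 0 (real n) \<inter> G) < \<infinity>" for n
  proof -
    have "cball 0 (real n) \<inter> G \<subseteq> {x. x \<bullet> i = 0 \<and> (\<forall>j\<in>Basis. \<bar>x \<bullet> j\<bar> \<le> real n + 1)}"
    proof safe
      fix x j assume "x \<in> cball 0 (real n)" "x \<in> G" and j: "(j::'a) \<in> Basis"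
      then show "\<bar>x \<bullet> j\<bar> \<le> real n + 1" using Basis_le_norm[OF j, of x] by simp
    qed (simp add: G_def)
    then have "?H (cball 0 (real n) \<inter> G) \<le> ?H {x. x \<bullet> i = 0 \<and> (\<forall>j\<in>Basis. \<bar>x \<bullet> j\<bar> \<le> real n + 1)}"
      by (rule hausdorff_outer_mono)
    also have "\<dots> < \<infinity>" by (rule hausdorff_outer_hyperplane_cube_finite[OF i]) simp
    finally show ?thesis .
  qed
  have MQf: "emeasure M ?Q < \<infinity>"
  proof -
    have "?Q \<subseteq> {x. x \<bullet> i = 0 \<and> (\<forall>j\<in>Basis. \<bar>x \<bullet> j\<bar> \<le> 1)}" by auto
    then have "?H ?Q \<le> ?H {x. x \<bullet> i = 0 \<and> (\<forall>j\<in>Basis. \<bar>x \<bullet> j\<bar> \<le> 1)}"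
      by (rule hausdorff_outer_mono)
    also have "\<dots> < \<infinity>" by (rule hausdorff_outer_hyperplane_cube_finite[OF i]) simp
    finally show ?thesis by (simp only: M[OF Qb] QG)
  qed
  have cov: "\<Union> (range (\<lambda>n::nat. cball 0 (real n))) = (UNIV :: 'a set)" by (auto simp: real_arch_simple)
  have sfM: "sigma_finite_measure M"
  proof (unfold_locales, intro exI[of _ "range (\<lambda>n::nat. cball 0 (real n))"] conjI)
    show "\<forall>a\<in>range (\<lambda>n::nat. cball 0 (real n)). emeasure M a \<noteq> \<infinity>" using fin by (auto simp: M less_top)
  qed (use cov in \<open>auto simp: M_def\<close>)
  have finN: "emeasure N (cball 0 (real n)) < \<infinity>" for n
  proof -
    have "slab_over i 0 (cball 0 (real n)) \<subseteq> cball 0 (real n + 1)"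
    proof
      fix x assume x: "x \<in> slab_over i 0 (cball 0 (real n))"
      have "norm x \<le> norm (x - (i \<bullet> x) *\<^sub>R i) + norm ((i \<bullet> x) *\<^sub>R i)" by (metis diff_add_cancel norm_triangle_ineq)
      then show "x \<in> cball 0 (real n + 1)" using x i by (auto simp: slab_over_def)
    qed
    then have "bounded (slab_over i 0 (cball 0 (real n)))" by (rule bounded_subset[OF bounded_cball])
    then have "emeasure lborel (slab_over i 0 (cball 0 (real n))) < \<infinity>" by (rule emeasure_bounded_finite)
    then show ?thesis by (simp add: N)
  qed
  have sfN: "sigma_finite_measure N"
  proof (unfold_locales, intro exI[of _ "range (\<lambda>n::nat. cball 0 (real n))"] conjI)
    show "\<forall>a\<in>range (\<lambda>n::nat. cball 0 (real n)). emeasure N a \<noteq> \<infinity>" using finN by (auto simp: less_top)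
  qed (use cov in \<open>auto simp: N_def\<close>)
  have trans: "emeasure lborel ((+) h -` A) = emeasure lborel A" if "A \<in> sets borel" for h and A :: "'a set"
    using that by (subst (2) lborel_distr_translation[of h, symmetric]) (simp add: emeasure_distr)
  have refl: "emeasure lborel (uminus -` A) = emeasure lborel A" if "A \<in> sets borel" for A :: "'a set"
    using that by (subst (2) lborel_distr_uminus_eq[symmetric]) (simp add: emeasure_distr)
  have MN: "emeasure M B * emeasure N ?Q = emeasure N B * emeasure M ?Q" if B: "B \<in> sets borel" for B
  proof (rule translation_invariant_measure_unique[where G=G])
    show "AE x in M. x \<in> G" unfolding M_def by (subst AE_density) (auto simp: indicator_def split: if_splits)
    have "\<pi> x \<in> G" for x using ii by (simp add: G_def \<pi>_def inner_diff_left inner_commute[of i x])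
    then show "AE x in N. x \<in> G" unfolding N_def by (subst AE_distr_iff) (use Gb in auto)
    show "distr M borel ((+) h) = M" if h: "h \<in> G" for h
    proof (rule measure_eqI)
      fix A assume "A \<in> sets (distr M borel ((+) h))"
      then have A: "A \<in> sets borel" by simp
      have "emeasure (distr M borel ((+) h)) A = ?H (((+) h -` A) \<inter> G)"
        using A measurable_sets[of "(+) h" borel borel A] by (simp add: emeasure_distr M sM cong: measurable_cong_sets)
      also have "\<dots> = ?H ((+) h ` (((+) h -` A) \<inter> G))"
        by (rule hausdorff_outer_isometry[symmetric]) (auto simp: bij_plus_right)
      also have "(+) h ` (((+) h -` A) \<inter> G) = A \<inter> G"
      proof safe
        fix x assume "x \<in> A" "x \<in> G"
        then show "x \<in> (+) h ` (((+) h -` A) \<inter> G)" using h by (intro image_eqI[of _ _ "x - h"]) (auto simp: G_def inner_diff_left)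
      qed (use h in \<open>auto simp: G_def inner_add_left\<close>)
      finally show "emeasure (distr M borel ((+) h)) A = emeasure M A" by (simp add: M A)
    qed (simp add: sM)
    show "distr N borel ((+) h) = N" if h: "h \<in> G" for h
    proof (rule measure_eqI)
      fix A assume "A \<in> sets (distr N borel ((+) h))"
      then have A [measurable]: "A \<in> sets borel" by simp
      have "emeasure (distr N borel ((+) h)) A = emeasure lborel (slab_over i 0 ((+) h -` A))"
        using measurable_sets[of "(+) h" borel borel A] by (simp add: emeasure_distr N sN cong: measurable_cong_sets)
      also have "slab_over i 0 ((+) h -` A) = (+) h -` slab_over i 0 A"
        using h by (auto simp: slab_over_def G_def inner_add_right inner_commute algebra_simps)
      also have "emeasure lborel \<dots> = emeasure lborel (slab_over i 0 A)" by (rule trans) measurable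
      finally show "emeasure (distr N borel ((+) h)) A = emeasure N A" by (simp add: N)
    qed (simp add: sN)
    show "distr N borel uminus = N"
    proof (rule measure_eqI)
      fix A assume "A \<in> sets (distr N borel uminus)"
      then have A [measurable]: "A \<in> sets borel" by simp
      have "emeasure (distr N borel uminus) A = emeasure lborel (slab_over i 0 (uminus -` A))"
        using measurable_sets[of uminus borel borel A] by (simp add: emeasure_distr N sN cong: measurable_cong_sets)
      \<comment> \<open>The reflection turns the slab over heights from 0 to 1 into one over heights
        from -1 to 0; the translation by i moves it back.\<close>
      also have "slab_over i 0 (uminus -` A) = uminus -` ((+) i -` slab_over i 0 A)"
        using ii by (auto simp: slab_over_def inner_diff_right algebra_simps)
      also have "emeasure lborel \<dots> = emeasure lborel ((+) i -` slab_over i 0 A)"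
        using measurable_sets[of "(+) i" borel borel "slab_over i 0 A"] by (intro refl) simp
      also have "\<dots> = emeasure lborel (slab_over i 0 A)" by (rule trans) measurable
      finally show "emeasure (distr N borel uminus) A = emeasure N A" by (simp add: N)
    qed (simp add: sN)
  qed (use Qb B sM sN sfM sfN in \<open>auto simp: G_def\<close>)
  have "?H (B \<inter> G) = ennreal (enn2real (emeasure M ?Q)) * emeasure lborel (slab_over i 0 B)" if "B \<in> sets borel" for B
  proof -
    have "ennreal (enn2real (emeasure M ?Q)) = emeasure M ?Q"
      using MQf by (intro ennreal_enn2real) simp
    moreover have "emeasure M B * emeasure N ?Q = emeasure N B * emeasure M ?Q" by (rule MN[OF that])
    ultimately show ?thesis using that by (simp only: M N NQ mult.commute mult_1_left)
  qed
  moreover have "enn2real (emeasure M ?Q) > 0" using MQ MQf by (simp add: enn2real_positive_iff less_top)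
  ultimately show ?thesis unfolding G_def by blast
qed

text \<open>A rotation followed by a shift takes the coordinate hyperplane to any other one and
  preserves both Hausdorff and Lebesgue measure. So a single c serves for all facets of all
  surfaces, which is why it drops out when two fluxes are compared.\<close>

lemma hausdorff_hyperplane:
  "\<exists>c>0. \<forall>n a. \<forall>B::(real^'n) set. norm n = 1 \<longrightarrow> B \<in> sets borel \<longrightarrow> bounded B \<longrightarrow> B \<subseteq> {x. n \<bullet> x = a} \<longrightarrow>
     emeasure (hausdorff_measure (CARD('n) - 1)) B = ennreal (c * measure lebesgue (slab_over n a B))"
proof -
  define i :: "real^'n" where "i = axis undefined 1"
  have i: "i \<in> Basis" by (simp add: i_def axis_in_Basis_iff)
  obtain c where c: "c > 0" "\<And>B. B \<in> sets borel \<Longrightarrow> hausdorff_outer (CARD('n) - 1) (B \<inter> {x. x \<bullet> i = 0}) = ennreal c * emeasure lborel (slab_over i 0 B)"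
    using hausdorff_coordinate_hyperplane[OF i] by auto
  show ?thesis
  proof (intro exI[of _ c] conjI allI impI c(1))
    fix n a and B :: "(real^'n) set"
    assume n: "norm n = 1" and B: "B \<in> sets borel" "bounded B" "B \<subseteq> {x. n \<bullet> x = a}"
    obtain f where f: "orthogonal_transformation f" "f i = n"
      using orthogonal_transformation_exists_1[of i n] i n by auto
    have lf: "linear f" using f(1) by (rule orthogonal_transformation_linear)
    define T where "T x = a *\<^sub>R n + f x" for x
    have "T = (+) (a *\<^sub>R n) \<circ> f" by (auto simp: T_def)
    then have bij: "bij T" using orthogonal_transformation_bij[OF f(1)] bij_plus_right by (simp add: bij_comp)
    have iso: "dist (T x) (T y) = dist x y" for x y
      using f(1) by (simp add: T_def dist_norm linear_diff[OF lf, symmetric] orthogonal_transformation_norm)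
    have Tm: "T \<in> borel_measurable borel" unfolding T_def
      by (intro borel_measurable_continuous_onI continuous_intros linear_continuous_on linear_conv_bounded_linear[THEN iffD1] lf)
    define B0 where "B0 = T -` B"
    have B0: "B0 \<in> sets borel" using measurable_sets[OF Tm B(1)] by (simp add: B0_def)
    have TB: "T ` B0 = B" unfolding B0_def using bij by (simp add: bij_is_surj surj_image_vimage_eq)
    have fi: "n \<bullet> f x = i \<bullet> x" for x using f by (metis orthogonal_transformation_def)
    have nn: "n \<bullet> n = 1" using n by (simp add: dot_square_norm)
    have nT: "n \<bullet> T x = a + i \<bullet> x" for x by (simp add: T_def inner_add_right fi nn)
    have "B0 \<subseteq> {x. x \<bullet> i = 0}"
    proof
      fix x assume "x \<in> B0"
      then have "n \<bullet> T x = a" using B(3) by (auto simp: B0_def)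
      then show "x \<in> {x. x \<bullet> i = 0}" using nT[of x] by (simp add: inner_commute)
    qed
    then have "hausdorff_outer (CARD('n) - 1) B0 = ennreal c * emeasure lborel (slab_over i 0 B0)"
      using c(2)[OF B0] by (simp add: Int_absorb2)
    moreover have "hausdorff_outer (CARD('n) - 1) B = hausdorff_outer (CARD('n) - 1) B0"
      unfolding TB[symmetric] by (rule hausdorff_outer_isometry[OF iso bij])
    moreover have sl: "slab_over n a B = (+) (a *\<^sub>R n) ` f ` slab_over i 0 B0"
    proof -
      have "T x \<in> slab_over n a B \<longleftrightarrow> x \<in> slab_over i 0 B0" for x
      proof -
        have "T x - (n \<bullet> T x - a) *\<^sub>R n = T (x - (i \<bullet> x) *\<^sub>R i)"
          by (simp add: nT) (simp add: T_def linear_diff[OF lf] linear_cmul[OF lf] f(2))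
        then show ?thesis by (auto simp: slab_over_def nT B0_def)
      qed
      then have "slab_over n a B = T ` slab_over i 0 B0" using bij_is_surj[OF bij] by (auto simp: image_iff) (metis surjE)
      then show ?thesis by (auto simp: T_def image_image)
    qed
    moreover have lm: "slab_over i 0 B0 \<in> lmeasurable"
    proof (rule bounded_set_imp_lmeasurable)
      show "slab_over i 0 B0 \<in> sets lebesgue" using slab_over_borel[OF B0] by simp
      have "bounded B0"
      proof -
        obtain M where M: "\<And>x. x \<in> B \<Longrightarrow> norm x \<le> M" using B(2) by (auto simp: bounded_iff)
        have "norm x \<le> M + norm (T 0)" if "x \<in> B0" for x
          using iso[of x 0] M[of "T x"] that norm_triangle_ineq4[of "T x" "T 0"] by (auto simp: B0_def dist_norm)
        then show ?thesis by (auto simp: bounded_iff)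
      qed
      then obtain M where M: "\<And>x. x \<in> B0 \<Longrightarrow> norm x \<le> M" by (auto simp: bounded_iff)
      have "norm x \<le> M + 1" if x: "x \<in> slab_over i 0 B0" for x
      proof -
        have "norm x \<le> norm (x - (i \<bullet> x) *\<^sub>R i) + norm ((i \<bullet> x) *\<^sub>R i)" by (metis diff_add_cancel norm_triangle_ineq)
        then show ?thesis using x i M[of "x - (i \<bullet> x) *\<^sub>R i"] by (auto simp: slab_over_def)
      qed
      then show "bounded (slab_over i 0 B0)" by (auto simp: bounded_iff)
    qed
    moreover have "\<bar>det (matrix f)\<bar> = 1"
      using f(1) by (metis abs_1 abs_minus_cancel det_orthogonal_matrix orthogonal_transformation_matrix)
    then have "measure lebesgue (slab_over n a B) = measure lebesgue (slab_over i 0 B0)"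
      unfolding sl measure_translation by (simp add: measure_linear_image_cart[OF lf lm])
    moreover have "emeasure lborel (slab_over i 0 B0) = ennreal (measure lebesgue (slab_over i 0 B0))"
    proof -
      have "emeasure lebesgue (slab_over i 0 B0) = emeasure lborel (slab_over i 0 B0)"
        using slab_over_borel[OF B0] by simp
      moreover have "emeasure lebesgue (slab_over i 0 B0) = ennreal (measure lebesgue (slab_over i 0 B0))"
        using fmeasurableD2[OF lm] by (intro emeasure_eq_ennreal_measure) auto
      ultimately show ?thesis by simp
    qed
    ultimately show "emeasure (hausdorff_measure (CARD('n) - 1)) B = ennreal (c * measure lebesgue (slab_over n a B))"
      using c(1) B(1) by (simp add: emeasure_hausdorff_measure ennreal_mult)
  qed
qed

section \<open>Simplices and their facets\<close>

lemma hull_range: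
  fixes a :: "'i::finite \<Rightarrow> 'a::real_vector"
  shows "convex hull (range a) = {\<Sum>i\<in>UNIV. u i *\<^sub>R a i | u. (\<forall>i. 0 \<le> u i) \<and> sum u UNIV = 1}" (is "_ = ?R")
proof
  have "convex ?R"
  proof (rule convexI, clarify)
    fix s t :: real and u v :: "'i \<Rightarrow> real" assume *: "0 \<le> s" "0 \<le> t" "s + t = 1" "\<forall>i. 0 \<le> u i" "sum u UNIV = 1" "\<forall>i. 0 \<le> v i" "sum v UNIV = 1"
    show "\<exists>w. s *\<^sub>R (\<Sum>i\<in>UNIV. u i *\<^sub>R a i) + t *\<^sub>R (\<Sum>i\<in>UNIV. v i *\<^sub>R a i) = (\<Sum>i\<in>UNIV. w i *\<^sub>R a i) \<and> (\<forall>i. 0 \<le> w i) \<and> sum w UNIV = 1"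
      using * by (intro exI[of _ "\<lambda>i. s * u i + t * v i"])
        (simp add: scaleR_left_distrib sum.distrib scaleR_sum_right sum_distrib_left[symmetric])
  qed
  moreover have "range a \<subseteq> ?R"
  proof clarify
    fix i show "\<exists>u. a i = (\<Sum>j\<in>UNIV. u j *\<^sub>R a j) \<and> (\<forall>j. 0 \<le> u j) \<and> sum u UNIV = 1"
      by (intro exI[of _ "\<lambda>j. if j = i then 1 else 0"]) (simp add: if_distrib[of "\<lambda>c. c *\<^sub>R _"] cong: if_cong)
  qed
  ultimately show "convex hull range a \<subseteq> ?R" by (rule hull_minimal[rotated])
  show "?R \<subseteq> convex hull range a"
    by (safe, rule convex_sum) (auto intro: hull_inc)
qed

text \<open>The element \<^const>\<open>undefined\<close> serves as a distinguished index: \<open>span_det a v\<close> is, up to sign,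
  \<open>CARD('n)!\<close> times the volume of the simplex spanned by the facet \<open>a\<close> and its apex \<open>a k + v\<close>.\<close>

definition span_det :: "('n::finite \<Rightarrow> real^'n) \<Rightarrow> real^'n \<Rightarrow> real" where
  "span_det a v = det (\<chi> i. if i = undefined then v else a i - a undefined)"

section \<open>The determinant of a facet as a linear form\<close>

lemma span_det_add: "span_det a (x + y) = span_det a x + span_det a y"
  unfolding span_det_def by (rule det_row_add)

lemma span_det_scale: "span_det a (c *\<^sub>R x) = c * span_det a x"
  unfolding span_det_def scalar_mult_eq_scaleR[symmetric] by (rule det_row_mul)

lemma linear_span_det: "linear (span_det a)"
  by (rule linearI) (simp_all add: span_det_add span_det_scale)

lemma span_det_diff_vertices: "span_det a (a i - a j) = 0"
proof -
  have 1: "span_det a (a i - a undefined) = 0" for i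
  proof (cases "i = undefined")
    case True then show ?thesis using linear_0[OF linear_span_det] by simp
  next
    case False
    show ?thesis unfolding span_det_def
      by (rule det_identical_rows[of undefined i]) (use False in \<open>auto simp: row_def vec_eq_iff\<close>)
  qed
  have "a i - a j = (a i - a undefined) - (a j - a undefined)" by simp
  then show ?thesis using 1 by (simp only: linear_diff[OF linear_span_det])
qed

lemma span_det_sum_vertices:
  assumes "sum c UNIV = 0"
  shows "span_det a (\<Sum>i\<in>UNIV. c i *\<^sub>R a i) = 0"
proof -
  have "(\<Sum>i\<in>UNIV. c i *\<^sub>R a i) = (\<Sum>i\<in>UNIV. c i *\<^sub>R (a i - a undefined))"
    using assms by (simp add: scaleR_diff_right sum_subtractf scaleR_left.sum[symmetric])
  then show ?thesis by (simp add: linear_sum[OF linear_span_det] linear_cmul[OF linear_span_det] span_det_diff_vertices)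
qed

text \<open>The row with index \<open>undefined\<close> is v itself, and displacing the vertices
  along v adds multiples of this row to the others.\<close>

lemma span_det_shift_along:
  fixes a :: "'n::finite \<Rightarrow> real^'n"
  shows "span_det (\<lambda>i. a i + c i *\<^sub>R v) v = span_det a v"
proof -
  define A :: "'n set \<Rightarrow> real^'n^'n" where
    "A S = (\<chi> i. if i = undefined then v else (a i - a undefined) + (if i \<in> S then c i - c undefined else 0) *\<^sub>R v)" for S
  have rowA: "row i (A S) = A S $ i" for i S by (simp add: row_def)
  have "det (A S) = det (A {})" if "finite S" "undefined \<notin> S" for S
    using that
  proof (induction S rule: finite_induct)
    case (insert k S)
    have "A (insert k S) = (\<chi> i. if i = k then row k (A S) + (c k - c undefined) *s row undefined (A S) else row i (A S))"
    proof (rule vec_eq_iff[THEN iffD2], rule allI)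
      fix i
      show "A (insert k S) $ i = (\<chi> i. if i = k then row k (A S) + (c k - c undefined) *s row undefined (A S) else row i (A S)) $ i"
        using insert.hyps insert.prems by (cases "i = k") (auto simp: rowA scalar_mult_eq_scaleR, auto simp: A_def)
    qed
    also have "det \<dots> = det (A S)" using insert.prems by (intro det_row_operation) auto
    finally show ?case using insert by simp
  qed simp
  from this[of "- {undefined}"] have "det (A (- {undefined})) = det (A {})" by simp
  moreover have "A (- {undefined}) = (\<chi> i. if i = undefined then v else (a i + c i *\<^sub>R v) - (a undefined + c undefined *\<^sub>R v))"
    by (rule vec_eq_iff[THEN iffD2]) (auto simp: A_def scaleR_diff_left)
  moreover have "A {} = (\<chi> i. if i = undefined then v else a i - a undefined)"
    by (rule vec_eq_iff[THEN iffD2]) (auto simp: A_def)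
  ultimately show ?thesis by (simp add: span_det_def)
qed

text \<open>The determinant annihilates the left-hand side of the relation, so \<tau> vanishes; what
  remains is a relation between the edge vectors, which are independent as rows of an invertible
  matrix.\<close>

lemma span_det_independent:
  assumes "span_det a v \<noteq> 0" "sum c UNIV = 0" "(\<Sum>i\<in>UNIV. c i *\<^sub>R a i) = \<tau> *\<^sub>R v"
  shows "\<tau> = 0 \<and> (\<forall>i. c i = 0)"
proof -
  have "\<tau> * span_det a v = 0"
    using span_det_sum_vertices[OF assms(2), of a] assms(3) by (simp add: linear_cmul[OF linear_span_det])
  then have \<tau>: "\<tau> = 0" using assms(1) by simp
  let ?A = "\<chi> i. if i = undefined then v else a i - a undefined"
  have "(\<Sum>i\<in>UNIV. (if i = undefined then 0 else c i) *s row i ?A) = (\<Sum>i\<in>UNIV. c i *\<^sub>R (a i - a undefined))"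
    by (intro sum.cong) (auto simp: row_def vec_eq_iff)
  also have "\<dots> = (\<Sum>i\<in>UNIV. c i *\<^sub>R a i)"
    using assms(2) by (simp add: scaleR_diff_right sum_subtractf scaleR_left.sum[symmetric])
  also have "\<dots> = 0" using assms(3) \<tau> by simp
  finally have *: "(\<Sum>i\<in>UNIV. (if i = undefined then 0 else c i) *s row i ?A) = 0" .
  have "invertible ?A" using assms(1) by (simp add: invertible_det_nz span_det_def)
  then have "\<exists>B. B ** ?A = mat 1" "\<exists>B. ?A ** B = mat 1" unfolding invertible_def by blast+
  then have R: "\<forall>c. (\<Sum>i\<in>UNIV. c i *s row i ?A) = 0 \<longrightarrow> (\<forall>i. c i = 0)"
    unfolding matrix_right_invertible_independent_rows by blast
  have "\<forall>i. (if i = undefined then 0 else c i) = 0"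
    by (rule R[rule_format, OF *, THEN allI])
  then have z: "c i = 0" if "i \<noteq> undefined" for i using that by metis
  have "c undefined = sum c UNIV" using z by (subst sum.remove[of _ undefined]) auto
  then show ?thesis using assms(2) z \<tau> by metis
qed

lemma measure_simplex_cart:
  fixes f :: "'n::finite \<Rightarrow> real^'n"
  shows "measure lebesgue (convex hull (insert x0 (range f))) = \<bar>det (\<chi> i. f i - x0)\<bar> / fact CARD('n)"
proof -
  let ?M = "\<chi> i. f i - x0"
  define g where "g = (\<lambda>x. transpose ?M *v x)"
  have lg: "linear g" unfolding g_def by (rule matrix_vector_mul_linear)
  have ga: "g (axis i 1) = f i - x0" for i
    by (simp add: g_def matrix_vector_mult_basis column_def transpose_def vec_eq_iff)
  define std where "std = (convex hull insert 0 Basis :: (real^'n) set)"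
  have std: "compact std" unfolding std_def by (intro finite_imp_compact_convex_hull) auto
  have "convex hull (insert x0 (range f)) = (+) x0 ` g ` std"
  proof -
    have "g ` std = convex hull (g ` insert 0 Basis)" unfolding std_def by (rule convex_hull_linear_image[OF lg])
    also have "g ` insert 0 Basis = insert 0 ((\<lambda>i. f i - x0) ` UNIV)"
      by (auto simp: linear_0[OF lg] Basis_vec_def ga image_iff)
    finally show ?thesis by (simp add: convex_hull_translation[symmetric] image_image)
  qed
  then have "measure lebesgue (convex hull (insert x0 (range f))) = measure lebesgue (g ` std)" by (simp add: measure_translation)
  also have "\<dots> = \<bar>det (matrix g)\<bar> * measure lebesgue std"
    by (rule measure_linear_image_cart[OF lg]) (simp add: std lmeasurable_compact)
  also have "measure lebesgue std = 1 / fact CARD('n)"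
    using content_std_simplex[where 'a="real^'n"] std by (simp add: std_def compact_imp_closed)
  also have "matrix g = transpose ?M" unfolding g_def by (rule matrix_of_matrix_vector_mul)
  finally show ?thesis by (simp add: det_transpose)
qed

lemma measure_simplex_span_det:
  "measure lebesgue (convex hull (insert (a k + v) (range a))) = \<bar>span_det a v\<bar> / fact CARD('n::finite)" for a :: "'n \<Rightarrow> real^'n"
proof -
  let ?f = "\<lambda>i. if i = undefined then a k + v else a i"
  let ?A = "\<chi> i. if i = undefined then v else a i - a undefined"
  have "insert (a k + v) (range a) = insert (a undefined) (range ?f)" by auto
  then have "measure lebesgue (convex hull (insert (a k + v) (range a))) = \<bar>det (\<chi> i. ?f i - a undefined)\<bar> / fact CARD('n)"
    using measure_simplex_cart[of "a undefined" ?f] by (simp only:)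
  also have "det (\<chi> i. ?f i - a undefined) = det ?A"
  proof (cases "k = undefined")
    case True then show ?thesis by (auto intro!: arg_cong[of _ _ det] simp: vec_eq_iff)
  next
    case False
    \<comment> \<open>Seen from the vertex \<open>a undefined\<close>, the apex
      \<open>a k + v\<close> gives the row v plus the row of \<open>a k\<close>. So the volume does
      not depend on which vertex is raised.\<close>
    have "(\<chi> i. ?f i - a undefined) = (\<chi> i. if i = undefined then row undefined ?A + 1 *s row k ?A else row i ?A)"
      using False by (auto simp: vec_eq_iff row_def)
    then show ?thesis using det_row_operation[of undefined k ?A 1] False by auto
  qed
  finally show ?thesis by (simp add: span_det_def)
qed

section \<open>Columns over a facet in barycentric coordinates\<close>

lemma hull_rangeI:
  "(\<And>i. 0 \<le> u i) \<Longrightarrow> sum u UNIV = 1 \<Longrightarrow> (\<Sum>i\<in>UNIV. u i *\<^sub>R a i) \<in> convex hull (range a)" for a :: "'i::finite \<Rightarrow> 'a::real_vector"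
  unfolding hull_range by blast

lemma convex_hull_insert_range_iff:
  "x \<in> convex hull (insert p (range a)) \<longleftrightarrow>
    (\<exists>t b. 0 \<le> t \<and> t \<le> 1 \<and> b \<in> convex hull (range a) \<and> x = (1 - t) *\<^sub>R p + t *\<^sub>R b)"
  unfolding convex_hull_insert_alt by (simp only: image_is_empty UNIV_not_empty if_False mem_Collect_eq) blast

text \<open>The half-infinite prism swept by the facet in direction -v: the points whose ray in
  direction v meets the facet. Its indicator thus detects whether the ray from a point crosses this
  facet.\<close>

definition column :: "('n::finite \<Rightarrow> real^'n) \<Rightarrow> real^'n \<Rightarrow> (real^'n) set" where
  "column a v = {x. \<exists>\<tau>\<ge>0. x + \<tau> *\<^sub>R v \<in> convex hull (range a)}"

text \<open>Points are described by weights u and a height \<tau> with respect to the original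
  facet. Displacing the vertices along v only changes the lower bound for \<tau>, which makes the
  columns of the old and the new facet comparable.\<close>

lemma column_shift_iff:
  "x \<in> column (\<lambda>i. a i + w i *\<^sub>R v) v \<longleftrightarrow>
    (\<exists>u \<tau>. (\<forall>i. 0 \<le> u i) \<and> sum u UNIV = 1 \<and> - (\<Sum>i\<in>UNIV. u i * w i) \<le> \<tau> \<and> x = (\<Sum>i\<in>UNIV. u i *\<^sub>R a i) - \<tau> *\<^sub>R v)"
proof -
  have e: "(\<Sum>i\<in>UNIV. u i *\<^sub>R (a i + w i *\<^sub>R v)) = (\<Sum>i\<in>UNIV. u i *\<^sub>R a i) + (\<Sum>i\<in>UNIV. u i * w i) *\<^sub>R v" for u
    by (simp add: scaleR_add_right sum.distrib scaleR_sum_left)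
  show ?thesis
  proof
    assume "x \<in> column (\<lambda>i. a i + w i *\<^sub>R v) v"
    then obtain \<tau> u where *: "\<tau> \<ge> 0" "\<forall>i. 0 \<le> u i" "sum u UNIV = 1" "x + \<tau> *\<^sub>R v = (\<Sum>i\<in>UNIV. u i *\<^sub>R (a i + w i *\<^sub>R v))"
      unfolding column_def hull_range by blast
    from *(4) have "x = (\<Sum>i\<in>UNIV. u i *\<^sub>R a i) - (\<tau> - (\<Sum>i\<in>UNIV. u i * w i)) *\<^sub>R v"
      unfolding e by (simp add: scaleR_diff_left algebra_simps)
    moreover have "- (\<Sum>i\<in>UNIV. u i * w i) \<le> \<tau> - (\<Sum>i\<in>UNIV. u i * w i)" using *(1) by simp
    ultimately show "\<exists>u \<tau>. (\<forall>i. 0 \<le> u i) \<and> sum u UNIV = 1 \<and> - (\<Sum>i\<in>UNIV. u i * w i) \<le> \<tau> \<and> x = (\<Sum>i\<in>UNIV. u i *\<^sub>R a i) - \<tau> *\<^sub>R v"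
      using *(2,3) by blast
  next
    assume "\<exists>u \<tau>. (\<forall>i. 0 \<le> u i) \<and> sum u UNIV = 1 \<and> - (\<Sum>i\<in>UNIV. u i * w i) \<le> \<tau> \<and> x = (\<Sum>i\<in>UNIV. u i *\<^sub>R a i) - \<tau> *\<^sub>R v"
    then obtain u \<tau> where *: "\<forall>i. 0 \<le> u i" "sum u UNIV = 1" "- (\<Sum>i\<in>UNIV. u i * w i) \<le> \<tau>" "x = (\<Sum>i\<in>UNIV. u i *\<^sub>R a i) - \<tau> *\<^sub>R v"
      by blast
    have "x + (\<tau> + (\<Sum>i\<in>UNIV. u i * w i)) *\<^sub>R v = (\<Sum>i\<in>UNIV. u i *\<^sub>R (a i + w i *\<^sub>R v))"
      unfolding e *(4) by (simp add: scaleR_add_left)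
    moreover have "0 \<le> \<tau> + (\<Sum>i\<in>UNIV. u i * w i)" using *(3) by simp
    ultimately show "x \<in> column (\<lambda>i. a i + w i *\<^sub>R v) v"
      unfolding column_def hull_range using *(1,2) by blast
  qed
qed

lemma column_iff:
  "x \<in> column a v \<longleftrightarrow> (\<exists>u \<tau>. (\<forall>i. 0 \<le> u i) \<and> sum u UNIV = 1 \<and> 0 \<le> \<tau> \<and> x = (\<Sum>i\<in>UNIV. u i *\<^sub>R a i) - \<tau> *\<^sub>R v)"
  using column_shift_iff[of x a "\<lambda>_. 0" v] by simp

lemma affine_coordinates_unique:
  assumes "span_det a v \<noteq> 0" "sum u UNIV = 1" "sum u' UNIV = 1"
    "(\<Sum>i\<in>UNIV. u i *\<^sub>R a i) - \<tau> *\<^sub>R v = (\<Sum>i\<in>UNIV. u' i *\<^sub>R a i) - \<tau>' *\<^sub>R v"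
  shows "u = u' \<and> \<tau> = \<tau>'"
proof -
  have "(\<Sum>i\<in>UNIV. (u i - u' i) *\<^sub>R a i) = (\<tau> - \<tau>') *\<^sub>R v"
    using assms(4) by (simp add: scaleR_diff_left sum_subtractf algebra_simps)
  then have "\<tau> - \<tau>' = 0 \<and> (\<forall>i. u i - u' i = 0)"
    by (intro span_det_independent[OF assms(1)]) (simp_all add: sum_subtractf assms)
  then show ?thesis by auto
qed

text \<open>Same coordinates as in \<open>column_shift_iff\<close>: here -\<tau> is the weight of
  the new apex, and it can take over at most the weight u k of the vertex below it.\<close>

lemma simplex_over_facet_iff:
  fixes a :: "'n::finite \<Rightarrow> real^'n"
  shows "x \<in> convex hull (insert (a k + v) (range a)) \<longleftrightarrow>
    (\<exists>u \<tau>. (\<forall>i. 0 \<le> u i) \<and> sum u UNIV = 1 \<and> - u k \<le> \<tau> \<and> \<tau> \<le> 0 \<and> x = (\<Sum>i\<in>UNIV. u i *\<^sub>R a i) - \<tau> *\<^sub>R v)" (is "_ \<longleftrightarrow> ?R")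
proof -
  let ?e = "\<lambda>i. if i = k then 1 else (0::real)"
  have ek: "(\<Sum>i\<in>UNIV. ?e i *\<^sub>R a i) = a k" by (simp add: if_distrib[of "\<lambda>c. c *\<^sub>R _"] cong: if_cong)
  show ?thesis
  proof
    assume "x \<in> convex hull (insert (a k + v) (range a))"
    then obtain t b where t: "0 \<le> t" "t \<le> 1" "b \<in> convex hull (range a)" "x = (1 - t) *\<^sub>R (a k + v) + t *\<^sub>R b"
      unfolding convex_hull_insert_range_iff by (elim exE conjE) (rule that)
    define s where "s = 1 - t"
    have *: "0 \<le> s" "0 \<le> t" "s + t = 1" "b \<in> convex hull (range a)" "x = s *\<^sub>R (a k + v) + t *\<^sub>R b"
      using t by (simp_all add: s_def)
    then obtain u where u: "\<forall>i. 0 \<le> u i" "sum u UNIV = 1" "b = (\<Sum>i\<in>UNIV. u i *\<^sub>R a i)" unfolding hull_range by blast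
    let ?u = "\<lambda>i. s * ?e i + t * u i"
    have "x = (\<Sum>i\<in>UNIV. ?u i *\<^sub>R a i) - (- s) *\<^sub>R v"
    proof -
      have "(\<Sum>i\<in>UNIV. ?u i *\<^sub>R a i) = s *\<^sub>R (\<Sum>i\<in>UNIV. ?e i *\<^sub>R a i) + t *\<^sub>R (\<Sum>i\<in>UNIV. u i *\<^sub>R a i)"
        by (simp only: scaleR_add_left sum.distrib scaleR_sum_right scaleR_scaleR)
      then show ?thesis unfolding ek u(3)[symmetric] using *(5) by (simp add: scaleR_add_right)
    qed
    moreover have "sum ?u UNIV = 1" using u(2) *(3) by (simp add: sum.distrib sum_distrib_left[symmetric])
    moreover have "\<forall>i. 0 \<le> ?u i" "- ?u k \<le> - s" "- s \<le> 0" using u *(1,2) by auto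
    ultimately show ?R by (intro exI[of _ ?u] exI[of _ "- s"] conjI)
  next
    assume ?R
    then obtain u \<tau> where *: "\<forall>i. 0 \<le> u i" "sum u UNIV = 1" "- u k \<le> \<tau>" "\<tau> \<le> 0" "x = (\<Sum>i\<in>UNIV. u i *\<^sub>R a i) - \<tau> *\<^sub>R v"
      by blast
    define s where "s = - \<tau>"
    have s: "0 \<le> s" "s \<le> u k" using * by (auto simp: s_def)
    have uk: "u k \<le> 1" using *(1,2) member_le_sum[of k UNIV u] by simp
    let ?w = "\<lambda>i. u i - s * ?e i"
    have w: "(\<Sum>i\<in>UNIV. ?w i *\<^sub>R a i) = (\<Sum>i\<in>UNIV. u i *\<^sub>R a i) - s *\<^sub>R a k"
      by (simp only: scaleR_diff_left sum_subtractf scaleR_scaleR[symmetric] scaleR_sum_right[symmetric] ek)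
    have sw: "sum ?w UNIV = 1 - s" using *(2) by (simp add: sum_subtractf sum_distrib_left[symmetric])
    have x: "x = s *\<^sub>R (a k + v) + (\<Sum>i\<in>UNIV. ?w i *\<^sub>R a i)" unfolding w *(5) by (simp add: s_def scaleR_add_right)
    have wn: "0 \<le> ?w i" for i using s *(1) by auto
    show "x \<in> convex hull (insert (a k + v) (range a))"
    proof (cases "s = 1")
      case True
      then have "\<forall>i. ?w i = 0" using sw wn by (simp add: sum_nonneg_eq_0_iff)
      then have "x = a k + v" unfolding x using True by simp
      then show ?thesis by (simp add: hull_inc)
    next
      case False
      then have s1: "s < 1" using s uk by linarith
      let ?b = "\<Sum>i\<in>UNIV. (?w i / (1 - s)) *\<^sub>R a i"
      have "?b \<in> convex hull (range a)"
      proof (rule hull_rangeI)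
        show "0 \<le> ?w i / (1 - s)" for i using wn[of i] s1 by (intro divide_nonneg_pos) auto
        show "(\<Sum>i\<in>UNIV. ?w i / (1 - s)) = 1" using s1 sw by (simp add: sum_divide_distrib[symmetric])
      qed
      moreover have "x = (1 - (1 - s)) *\<^sub>R (a k + v) + (1 - s) *\<^sub>R ?b" unfolding x using s1 by (simp add: scaleR_sum_right)
      moreover have "0 \<le> 1 - s" "1 - s \<le> 1" using s s1 by auto
      ultimately show ?thesis unfolding convex_hull_insert_range_iff
        by (intro exI[of _ "1 - s"] exI[of _ ?b] conjI)
    qed
  qed
qed

lemma negligible_lowdim_hull:
  fixes S :: "'a::euclidean_space set"
  assumes "finite S" "card S \<le> DIM('a)"
  shows "negligible (affine hull S)"
proof (cases "S = {}")
  case False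
  then obtain x where x: "x \<in> S" by blast
  let ?T = "(\<lambda>y. - x + y) ` (S - {x})"
  have "dim ?T \<le> card ?T" using assms(1) by (intro dim_le_card') auto
  also have "\<dots> \<le> card (S - {x})" using assms(1) by (intro card_image_le) auto
  also have "\<dots> < DIM('a)" using x assms by (metis card_Diff1_less order_less_le_trans)
  finally have "negligible (span ?T)" by (intro negligible_lowdim) simp
  then have "negligible ((+) x ` span ?T)" by (rule negligible_translation)
  then show ?thesis using affine_hull_span2[OF x] by simp
qed simp

lemma negligible_hull_range: "negligible (convex hull (range (a :: 'n::finite \<Rightarrow> real^'n)))"
proof -
  have "negligible (affine hull (range a))" by (rule negligible_lowdim_hull) (simp_all add: card_image_le)
  then show ?thesis using convex_hull_subset_affine_hull negligible_subset by blast
qed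

lemma compact_hull_range: "compact (convex hull (range (a :: 'n::finite \<Rightarrow> 'a::euclidean_space)))"
  by (intro finite_imp_compact_convex_hull) simp

lemma closed_column: "closed (column a v)"
proof -
  have "column a v = (\<Union>x\<in>convex hull (range a). \<Union>y\<in>(\<lambda>\<tau>. \<tau> *\<^sub>R v) ` {0..}. {x - y})"
    by (force simp: column_def algebra_simps)
  moreover have "closed ((\<lambda>\<tau>. \<tau> *\<^sub>R v) ` {0..})"
  proof (cases "v = 0")
    case False
    then show ?thesis
      by (intro closed_injective_linear_image) (auto intro!: injI linearI simp: scaleR_add_left)
  qed (simp add: image_constant_conv)
  ultimately show ?thesis by (simp only: compact_closed_differences[OF compact_hull_range])
qed

text \<open>In the coordinates u and \<tau> the lower bound for \<tau> drops from 0 to -u k. The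
  added points fill the simplex over the facet with apex \<open>a k + v\<close>, except for its base
  \<tau> = 0, which is a null set.\<close>

lemma column_step:
  fixes a :: "'n::finite \<Rightarrow> real^'n"
  assumes D: "span_det a v \<noteq> 0"
  shows "column a v \<subseteq> column (a(k := a k + v)) v"
    "column (a(k := a k + v)) v - column a v \<in> lmeasurable"
    "measure lebesgue (column (a(k := a k + v)) v - column a v) = \<bar>span_det a v\<bar> / fact CARD('n)"
proof -
  let ?e = "\<lambda>i. if i = k then 1 else (0::real)"
  have a': "a(k := a k + v) = (\<lambda>i. a i + ?e i *\<^sub>R v)" by auto
  have c': "x \<in> column (a(k := a k + v)) v \<longleftrightarrow>
    (\<exists>u \<tau>. (\<forall>i. 0 \<le> u i) \<and> sum u UNIV = 1 \<and> - u k \<le> \<tau> \<and> x = (\<Sum>i\<in>UNIV. u i *\<^sub>R a i) - \<tau> *\<^sub>R v)" for x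
    unfolding a' column_shift_iff by (simp add: if_distrib cong: if_cong)
  show sub: "column a v \<subseteq> column (a(k := a k + v)) v"
  proof
    fix x assume "x \<in> column a v"
    then obtain u \<tau> where *: "\<forall>i. 0 \<le> u i" "sum u UNIV = 1" "0 \<le> \<tau>" "x = (\<Sum>i\<in>UNIV. u i *\<^sub>R a i) - \<tau> *\<^sub>R v"
      unfolding column_iff by blast
    then have "- u k \<le> \<tau>" by (meson neg_le_0_iff_le order_trans)
    then show "x \<in> column (a(k := a k + v)) v" unfolding c' using * by blast
  qed
  let ?S = "convex hull (insert (a k + v) (range a))"
  have 1: "column (a(k := a k + v)) v - column a v \<subseteq> ?S"
  proof
    fix x assume x: "x \<in> column (a(k := a k + v)) v - column a v"
    then obtain u \<tau> where *: "\<forall>i. 0 \<le> u i" "sum u UNIV = 1" "- u k \<le> \<tau>" "x = (\<Sum>i\<in>UNIV. u i *\<^sub>R a i) - \<tau> *\<^sub>R v"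
      using c' by blast
    moreover have "\<tau> \<le> 0"
    proof (rule ccontr)
      assume "\<not> \<tau> \<le> 0"
      then have "x \<in> column a v" unfolding column_iff
        by (intro exI[of _ u] exI[of _ \<tau>] conjI *) simp
      then show False using x by blast
    qed
    ultimately show "x \<in> ?S" unfolding simplex_over_facet_iff by blast
  qed
  have 2: "?S \<subseteq> (column (a(k := a k + v)) v - column a v) \<union> convex hull (range a)"
  proof
    fix x assume "x \<in> ?S"
    then obtain u \<tau> where *: "\<forall>i. 0 \<le> u i" "sum u UNIV = 1" "- u k \<le> \<tau>" "\<tau> \<le> 0" "x = (\<Sum>i\<in>UNIV. u i *\<^sub>R a i) - \<tau> *\<^sub>R v"
      unfolding simplex_over_facet_iff by blast
    show "x \<in> (column (a(k := a k + v)) v - column a v) \<union> convex hull (range a)"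
    proof (cases "x \<in> column a v")
      case True
      then obtain u' \<tau>' where u': "sum u' UNIV = 1" "0 \<le> \<tau>'" "x = (\<Sum>i\<in>UNIV. u' i *\<^sub>R a i) - \<tau>' *\<^sub>R v"
        unfolding column_iff by blast
      have "\<tau> = \<tau>'"
        using affine_coordinates_unique[OF D *(2) u'(1) trans[OF sym[OF *(5)] u'(3)]] by (rule conjunct2)
      then have "x = (\<Sum>i\<in>UNIV. u i *\<^sub>R a i)" using *(4,5) u'(2) by simp
      then show ?thesis using *(1,2) unfolding hull_range by blast
    next
      case False
      then show ?thesis using * c' by blast
    qed
  qed
  have S: "?S \<in> lmeasurable" by (intro lmeasurable_compact finite_imp_compact_convex_hull) simp
  have n: "negligible ((?S - (column (a(k := a k + v)) v - column a v)) \<union> ((column (a(k := a k + v)) v - column a v) - ?S))"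
    using 1 2 by (intro negligible_subset[OF negligible_hull_range[of a]]) blast
  show "column (a(k := a k + v)) v - column a v \<in> lmeasurable"
    using lmeasurable_negligible_symdiff[OF S n] .
  show "measure lebesgue (column (a(k := a k + v)) v - column a v) = \<bar>span_det a v\<bar> / fact CARD('n)"
    using measure_negligible_symdiff[OF S n] by (simp add: measure_simplex_span_det)
qed

text \<open>The vertices are shifted one at a time. By \<open>span_det_shift_along\<close> every
  step sees the same determinant and so adds the same volume.\<close>

lemma column_shift_all:
  fixes a :: "'n::finite \<Rightarrow> real^'n"
  assumes D: "span_det a v \<noteq> 0"
  shows "column (\<lambda>i. a i + v) v - column a v \<in> lmeasurable"
    "measure lebesgue (column (\<lambda>i. a i + v) v - column a v) = CARD('n) * \<bar>span_det a v\<bar> / fact CARD('n)"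
proof -
  define b where "b S i = a i + (if i \<in> S then 1 else 0) *\<^sub>R v" for S and i :: 'n
  have "column a v \<subseteq> column (b S) v \<and> column (b S) v - column a v \<in> lmeasurable \<and>
      measure lebesgue (column (b S) v - column a v) = card S * \<bar>span_det a v\<bar> / fact CARD('n)" if "finite S" for S
    using that
  proof (induction S rule: finite_induct)
    case empty then show ?case by (simp add: b_def)
  next
    case (insert k S)
    have Db: "span_det (b S) v = span_det a v" unfolding b_def by (rule span_det_shift_along)
    have bi: "b (insert k S) = (b S)(k := b S k + v)" using insert.hyps by (auto simp: b_def)
    note st = column_step[of "b S" v k, unfolded Db bi[symmetric], OF D]
    have eq: "column (b (insert k S)) v - column a v = (column (b (insert k S)) v - column (b S) v) \<union> (column (b S) v - column a v)"
      using st(1) insert.IH by blast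
    have "measure lebesgue (column (b (insert k S)) v - column a v) =
        measure lebesgue (column (b (insert k S)) v - column (b S) v) + measure lebesgue (column (b S) v - column a v)"
    proof -
      have "(column (b S) v - column a v) - (column (b (insert k S)) v - column (b S) v) = column (b S) v - column a v" by blast
      then show ?thesis unfolding eq using measure_Un2[OF st(2), of "column (b S) v - column a v"] insert.IH by simp
    qed
    then show ?case using st insert.IH insert.hyps eq by (auto simp: field_simps)
  qed
  from this[of UNIV] show "column (\<lambda>i. a i + v) v - column a v \<in> lmeasurable"
    "measure lebesgue (column (\<lambda>i. a i + v) v - column a v) = CARD('n) * \<bar>span_det a v\<bar> / fact CARD('n)"
    by (simp_all add: b_def[abs_def])
qed

text \<open>The generalised cross product of the edge vectors, up to sign: orthogonal to the facet,
  with length (d - 1)! times its area.\<close>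

definition facet_normal :: "('n::finite \<Rightarrow> real^'n) \<Rightarrow> real^'n" where
  "facet_normal a = (\<chi> i. span_det a (axis i 1))"

lemma span_det_inner: "span_det a v = facet_normal a \<bullet> v"
proof -
  have "span_det a v = span_det a (\<Sum>i\<in>UNIV. (v $ i) *\<^sub>R axis i 1)"
    using basis_expansion[of v] by (simp add: scalar_mult_eq_scaleR)
  then show ?thesis
    by (simp add: linear_sum[OF linear_span_det] linear_cmul[OF linear_span_det] inner_vec_def facet_normal_def mult.commute)
qed

section \<open>Open facets and the null sets of exceptional lines\<close>

definition open_facet :: "('n::finite \<Rightarrow> real^'n) \<Rightarrow> (real^'n) set" where
  "open_facet a = {\<Sum>i\<in>UNIV. u i *\<^sub>R a i | u. (\<forall>i. 0 < u i) \<and> sum u UNIV = 1}"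

lemma open_facet_subset: "open_facet a \<subseteq> convex hull (range a)"
  unfolding open_facet_def hull_range by (auto intro: less_imp_le)

lemma span_det_hull_diff:
  assumes "x \<in> convex hull (range a)" "y \<in> convex hull (range a)"
  shows "span_det a (x - y) = 0"
proof -
  obtain u w where *: "sum u UNIV = 1" "x = (\<Sum>i\<in>UNIV. u i *\<^sub>R a i)" "sum w UNIV = 1" "y = (\<Sum>i\<in>UNIV. w i *\<^sub>R a i)"
    using assms unfolding hull_range by blast
  have "x - y = (\<Sum>i\<in>UNIV. (u i - w i) *\<^sub>R a i)" by (simp add: * scaleR_diff_left sum_subtractf)
  then show ?thesis using span_det_sum_vertices[of "\<lambda>i. u i - w i" a] * by (simp add: sum_subtractf)
qed

text \<open>A line parallel to the facet that meets it stays in the hyperplane of the facet. The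
  vector w certifies that the normal is nonzero, so that this set is a proper hyperplane.\<close>

lemma negligible_parallel_sweep:
  assumes "span_det a v = 0" "span_det a w \<noteq> 0"
  shows "negligible {x. \<exists>\<tau>. x + \<tau> *\<^sub>R v \<in> convex hull (range a)}"
proof (rule negligible_subset)
  have "facet_normal a \<noteq> 0" using assms(2) by (auto simp: span_det_inner)
  then show "negligible {x. facet_normal a \<bullet> x = facet_normal a \<bullet> a undefined}" by (intro negligible_hyperplane) auto
  show "{x. \<exists>\<tau>. x + \<tau> *\<^sub>R v \<in> convex hull (range a)} \<subseteq> {x. facet_normal a \<bullet> x = facet_normal a \<bullet> a undefined}"
  proof safe
    fix x \<tau> assume "x + \<tau> *\<^sub>R v \<in> convex hull (range a)"
    then have "span_det a (x + \<tau> *\<^sub>R v - a undefined) = 0" by (rule span_det_hull_diff) (simp add: hull_inc)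
    then show "facet_normal a \<bullet> x = facet_normal a \<bullet> a undefined"
      using assms(1) by (simp add: span_det_inner inner_diff_right inner_add_right)
  qed
qed

text \<open>A point of the facet with a vanishing weight lies in the hull of the other d - 1
  vertices. Adjoining the direction v gives the affine hull of d points, still of dimension at most
  d - 1.\<close>

lemma negligible_boundary_sweep:
  fixes a :: "'n::finite \<Rightarrow> real^'n"
  shows "negligible {x. \<exists>\<tau>. x + \<tau> *\<^sub>R v \<in> convex hull (range a) - open_facet a}"
proof (rule negligible_subset)
  let ?H = "\<lambda>p. affine hull (insert (a (snd p) + v) (a ` (- {fst p})))"
  let ?P = "{p :: 'n \<times> 'n. fst p \<noteq> snd p}"
  show "negligible (\<Union>p\<in>?P. ?H p)"
  proof (rule negligible_Union)
    show "finite (?H ` ?P)" by simp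
    fix t assume "t \<in> ?H ` ?P"
    then obtain p where t: "t = ?H p" by blast
    have "card (insert (a (snd p) + v) (a ` (- {fst p}))) \<le> Suc (card (a ` (- {fst p})))" by (rule card_insert_le_m1) auto
    also have "card (a ` (- {fst p})) \<le> card (- {fst p})" by (rule card_image_le) simp
    also have "card (- {fst p}) = CARD('n) - 1" by (simp add: Compl_eq_Diff_UNIV)
    finally have "card (insert (a (snd p) + v) (a ` (- {fst p}))) \<le> CARD('n)" by simp
    then show "negligible t" unfolding t by (intro negligible_lowdim_hull) simp_all
  qed
  show "{x. \<exists>\<tau>. x + \<tau> *\<^sub>R v \<in> convex hull (range a) - open_facet a} \<subseteq> (\<Union>p\<in>?P. ?H p)"
  proof safe
    fix x \<tau> assume h: "x + \<tau> *\<^sub>R v \<in> convex hull (range a)" and n: "x + \<tau> *\<^sub>R v \<notin> open_facet a"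
    obtain u where u: "\<forall>i. 0 \<le> u i" "sum u UNIV = 1" "x + \<tau> *\<^sub>R v = (\<Sum>i\<in>UNIV. u i *\<^sub>R a i)"
      using h unfolding hull_range by blast
    have "\<exists>i. \<not> 0 < u i" using n u unfolding open_facet_def by blast
    then obtain i where i: "u i = 0" using u(1) by (metis less_eq_real_def)
    have s1: "sum u (- {i}) = 1" using u(2) i by (subst (asm) sum.remove[of _ i]) (auto simp: Compl_eq_Diff_UNIV)
    \<comment> \<open>The weights other than u i sum to 1, so there is a second vertex; with it v is
      the difference of two points of \<open>?A\<close>, namely \<open>a k + v\<close> and
      \<open>a k\<close>.\<close>
    then obtain k where k: "k \<noteq> i" by (metis Compl_iff insert_iff sum.neutral zero_neq_one)
    let ?A = "?H (i, k)"
    have "x + \<tau> *\<^sub>R v = (\<Sum>j\<in>-{i}. u j *\<^sub>R a j)" unfolding u(3) using i by (subst sum.remove[of _ i]) (auto simp: Compl_eq_Diff_UNIV)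
    also have "\<dots> \<in> convex hull (a ` (- {i}))" by (rule convex_sum) (use s1 u in \<open>auto intro: hull_inc\<close>)
    also have "\<dots> \<subseteq> ?A" by (metis convex_hull_subset_affine_hull hull_mono subset_insertI subset_trans fst_conv snd_conv)
    finally have y: "x + \<tau> *\<^sub>R v \<in> ?A" .
    have z: "a k + v \<in> ?A" "a k \<in> ?A" using k by (auto intro: hull_inc)
    have "x + \<tau> *\<^sub>R v + (- \<tau>) *\<^sub>R ((a k + v) - a k) \<in> ?A"
      by (rule mem_affine_3_minus[OF affine_affine_hull y z])
    then have "x \<in> ?A" by simp
    then show "x \<in> (\<Union>p\<in>?P. ?H p)" using k by (intro UN_I[of "(i, k)"]) auto
  qed
qed

text \<open>The function g plus the jumps passed so far is locally constant, hence constant on the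
  half line. Its values at 0 and at a point beyond all jumps are compared.\<close>

lemma sum_jumps:
  fixes g l r :: "real \<Rightarrow> real"
  assumes S: "finite S" "S \<subseteq> {0<..}"
    and loc: "\<And>\<tau>. 0 \<le> \<tau> \<Longrightarrow> \<tau> \<notin> S \<Longrightarrow> \<forall>\<^sub>F z in nhds \<tau>. g z = g \<tau>"
    and jump: "\<And>\<tau>. \<tau> \<in> S \<Longrightarrow> \<forall>\<^sub>F \<epsilon> in at_right 0. g (\<tau> - \<epsilon>) = l \<tau> \<and> g (\<tau> + \<epsilon>) = r \<tau>"
    and zero: "\<And>\<tau>. R \<le> \<tau> \<Longrightarrow> g \<tau> = 0"
  shows "g 0 = (\<Sum>\<tau>\<in>S. l \<tau> - r \<tau>)"
proof -
  \<comment> \<open>At a jump point nothing is known about g itself. As the sum already counts the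
    jump there, the value behind the jump is the one to insert.\<close>
  define k where "k \<tau> = (if \<tau> \<in> S then r \<tau> else g \<tau>) + (\<Sum>\<sigma>\<in>{\<sigma>\<in>S. \<sigma> \<le> \<tau>}. l \<sigma> - r \<sigma>)" for \<tau>
  have lc: "\<exists>e>0. \<forall>z. \<bar>z - \<tau>\<bar> < e \<longrightarrow> k z = k \<tau>" if \<tau>: "0 \<le> \<tau>" for \<tau>
  proof -
    obtain d where d: "d > 0" "\<And>x. x \<in> S \<Longrightarrow> x \<noteq> \<tau> \<Longrightarrow> d \<le> dist \<tau> x" using finite_set_avoid[OF S(1), of \<tau>] by blast
    have noS: "z \<notin> S" if "\<bar>z - \<tau>\<bar> < d" "z \<noteq> \<tau>" for z
      using d(2)[of z] that by (auto simp: dist_real_def abs_minus_commute)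
    have le: "x \<le> z \<longleftrightarrow> x \<le> \<tau>" if "x \<in> S" "x \<noteq> \<tau>" "\<bar>z - \<tau>\<bar> < d" for x z
      using d(2)[OF that(1,2)] that(3) by (auto simp: dist_real_def)
    show ?thesis
    proof (cases "\<tau> \<in> S")
      case False
      then obtain e where e: "e > 0" "\<And>z. dist z \<tau> < e \<Longrightarrow> g z = g \<tau>"
        using loc[OF \<tau>] unfolding eventually_nhds_metric by blast
      show ?thesis
      proof (intro exI[of _ "min d e"] conjI allI impI)
        fix z assume z: "\<bar>z - \<tau>\<bar> < min d e"
        then have "z \<notin> S" using noS[of z] False by (cases "z = \<tau>") auto
        moreover have "{\<sigma>\<in>S. \<sigma> \<le> z} = {\<sigma>\<in>S. \<sigma> \<le> \<tau>}" using le False z by auto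
        moreover have "g z = g \<tau>" using e(2) z by (simp add: dist_real_def)
        ultimately show "k z = k \<tau>" using False by (simp add: k_def)
      qed (use d e in auto)
    next
      case True
      then obtain e where e: "e > 0" "\<And>\<epsilon>. 0 < \<epsilon> \<Longrightarrow> \<epsilon> < e \<Longrightarrow> g (\<tau> - \<epsilon>) = l \<tau> \<and> g (\<tau> + \<epsilon>) = r \<tau>"
        using jump unfolding eventually_at_right_field by force
      show ?thesis
      proof (intro exI[of _ "min d e"] conjI allI impI)
        fix z assume z: "\<bar>z - \<tau>\<bar> < min d e"
        consider "z = \<tau>" | "z < \<tau>" | "\<tau> < z" by linarith
        then show "k z = k \<tau>"
        proof cases
          case 2
          then have zS: "z \<notin> S" using noS[of z] z by auto
          have gz: "g z = l \<tau>" using e(2)[of "\<tau> - z"] 2 z by simp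
          have "x \<le> z" if "x \<in> S" "x \<noteq> \<tau>" "x \<le> \<tau>" for x using le[OF that(1,2), of z] that(3) z by simp
          then have "{\<sigma>\<in>S. \<sigma> \<le> \<tau>} = insert \<tau> {\<sigma>\<in>S. \<sigma> \<le> z}" using True 2 by force
          moreover have "\<tau> \<notin> {\<sigma>\<in>S. \<sigma> \<le> z}" using 2 by simp
          ultimately show ?thesis using True zS gz S(1) by (simp add: k_def)
        next
          case 3
          then have zS: "z \<notin> S" using noS[of z] z by auto
          have gz: "g z = r \<tau>" using e(2)[of "z - \<tau>"] 3 z by simp
          have "x \<le> z \<longleftrightarrow> x \<le> \<tau>" if "x \<in> S" for x
            using le[OF that, of z] z 3 by (cases "x = \<tau>") auto
          then have "{\<sigma>\<in>S. \<sigma> \<le> z} = {\<sigma>\<in>S. \<sigma> \<le> \<tau>}" by blast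
          then show ?thesis using True zS gz by (simp add: k_def)
        qed simp
      qed (use d e in auto)
    qed
  qed
  have const: "k 0 = k z" if "0 \<le> z" for z
  proof (rule connected_equivalence_relation[where S="{0..}" and R="\<lambda>x y. k x = k y"])
    fix x :: real assume "x \<in> {0..}"
    then have "0 \<le> x" by simp
    from lc[OF this] obtain e where "e > 0" "\<forall>z. \<bar>z - x\<bar> < e \<longrightarrow> k z = k x" by blast
    then show "\<exists>T. openin (top_of_set {0..}) T \<and> x \<in> T \<and> (\<forall>y\<in>T. k x = k y)"
    proof (intro exI conjI ballI)
      show "openin (top_of_set {0..}) ({0..} \<inter> ball x e)" by (rule openin_open_Int) simp
      show "x \<in> {0..} \<inter> ball x e" using \<open>0 < e\<close> \<open>0 \<le> x\<close> by simp
      fix y assume "y \<in> {0..} \<inter> ball x e"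
      then have "\<bar>y - x\<bar> < e" by (simp add: dist_real_def abs_minus_commute)
      then show "k x = k y" using spec[OF \<open>\<forall>z. \<bar>z - x\<bar> < e \<longrightarrow> k z = k x\<close>, of y] by (metis)
    qed
  qed (use that in auto)
  define z where "z = Max (insert 0 (insert R S)) + 1"
  have z: "0 \<le> z" "R \<le> z" "\<And>x. x \<in> S \<Longrightarrow> x < z"
  proof -
    have "x < z" if "x \<in> insert 0 (insert R S)" for x
    proof -
      have "x \<le> Max (insert 0 (insert R S))" using that S(1) by (intro Max_ge) auto
      then show ?thesis unfolding z_def by linarith
    qed
    then show "0 \<le> z" "R \<le> z" "\<And>x. x \<in> S \<Longrightarrow> x < z" by (auto intro: less_imp_le)
  qed
  have "k 0 = g 0"
  proof -
    have n: "0 \<notin> S" and e: "{\<sigma>\<in>S. \<sigma> \<le> 0} = {}" using S(2) by force+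
    show ?thesis unfolding k_def e using n by simp
  qed
  moreover have "k z = (\<Sum>\<tau>\<in>S. l \<tau> - r \<tau>)"
  proof -
    have n: "z \<notin> S" and e: "{\<sigma>\<in>S. \<sigma> \<le> z} = S" using z(3) by force+
    show ?thesis unfolding k_def e using n zero[OF z(2)] by simp
  qed
  ultimately show ?thesis using const[OF z(1)] by simp
qed

section \<open>Sets bounded by facets\<close>

text \<open>\<open>\<sigma> j\<close> records whether the normal \<open>facet_normal (A j)\<close> points out of or into \<open>I\<close>.\<close>

definition sided :: "'s set \<Rightarrow> ('s \<Rightarrow> 'n::finite \<Rightarrow> real^'n) \<Rightarrow> ('s \<Rightarrow> real) \<Rightarrow> (real^'n) set \<Rightarrow> bool" where
  "sided J A \<sigma> I \<longleftrightarrow> finite J \<and> bounded I \<and> frontier I \<subseteq> (\<Union>j\<in>J. convex hull (range (A j))) \<and>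
     (\<forall>i\<in>J. \<forall>j\<in>J. i \<noteq> j \<longrightarrow> open_facet (A i) \<inter> convex hull (range (A j)) = {}) \<and>
     (\<forall>j\<in>J. (\<sigma> j = 1 \<or> \<sigma> j = - 1) \<and> (\<exists>v. span_det (A j) v \<noteq> 0) \<and>
       (\<forall>x\<in>open_facet (A j). \<forall>v. 0 < \<sigma> j * span_det (A j) v \<longrightarrow>
          (\<forall>\<^sub>F \<epsilon> in at_right 0. x + \<epsilon> *\<^sub>R v \<notin> I \<and> x - \<epsilon> *\<^sub>R v \<in> I)))"

lemma negligible_frontier_sided: "sided J A \<sigma> I \<Longrightarrow> negligible (frontier I)"
proof -
  assume "sided J A \<sigma> I"
  then have "frontier I \<subseteq> (\<Union>j\<in>J. convex hull (range (A j)))" "finite J" by (simp_all add: sided_def)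
  moreover from this(2) have "negligible (\<Union>j\<in>J. convex hull (range (A j)))"
    by (intro negligible_Union) (auto simp: negligible_hull_range)
  ultimately show ?thesis using negligible_subset by blast
qed

text \<open>For x outside the null set B the line in direction v avoids the relative boundaries of
  all facets and all facets parallel to v. Then each facet is crossed at most once, different facets
  at different times, and at each crossing the indicator switches in the direction given by \<sigma>
  and the determinant. Since I is bounded, the ray ends outside, and \<open>sum_jumps\<close>
  applies.\<close>

theorem sided_indicator:
  fixes A :: "'s \<Rightarrow> 'n::finite \<Rightarrow> real^'n"
  assumes sd: "sided J A \<sigma> I" and v: "v \<noteq> 0"
  shows "AE x in lebesgue. indicat_real I x = (\<Sum>j\<in>J. \<sigma> j * sgn (span_det (A j) v) * indicat_real (column (A j) v) x)"
proof -
  let ?hull = "\<lambda>j. convex hull (range (A j))"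
  let ?D = "\<lambda>j. span_det (A j) v"
  have J: "finite J" and bI: "bounded I" and fr: "frontier I \<subseteq> (\<Union>j\<in>J. ?hull j)"
    and dis: "\<And>i j. i \<in> J \<Longrightarrow> j \<in> J \<Longrightarrow> i \<noteq> j \<Longrightarrow> open_facet (A i) \<inter> ?hull j = {}"
    and sg: "\<And>j. j \<in> J \<Longrightarrow> \<sigma> j = 1 \<or> \<sigma> j = - 1"
    and nd: "\<And>j. j \<in> J \<Longrightarrow> \<exists>v. span_det (A j) v \<noteq> 0"
    and side: "\<And>j x v. j \<in> J \<Longrightarrow> x \<in> open_facet (A j) \<Longrightarrow> 0 < \<sigma> j * span_det (A j) v \<Longrightarrow>
          \<forall>\<^sub>F \<epsilon> in at_right 0. x + \<epsilon> *\<^sub>R v \<notin> I \<and> x - \<epsilon> *\<^sub>R v \<in> I"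
    using sd unfolding sided_def by blast+
  define B where "B = (\<Union>j\<in>J. ?hull j) \<union> (\<Union>j\<in>{j\<in>J. ?D j = 0}. {x. \<exists>\<tau>. x + \<tau> *\<^sub>R v \<in> ?hull j}) \<union>
    (\<Union>j\<in>J. {x. \<exists>\<tau>. x + \<tau> *\<^sub>R v \<in> ?hull j - open_facet (A j)})"
  have "negligible (\<Union>j\<in>J. ?hull j)"
    using J by (intro negligible_Union) (auto simp: negligible_hull_range)
  moreover have "negligible (\<Union>j\<in>{j\<in>J. ?D j = 0}. {x. \<exists>\<tau>. x + \<tau> *\<^sub>R v \<in> ?hull j})"
    using J nd by (intro negligible_Union) (auto intro: negligible_parallel_sweep)
  moreover have "negligible (\<Union>j\<in>J. {x. \<exists>\<tau>. x + \<tau> *\<^sub>R v \<in> ?hull j - open_facet (A j)})"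
  proof (rule negligible_Union)
    fix t assume "t \<in> (\<lambda>j. {x. \<exists>\<tau>. x + \<tau> *\<^sub>R v \<in> ?hull j - open_facet (A j)}) ` J"
    then obtain j where "t = {x. \<exists>\<tau>. x + \<tau> *\<^sub>R v \<in> ?hull j - open_facet (A j)}" by blast
    then show "negligible t" by (simp only: negligible_boundary_sweep)
  qed (use J in simp)
  ultimately have "negligible B" unfolding B_def by (intro negligible_Un)
  then have "AE x in lebesgue. x \<notin> B" by (simp add: negligible_iff_null_sets AE_not_in)
  then show ?thesis
  proof eventually_elim
    fix x assume x: "x \<notin> B"
    define g where "g \<tau> = indicat_real I (x + \<tau> *\<^sub>R v)" for \<tau>
    define J' where "J' = {j\<in>J. x \<in> column (A j) v}"
    define t where "t j = (SOME \<tau>. 0 \<le> \<tau> \<and> x + \<tau> *\<^sub>R v \<in> ?hull j)" for j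
    have t: "0 \<le> t j" "x + t j *\<^sub>R v \<in> ?hull j" if "j \<in> J'" for j
    proof -
      have "\<exists>\<tau>. 0 \<le> \<tau> \<and> x + \<tau> *\<^sub>R v \<in> ?hull j" using that by (auto simp: J'_def column_def)
      from someI_ex[OF this] show "0 \<le> t j" "x + t j *\<^sub>R v \<in> ?hull j" by (auto simp: t_def)
    qed
    have tpos: "0 < t j" if "j \<in> J'" for j
    proof -
      have "t j \<noteq> 0" using t(2)[OF that] x that by (auto simp: B_def J'_def)
      then show ?thesis using t(1)[OF that] by simp
    qed
    have D: "?D j \<noteq> 0" if "j \<in> J'" for j using t[OF that] x that by (auto simp: B_def J'_def)
    have op: "x + \<tau> *\<^sub>R v \<in> open_facet (A j)" if "j \<in> J" "x + \<tau> *\<^sub>R v \<in> ?hull j" for j \<tau>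
      using x that by (auto simp: B_def)
    have uniq: "\<tau> = t j" if "j \<in> J'" "x + \<tau> *\<^sub>R v \<in> ?hull j" for j \<tau>
    proof -
      have "span_det (A j) ((x + \<tau> *\<^sub>R v) - (x + t j *\<^sub>R v)) = 0"
        using that t(2) by (intro span_det_hull_diff) auto
      also have "(x + \<tau> *\<^sub>R v) - (x + t j *\<^sub>R v) = (\<tau> - t j) *\<^sub>R v" by (simp add: scaleR_diff_left)
      finally show ?thesis using D[OF that(1)] by (simp add: linear_cmul[OF linear_span_det])
    qed
    have inj: "inj_on t J'"
    proof (rule inj_onI, rule ccontr)
      fix i j assume ij: "i \<in> J'" "j \<in> J'" "t i = t j" "i \<noteq> j"
      then have "x + t i *\<^sub>R v \<in> open_facet (A i)" "x + t i *\<^sub>R v \<in> ?hull j"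
        using op[of i "t i"] t(2)[of i] t(2)[of j] by (auto simp: J'_def)
      then show False using dis[of i j] ij by (auto simp: J'_def)
    qed
    \<comment> \<open>The value of the indicator just before the crossing: 1 if the ray leaves I
      there, 0 if it enters. The value behind is 1 - l, so the jump l - (1 - l) is \<sigma> times
      the sign of the determinant.\<close>
    define l where "l \<tau> = (if 0 < \<sigma> (inv_into J' t \<tau>) * ?D (inv_into J' t \<tau>) then 1 else (0::real))" for \<tau>
    have l: "l (t j) = (if 0 < \<sigma> j * ?D j then 1 else 0)" if "j \<in> J'" for j
      using that inj by (simp add: l_def)
    obtain M where M: "\<And>y. y \<in> I \<Longrightarrow> norm y \<le> M" using bI by (auto simp: bounded_iff)
    have "g 0 = (\<Sum>\<tau>\<in>t ` J'. l \<tau> - (1 - l \<tau>))"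
    proof (rule sum_jumps[where R="(\<bar>M\<bar> + norm x + 1) / norm v"])
      show "finite (t ` J')" using J by (simp add: J'_def)
      show "t ` J' \<subseteq> {0<..}" using tpos by auto
    next
      fix \<tau> :: real assume \<tau>: "0 \<le> \<tau>" "\<tau> \<notin> t ` J'"
      have "x + \<tau> *\<^sub>R v \<notin> ?hull j" if "j \<in> J" for j
      proof
        assume h: "x + \<tau> *\<^sub>R v \<in> ?hull j"
        then have "j \<in> J'" using that \<tau>(1) by (auto simp: J'_def column_def)
        then show False using uniq[OF _ h] \<tau>(2) by auto
      qed
      then have "x + \<tau> *\<^sub>R v \<notin> frontier I" using fr by blast
      then have "\<forall>\<^sub>F y in nhds (x + \<tau> *\<^sub>R v). indicat_real I y = indicat_real I (x + \<tau> *\<^sub>R v)"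
      proof (cases "x + \<tau> *\<^sub>R v \<in> I")
        case True
        then have "x + \<tau> *\<^sub>R v \<in> interior I" using \<open>x + \<tau> *\<^sub>R v \<notin> frontier I\<close> closure_subset by (auto simp: frontier_def)
        then have "\<forall>\<^sub>F y in nhds (x + \<tau> *\<^sub>R v). y \<in> interior I" by (intro eventually_nhds_in_open) auto
        then show ?thesis by eventually_elim (use True interior_subset in \<open>auto simp: indicator_def\<close>)
      next
        case False
        then have "x + \<tau> *\<^sub>R v \<in> - closure I" using \<open>x + \<tau> *\<^sub>R v \<notin> frontier I\<close> interior_subset by (auto simp: frontier_def)
        then have "\<forall>\<^sub>F y in nhds (x + \<tau> *\<^sub>R v). y \<in> - closure I" by (intro eventually_nhds_in_open) auto
        then show ?thesis by eventually_elim (use False closure_subset in \<open>auto simp: indicator_def\<close>)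
      qed
      moreover have "filterlim (\<lambda>z. x + z *\<^sub>R v) (nhds (x + \<tau> *\<^sub>R v)) (nhds \<tau>)"
        by (intro tendsto_intros filterlim_ident)
      ultimately show "\<forall>\<^sub>F z in nhds \<tau>. g z = g \<tau>" unfolding g_def by (rule eventually_compose_filterlim)
    next
      fix \<tau> assume "\<tau> \<in> t ` J'"
      then obtain j where j: "j \<in> J'" "\<tau> = t j" by blast
      have jJ: "j \<in> J" using j by (simp add: J'_def)
      have o: "x + t j *\<^sub>R v \<in> open_facet (A j)" using op[OF jJ t(2)[OF j(1)]] .
      have nz: "\<sigma> j * ?D j \<noteq> 0" using sg[OF jJ] D[OF j(1)] by auto
      show "\<forall>\<^sub>F \<epsilon> in at_right 0. g (\<tau> - \<epsilon>) = l \<tau> \<and> g (\<tau> + \<epsilon>) = 1 - l \<tau>"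
      proof (cases "0 < \<sigma> j * ?D j")
        case True
        from side[OF jJ o this] show ?thesis
          by eventually_elim (use True in \<open>simp add: g_def j(2) l[OF j(1)] scaleR_add_left scaleR_diff_left add.assoc add_diff_eq\<close>)
      next
        case False
        then have "\<sigma> j * ?D j < 0" using nz by linarith
        then have "0 < \<sigma> j * span_det (A j) (- v)" by (simp add: linear_neg[OF linear_span_det])
        from side[OF jJ o this] show ?thesis
          by eventually_elim (use False in \<open>simp add: g_def j(2) l[OF j(1)] scaleR_add_left scaleR_diff_left add.assoc add_diff_eq\<close>)
      qed
    next
      fix \<tau> assume \<tau>: "(\<bar>M\<bar> + norm x + 1) / norm v \<le> \<tau>"
      then have "\<bar>M\<bar> + norm x + 1 \<le> \<tau> * norm v" using v by (simp add: pos_divide_le_eq)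
      also have "\<dots> \<le> norm (\<tau> *\<^sub>R v)" by (simp add: mult_right_mono)
      also have "\<dots> \<le> norm (x + \<tau> *\<^sub>R v) + norm x" using norm_triangle_ineq4[of "x + \<tau> *\<^sub>R v" x] by simp
      finally have "x + \<tau> *\<^sub>R v \<notin> I" using M[of "x + \<tau> *\<^sub>R v"] by auto
      then show "g \<tau> = 0" by (simp add: g_def)
    qed
    also have "\<dots> = (\<Sum>j\<in>J'. \<sigma> j * sgn (?D j))"
      unfolding sum.reindex[OF inj] o_def
    proof (rule sum.cong)
      fix j assume j: "j \<in> J'"
      then show "l (t j) - (1 - l (t j)) = \<sigma> j * sgn (?D j)"
        using l[OF j] D[OF j] sg[of j] by (auto simp: J'_def sgn_if split: if_splits)
    qed simp
    also have "\<dots> = (\<Sum>j\<in>J. \<sigma> j * sgn (?D j) * indicat_real (column (A j) v) x)"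
      unfolding J'_def using J by (intro sum.mono_neutral_cong_left) (auto simp: indicator_def)
    finally show "indicat_real I x = (\<Sum>j\<in>J. \<sigma> j * sgn (?D j) * indicat_real (column (A j) v) x)"
      by (simp add: g_def)
  qed
qed

lemma lmeasurable_sided: "sided J A \<sigma> I \<Longrightarrow> I \<in> lmeasurable"
  using measurable_Jordan[of I] negligible_frontier_sided[of J A \<sigma> I] by (simp add: sided_def)

text \<open>Columns are unbounded, so the two crossing formulas are subtracted before integrating.
  The facets outside M cancel, and each other facet contributes the difference of two nested
  columns. The vertex moves along v, so the determinants before and after agree and the formula is
  exact for moves of any size between sided sets.\<close>

theorem measure_sided_move_vertex:
  fixes A A' :: "'s \<Rightarrow> 'n::finite \<Rightarrow> real^'n"
  assumes sd: "sided J A \<sigma> I" "sided J A' \<sigma> I'" and v: "v \<noteq> 0"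
    and M: "M \<subseteq> J" "\<And>j. j \<in> J - M \<Longrightarrow> A' j = A j" "\<And>j. j \<in> M \<Longrightarrow> \<exists>k. A' j = (A j)(k := A j k + v)"
  shows "measure lebesgue I' - measure lebesgue I = (\<Sum>j\<in>M. \<sigma> j * span_det (A j) v / fact CARD('n))"
proof -
  let ?D = "\<lambda>j. span_det (A j) v"
  let ?C = "\<lambda>j. column (A' j) v - column (A j) v"
  have J: "finite J" using sd by (simp add: sided_def)
  have D': "span_det (A' j) v = ?D j" if "j \<in> J" for j
  proof (cases "j \<in> M")
    case True
    from M(3)[OF True] obtain k where "A' j = (A j)(k := A j k + v)" by blast
    then have "A' j = (\<lambda>i. A j i + (if i = k then 1 else 0) *\<^sub>R v)" by auto
    then show ?thesis by (simp only: span_det_shift_along)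
  qed (use M that in auto)
  have step: "column (A j) v \<subseteq> column (A' j) v" "?C j \<in> lmeasurable" "measure lebesgue (?C j) = \<bar>?D j\<bar> / fact CARD('n)"
    if "j \<in> M" "?D j \<noteq> 0" for j
  proof -
    from M(3)[OF that(1)] obtain k where "A' j = (A j)(k := A j k + v)" by blast
    then show "column (A j) v \<subseteq> column (A' j) v" "?C j \<in> lmeasurable" "measure lebesgue (?C j) = \<bar>?D j\<bar> / fact CARD('n)"
      using column_step[OF that(2), of k] by simp_all
  qed
  have I: "I \<in> lmeasurable" "I' \<in> lmeasurable" using sd lmeasurable_sided by blast+
  have "measure lebesgue I' - measure lebesgue I = (\<integral>x. indicat_real I' x - indicat_real I x \<partial>lebesgue)"
    using I by (subst Bochner_Integration.integral_diff) (auto simp: fmeasurable_def integrable_indicator_iff)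
  also have "\<dots> = (\<integral>x. (\<Sum>j\<in>M. \<sigma> j * sgn (?D j) * (if ?D j = 0 then 0 else indicat_real (?C j) x)) \<partial>lebesgue)"
  proof (rule integral_cong_AE)
    show "AE x in lebesgue. indicat_real I' x - indicat_real I x = (\<Sum>j\<in>M. \<sigma> j * sgn (?D j) * (if ?D j = 0 then 0 else indicat_real (?C j) x))"
      using sided_indicator[OF sd(1) v] sided_indicator[OF sd(2) v]
    proof eventually_elim
      fix x
      assume *: "indicat_real I x = (\<Sum>j\<in>J. \<sigma> j * sgn (?D j) * indicat_real (column (A j) v) x)"
        "indicat_real I' x = (\<Sum>j\<in>J. \<sigma> j * sgn (span_det (A' j) v) * indicat_real (column (A' j) v) x)"
      have "indicat_real I' x - indicat_real I x =
          (\<Sum>j\<in>J. \<sigma> j * sgn (?D j) * (indicat_real (column (A' j) v) x - indicat_real (column (A j) v) x))"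
        unfolding * by (simp add: D' sum_subtractf right_diff_distrib cong: sum.cong)
      also have "\<dots> = (\<Sum>j\<in>M. \<sigma> j * sgn (?D j) * (indicat_real (column (A' j) v) x - indicat_real (column (A j) v) x))"
        using M(1,2) J by (intro sum.mono_neutral_right) auto
      also have "\<dots> = (\<Sum>j\<in>M. \<sigma> j * sgn (?D j) * (if ?D j = 0 then 0 else indicat_real (?C j) x))"
      proof (rule sum.cong)
        fix j assume j: "j \<in> M"
        show "\<sigma> j * sgn (?D j) * (indicat_real (column (A' j) v) x - indicat_real (column (A j) v) x) =
            \<sigma> j * sgn (?D j) * (if ?D j = 0 then 0 else indicat_real (?C j) x)"
          using step(1)[OF j] by (cases "?D j = 0") (auto simp: indicator_def)
      qed simp
      finally show "indicat_real I' x - indicat_real I x = (\<Sum>j\<in>M. \<sigma> j * sgn (?D j) * (if ?D j = 0 then 0 else indicat_real (?C j) x))" .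
    qed
    show "(\<lambda>x. \<Sum>j\<in>M. \<sigma> j * sgn (?D j) * (if ?D j = 0 then 0 else indicat_real (?C j) x)) \<in> borel_measurable lebesgue"
    proof (intro borel_measurable_sum borel_measurable_times borel_measurable_const)
      fix j assume "j \<in> M"
      then show "(\<lambda>x. if ?D j = 0 then 0 else indicat_real (?C j) x) \<in> borel_measurable lebesgue"
        using step(2)[of j] by (cases "?D j = 0") (auto simp: fmeasurableD)
    qed
  qed (use I in \<open>auto simp: fmeasurableD intro!: borel_measurable_diff\<close>)
  also have "\<dots> = (\<Sum>j\<in>M. \<sigma> j * sgn (?D j) * (\<integral>x. (if ?D j = 0 then 0 else indicat_real (?C j) x) \<partial>lebesgue))"
  proof (subst Bochner_Integration.integral_sum)
    fix j assume j: "j \<in> M"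
    have "integrable lebesgue (\<lambda>x. if ?D j = 0 then 0 else indicat_real (?C j) x)"
      using step(2)[OF j] by (cases "?D j = 0") (auto simp: fmeasurable_def integrable_indicator_iff)
    then show "integrable lebesgue (\<lambda>x. \<sigma> j * sgn (?D j) * (if ?D j = 0 then 0 else indicat_real (?C j) x))"
      by (rule integrable_mult_right)
  qed simp
  also have "\<dots> = (\<Sum>j\<in>M. \<sigma> j * ?D j / fact CARD('n))"
  proof (rule sum.cong)
    fix j assume j: "j \<in> M"
    show "\<sigma> j * sgn (?D j) * (\<integral>x. (if ?D j = 0 then 0 else indicat_real (?C j) x) \<partial>lebesgue) = \<sigma> j * ?D j / fact CARD('n)"
    proof (cases "?D j = 0")
      case False
      then have "(\<integral>x. (if ?D j = 0 then 0 else indicat_real (?C j) x) \<partial>lebesgue) = \<bar>?D j\<bar> / fact CARD('n)"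
        using step(2,3)[OF j] by (simp add: fmeasurableD)
      moreover have "sgn (?D j) * \<bar>?D j\<bar> = ?D j" by (rule sgn_mult_abs)
      ultimately show ?thesis by simp
    qed simp
  qed simp
  finally show ?thesis .
qed

section \<open>Moving all vertices at once\<close>

text \<open>McShane's extension: the infimum over y of the cones h y + C * dist x y.\<close>

lemma lipschitz_extension_real:
  fixes h :: "'a::metric_space \<Rightarrow> real"
  assumes "0 \<le> C" "S \<noteq> {}" "\<And>x y. x \<in> S \<Longrightarrow> y \<in> S \<Longrightarrow> \<bar>h x - h y\<bar> \<le> C * dist x y"
  shows "\<exists>g. (\<forall>x\<in>S. g x = h x) \<and> (\<forall>x y. \<bar>g x - g y\<bar> \<le> C * dist x y)"
proof (intro exI conjI ballI allI)
  let ?g = "\<lambda>x. INF y\<in>S. h y + C * dist x y"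
  have bdd: "bdd_below ((\<lambda>y. h y + C * dist x y) ` S)" for x
  proof -
    obtain y0 where y0: "y0 \<in> S" using assms(2) by blast
    have "h y0 - C * dist x y0 \<le> h y + C * dist x y" if "y \<in> S" for y
    proof -
      have "dist y0 y \<le> dist x y0 + dist x y" by (rule dist_triangle3[of y0 y x, unfolded dist_commute[of x y0]] | metis dist_commute dist_triangle)
      then have "C * dist y0 y \<le> C * (dist x y0 + dist x y)" using assms(1) by (rule mult_left_mono)
      then show ?thesis using assms(3)[OF y0 that] by (simp add: distrib_left)
    qed
    then show ?thesis by (auto intro!: bdd_belowI[of _ "h y0 - C * dist x y0"])
  qed
  fix x
  show "?g x = h x" if x: "x \<in> S"
  proof (rule antisym)
    show "?g x \<le> h x" using cINF_lower[OF bdd x, of x] by simp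
    show "h x \<le> ?g x" using assms(2)
    proof (rule cINF_greatest)
      fix y assume "y \<in> S"
      then show "h x \<le> h y + C * dist x y" using assms(3)[OF x] by (smt (verit))
    qed
  qed
  have le: "?g x \<le> ?g y + C * dist x y" for x y
  proof -
    have "?g x - C * dist x y \<le> ?g y"
      using assms(2)
    proof (rule cINF_greatest)
      fix z assume z: "z \<in> S"
      have "?g x \<le> h z + C * dist x z" by (rule cINF_lower[OF bdd z])
      also have "C * dist x z \<le> C * (dist x y + dist y z)" using assms(1) by (intro mult_left_mono dist_triangle)
      finally show "?g x - C * dist x y \<le> h z + C * dist y z" by (simp add: distrib_left)
    qed
    then show ?thesis by simp
  qed
  fix y show "\<bar>?g x - ?g y\<bar> \<le> C * dist x y"
    using le[of x y] le[of y x] by (simp add: dist_commute abs_le_iff)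
qed

section \<open>Barycentric coordinates on a simplicial surface\<close>

definition barycentric :: "'k set \<Rightarrow> ('k \<Rightarrow> real) set" where
  "barycentric s = {a. (\<forall>k. 0 \<le> a k) \<and> (\<forall>k. k \<notin> s \<longrightarrow> a k = 0) \<and> sum a s = 1}"

lemma barycentric_sum_superset:
  "a \<in> barycentric s \<Longrightarrow> finite K \<Longrightarrow> s \<subseteq> K \<Longrightarrow> (\<Sum>k\<in>K. a k *\<^sub>R p k) = (\<Sum>k\<in>s. a k *\<^sub>R (p k :: 'a::real_vector))"
  by (intro sum.mono_neutral_right) (auto simp: barycentric_def)

lemma convex_hull_image_barycentric:
  fixes p :: "'k \<Rightarrow> 'a::real_vector"
  assumes "finite s"
  shows "convex hull (p ` s) = {\<Sum>k\<in>s. a k *\<^sub>R p k | a. a \<in> barycentric s}" (is "_ = ?R")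
proof
  have "convex ?R"
  proof (rule convexI, clarify)
    fix u v :: real and a b assume *: "0 \<le> u" "0 \<le> v" "u + v = 1" "a \<in> barycentric s" "b \<in> barycentric s"
    show "\<exists>c. u *\<^sub>R (\<Sum>k\<in>s. a k *\<^sub>R p k) + v *\<^sub>R (\<Sum>k\<in>s. b k *\<^sub>R p k) = (\<Sum>k\<in>s. c k *\<^sub>R p k) \<and> c \<in> barycentric s"
      using * by (intro exI[of _ "\<lambda>i. u * a i + v * b i"])
        (auto simp: barycentric_def scaleR_left_distrib sum.distrib scaleR_sum_right sum_distrib_left[symmetric])
  qed
  moreover have "p ` s \<subseteq> ?R"
  proof clarify
    fix i assume "i \<in> s"
    then show "\<exists>a. p i = (\<Sum>k\<in>s. a k *\<^sub>R p k) \<and> a \<in> barycentric s"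
      using assms by (intro exI[of _ "\<lambda>j. if j = i then 1 else 0"])
        (simp add: if_distrib[of "\<lambda>c. c *\<^sub>R _"] barycentric_def cong: if_cong)
  qed
  ultimately show "convex hull (p ` s) \<subseteq> ?R" by (rule hull_minimal[rotated])
  show "?R \<subseteq> convex hull (p ` s)"
    by (safe, rule convex_sum) (use assms in \<open>auto intro: hull_inc simp: barycentric_def\<close>)
qed

text \<open>The simplicial content of \<open>closed_polyhedral_surface\<close>: nondegenerate
  simplices that meet in common faces. This is what the interpolation of vertex motions relies
  on.\<close>

locale simplicial_surface =
  fixes F :: "'k set set" and p :: "'k \<Rightarrow> 'a::euclidean_space"
  assumes finite_F: "finite F" and finite_facet: "s \<in> F \<Longrightarrow> finite s"
    and inj: "inj_on p (\<Union>F)"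
    and indep: "s \<in> F \<Longrightarrow> \<not> affine_dependent (p ` s)"
    and face: "s \<in> F \<Longrightarrow> t \<in> F \<Longrightarrow> (convex hull (p ` s) \<inter> convex hull (p ` t)) face_of (convex hull (p ` s))"
begin

lemma finite_vertices: "finite (\<Union>F)" using finite_F finite_facet by blast

text \<open>The intersection is a face of both simplices, hence the hull of some vertices of each.
  Affinely independent points are exactly the extreme points of their hull, so both descriptions use
  the same points, and these are common vertices.\<close>

lemma Int_facets:
  assumes "s \<in> F" "t \<in> F"
  shows "convex hull (p ` s) \<inter> convex hull (p ` t) \<subseteq> convex hull (p ` (s \<inter> t))"
proof -
  let ?T = "convex hull (p ` s) \<inter> convex hull (p ` t)"
  obtain c where c: "c \<subseteq> p ` s" "?T = convex hull c"
    using face[OF assms] face_of_convex_hull_affine_independent[OF indep[OF assms(1)]] by blast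
  obtain d where d: "d \<subseteq> p ` t" "?T = convex hull d"
    using face[OF assms(2,1)] face_of_convex_hull_affine_independent[OF indep[OF assms(2)]] by (metis Int_commute)
  have ic: "\<not> affine_dependent c" "\<not> affine_dependent d"
    using c d indep assms affine_dependent_subset by blast+
  have "x \<in> c \<longleftrightarrow> x \<in> d" for x
    using extreme_point_of_convex_hull_affine_independent[OF ic(1), of x]
      extreme_point_of_convex_hull_affine_independent[OF ic(2), of x] c(2) d(2) by metis
  then have "c = d" by blast
  then have "c \<subseteq> p ` s \<inter> p ` t" using c d by blast
  also have "\<dots> = p ` (s \<inter> t)" using inj assms by (intro inj_on_image_Int[symmetric, of _ "\<Union>F"]) auto
  finally show ?thesis using c(2) hull_mono by metis
qed

text \<open>A common point would lie in the shared face by \<open>Int_facets\<close>. Within a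
  single simplex affine independence lets hulls intersect only as their vertex sets do, so the
  problem reduces to the disjoint sets A and B.\<close>

lemma disjoint_vertex_sets:
  assumes "s \<in> F" "t \<in> F" "A \<subseteq> s" "B \<subseteq> t" "A \<inter> B = {}"
  shows "convex hull (p ` A) \<inter> convex hull (p ` B) = {}"
proof -
  have I: "p ` X \<inter> p ` Y = p ` (X \<inter> Y)" if "X \<subseteq> s \<union> t" "Y \<subseteq> s \<union> t" for X Y
    using inj assms(1,2) that by (intro inj_on_image_Int[symmetric, of _ "\<Union>F"]) auto
  let ?C = "s \<inter> t"
  have h: "convex hull (p ` X) \<inter> convex hull (p ` Y) = convex hull (p ` (X \<inter> Y))" if "X \<subseteq> r" "Y \<subseteq> r" "r \<in> F" "r \<subseteq> s \<union> t" for X Y r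
  proof -
    have "\<not> affine_dependent (p ` X \<union> p ` Y)" using affine_dependent_subset[of "p ` X \<union> p ` Y" "p ` r"] indep[OF that(3)] that by blast
    from convex_hull_Int[OF this] show ?thesis using I[of X Y] that by auto
  qed
  have "convex hull (p ` A) \<inter> convex hull (p ` B) \<subseteq> convex hull (p ` s) \<inter> convex hull (p ` t)"
    using assms(3,4) by (intro Int_mono hull_mono image_mono)
  also have "\<dots> \<subseteq> convex hull (p ` ?C)" by (rule Int_facets[OF assms(1,2)])
  finally have "convex hull (p ` A) \<inter> convex hull (p ` B) \<subseteq>
      (convex hull (p ` A) \<inter> convex hull (p ` ?C)) \<inter> (convex hull (p ` B) \<inter> convex hull (p ` ?C))" by blast
  also have "\<dots> = convex hull (p ` (A \<inter> ?C)) \<inter> convex hull (p ` (B \<inter> ?C))"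
    using h[of A s ?C] h[of B t ?C] assms by simp
  also have "\<dots> = convex hull (p ` ((A \<inter> ?C) \<inter> (B \<inter> ?C)))" using assms by (intro h[of _ s]) auto
  also have "(A \<inter> ?C) \<inter> (B \<inter> ?C) = {}" using assms(5) by blast
  finally show ?thesis by simp
qed

lemma barycentric_lipschitz:
  obtains C where "C > 0" "\<And>s t a b k. s \<in> F \<Longrightarrow> t \<in> F \<Longrightarrow> a \<in> barycentric s \<Longrightarrow> b \<in> barycentric t \<Longrightarrow>
    \<bar>a k - b k\<bar> \<le> C * dist (\<Sum>k\<in>s. a k *\<^sub>R p k) (\<Sum>k\<in>t. b k *\<^sub>R p k)"
proof -
  (* The positive and negative parts of a - b have disjoint supports, so after normalisation they
     represent points of two disjoint compact hulls, which have a positive distance. *)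
  let ?P = "{(A, B). \<exists>s\<in>F. \<exists>t\<in>F. A \<subseteq> s \<and> B \<subseteq> t \<and> A \<inter> B = {}}"
  have "finite ?P"
    by (rule finite_subset[of _ "Pow (\<Union>F) \<times> Pow (\<Union>F)"]) (use finite_vertices in auto)
  moreover have "\<exists>d>0. \<forall>x\<in>convex hull (p ` fst P). \<forall>y\<in>convex hull (p ` snd P). d \<le> dist x y" if "P \<in> ?P" for P
  proof -
    obtain s t where st: "s \<in> F" "t \<in> F" "fst P \<subseteq> s" "snd P \<subseteq> t" "fst P \<inter> snd P = {}" using \<open>P \<in> ?P\<close> by auto
    then have "finite (fst P)" "finite (snd P)" using finite_facet finite_subset by blast+
    then have "compact (convex hull (p ` fst P))" "closed (convex hull (p ` snd P))"
      by (auto intro!: finite_imp_compact_convex_hull compact_imp_closed)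
    with separate_compact_closed[OF this disjoint_vertex_sets[OF st]] show ?thesis by auto
  qed
  ultimately have "\<exists>d>0. \<forall>P\<in>?P. \<forall>x\<in>convex hull (p ` fst P). \<forall>y\<in>convex hull (p ` snd P). d \<le> dist x y"
  proof (induction rule: finite_induct)
    case empty then show ?case by (intro exI[of _ 1]) auto
  next
    case (insert P Q)
    obtain d where d: "d > 0" "\<forall>P\<in>Q. \<forall>x\<in>convex hull (p ` fst P). \<forall>y\<in>convex hull (p ` snd P). d \<le> dist x y"
      using insert by blast
    obtain d' where d': "d' > 0" "\<forall>x\<in>convex hull (p ` fst P). \<forall>y\<in>convex hull (p ` snd P). d' \<le> dist x y"
      using insert.prems by blast
    show ?case using d d' by (intro exI[of _ "min d d'"]) (auto simp: min.coboundedI1 min.coboundedI2)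
  qed
  then obtain d where d1: "d > 0" and d0: "\<forall>P\<in>?P. \<forall>x\<in>convex hull (p ` fst P). \<forall>y\<in>convex hull (p ` snd P). d \<le> dist x y"
    by blast
  have d2: "d \<le> dist x y" if "s \<in> F" "t \<in> F" "A \<subseteq> s" "B \<subseteq> t" "A \<inter> B = {}" "x \<in> convex hull (p ` A)" "y \<in> convex hull (p ` B)"
    for A B s t x y
  proof -
    have "(A, B) \<in> ?P" using that by blast
    from bspec[OF d0 this] show ?thesis using that by simp
  qed
  note d = d1 d2
  show ?thesis
  proof (rule that[of "1 / d"])
    fix s t a b k assume st: "s \<in> F" "t \<in> F" and a: "a \<in> barycentric s" and b: "b \<in> barycentric t"
    let ?K = "\<Union>F"
    have K: "finite ?K" "s \<subseteq> ?K" "t \<subseteq> ?K" using finite_vertices st by auto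
    have sa: "sum a ?K = 1" "sum b ?K = 1"
      using barycentric_sum_superset[OF a K(1,2), of "\<lambda>_. 1::real"] barycentric_sum_superset[OF b K(1,3), of "\<lambda>_. 1::real"] a b
      by (simp_all add: barycentric_def)
    define m where "m = (\<Sum>k\<in>?K. max 0 (a k - b k))"
    \<comment> \<open>Both weights sum to 1, so positive and negative part have the same mass m, and
      one factor normalises both.\<close>
    have m': "m = (\<Sum>k\<in>?K. max 0 (b k - a k))"
    proof -
      have "m - (\<Sum>k\<in>?K. max 0 (b k - a k)) = (\<Sum>k\<in>?K. a k - b k)"
        unfolding m_def sum_subtractf[symmetric] by (intro sum.cong) auto
      then show ?thesis using sa by (simp add: sum_subtractf)
    qed
    have m0: "0 \<le> m" unfolding m_def by (intro sum_nonneg) auto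
    have le: "\<bar>a k - b k\<bar> \<le> m"
    proof (cases "k \<in> ?K")
      case True
      have "max 0 (a k - b k) \<le> m"
        unfolding m_def by (rule member_le_sum[of k ?K "\<lambda>k. max 0 (a k - b k)"]) (use True K(1) in auto)
      moreover have "max 0 (b k - a k) \<le> m"
        unfolding m' by (rule member_le_sum[of k ?K "\<lambda>k. max 0 (b k - a k)"]) (use True K(1) in auto)
      ultimately show ?thesis by auto
    next
      case False
      then have "k \<notin> s" "k \<notin> t" using K by auto
      then show ?thesis using a b m0 by (simp add: barycentric_def)
    qed
    show "\<bar>a k - b k\<bar> \<le> 1 / d * dist (\<Sum>k\<in>s. a k *\<^sub>R p k) (\<Sum>k\<in>t. b k *\<^sub>R p k)"
    proof (cases "m = 0")
      case True then show ?thesis using le d(1) by auto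
    next
      case False
      with m0 have m: "m > 0" by simp
      define A B where "A = {k\<in>?K. b k < a k}" and "B = {k\<in>?K. a k < b k}"
      define a' b' where "a' k = max 0 (a k - b k) / m" and "b' k = max 0 (b k - a k) / m" for k
      have A: "A \<subseteq> s" using a b by (auto simp: A_def barycentric_def) (metis less_le_not_le)
      have B: "B \<subseteq> t" using a b by (auto simp: B_def barycentric_def) (metis less_le_not_le)
      have "(\<Sum>k\<in>?K. a' k *\<^sub>R p k) \<in> convex hull (p ` A)"
      proof -
        have z: "a' k = 0" if "k \<in> ?K - A" for k
        proof -
          have "\<not> b k < a k" using that unfolding A_def by blast
          then show ?thesis by (simp add: a'_def)
        qed
        have "(\<Sum>k\<in>?K. a' k *\<^sub>R p k) = (\<Sum>k\<in>A. a' k *\<^sub>R p k)" using K(1) z by (intro sum.mono_neutral_right) (auto simp: A_def)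
        moreover have "sum a' A = sum a' ?K" using K(1) z by (intro sum.mono_neutral_left) (auto simp: A_def)
        moreover have "sum a' ?K = 1" using m by (simp add: a'_def sum_divide_distrib[symmetric] m_def[symmetric])
        moreover have "(\<Sum>k\<in>A. a' k *\<^sub>R p k) \<in> convex hull (p ` A)"
        proof (rule convex_sum)
          show "finite A" unfolding A_def using K(1) by (rule rev_finite_subset) blast
          show "sum a' A = 1" using calculation(2,3) by simp
          show "0 \<le> a' k" for k using m by (simp add: a'_def)
        qed (auto intro: hull_inc)
        ultimately show ?thesis by simp
      qed
      moreover have "(\<Sum>k\<in>?K. b' k *\<^sub>R p k) \<in> convex hull (p ` B)"
      proof -
        have z: "b' k = 0" if "k \<in> ?K - B" for k
        proof -
          have "\<not> a k < b k" using that unfolding B_def by blast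
          then show ?thesis by (simp add: b'_def)
        qed
        have "(\<Sum>k\<in>?K. b' k *\<^sub>R p k) = (\<Sum>k\<in>B. b' k *\<^sub>R p k)" using K(1) z by (intro sum.mono_neutral_right) (auto simp: B_def)
        moreover have "sum b' B = sum b' ?K" using K(1) z by (intro sum.mono_neutral_left) (auto simp: B_def)
        moreover have "sum b' ?K = 1" using m by (simp add: b'_def sum_divide_distrib[symmetric] m'[symmetric])
        moreover have "(\<Sum>k\<in>B. b' k *\<^sub>R p k) \<in> convex hull (p ` B)"
        proof (rule convex_sum)
          show "finite B" unfolding B_def using K(1) by (rule rev_finite_subset) blast
          show "sum b' B = 1" using calculation(2,3) by simp
          show "0 \<le> b' k" for k using m by (simp add: b'_def)
        qed (auto intro: hull_inc)
        ultimately show ?thesis by simp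
      qed
      moreover have "A \<inter> B = {}" by (auto simp: A_def B_def)
      ultimately have "d \<le> dist (\<Sum>k\<in>?K. a' k *\<^sub>R p k) (\<Sum>k\<in>?K. b' k *\<^sub>R p k)" using d(2)[OF st A B] by blast
      also have "\<dots> = norm (\<Sum>k\<in>?K. (a' k - b' k) *\<^sub>R p k)" by (simp add: dist_norm sum_subtractf scaleR_diff_left)
      also have "(\<Sum>k\<in>?K. (a' k - b' k) *\<^sub>R p k) = (\<Sum>k\<in>?K. (1 / m) *\<^sub>R ((a k - b k) *\<^sub>R p k))"
      proof (rule sum.cong)
        fix k
        have "a' k - b' k = (1 / m) * (a k - b k)" by (cases "b k \<le> a k") (auto simp: a'_def b'_def max_def diff_divide_distrib)
        then show "(a' k - b' k) *\<^sub>R p k = (1 / m) *\<^sub>R ((a k - b k) *\<^sub>R p k)" by simp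
      qed simp
      also have "\<dots> = (1 / m) *\<^sub>R ((\<Sum>k\<in>s. a k *\<^sub>R p k) - (\<Sum>k\<in>t. b k *\<^sub>R p k))"
        by (simp add: scaleR_sum_right[symmetric] scaleR_diff_left sum_subtractf barycentric_sum_superset[OF a K(1,2)] barycentric_sum_superset[OF b K(1,3)])
      also have "norm \<dots> = dist (\<Sum>k\<in>s. a k *\<^sub>R p k) (\<Sum>k\<in>t. b k *\<^sub>R p k) / m" using m by (simp add: dist_norm)
      finally have "d * m \<le> dist (\<Sum>k\<in>s. a k *\<^sub>R p k) (\<Sum>k\<in>t. b k *\<^sub>R p k)" using m by (simp add: pos_le_divide_eq)
      then show ?thesis using le d(1) by (simp add: field_simps) (smt (verit) mult_left_mono)
    qed
  qed (use d in auto)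
qed

text \<open>Two representations of the same surface point have distance 0, hence equal weights by
  \<open>barycentric_lipschitz\<close>; the weights are therefore functions on the surface. They are
  the nodal basis functions, extended to the whole space with the same Lipschitz constant.\<close>

lemma hat_functions:
  obtains \<Lambda> :: "'k \<Rightarrow> 'a \<Rightarrow> real" and C where "C > 0" "\<And>k x y. \<bar>\<Lambda> k x - \<Lambda> k y\<bar> \<le> C * dist x y"
    "\<And>s a k. s \<in> F \<Longrightarrow> a \<in> barycentric s \<Longrightarrow> \<Lambda> k (\<Sum>k\<in>s. a k *\<^sub>R p k) = a k"
proof (rule barycentric_lipschitz)
  fix C :: real assume C: "C > 0" "\<And>s t a b k. s \<in> F \<Longrightarrow> t \<in> F \<Longrightarrow> a \<in> barycentric s \<Longrightarrow> b \<in> barycentric t \<Longrightarrow>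
    \<bar>a k - b k\<bar> \<le> C * dist (\<Sum>k\<in>s. a k *\<^sub>R p k) (\<Sum>k\<in>t. b k *\<^sub>R p k)"
  let ?S = "{(\<Sum>k\<in>s. a k *\<^sub>R p k) | s a. s \<in> F \<and> a \<in> barycentric s}"
  define c where "c x = (SOME a. \<exists>s\<in>F. a \<in> barycentric s \<and> x = (\<Sum>k\<in>s. a k *\<^sub>R p k))" for x
  have c: "\<exists>s\<in>F. c x \<in> barycentric s \<and> x = (\<Sum>k\<in>s. c x k *\<^sub>R p k)" if "x \<in> ?S" for x
  proof -
    have "\<exists>a. \<exists>s\<in>F. a \<in> barycentric s \<and> x = (\<Sum>k\<in>s. a k *\<^sub>R p k)" using that by blast
    from someI_ex[OF this] show ?thesis unfolding c_def .
  qed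
  have lip: "\<bar>c x k - c y k\<bar> \<le> C * dist x y" if xy: "x \<in> ?S" "y \<in> ?S" for x y k
  proof -
    obtain s t where "s \<in> F" "c x \<in> barycentric s" "x = (\<Sum>k\<in>s. c x k *\<^sub>R p k)" "t \<in> F" "c y \<in> barycentric t" "y = (\<Sum>k\<in>t. c y k *\<^sub>R p k)"
      using c[OF xy(1)] c[OF xy(2)] by blast
    then show ?thesis using C(2)[of s t "c x" "c y" k] by metis
  qed
  have "\<exists>g. (\<forall>x\<in>?S. g x = c x k) \<and> (\<forall>x y. \<bar>g x - g y\<bar> \<le> C * dist x y)" for k
  proof (cases "?S = {}")
    case True
    then show ?thesis using C(1) by (intro exI[of _ "\<lambda>_. 0"]) auto
  next
    case False
    show ?thesis by (rule lipschitz_extension_real) (use C(1) False lip in auto)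
  qed
  then have "\<exists>\<Lambda>. \<forall>k. (\<forall>x\<in>?S. \<Lambda> k x = c x k) \<and> (\<forall>x y. \<bar>\<Lambda> k x - \<Lambda> k y\<bar> \<le> C * dist x y)"
    by (intro choice allI)
  then obtain \<Lambda> where \<Lambda>0: "\<forall>k. (\<forall>x\<in>?S. \<Lambda> k x = c x k) \<and> (\<forall>x y. \<bar>\<Lambda> k x - \<Lambda> k y\<bar> \<le> C * dist x y)" ..
  have \<Lambda>1: "\<Lambda> k x = c x k" if "x \<in> ?S" for k x
  proof -
    have "\<forall>x\<in>?S. \<Lambda> k x = c x k" using spec[OF \<Lambda>0, of k] by (rule conjunct1)
    then show ?thesis using that by (rule bspec)
  qed
  have \<Lambda>2: "\<bar>\<Lambda> k x - \<Lambda> k y\<bar> \<le> C * dist x y" for k x y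
  proof -
    have "\<forall>x y. \<bar>\<Lambda> k x - \<Lambda> k y\<bar> \<le> C * dist x y" using spec[OF \<Lambda>0, of k] by (rule conjunct2)
    from spec[OF spec[OF this, of x], of y] show ?thesis .
  qed
  show ?thesis
  proof (rule that[OF C(1) \<Lambda>2])
    fix s a k assume sa: "s \<in> F" "a \<in> barycentric s"
    let ?x = "\<Sum>k\<in>s. a k *\<^sub>R p k"
    have x: "?x \<in> ?S" using sa by blast
    then obtain t where t: "t \<in> F" "c ?x \<in> barycentric t" "?x = (\<Sum>k\<in>t. c ?x k *\<^sub>R p k)" using c by blast
    have "\<bar>a k - c ?x k\<bar> \<le> C * dist ?x ?x" using C(2)[OF sa(1) t(1) sa(2) t(2), of k] t(3) by metis
    then show "\<Lambda> k ?x = a k" using \<Lambda>1[OF x] by simp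
  qed
qed

end

section \<open>Homeomorphisms close to the identity\<close>

definition near_identity :: "real \<Rightarrow> ('a::euclidean_space \<Rightarrow> 'a) \<Rightarrow> bool" where
  "near_identity L f \<longleftrightarrow> 0 \<le> L \<and> L < 1/2 \<and> (\<forall>x y. norm ((f x - x) - (f y - y)) \<le> L * dist x y)"

context
  fixes L :: real and f :: "'a::euclidean_space \<Rightarrow> 'a"
  assumes f: "near_identity L f"
begin

lemma near_identity_bounds: "0 \<le> L" "L < 1/2" "norm ((f x - x) - (f y - y)) \<le> L * dist x y"
  using f unfolding near_identity_def by blast+

text \<open>The deviation L * dist x y is absorbed by half of the distance. The bound 1/2 thus fixes
  the factor 2 for the inverse map, and in \<open>sided_image_near_identity\<close> it prevents the
  deviation from reversing a small step.\<close>

lemma near_identity_expansion: "dist x y \<le> 2 * dist (f x) (f y)"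
proof -
  have "dist x y = norm ((f x - f y) - ((f x - x) - (f y - y)))" by (simp add: dist_norm)
  also have "\<dots> \<le> dist (f x) (f y) + L * dist x y"
    using near_identity_bounds(3)[of x y] norm_triangle_ineq4[of "f x - f y" "(f x - x) - (f y - y)"] by (simp add: dist_norm)
  also have "L * dist x y \<le> 1/2 * dist x y" using near_identity_bounds(2) by (intro mult_right_mono) auto
  finally show ?thesis by simp
qed

lemma near_identity_lipschitz: "dist (f x) (f y) \<le> 2 * dist x y"
proof -
  have "dist (f x) (f y) = norm (((f x - x) - (f y - y)) + (x - y))" by (simp add: dist_norm)
  also have "\<dots> \<le> L * dist x y + dist x y"
    using near_identity_bounds(3)[of x y] norm_triangle_ineq[of "(f x - x) - (f y - y)" "x - y"] by (simp add: dist_norm)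
  also have "L * dist x y \<le> 1 * dist x y" using near_identity_bounds(2) by (intro mult_right_mono) auto
  finally show ?thesis by simp
qed

lemma near_identity_bij: "bij f"
proof (rule bijI)
  show "inj f" using near_identity_expansion by (intro injI) (metis dist_le_zero_iff dist_self mult_zero_right)
  show "surj f" unfolding surj_def
  proof
    fix y
    \<comment> \<open>The solutions of f x = y are the fixed points of this contraction.\<close>
    have "\<exists>!x. y - (f x - x) = x"
    proof (rule banach_fix_type)
      show "0 \<le> L" "L < 1" using near_identity_bounds by linarith+
      show "\<forall>x x'. dist (y - (f x - x)) (y - (f x' - x')) \<le> L * dist x x'"
      proof (intro allI)
        fix x x'
        have "dist (y - (f x - x)) (y - (f x' - x')) = norm ((f x' - x') - (f x - x))"
          unfolding dist_norm by (rule arg_cong[of _ _ norm]) (simp add: algebra_simps)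
        then show "dist (y - (f x - x)) (y - (f x' - x')) \<le> L * dist x x'"
          using near_identity_bounds(3)[of x' x] by (simp add: dist_commute)
      qed
    qed
    then obtain x where "y - (f x - x) = x" by blast
    then have "y = f x" by (simp add: algebra_simps)
    then show "\<exists>x. y = f x" by blast
  qed
qed

lemma near_identity_inv [simp]: "f (inv f y) = y" "inv f (f x) = x"
  using near_identity_bij by (simp_all add: bij_is_surj bij_is_inj surj_f_inv_f)

lemma dist_inv_near_identity: "dist (inv f x) (inv f y) \<le> 2 * dist x y"
  using near_identity_expansion[of "inv f x" "inv f y"] by simp

lemma continuous_near_identity: "continuous_on S f" "continuous_on S (inv f)"
  using near_identity_lipschitz dist_inv_near_identity
  by (auto intro!: lipschitz_on_continuous_on[where L=2] lipschitz_onI)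

lemma vimage_inv_near_identity: "f ` S = inv f -` S"
  by (auto simp: image_iff) (metis near_identity_inv(1))

lemma closed_image_near_identity: "closed S \<Longrightarrow> closed (f ` S)"
  unfolding vimage_inv_near_identity using continuous_near_identity(2)[of UNIV] by (simp add: closed_vimage)

lemma closure_image_near_identity: "closure (f ` S) = f ` closure S"
proof
  show "closure (f ` S) \<subseteq> f ` closure S"
    by (intro closure_minimal image_mono closure_subset closed_image_near_identity) simp
  show "f ` closure S \<subseteq> closure (f ` S)"
    by (rule image_closure_subset[OF continuous_near_identity(1)]) (auto intro: closure_subset[THEN subsetD])
qed

lemma frontier_image_near_identity: "frontier (f ` S) = f ` frontier S"
proof -
  have "- f ` S = f ` (- S)" by (rule bij_image_Compl_eq[OF near_identity_bij, symmetric])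
  then show ?thesis unfolding frontier_closures closure_image_near_identity
    using near_identity_bij by (simp add: closure_image_near_identity image_Int bij_is_inj)
qed

lemma bounded_image_near_identity: "bounded (f ` S) \<longleftrightarrow> bounded S"
proof
  assume "bounded (f ` S)"
  then obtain c M where M: "\<forall>y\<in>f ` S. dist c y \<le> M" unfolding bounded_def by blast
  have "dist (inv f c) x \<le> 2 * M" if "x \<in> S" for x
    using dist_inv_near_identity[of c "f x"] M that by fastforce
  then show "bounded S" unfolding bounded_def by blast
next
  assume "bounded S"
  then obtain c M where M: "\<forall>y\<in>S. dist c y \<le> M" unfolding bounded_def by blast
  have "dist (f c) y \<le> 2 * M" if y: "y \<in> f ` S" for y
  proof -
    obtain x where "x \<in> S" "y = f x" using y by blast
    then show ?thesis using near_identity_lipschitz[of c x] M by fastforce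
  qed
  then show "bounded (f ` S)" unfolding bounded_def by blast
qed

lemma component_image_near_identity:
  "f ` connected_component_set S x = connected_component_set (f ` S) (f x)"
proof (cases "x \<in> S")
  case False
  then have "f x \<notin> f ` S" using near_identity_bij by (simp add: bij_is_inj inj_image_mem_iff)
  then show ?thesis using False by (simp add: connected_component_eq_empty[THEN iffD2])
next
  case True
  show ?thesis
  proof
    show "f ` connected_component_set S x \<subseteq> connected_component_set (f ` S) (f x)"
      using True by (intro connected_component_maximal connected_continuous_image continuous_near_identity image_mono connected_component_subset)
        (auto simp: connected_component_refl)
    have "inv f ` connected_component_set (f ` S) (f x) \<subseteq> connected_component_set S x"
    proof (rule connected_component_maximal)
      show "x \<in> inv f ` connected_component_set (f ` S) (f x)"
        using True by (intro image_eqI[of _ _ "f x"]) (auto simp: connected_component_refl)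
      show "inv f ` connected_component_set (f ` S) (f x) \<subseteq> S"
        using connected_component_subset[of "f ` S" "f x"] by fastforce
    qed (intro connected_continuous_image continuous_near_identity connected_connected_component)
    then have "f ` inv f ` connected_component_set (f ` S) (f x) \<subseteq> f ` connected_component_set S x" by (rule image_mono)
    then show "connected_component_set (f ` S) (f x) \<subseteq> f ` connected_component_set S x" by (simp add: image_image)
  qed
qed

text \<open>A homeomorphism of the whole space carries the components of the complement to those of
  the complement of the image, and the Lipschitz bounds preserve their boundedness. This identifies
  the interior of the moved surface as the image of the old interior.\<close>

lemma inside_image_near_identity: "inside (f ` S) = f ` inside S"
proof -
  have C: "- f ` S = f ` (- S)" by (rule bij_image_Compl_eq[OF near_identity_bij, symmetric])
  have "f x \<in> inside (f ` S) \<longleftrightarrow> x \<in> inside S" for x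
    unfolding inside_def C using near_identity_bij
    by (simp add: component_image_near_identity[symmetric] bounded_image_near_identity bij_is_inj inj_image_mem_iff)
  then have "y \<in> inside (f ` S) \<longleftrightarrow> inv f y \<in> inside S" for y
    by (metis near_identity_inv(1))
  then show ?thesis unfolding vimage_inv_near_identity[of "inside S"] by blast
qed

text \<open>The inverse moves x by at most 2 * norm (f x - x), so the preimage of x stays in the
  ball on which membership in I is constant.\<close>

lemma mem_image_near_identity_iff:
  assumes "ball x \<rho> \<subseteq> I \<or> ball x \<rho> \<inter> I = {}" "2 * norm (f x - x) < \<rho>"
  shows "x \<in> f ` I \<longleftrightarrow> x \<in> I"
proof -
  have "dist x (inv f x) < \<rho>"
    using dist_inv_near_identity[of "f x" x] assms(2) by (simp add: dist_norm norm_minus_commute)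
  moreover have "0 < \<rho>" using assms(2) norm_ge_zero[of "f x - x"] by linarith
  ultimately have "inv f x \<in> ball x \<rho>" "x \<in> ball x \<rho>" by auto
  then have "inv f x \<in> I \<longleftrightarrow> x \<in> I" using assms(1) by blast
  then show ?thesis unfolding vimage_inv_near_identity by simp
qed

end

section \<open>One-sidedness of facets under perturbation\<close>

lemma open_facet_image:
  fixes a b :: "'i::finite \<Rightarrow> real^'i"
  assumes "\<And>u. (\<forall>i. 0 \<le> u i) \<Longrightarrow> sum u UNIV = 1 \<Longrightarrow> f (\<Sum>i\<in>UNIV. u i *\<^sub>R a i) = (\<Sum>i\<in>UNIV. u i *\<^sub>R b i)"
  shows "f ` (convex hull (range a)) = convex hull (range b)" "f ` open_facet a = open_facet b"
proof -
  show "f ` (convex hull (range a)) = convex hull (range b)"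
  proof safe
    fix x assume "x \<in> convex hull (range a)"
    then obtain u where "\<forall>i. 0 \<le> u i" "sum u UNIV = 1" "x = (\<Sum>i\<in>UNIV. u i *\<^sub>R a i)" unfolding hull_range by blast
    then show "f x \<in> convex hull (range b)" unfolding hull_range using assms by blast
  next
    fix y assume "y \<in> convex hull (range b)"
    then obtain u where u: "\<forall>i. 0 \<le> u i" "sum u UNIV = 1" "y = (\<Sum>i\<in>UNIV. u i *\<^sub>R b i)" unfolding hull_range by blast
    then have "y = f (\<Sum>i\<in>UNIV. u i *\<^sub>R a i)" using assms by simp
    moreover have "(\<Sum>i\<in>UNIV. u i *\<^sub>R a i) \<in> convex hull (range a)" unfolding hull_range using u by blast
    ultimately show "y \<in> f ` (convex hull (range a))" by (rule image_eqI)
  qed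
  have nn: "\<forall>i. 0 \<le> u i" if "\<forall>i. 0 < u i" for u :: "'i \<Rightarrow> real" using that by (auto intro: less_imp_le)
  show "f ` open_facet a = open_facet b"
  proof safe
    fix x assume "x \<in> open_facet a"
    then obtain u where "\<forall>i. 0 < u i" "sum u UNIV = 1" "x = (\<Sum>i\<in>UNIV. u i *\<^sub>R a i)" unfolding open_facet_def by blast
    then show "f x \<in> open_facet b" unfolding open_facet_def using assms nn by blast
  next
    fix y assume "y \<in> open_facet b"
    then obtain u where u: "\<forall>i. 0 < u i" "sum u UNIV = 1" "y = (\<Sum>i\<in>UNIV. u i *\<^sub>R b i)" unfolding open_facet_def by blast
    then have "y = f (\<Sum>i\<in>UNIV. u i *\<^sub>R a i)" using assms nn[OF u(1)] by simp
    moreover have "(\<Sum>i\<in>UNIV. u i *\<^sub>R a i) \<in> open_facet a" unfolding open_facet_def using u by blast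
    ultimately show "y \<in> f ` open_facet a" by (rule image_eqI)
  qed
qed

text \<open>The open half-ball is connected and misses the frontier of I, which near x lies in the
  hyperplane through x normal to w. So it is contained in I as soon as it contains one point of I,
  and the steps along v supply such a point.\<close>

lemma halfball_one_sided:
  fixes w :: "'a::euclidean_space"
  assumes G: "frontier I \<subseteq> G" and x: "\<And>z. z \<in> ball x r \<Longrightarrow> z \<in> G \<Longrightarrow> w \<bullet> (z - x) = 0" and r: "0 < r"
    and v: "0 < w \<bullet> v" "\<exists>\<^sub>F \<epsilon> in at_right 0. x + \<epsilon> *\<^sub>R v \<in> I"
  shows "{z \<in> ball x r. 0 < w \<bullet> (z - x)} \<subseteq> I"
proof -
  let ?P = "{z \<in> ball x r. 0 < w \<bullet> (z - x)}"
  have "?P = ball x r \<inter> {z. w \<bullet> x < w \<bullet> z}" by (auto simp: inner_diff_right)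
  then have "connected ?P" by (simp add: convex_connected convex_Int convex_halfspace_gt)
  moreover have "?P \<inter> frontier I = {}" using G x by force
  moreover have "\<forall>\<^sub>F \<epsilon> in at_right 0. x + \<epsilon> *\<^sub>R v \<in> ?P"
  proof -
    have "((\<lambda>\<epsilon>. x + \<epsilon> *\<^sub>R v) \<longlongrightarrow> x + 0 *\<^sub>R v) (at_right 0)" by (intro tendsto_intros)
    then have "\<forall>\<^sub>F \<epsilon> in at_right 0. x + \<epsilon> *\<^sub>R v \<in> ball x r"
      using r by (intro topological_tendstoD) auto
    moreover have "\<forall>\<^sub>F \<epsilon> in at_right (0::real). 0 < \<epsilon>" by (rule eventually_at_right_less)
    ultimately show ?thesis by eventually_elim (use v in auto)
  qed
  from frequently_eventually_conj[OF v(2) this] have "?P \<inter> I \<noteq> {}" using frequently_ex by fastforce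
  ultimately show ?thesis using connected_Int_frontier[of ?P I] by blast
qed

text \<open>Without differentiability of f, sides cannot be transported through derivatives. A short
  step from the new facet along the old normal n is pulled back instead; the preimage is on the
  expected side of the old facet, since the deviation is shorter than the step. By
  \<open>pos\<close> the direction n also points to the positive side of the new facet, so this
  single direction determines both new half-balls.\<close>

theorem sided_image_near_identity:
  fixes A :: "'s \<Rightarrow> 'n::finite \<Rightarrow> real^'n"
  assumes f: "near_identity L f" and sd: "sided J A \<sigma> I"
    and fA: "\<And>j u. j \<in> J \<Longrightarrow> (\<forall>i. 0 \<le> u i) \<Longrightarrow> sum u UNIV = 1 \<Longrightarrow> f (\<Sum>i\<in>UNIV. u i *\<^sub>R A j i) = (\<Sum>i\<in>UNIV. u i *\<^sub>R A' j i)"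
    and pos: "\<And>j. j \<in> J \<Longrightarrow> 0 < facet_normal (A' j) \<bullet> facet_normal (A j)"
  shows "sided J A' \<sigma> (f ` I)"
proof -
  let ?hull = "\<lambda>A j. convex hull (range (A j))"
  have J: "finite J" and bI: "bounded I" and fr: "frontier I \<subseteq> (\<Union>j\<in>J. ?hull A j)"
    and dis: "\<And>i j. i \<in> J \<Longrightarrow> j \<in> J \<Longrightarrow> i \<noteq> j \<Longrightarrow> open_facet (A i) \<inter> ?hull A j = {}"
    and sg: "\<And>j. j \<in> J \<Longrightarrow> \<sigma> j = 1 \<or> \<sigma> j = - 1"
    and side: "\<And>j x v. j \<in> J \<Longrightarrow> x \<in> open_facet (A j) \<Longrightarrow> 0 < \<sigma> j * span_det (A j) v \<Longrightarrow>
          \<forall>\<^sub>F \<epsilon> in at_right 0. x + \<epsilon> *\<^sub>R v \<notin> I \<and> x - \<epsilon> *\<^sub>R v \<in> I"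
    using sd unfolding sided_def by blast+
  note im = open_facet_image[of f "A j" "A' j" for j, OF fA]
  have inj: "inj f" using near_identity_bij[OF f] by (rule bij_is_inj)
  have frf: "frontier (f ` I) \<subseteq> (\<Union>j\<in>J. ?hull A' j)"
  proof -
    have "f ` frontier I \<subseteq> f ` (\<Union>j\<in>J. ?hull A j)" using fr by (rule image_mono)
    also have "\<dots> = (\<Union>j\<in>J. f ` (?hull A j))" by (rule image_UN)
    also have "\<dots> = (\<Union>j\<in>J. ?hull A' j)" using im(1) by (intro SUP_cong refl)
    finally show ?thesis unfolding frontier_image_near_identity[OF f] .
  qed
  have key: "\<forall>\<^sub>F \<epsilon> in at_right 0. x' + \<epsilon> *\<^sub>R v \<notin> f ` I \<and> x' - \<epsilon> *\<^sub>R v \<in> f ` I"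
    if j: "j \<in> J" and x': "x' \<in> open_facet (A' j)" and v: "0 < \<sigma> j * span_det (A' j) v" for j x' v
  proof -
    obtain x where x: "x \<in> open_facet (A j)" "x' = f x" using x' im(2)[OF j] by blast
    define n where "n = \<sigma> j *\<^sub>R facet_normal (A j)"
    define n' where "n' = \<sigma> j *\<^sub>R facet_normal (A' j)"
    have nn: "0 < n' \<bullet> n" using pos[OF j] sg[OF j] by (auto simp: n_def n'_def)
    then have n0: "0 < n \<bullet> n" by auto
    have nv: "0 < n' \<bullet> v" using v by (simp add: n'_def span_det_inner)
    let ?G = "\<Union>j\<in>J. ?hull A j" and ?G' = "\<Union>j\<in>J. ?hull A' j"
    \<comment> \<open>In a small ball around x the facet j is the only one, because an open facet is
      disjoint from the other closed facets.\<close>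
    obtain r where r: "0 < r" "\<And>z. z \<in> ball x r \<Longrightarrow> z \<in> ?G \<Longrightarrow> z \<in> ?hull A j"
    proof -
      have "closed (\<Union>i\<in>J-{j}. ?hull A i)" using J by (intro closed_UN) (auto intro: compact_imp_closed compact_hull_range)
      moreover have "x \<notin> (\<Union>i\<in>J-{j}. ?hull A i)" using dis[OF j] x(1) by blast
      ultimately obtain r where "r > 0" "ball x r \<inter> (\<Union>i\<in>J-{j}. ?hull A i) = {}"
        by (metis ComplI Int_commute disjoint_eq_subset_Compl open_Compl open_contains_ball)
      then show ?thesis using that[of r] by blast
    qed
    have hx: "x \<in> ?hull A j" using x(1) open_facet_subset by blast
    have flat: "n \<bullet> (z - x) = 0" if "z \<in> ball x r" "z \<in> ?G" for z
      using span_det_hull_diff[OF r(2)[OF that] hx] by (simp add: n_def span_det_inner)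
    \<comment> \<open>The inverse at most doubles distances, so half of the old radius isolates the
      new facet.\<close>
    have flat': "n' \<bullet> (z - x') = 0" if z: "z \<in> ball x' (r / 2)" "z \<in> ?G'" for z
    proof -
      have "dist (inv f x') (inv f z) \<le> 2 * dist x' z" by (rule dist_inv_near_identity[OF f])
      then have "inv f z \<in> ball x r" using z(1) x(2) near_identity_inv(2)[OF f] by simp
      moreover have "inv f z \<in> ?G"
      proof -
        obtain i where i: "i \<in> J" "z \<in> ?hull A' i" using z(2) by blast
        then have "z \<in> f ` ?hull A i" using im(1) by blast
        then have "inv f z \<in> ?hull A i" unfolding vimage_inv_near_identity[OF f] by simp
        then show ?thesis using i(1) by blast
      qed
      ultimately have "inv f z \<in> ?hull A j" by (rule r(2))
      then have "z \<in> ?hull A' j" using im(1)[OF j] near_identity_inv(1)[OF f] by (metis imageI)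
      then have "span_det (A' j) (z - x') = 0"
        using x' open_facet_subset by (intro span_det_hull_diff) blast+
      then show ?thesis by (simp add: n'_def span_det_inner)
    qed
    have "0 < \<sigma> j * span_det (A j) n" using n0 by (simp add: n_def span_det_inner)
    from side[OF j x(1) this] have ev: "\<forall>\<^sub>F \<epsilon> in at_right 0. x + \<epsilon> *\<^sub>R n \<notin> I" "\<forall>\<^sub>F \<epsilon> in at_right 0. x - \<epsilon> *\<^sub>R n \<in> I"
      by (simp_all add: eventually_conj_iff)
    have freq: "\<exists>\<^sub>F \<epsilon> in at_right (0::real). P \<epsilon>" if "\<forall>\<^sub>F \<epsilon> in at_right 0. P \<epsilon>" for P
      using that by (intro eventually_frequently) auto
    have up: "{z \<in> ball x r. 0 < n \<bullet> (z - x)} \<subseteq> - I"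
      by (rule halfball_one_sided[where G="?G" and v=n]) (use fr flat r n0 freq[OF ev(1)] in \<open>auto simp: frontier_complement\<close>)
    have dn: "{z \<in> ball x r. 0 < (- n) \<bullet> (z - x)} \<subseteq> I"
      by (rule halfball_one_sided[where G="?G" and v="- n"]) (use fr flat r n0 freq[OF ev(2)] in auto)
    have near: "\<forall>\<^sub>F \<epsilon> in at_right 0. inv f (x' + \<epsilon> *\<^sub>R (c *\<^sub>R n)) \<in> ball x r \<and> 0 < (c *\<^sub>R n) \<bullet> (inv f (x' + \<epsilon> *\<^sub>R (c *\<^sub>R n)) - x)"
      if c: "c = 1 \<or> c = -1" for c
    proof -
      have "((\<lambda>\<epsilon>. x' + \<epsilon> *\<^sub>R (c *\<^sub>R n)) \<longlongrightarrow> x' + 0 *\<^sub>R (c *\<^sub>R n)) (at_right 0)" by (intro tendsto_intros)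
      then have "\<forall>\<^sub>F \<epsilon> in at_right 0. x' + \<epsilon> *\<^sub>R (c *\<^sub>R n) \<in> ball x' (r/2)"
        using r(1) by (intro topological_tendstoD) auto
      moreover have "\<forall>\<^sub>F \<epsilon> in at_right (0::real). 0 < \<epsilon>" by (rule eventually_at_right_less)
      ultimately show ?thesis
      proof eventually_elim
        fix \<epsilon> :: real assume \<epsilon>: "x' + \<epsilon> *\<^sub>R (c *\<^sub>R n) \<in> ball x' (r/2)" "0 < \<epsilon>"
        define m where "m = c *\<^sub>R n"
        have m: "norm m = norm n" "m \<bullet> m = n \<bullet> n" using c by (auto simp: m_def)
        define y where "y = inv f (x' + \<epsilon> *\<^sub>R m)"
        have fy: "f y = f x + \<epsilon> *\<^sub>R m" unfolding y_def near_identity_inv(1)[OF f] x(2) ..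
        have d: "dist y x \<le> 2 * dist (f y) (f x)" by (rule near_identity_expansion[OF f])
        have "dist (x' + \<epsilon> *\<^sub>R m) x' < r / 2" using \<epsilon>(1) by (simp add: m_def dist_commute)
        then have "y \<in> ball x r" using d unfolding fy x(2) by (simp add: dist_commute)
        moreover have "0 < m \<bullet> (y - x)"
        proof -
          \<comment> \<open>R measures how far f deviates from a translation between x and y. From
            norm R \<le> L * (norm (\<epsilon> m) + norm R) and L < 1/2 it follows that R is shorter
            than the step \<epsilon> m, so y - x keeps a positive component along m.\<close>
          define R where "R = (f y - y) - (f x - x)"
          have yx: "y - x = \<epsilon> *\<^sub>R m - R" unfolding R_def fy by simp
          have "norm R \<le> L * dist y x" unfolding R_def by (rule near_identity_bounds(3)[OF f])
          also have "\<dots> \<le> L * (norm (\<epsilon> *\<^sub>R m) + norm R)"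
            using near_identity_bounds(1)[OF f] norm_triangle_ineq4[of "\<epsilon> *\<^sub>R m" R] by (intro mult_left_mono) (auto simp: dist_norm yx)
          also have "\<dots> \<le> L * norm (\<epsilon> *\<^sub>R m) + 1/2 * norm R"
          proof -
            have "L * norm R \<le> 1/2 * norm R" using near_identity_bounds(2)[OF f] by (intro mult_right_mono) auto
            then show ?thesis unfolding distrib_left by linarith
          qed
          finally have "norm R \<le> 2 * L * (\<epsilon> * norm m)" using \<epsilon>(2) by simp
          moreover have "2 * L * (\<epsilon> * norm m) < 1 * (\<epsilon> * norm m)"
            using near_identity_bounds(2)[OF f] \<epsilon>(2) n0 m(1) by (intro mult_strict_right_mono) auto
          ultimately have Rl: "norm R < \<epsilon> * norm m" by simp
          have "m \<bullet> R \<le> norm m * norm R" by (rule norm_cauchy_schwarz)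
          also have "\<dots> < norm m * (\<epsilon> * norm m)" using Rl n0 m(1) by (intro mult_strict_left_mono) auto
          also have "\<dots> = \<epsilon> * (m \<bullet> m)" by (simp add: dot_square_norm power2_eq_square)
          finally show ?thesis unfolding yx by (simp add: inner_diff_right)
        qed
        ultimately show "inv f (x' + \<epsilon> *\<^sub>R (c *\<^sub>R n)) \<in> ball x r \<and> 0 < (c *\<^sub>R n) \<bullet> (inv f (x' + \<epsilon> *\<^sub>R (c *\<^sub>R n)) - x)"
          by (simp add: y_def m_def)
      qed
    qed
    have e1: "\<forall>\<^sub>F \<epsilon> in at_right 0. x' + \<epsilon> *\<^sub>R n \<in> - f ` I"
      using near[of 1, OF disjI1[OF refl]] by eventually_elim (use up in \<open>auto simp: vimage_inv_near_identity[OF f]\<close>)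
    have e2: "\<forall>\<^sub>F \<epsilon> in at_right 0. x' + \<epsilon> *\<^sub>R (- n) \<in> f ` I"
      using near[of "-1", OF disjI2[OF refl]] by eventually_elim (use dn in \<open>auto simp: vimage_inv_near_identity[OF f]\<close>)
    have r2: "0 < r / 2" using r(1) by simp
    have up': "{z \<in> ball x' (r/2). 0 < n' \<bullet> (z - x')} \<subseteq> - f ` I"
      by (rule halfball_one_sided[where G="?G'" and v=n, OF _ flat' r2 nn freq[OF e1]]) (use frf in \<open>simp_all add: frontier_complement\<close>)
    have dn': "{z \<in> ball x' (r/2). 0 < (- n') \<bullet> (z - x')} \<subseteq> f ` I"
      by (rule halfball_one_sided[where G="?G'" and v="- n", OF frf _ r2 _ freq[OF e2]]) (use flat' nn in simp_all)
    have "((\<lambda>\<epsilon>. x' + \<epsilon> *\<^sub>R v) \<longlongrightarrow> x' + 0 *\<^sub>R v) (at_right 0)" "((\<lambda>\<epsilon>. x' - \<epsilon> *\<^sub>R v) \<longlongrightarrow> x' - 0 *\<^sub>R v) (at_right 0)"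
      by (intro tendsto_intros)+
    then have lims: "((\<lambda>\<epsilon>. x' + \<epsilon> *\<^sub>R v) \<longlongrightarrow> x') (at_right 0)" "((\<lambda>\<epsilon>. x' - \<epsilon> *\<^sub>R v) \<longlongrightarrow> x') (at_right 0)"
      by simp_all
    have "\<forall>\<^sub>F \<epsilon> in at_right 0. h \<epsilon> \<in> ball x' (r/2)" if "(h \<longlongrightarrow> x') (at_right (0::real))" for h
      by (rule topological_tendstoD[OF that open_ball]) (use r2 in simp)
    from this[OF lims(1)] this[OF lims(2)]
    have "\<forall>\<^sub>F \<epsilon> in at_right 0. x' + \<epsilon> *\<^sub>R v \<in> ball x' (r/2)" "\<forall>\<^sub>F \<epsilon> in at_right 0. x' - \<epsilon> *\<^sub>R v \<in> ball x' (r/2)"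
      by this+
    moreover have "\<forall>\<^sub>F \<epsilon> in at_right (0::real). 0 < \<epsilon>" by (rule eventually_at_right_less)
    ultimately show ?thesis
    proof eventually_elim
      fix \<epsilon> :: real assume "x' + \<epsilon> *\<^sub>R v \<in> ball x' (r/2)" "x' - \<epsilon> *\<^sub>R v \<in> ball x' (r/2)" "0 < \<epsilon>"
      then have "x' + \<epsilon> *\<^sub>R v \<in> {z \<in> ball x' (r/2). 0 < n' \<bullet> (z - x')}" "x' - \<epsilon> *\<^sub>R v \<in> {z \<in> ball x' (r/2). 0 < (- n') \<bullet> (z - x')}"
        using nv by auto
      then show "x' + \<epsilon> *\<^sub>R v \<notin> f ` I \<and> x' - \<epsilon> *\<^sub>R v \<in> f ` I" using up' dn' by blast
    qed
  qed
  have nd: "\<exists>v. span_det (A' j) v \<noteq> 0" if "j \<in> J" for j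
    using pos[OF that] by (metis less_irrefl span_det_inner)
  have dis': "open_facet (A' i) \<inter> ?hull A' j = {}" if "i \<in> J" "j \<in> J" "i \<noteq> j" for i j
    using dis[OF that] im that inj by (metis image_Int image_empty)
  show ?thesis unfolding sided_def
    using J bI sg key nd dis' frf by (simp add: bounded_image_near_identity[OF f])
qed

section \<open>The derivative of the enclosed volume\<close>

lemma tendsto_facet_normal:
  fixes a :: "'x \<Rightarrow> 'n::finite \<Rightarrow> real^'n"
  assumes "\<And>i. ((\<lambda>s. a s i) \<longlongrightarrow> b i) X"
  shows "((\<lambda>s. facet_normal (a s)) \<longlongrightarrow> facet_normal b) X"
proof (rule vec_tendstoI)
  fix i
  have *: "((\<lambda>s. (if k = undefined then axis i 1 else a s k - a s undefined) $ l) \<longlongrightarrow> (if k = undefined then axis i 1 else b k - b undefined) $ l) X" for k l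
    by (cases "k = undefined") (auto intro!: tendsto_intros assms)
  show "((\<lambda>s. facet_normal (a s) $ i) \<longlongrightarrow> facet_normal b $ i) X"
    unfolding facet_normal_def span_det_def det_def by (simp only: vec_lambda_beta, intro tendsto_sum tendsto_mult tendsto_prod tendsto_const *)
qed

text \<open>As g vanishes at t, the difference quotient of the product is c times that of g. It will
  be used with a vertex displacement as g and a component of a moving normal as c.\<close>

lemma has_real_derivative_mult_zero:
  fixes c g :: "real \<Rightarrow> real"
  assumes "(c \<longlongrightarrow> c t) (at t within S)" "(g has_real_derivative d) (at t within S)" "g t = 0"
  shows "((\<lambda>s. c s * g s) has_real_derivative c t * d) (at t within S)"
proof -
  have "((\<lambda>s. c s * ((g s - g t) / (s - t))) \<longlongrightarrow> c t * d) (at t within S)"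
    using assms(2) by (intro tendsto_mult assms(1)) (simp add: has_field_derivative_iff)
  then show ?thesis by (simp add: has_field_derivative_iff assms(3))
qed

text \<open>\<open>f s\<close> is the identity plus the vertex displacements interpolated by the hat
  functions. It is affine on every facet and close to the identity once the displacements are small,
  so it carries sided sets to sided sets. The volume is differentiated by induction over the set of
  vertices already moved.\<close>

theorem swept_volume_derivative:
  fixes q :: "real \<Rightarrow> 'k \<Rightarrow> real^'n" and I :: "(real^'n) set"
  assumes surf: "simplicial_surface F (q t)"
    and e: "\<And>r. r \<in> F \<Longrightarrow> bij_betw (e r) UNIV r"
    and sd: "sided F (\<lambda>r i. q t (e r i)) \<sigma> I"
    and q: "\<And>k. k \<in> \<Union>F \<Longrightarrow> ((\<lambda>s. q s k) has_vector_derivative w k) (at t within S)"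
  obtains f :: "real \<Rightarrow> real^'n \<Rightarrow> real^'n" where
    "\<forall>\<^sub>F s in at t within S. \<exists>L. near_identity L (f s)"
    "\<And>s r. r \<in> F \<Longrightarrow> f s ` (convex hull (q t ` r)) = convex hull (q s ` r)"
    "\<And>x. ((\<lambda>s. f s x) \<longlongrightarrow> x) (at t within S)" "f t = id"
    "((\<lambda>s. measure lebesgue (f s ` I)) has_real_derivative
       (\<Sum>k\<in>\<Union>F. \<Sum>r\<in>{r\<in>F. k \<in> r}. \<sigma> r * span_det (\<lambda>i. q t (e r i)) (w k) / fact CARD('n))) (at t within S)"
proof -
  interpret simplicial_surface F "q t" by fact
  let ?K = "\<Union>F"
  have K: "finite ?K" by (rule finite_vertices)
  show ?thesis
  proof (rule hat_functions)
    fix \<Lambda> :: "'k \<Rightarrow> real^'n \<Rightarrow> real" and C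
    assume C: "C > 0" and lip: "\<And>k x y. \<bar>\<Lambda> k x - \<Lambda> k y\<bar> \<le> C * dist x y"
      and hat: "\<And>r a k. r \<in> F \<Longrightarrow> a \<in> barycentric r \<Longrightarrow> \<Lambda> k (\<Sum>k\<in>r. a k *\<^sub>R q t k) = a k"
    define g where "g \<delta> x = x + (\<Sum>k\<in>?K. \<Lambda> k x *\<^sub>R \<delta> k)" for \<delta> :: "'k \<Rightarrow> real^'n" and x
    have g_near: "near_identity (C * (\<Sum>k\<in>?K. norm (\<delta> k))) (g \<delta>)" if "C * (\<Sum>k\<in>?K. norm (\<delta> k)) < 1/2" for \<delta>
      unfolding near_identity_def
    proof (intro conjI allI that)
      show "0 \<le> C * (\<Sum>k\<in>?K. norm (\<delta> k))" using C by (intro mult_nonneg_nonneg sum_nonneg) auto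
      fix x y
      have "(g \<delta> x - x) - (g \<delta> y - y) = (\<Sum>k\<in>?K. (\<Lambda> k x - \<Lambda> k y) *\<^sub>R \<delta> k)"
        by (simp add: g_def scaleR_diff_left sum_subtractf)
      also have "norm \<dots> \<le> (\<Sum>k\<in>?K. (C * dist x y) * norm (\<delta> k))"
        by (rule sum_norm_le) (use lip in \<open>auto intro!: mult_right_mono\<close>)
      finally show "norm ((g \<delta> x - x) - (g \<delta> y - y)) \<le> C * (\<Sum>k\<in>?K. norm (\<delta> k)) * dist x y"
        by (simp add: sum_distrib_left[symmetric] mult_ac)
    qed
    have g_bary: "g \<delta> (\<Sum>k\<in>r. a k *\<^sub>R q t k) = (\<Sum>k\<in>r. a k *\<^sub>R (q t k + \<delta> k))" if "r \<in> F" "a \<in> barycentric r" for \<delta> r a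
    proof -
      have "(\<Sum>k\<in>?K. \<Lambda> k (\<Sum>k\<in>r. a k *\<^sub>R q t k) *\<^sub>R \<delta> k) = (\<Sum>k\<in>r. a k *\<^sub>R \<delta> k)"
        unfolding hat[OF that] using that K by (intro barycentric_sum_superset) auto
      then show ?thesis by (simp add: g_def scaleR_add_right sum.distrib)
    qed
    have g_vert: "g \<delta> (\<Sum>i\<in>UNIV. u i *\<^sub>R q t (e r i)) = (\<Sum>i\<in>UNIV. u i *\<^sub>R (q t (e r i) + \<delta> (e r i)))"
      if r: "r \<in> F" and u: "\<forall>i. 0 \<le> u i" "sum u UNIV = 1" for \<delta> r u
    proof -
      define a where "a k = (if k \<in> r then u (inv_into UNIV (e r) k) else 0)" for k
      have inj: "inj (e r)" and rg: "range (e r) = r" using e[OF r] by (auto simp: bij_betw_def)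
      have ae: "a (e r i) = u i" for i using inj rg by (auto simp: a_def)
      have sr: "(\<Sum>k\<in>r. h k) = (\<Sum>i\<in>UNIV. h (e r i))" for h :: "'k \<Rightarrow> 'z::comm_monoid_add"
        using sum.reindex_bij_betw[OF e[OF r], of h] by simp
      have "a \<in> barycentric r" unfolding barycentric_def using u by (simp add: sr ae) (simp add: a_def)
      from g_bary[OF r this, of \<delta>] show ?thesis by (simp add: sr ae)
    qed
    define \<delta> where "\<delta> A s k = (if k \<in> A then q s k - q t k else 0)" for A s k
    have q_tends: "((\<lambda>s. q s k) \<longlongrightarrow> q t k) (at t within S)" if "k \<in> ?K" for k
      using has_vector_derivative_continuous[OF q[OF that]] by (simp add: continuous_within)
    have \<delta>_tends: "((\<lambda>s. \<delta> A s k) \<longlongrightarrow> 0) (at t within S)" if "k \<in> ?K" for A k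
      using tendsto_diff[OF q_tends[OF that] tendsto_const[of "q t k"]] by (cases "k \<in> A") (simp_all add: \<delta>_def)
    let ?A = "\<lambda>A s r i. q t (e r i) + \<delta> A s (e r i)"
    have eK: "e r i \<in> ?K" if "r \<in> F" for r i using e[OF that] that by (auto simp: bij_betw_def)
    have fn_tends: "((\<lambda>s. facet_normal (?A A s r)) \<longlongrightarrow> facet_normal (\<lambda>i. q t (e r i))) (at t within S)" if "r \<in> F" for A r
      by (rule tendsto_facet_normal) (use tendsto_add[OF tendsto_const \<delta>_tends[OF eK[OF that]]] in simp)
    have small: "\<forall>\<^sub>F s in at t within S. C * (\<Sum>k\<in>?K. norm (\<delta> A s k)) < 1/2" for A
    proof -
      have "((\<lambda>s. C * (\<Sum>k\<in>?K. norm (\<delta> A s k))) \<longlongrightarrow> C * (\<Sum>k\<in>?K. norm (0::real^'n))) (at t within S)"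
        by (intro tendsto_intros \<delta>_tends)
      then show ?thesis by (rule order_tendstoD) simp
    qed
    \<comment> \<open>At s = t the inner product is the squared length of a nonzero normal;
      continuity keeps it positive nearby, as \<open>sided_image_near_identity\<close>
      requires.\<close>
    have pos: "\<forall>\<^sub>F s in at t within S. \<forall>r\<in>F. 0 < facet_normal (?A A s r) \<bullet> facet_normal (\<lambda>i. q t (e r i))" for A
    proof (rule eventually_ball_finite[OF finite_F], rule ballI)
      fix r assume r: "r \<in> F"
      have "facet_normal (\<lambda>i. q t (e r i)) \<noteq> 0"
        using sd r unfolding sided_def span_det_inner by (metis inner_zero_left)
      moreover have "((\<lambda>s. facet_normal (?A A s r) \<bullet> facet_normal (\<lambda>i. q t (e r i))) \<longlongrightarrow>
          facet_normal (\<lambda>i. q t (e r i)) \<bullet> facet_normal (\<lambda>i. q t (e r i))) (at t within S)"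
        by (intro tendsto_intros fn_tends r)
      ultimately show "\<forall>\<^sub>F s in at t within S. 0 < facet_normal (?A A s r) \<bullet> facet_normal (\<lambda>i. q t (e r i))"
        by (intro order_tendstoD(1)) auto
    qed
    have sided: "\<forall>\<^sub>F s in at t within S. sided F (?A A s) \<sigma> (g (\<delta> A s) ` I)" for A
      using small[of A] pos[of A]
    proof eventually_elim
      fix s assume s: "C * (\<Sum>k\<in>?K. norm (\<delta> A s k)) < 1/2" "\<forall>r\<in>F. 0 < facet_normal (?A A s r) \<bullet> facet_normal (\<lambda>i. q t (e r i))"
      show "sided F (?A A s) \<sigma> (g (\<delta> A s) ` I)"
        by (rule sided_image_near_identity[OF g_near[OF s(1)] sd]) (use g_vert s(2) in auto)
    qed
    have \<delta>t: "\<delta> A t = (\<lambda>_. 0)" for A by (auto simp: \<delta>_def)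
    have g0: "g (\<lambda>_. 0) = id" by (auto simp: g_def)
    let ?d = "\<lambda>k. \<Sum>r\<in>{r\<in>F. k \<in> r}. \<sigma> r * span_det (\<lambda>i. q t (e r i)) (w k) / fact CARD('n)"
    have deriv: "((\<lambda>s. measure lebesgue (g (\<delta> A s) ` I)) has_real_derivative (\<Sum>k\<in>A. ?d k)) (at t within S)"
      if "finite A" "A \<subseteq> ?K" for A
      using that
    proof (induction A rule: finite_induct)
      case empty
      have "\<delta> {} s = (\<lambda>_. 0)" for s by (auto simp: \<delta>_def)
      then show ?case by simp
    next
      case (insert k A)
      \<comment> \<open>The exact increment when k is moved after the vertices of A. Its
        determinants contain the normals of the intermediate configuration, which converge to those
        at time t, and the displacement of k, which is differentiable and vanishes at t.\<close>
      let ?h = "\<lambda>s. \<Sum>r\<in>{r\<in>F. k \<in> r}. \<sigma> r * span_det (?A A s r) (q s k - q t k) / fact CARD('n)"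
      have kK: "k \<in> ?K" using insert.prems by blast
      have comp: "((\<lambda>s. (q s k - q t k) $ i) has_real_derivative w k $ i) (at t within S)" for i
      proof -
        have "((\<lambda>s. q s k - q t k) has_vector_derivative w k) (at t within S)"
          using has_vector_derivative_diff_const[of "\<lambda>s. q s k" "q t k" "w k" "at t within S"] q[OF kK] by simp
        from bounded_linear.has_vector_derivative[OF bounded_linear_vec_nth this, of i]
        show ?thesis by (simp add: has_real_derivative_iff_has_vector_derivative)
      qed
      have "((\<lambda>s. span_det (?A A s r) (q s k - q t k)) has_real_derivative span_det (\<lambda>i. q t (e r i)) (w k)) (at t within S)"
        if r: "r \<in> F" for r
      proof -
        have "((\<lambda>s. facet_normal (?A A s r) $ i * (q s k - q t k) $ i) has_real_derivative facet_normal (\<lambda>i. q t (e r i)) $ i * w k $ i) (at t within S)" for i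
          using has_real_derivative_mult_zero[of "\<lambda>s. facet_normal (?A A s r) $ i" t S "\<lambda>s. (q s k - q t k) $ i", OF _ comp]
            tendsto_vec_nth[OF fn_tends[OF r]] by (simp add: \<delta>t)
        then show ?thesis unfolding span_det_inner inner_vec_def by (auto intro!: DERIV_sum)
      qed
      then have "(?h has_real_derivative ?d k) (at t within S)"
        by (intro DERIV_sum DERIV_cdivide DERIV_cmult) auto
      with insert.IH insert.prems have "((\<lambda>s. measure lebesgue (g (\<delta> A s) ` I) + ?h s) has_real_derivative (\<Sum>k\<in>A. ?d k) + ?d k) (at t within S)"
        by (intro DERIV_add) auto
      moreover have "\<forall>\<^sub>F s in at t within S. measure lebesgue (g (\<delta> (insert k A) s) ` I) = measure lebesgue (g (\<delta> A s) ` I) + ?h s"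
        using sided[of A] sided[of "insert k A"]
      proof eventually_elim
        fix s assume s1: "sided F (?A A s) \<sigma> (g (\<delta> A s) ` I)" and s2: "sided F (?A (insert k A) s) \<sigma> (g (\<delta> (insert k A) s) ` I)"
        show "measure lebesgue (g (\<delta> (insert k A) s) ` I) = measure lebesgue (g (\<delta> A s) ` I) + ?h s"
        \<comment> \<open>A zero displacement is no direction for
          \<open>measure_sided_move_vertex\<close>; in that case nothing moves.\<close>
        proof (cases "q s k - q t k = 0")
          case True
          then have "\<delta> (insert k A) s = \<delta> A s" by (auto simp: \<delta>_def)
          moreover have "?h s = 0" unfolding True by (simp add: linear_0[OF linear_span_det])
          ultimately show ?thesis by simp
        next
          case False
          have "measure lebesgue (g (\<delta> (insert k A) s) ` I) - measure lebesgue (g (\<delta> A s) ` I) = ?h s"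
          proof (rule measure_sided_move_vertex[OF s1 s2 False])
            show "{r \<in> F. k \<in> r} \<subseteq> F" by blast
          next
            fix r assume "r \<in> F - {r \<in> F. k \<in> r}"
            then have "e r i \<noteq> k" for i using e[of r] by (auto simp: bij_betw_def)
            then show "?A (insert k A) s r = ?A A s r" by (auto simp: \<delta>_def)
          next
            fix r assume "r \<in> {r \<in> F. k \<in> r}"
            then have "k \<in> range (e r)" and inj: "inj (e r)" using e[of r] by (auto simp: bij_betw_def)
            then obtain j where "k = e r j" by blast
            note j = this[symmetric] inj
            have "?A (insert k A) s r = (?A A s r)(j := ?A A s r j + (q s k - q t k))"
              using j insert.hyps by (auto simp: \<delta>_def fun_eq_iff dest: injD)
            then show "\<exists>j. ?A (insert k A) s r = (?A A s r)(j := ?A A s r j + (q s k - q t k))" by blast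
          qed
          then show ?thesis by simp
        qed
      qed
      moreover have "?h t = 0" by (simp add: linear_0[OF linear_span_det])
      ultimately show ?case using insert.hyps
        by (subst has_field_derivative_cong_eventually[of _ "\<lambda>s. measure lebesgue (g (\<delta> A s) ` I) + ?h s"]) (auto simp: \<delta>t add.commute)
    qed
    show ?thesis
    proof (rule that[of "\<lambda>s. g (\<delta> ?K s)"])
      show "\<forall>\<^sub>F s in at t within S. \<exists>L. near_identity L (g (\<delta> ?K s))"
        using small[of ?K] by eventually_elim (use g_near in blast)
      show "g (\<delta> ?K s) ` (convex hull (q t ` r)) = convex hull (q s ` r)" if r: "r \<in> F" for s r
      proof -
        have fr: "finite r" using finite_facet[OF r] .
        have *: "q t k + \<delta> ?K s k = q s k" if "k \<in> r" for k using that r by (auto simp: \<delta>_def)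
        have "g (\<delta> ?K s) (\<Sum>k\<in>r. a k *\<^sub>R q t k) = (\<Sum>k\<in>r. a k *\<^sub>R q s k)" if "a \<in> barycentric r" for a
          unfolding g_bary[OF r that] using * by (intro sum.cong) auto
        then show ?thesis unfolding convex_hull_image_barycentric[OF fr] by (force simp: image_iff)
      qed
      show "((\<lambda>s. g (\<delta> ?K s) x) \<longlongrightarrow> x) (at t within S)" for x
      proof -
        have "((\<lambda>s. g (\<delta> ?K s) x) \<longlongrightarrow> x + (\<Sum>k\<in>?K. \<Lambda> k x *\<^sub>R 0)) (at t within S)"
          unfolding g_def by (intro tendsto_intros \<delta>_tends)
        then show ?thesis by simp
      qed
      show "g (\<delta> ?K t) = id" by (simp add: \<delta>t g0)
      show "((\<lambda>s. measure lebesgue (g (\<delta> ?K s) ` I)) has_real_derivative (\<Sum>k\<in>?K. ?d k)) (at t within S)"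
        by (rule deriv[OF K order_refl])
    qed
  qed
qed

section \<open>The divergence theorem for Sobolev functions\<close>

text \<open>The Jacobian is eliminated by applying the same substitution to the indicator of T,
  which expresses it through the volumes of S and T.\<close>

lemma integral_affine_image:
  fixes u :: "'a::euclidean_space \<Rightarrow> real" and g :: "'a \<Rightarrow> 'a"
  assumes g: "linear g" "inj g" and S: "S \<in> sets borel" "T \<in> sets borel" "\<And>x. b + g x \<in> T \<longleftrightarrow> x \<in> S"
    and pos: "measure lborel T > 0" and u: "u \<in> borel_measurable borel"
  shows "(\<integral>x. indicator T x * u x \<partial>lborel) * measure lborel S = measure lborel T * (\<integral>x. indicator S x * u (b + g x) \<partial>lborel)"
proof -
  obtain c where c: "c \<ge> 0" "distr lborel borel (\<lambda>x. b + g x) = density lborel (\<lambda>_. ennreal c)"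
    using distr_lborel_affine_bij[OF g, of b] by blast
  have [measurable]: "u \<in> borel_measurable borel" "T \<in> sets borel" by fact+
  have [measurable]: "(\<lambda>x. b + g x) \<in> borel_measurable borel"
    by (intro borel_measurable_continuous_onI continuous_intros linear_continuous_on linear_conv_bounded_linear[THEN iffD1] g)
  have *: "c * (\<integral>x. h x \<partial>lborel) = (\<integral>x. h (b + g x) \<partial>lborel)" if [measurable]: "h \<in> borel_measurable borel" for h :: "'a \<Rightarrow> real"
  proof -
    have "(\<integral>x. h (b + g x) \<partial>lborel) = (\<integral>x. h x \<partial>distr lborel borel (\<lambda>x. b + g x))"
      by (rule integral_distr[symmetric]) measurable
    also have "\<dots> = (\<integral>x. c * h x \<partial>lborel)" unfolding c(2) by (subst integral_density) (use c(1) in auto)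
    finally show ?thesis by simp
  qed
  have iT: "indicat_real T (b + g x) = indicat_real S x" for x using S(3) by (simp add: indicator_def)
  have "c * measure lborel T = measure lborel S" using *[of "indicator T"] S(1,2) by (simp add: iT)
  moreover have "c * (\<integral>x. indicator T x * u x \<partial>lborel) = (\<integral>x. indicator S x * u (b + g x) \<partial>lborel)"
    using *[of "\<lambda>x. indicator T x * u x"] by (simp add: iT)
  ultimately show ?thesis by (metis mult.assoc mult.commute)
qed

section \<open>Thin slices between a column and its translate\<close>

lemma column_scale_direction: "0 < c \<Longrightarrow> column a (c *\<^sub>R v) = column a v"
proof safe
  fix x assume c: "0 < c"
  { assume "x \<in> column a (c *\<^sub>R v)"
    then obtain \<tau> where "0 \<le> \<tau>" "x + \<tau> *\<^sub>R c *\<^sub>R v \<in> convex hull (range a)" by (auto simp: column_def)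
    then show "x \<in> column a v" using c by (auto simp: column_def intro!: exI[of _ "\<tau> * c"]) }
  { assume "x \<in> column a v"
    then obtain \<tau> where "0 \<le> \<tau>" "x + \<tau> *\<^sub>R v \<in> convex hull (range a)" by (auto simp: column_def)
    then show "x \<in> column a (c *\<^sub>R v)" using c by (auto simp: column_def intro!: exI[of _ "\<tau> / c"]) }
qed

lemma column_translate: "x + w \<in> column a v \<longleftrightarrow> x \<in> column (\<lambda>i. a i - w) v"
proof -
  have "convex hull (range (\<lambda>i. a i - w)) = (\<lambda>y. - w + y) ` (convex hull (range a))"
    unfolding convex_hull_translation[symmetric] by (simp add: image_image)
  then have "y \<in> convex hull (range (\<lambda>i. a i - w)) \<longleftrightarrow> y + w \<in> convex hull (range a)" for y
    by (force simp: image_iff algebra_simps)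
  then show ?thesis by (simp add: column_def add_ac)
qed

lemma span_det_translate: "span_det (\<lambda>i. a i - w) = span_det a"
proof
  fix v
  have *: "(a i - w) - (a j - w) = a i - a j" for i j by simp
  show "span_det (\<lambda>i. a i - w) v = span_det a v" unfolding span_det_def * ..
qed

definition facet_slice :: "('n::finite \<Rightarrow> real^'n) \<Rightarrow> real^'n \<Rightarrow> (real^'n) set" where
  "facet_slice a v = {x. \<exists>\<tau>. 0 \<le> \<tau> \<and> \<tau> \<le> 1 \<and> x + \<tau> *\<^sub>R v \<in> convex hull (range a)}"

text \<open>A ray not parallel to the facet meets it at one time only. A point that reaches it both
  within time 1 and not before time 1 does so at time exactly 1, so slice and difference of columns
  differ at most by the translated facet. The volume is the one added when all vertices are shifted
  by v.\<close>

lemma facet_slice: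
  fixes a :: "'n::finite \<Rightarrow> real^'n"
  assumes D: "span_det a v \<noteq> 0"
  shows "column a v - column (\<lambda>i. a i - v) v \<subseteq> facet_slice a v"
    "facet_slice a v \<subseteq> (column a v - column (\<lambda>i. a i - v) v) \<union> convex hull (range (\<lambda>i. a i - v))"
    "facet_slice a v \<in> sets borel" "bounded (facet_slice a v)"
    "measure lborel (facet_slice a v) = CARD('n) * \<bar>span_det a v\<bar> / fact CARD('n)"
proof -
  let ?b = "\<lambda>i. a i - v"
  have hull: "y \<in> convex hull (range ?b) \<longleftrightarrow> y + v \<in> convex hull (range a)" for y
  proof -
    have "convex hull (range ?b) = (\<lambda>y. - v + y) ` (convex hull (range a))"
      unfolding convex_hull_translation[symmetric] by (simp add: image_image)
    then show ?thesis by (force simp: image_iff algebra_simps)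
  qed
  have cb: "x \<in> column ?b v \<longleftrightarrow> (\<exists>\<tau>\<ge>1. x + \<tau> *\<^sub>R v \<in> convex hull (range a))" for x
  proof
    assume "x \<in> column ?b v"
    then obtain \<tau> where "0 \<le> \<tau>" "x + \<tau> *\<^sub>R v + v \<in> convex hull (range a)" by (auto simp: column_def hull)
    then show "\<exists>\<tau>\<ge>1. x + \<tau> *\<^sub>R v \<in> convex hull (range a)" by (intro exI[of _ "\<tau> + 1"]) (simp add: scaleR_add_left add.assoc)
  next
    assume "\<exists>\<tau>\<ge>1. x + \<tau> *\<^sub>R v \<in> convex hull (range a)"
    then obtain \<tau> where "1 \<le> \<tau>" "x + \<tau> *\<^sub>R v \<in> convex hull (range a)" by blast
    then show "x \<in> column ?b v" unfolding column_def mem_Collect_eq hull by (intro exI[of _ "\<tau> - 1"]) (simp add: scaleR_diff_left)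
  qed
  show 1: "column a v - column ?b v \<subseteq> facet_slice a v"
  proof
    fix x assume x: "x \<in> column a v - column ?b v"
    then obtain \<tau> where \<tau>: "0 \<le> \<tau>" "x + \<tau> *\<^sub>R v \<in> convex hull (range a)" by (auto simp: column_def)
    moreover have "\<tau> \<le> 1" using x \<tau>(2) unfolding Diff_iff cb by (meson linear)
    ultimately show "x \<in> facet_slice a v" unfolding facet_slice_def by blast
  qed
  show 2: "facet_slice a v \<subseteq> (column a v - column ?b v) \<union> convex hull (range ?b)"
  proof
    fix x assume "x \<in> facet_slice a v"
    then obtain \<tau> where \<tau>: "0 \<le> \<tau>" "\<tau> \<le> 1" "x + \<tau> *\<^sub>R v \<in> convex hull (range a)" by (auto simp: facet_slice_def)
    have "x \<in> convex hull (range ?b)" if "x \<in> column ?b v"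
    proof -
      from cb[THEN iffD1, OF that] obtain \<sigma> where \<sigma>: "1 \<le> \<sigma>" "x + \<sigma> *\<^sub>R v \<in> convex hull (range a)" by blast
      have "span_det a ((x + \<tau> *\<^sub>R v) - (x + \<sigma> *\<^sub>R v)) = 0" by (rule span_det_hull_diff[OF \<tau>(3) \<sigma>(2)])
      also have "(x + \<tau> *\<^sub>R v) - (x + \<sigma> *\<^sub>R v) = (\<tau> - \<sigma>) *\<^sub>R v" by (simp add: scaleR_diff_left)
      finally have "\<tau> = \<sigma>" using D by (simp add: linear_cmul[OF linear_span_det])
      then have "\<tau> = 1" using \<tau>(2) \<sigma>(1) by simp
      then show ?thesis using \<tau>(3) unfolding hull by simp
    qed
    moreover have "x \<in> column a v" using \<tau> by (auto simp: column_def)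
    ultimately show "x \<in> (column a v - column ?b v) \<union> convex hull (range ?b)" by blast
  qed
  have cpt: "compact (facet_slice a v)"
  proof -
    have "facet_slice a v = (\<lambda>(y, \<tau>). y - \<tau> *\<^sub>R v) ` ((convex hull (range a)) \<times> {0..1})"
    proof (rule set_eqI, rule iffI)
      fix x assume "x \<in> facet_slice a v"
      then obtain \<tau> where "0 \<le> \<tau>" "\<tau> \<le> 1" "x + \<tau> *\<^sub>R v \<in> convex hull (range a)" by (auto simp: facet_slice_def)
      then show "x \<in> (\<lambda>(y, \<tau>). y - \<tau> *\<^sub>R v) ` ((convex hull (range a)) \<times> {0..1})"
        by (intro image_eqI[of _ _ "(x + \<tau> *\<^sub>R v, \<tau>)"]) auto
    next
      fix x assume "x \<in> (\<lambda>(y, \<tau>). y - \<tau> *\<^sub>R v) ` ((convex hull (range a)) \<times> {0..1})"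
      then obtain y \<tau> where "y \<in> convex hull (range a)" "0 \<le> \<tau>" "\<tau> \<le> 1" "x = y - \<tau> *\<^sub>R v" by auto
      then show "x \<in> facet_slice a v" unfolding facet_slice_def by (intro CollectI exI[of _ \<tau>]) simp
    qed
    moreover have "compact \<dots>"
      unfolding case_prod_unfold by (intro compact_continuous_image compact_Times compact_hull_range compact_Icc continuous_intros)
    ultimately show ?thesis by simp
  qed
  then show b: "facet_slice a v \<in> sets borel" and "bounded (facet_slice a v)"
    by (auto intro: borel_compact compact_imp_bounded)
  have Db: "span_det ?b v \<noteq> 0" using D by (simp add: span_det_translate)
  have ab: "(\<lambda>i. ?b i + v) = a" by auto
  have neg: "negligible (((column a v - column ?b v) - facet_slice a v) \<union> (facet_slice a v - (column a v - column ?b v)))"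
    using 1 2 by (intro negligible_subset[OF negligible_hull_range[of ?b]]) blast
  have "measure lborel (facet_slice a v) = measure lebesgue (facet_slice a v)" using b by simp
  also have "\<dots> = measure lebesgue (column a v - column ?b v)"
    using measure_negligible_symdiff[OF column_shift_all(1)[OF Db, unfolded ab] neg] .
  also have "\<dots> = CARD('n) * \<bar>span_det a v\<bar> / fact CARD('n)"
    using column_shift_all(2)[OF Db, unfolded ab] by (simp add: span_det_translate)
  finally show "measure lborel (facet_slice a v) = CARD('n) * \<bar>span_det a v\<bar> / fact CARD('n)" .
qed

definition facet_unit :: "('n::finite \<Rightarrow> real^'n) \<Rightarrow> real^'n" where
  "facet_unit a = (1 / norm (facet_normal a)) *\<^sub>R facet_normal a"

definition facet_slab :: "('n::finite \<Rightarrow> real^'n) \<Rightarrow> (real^'n) set" where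
  "facet_slab a = slab_over (facet_unit a) (facet_unit a \<bullet> a undefined) (convex hull (range a))"

definition facet_proj :: "('n::finite \<Rightarrow> real^'n) \<Rightarrow> real^'n \<Rightarrow> real^'n" where
  "facet_proj a x = x - (facet_unit a \<bullet> x - facet_unit a \<bullet> a undefined) *\<^sub>R facet_unit a"

text \<open>The surface integral of \<open>u\<close> over the facet, with the surface measure normalised such that a slab
  of width 1 has the measure of its base.\<close>

definition facet_integral :: "('n::finite \<Rightarrow> real^'n) \<Rightarrow> (real^'n \<Rightarrow> real) \<Rightarrow> real" where
  "facet_integral a u = (\<integral>x. indicator (facet_slab a) x * u (facet_proj a x) \<partial>lborel)"

lemma facet_unit_props:
  assumes "facet_normal a \<noteq> 0"
  shows "norm (facet_unit a) = 1" "facet_unit a \<bullet> facet_unit a = 1" "span_det a v = norm (facet_normal a) * (facet_unit a \<bullet> v)"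
    "x \<in> convex hull (range a) \<Longrightarrow> facet_unit a \<bullet> x = facet_unit a \<bullet> a undefined"
proof -
  show n1: "norm (facet_unit a) = 1" using assms by (simp add: facet_unit_def)
  then show "facet_unit a \<bullet> facet_unit a = 1" by (simp add: dot_square_norm)
  show sp: "span_det a v = norm (facet_normal a) * (facet_unit a \<bullet> v)" for v
    using assms by (simp add: facet_unit_def span_det_inner)
  assume "x \<in> convex hull (range a)"
  then have "span_det a (x - a undefined) = 0" by (intro span_det_hull_diff) (auto intro: hull_inc)
  then show "facet_unit a \<bullet> x = facet_unit a \<bullet> a undefined" using assms by (simp add: sp inner_diff_right)
qed

text \<open>A slice extends from the facet against its direction, hence the minus sign for a slab on
  the side of \<open>facet_unit\<close>.\<close>

lemma facet_slab_slice:
  assumes "facet_normal a \<noteq> 0"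
  shows "facet_slab a = facet_slice a (- facet_unit a)"
proof -
  note p = facet_unit_props[OF assms]
  have "x \<in> facet_slab a \<longleftrightarrow> x \<in> facet_slice a (- facet_unit a)" for x
  proof
    assume "x \<in> facet_slab a"
    then show "x \<in> facet_slice a (- facet_unit a)"
      by (auto simp: facet_slab_def slab_over_def facet_slice_def intro!: exI[of _ "facet_unit a \<bullet> x - facet_unit a \<bullet> a undefined"])
  next
    assume "x \<in> facet_slice a (- facet_unit a)"
    then obtain \<tau> where \<tau>: "0 \<le> \<tau>" "\<tau> \<le> 1" "x - \<tau> *\<^sub>R facet_unit a \<in> convex hull (range a)" by (auto simp: facet_slice_def)
    then have "facet_unit a \<bullet> x - \<tau> = facet_unit a \<bullet> a undefined" using p(4)[OF \<tau>(3)] by (simp add: inner_diff_right p(2))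
    then have "\<tau> = facet_unit a \<bullet> x - facet_unit a \<bullet> a undefined" by simp
    then show "x \<in> facet_slab a" using \<tau> by (auto simp: facet_slab_def slab_over_def)
  qed
  then show ?thesis by blast
qed

lemma facet_slab:
  fixes a :: "'n::finite \<Rightarrow> real^'n"
  assumes "facet_normal a \<noteq> 0"
  shows "facet_slab a \<in> sets borel" "bounded (facet_slab a)"
    "measure lborel (facet_slab a) = CARD('n) * norm (facet_normal a) / fact CARD('n)"
proof -
  note p = facet_unit_props[OF assms]
  have D: "span_det a (- facet_unit a) = - norm (facet_normal a)" by (simp add: p)
  then have "span_det a (- facet_unit a) \<noteq> 0" using assms by simp
  note s = facet_slice(3-5)[OF this, folded facet_slab_slice[OF assms], unfolded D]
  show "facet_slab a \<in> sets borel" "bounded (facet_slab a)"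
    "measure lborel (facet_slab a) = CARD('n) * norm (facet_normal a) / fact CARD('n)"
    using s by simp_all
qed

text \<open>The difference of the indicators is almost everywhere that of the slice for \<epsilon>
  v. An affine map takes the slab over the facet to this slice; its volume factor divided by
  \<epsilon> is the modulus of the normal component of v, and as \<epsilon> tends to 0 it converges
  to the projection onto the facet.\<close>

lemma column_difference_quotient:
  fixes a :: "'n::finite \<Rightarrow> real^'n"
  assumes D: "span_det a v \<noteq> 0" and u: "continuous_on UNIV u" "bounded (range u)"
    and \<epsilon>: "\<And>m. 0 < \<epsilon> m" "\<epsilon> \<longlonglongrightarrow> 0"
  shows "integrable lborel (\<lambda>x. u x * (indicator (column a v) x - indicator (column a v) (x + \<epsilon> m *\<^sub>R v)))"
    "(\<lambda>m. (\<integral>x. u x * (indicator (column a v) x - indicator (column a v) (x + \<epsilon> m *\<^sub>R v)) \<partial>lborel) / \<epsilon> m)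
       \<longlonglongrightarrow> \<bar>span_det a v\<bar> / norm (facet_normal a) * facet_integral a u"
proof -
  have fn: "facet_normal a \<noteq> 0" using D by (auto simp: span_det_inner)
  note p = facet_unit_props[OF fn] and sl = facet_slab[OF fn]
  let ?n = "facet_unit a" let ?\<alpha> = "?n \<bullet> a undefined"
  have um [measurable]: "u \<in> borel_measurable borel" by (intro borel_measurable_continuous_onI u)
  obtain M where M: "\<And>x. \<bar>u x\<bar> \<le> M" using u(2) by (auto simp: bounded_iff)
  have Dm: "span_det a (\<epsilon> m *\<^sub>R v) = \<epsilon> m * span_det a v" for m by (simp add: linear_cmul[OF linear_span_det])
  have D': "span_det a (\<epsilon> m *\<^sub>R v) \<noteq> 0" for m using D \<epsilon>(1)[of m] by (simp add: Dm)
  note sc = facet_slice[OF D', unfolded column_scale_direction[OF \<epsilon>(1)]]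
  have ae: "AE x in lborel. u x * (indicator (column a v) x - indicator (column a v) (x + \<epsilon> m *\<^sub>R v)) = indicator (facet_slice a (\<epsilon> m *\<^sub>R v)) x * u x" for m
  proof -
    have "AE x in lebesgue. x \<notin> convex hull (range (\<lambda>i. a i - \<epsilon> m *\<^sub>R v))"
      using negligible_hull_range[of "\<lambda>i. a i - \<epsilon> m *\<^sub>R v"] unfolding negligible_iff_null_sets by (rule AE_not_in)
    then have "AE x in lborel. x \<notin> convex hull (range (\<lambda>i. a i - \<epsilon> m *\<^sub>R v))"
      by (subst (asm) AE_completion_iff) auto
    then show ?thesis
    proof eventually_elim
      fix x assume n: "x \<notin> convex hull (range (\<lambda>i. a i - \<epsilon> m *\<^sub>R v))"
      have "column (\<lambda>i. a i - \<epsilon> m *\<^sub>R v) v \<subseteq> column a v"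
      proof
        fix y assume "y \<in> column (\<lambda>i. a i - \<epsilon> m *\<^sub>R v) v"
        then have "y + \<epsilon> m *\<^sub>R v \<in> column a v" by (simp add: column_translate)
        then obtain \<tau> where "0 \<le> \<tau>" "y + \<epsilon> m *\<^sub>R v + \<tau> *\<^sub>R v \<in> convex hull (range a)" by (auto simp: column_def)
        then show "y \<in> column a v" using \<epsilon>(1)[of m] unfolding column_def
          by (intro CollectI exI[of _ "\<epsilon> m + \<tau>"]) (simp add: scaleR_add_left add.assoc)
      qed
      then show "u x * (indicator (column a v) x - indicator (column a v) (x + \<epsilon> m *\<^sub>R v)) = indicator (facet_slice a (\<epsilon> m *\<^sub>R v)) x * u x"
        using n sc(1,2)[of m] by (auto simp: indicator_def column_translate)
    qed
  qed
  have cb [measurable]: "column a v \<in> sets borel" using closed_column by (rule borel_closed)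
  have cm [measurable]: "(\<lambda>x. indicat_real (column a v) (x + \<epsilon> m *\<^sub>R v)) \<in> borel_measurable borel" for m
    by (rule measurable_compose[of "\<lambda>x. x + \<epsilon> m *\<^sub>R v" borel borel]) (use cb in \<open>auto intro!: borel_measurable_continuous_onI continuous_intros\<close>)
  have fs: "integrable lborel (\<lambda>x. indicator (facet_slice a (\<epsilon> m *\<^sub>R v)) x * u x)" for m
  proof -
    have "emeasure lborel (facet_slice a (\<epsilon> m *\<^sub>R v)) < \<infinity>" using sc(4)[of m] by (rule emeasure_bounded_finite)
    then have "integrable lborel (\<lambda>x. indicator (facet_slice a (\<epsilon> m *\<^sub>R v)) x *\<^sub>R u x)"
      using sc(3)[of m] M by (intro integrableI_bounded_set_indicator[where B=M]) auto
    then show ?thesis by simp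
  qed
  show "integrable lborel (\<lambda>x. u x * (indicator (column a v) x - indicator (column a v) (x + \<epsilon> m *\<^sub>R v)))"
    using fs[of m] by (subst integrable_cong_AE[OF _ _ ae]) (use sc(3)[of m] in auto)
  have int: "(\<integral>x. u x * (indicator (column a v) x - indicator (column a v) (x + \<epsilon> m *\<^sub>R v)) \<partial>lborel) = (\<integral>x. indicator (facet_slice a (\<epsilon> m *\<^sub>R v)) x * u x \<partial>lborel)" for m
    using sc(3)[of m] by (intro integral_cong_AE ae) auto
  \<comment> \<open>\<open>b m + g m x\<close> projects x to the plane of the facet and then goes
    back along v by \<epsilon> times the height of x above that plane. The height parameter of the
    slab thus becomes the time parameter of the slice.\<close>
  define g where "g m x = x - (?n \<bullet> x) *\<^sub>R ?n - (\<epsilon> m * (?n \<bullet> x)) *\<^sub>R v" for m x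
  define b where "b m = ?\<alpha> *\<^sub>R ?n + (\<epsilon> m * ?\<alpha>) *\<^sub>R v" for m
  have nv: "?n \<bullet> v \<noteq> 0" using D p(3)[of v] by auto
  have lg: "linear (g m)" for m by (rule linearI) (simp_all add: g_def inner_add_right algebra_simps)
  have ig: "inj (g m)" for m
  proof (subst linear_injective_0[OF lg], intro allI impI)
    fix x assume x: "g m x = 0"
    have "?n \<bullet> g m x = - (\<epsilon> m * (?n \<bullet> x)) * (?n \<bullet> v)" by (simp add: g_def inner_diff_right p(2))
    then have "?n \<bullet> x = 0" using x nv \<epsilon>(1)[of m] by simp
    then show "x = 0" using x by (simp add: g_def)
  qed
  have gb: "b m + g m x = facet_proj a x - (\<epsilon> m * (?n \<bullet> x - ?\<alpha>)) *\<^sub>R v" for m x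
    by (simp add: g_def b_def facet_proj_def algebra_simps)
  have npr: "?n \<bullet> facet_proj a x = ?\<alpha>" for x by (simp add: facet_proj_def inner_diff_right p(2))
  have mem: "b m + g m x \<in> facet_slice a (\<epsilon> m *\<^sub>R v) \<longleftrightarrow> x \<in> facet_slab a" for m x
  proof
    assume "x \<in> facet_slab a"
    then show "b m + g m x \<in> facet_slice a (\<epsilon> m *\<^sub>R v)"
      unfolding facet_slice_def gb by (intro CollectI exI[of _ "?n \<bullet> x - ?\<alpha>"]) (auto simp: facet_slab_def slab_over_def facet_proj_def mult.commute)
  next
    assume "b m + g m x \<in> facet_slice a (\<epsilon> m *\<^sub>R v)"
    then obtain \<tau> where \<tau>: "0 \<le> \<tau>" "\<tau> \<le> 1" "b m + g m x + \<tau> *\<^sub>R \<epsilon> m *\<^sub>R v \<in> convex hull (range a)" by (auto simp: facet_slice_def)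
    have eq: "b m + g m x + \<tau> *\<^sub>R \<epsilon> m *\<^sub>R v = facet_proj a x + (\<epsilon> m * (\<tau> - (?n \<bullet> x - ?\<alpha>))) *\<^sub>R v"
      unfolding gb by (simp add: algebra_simps)
    have "?n \<bullet> (b m + g m x + \<tau> *\<^sub>R \<epsilon> m *\<^sub>R v) = ?\<alpha>" by (rule p(4)[OF \<tau>(3)])
    then have "\<tau> = ?n \<bullet> x - ?\<alpha>" unfolding eq using nv \<epsilon>(1)[of m] by (simp add: inner_add_right npr)
    then show "x \<in> facet_slab a" using \<tau>(1,2) \<tau>(3)[unfolded eq] by (auto simp: facet_slab_def slab_over_def facet_proj_def)
  qed
  let ?r = "real CARD('n) / fact CARD('n)"
  have r: "?r > 0" by simp
  have mT: "measure lborel (facet_slice a (\<epsilon> m *\<^sub>R v)) = ?r * (\<epsilon> m * \<bar>span_det a v\<bar>)" for m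
    using sc(5)[of m] \<epsilon>(1)[of m] by (simp add: Dm abs_mult)
  have mS: "measure lborel (facet_slab a) = ?r * norm (facet_normal a)" using sl(3) by simp
  have eq: "(\<integral>x. indicator (facet_slice a (\<epsilon> m *\<^sub>R v)) x * u x \<partial>lborel) / \<epsilon> m =
      \<bar>span_det a v\<bar> / norm (facet_normal a) * (\<integral>x. indicator (facet_slab a) x * u (b m + g m x) \<partial>lborel)" for m
  proof -
    have "0 < measure lborel (facet_slice a (\<epsilon> m *\<^sub>R v))" unfolding mT using r \<epsilon>(1)[of m] D by (intro mult_pos_pos) auto
    from integral_affine_image[OF lg ig sl(1) sc(3) mem this um]
    have "(\<integral>x. indicator (facet_slice a (\<epsilon> m *\<^sub>R v)) x * u x \<partial>lborel) * (?r * norm (facet_normal a)) =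
       (?r * (\<epsilon> m * \<bar>span_det a v\<bar>)) * (\<integral>x. indicator (facet_slab a) x * u (b m + g m x) \<partial>lborel)"
      unfolding mS mT .
    then have "?r * ((\<integral>x. indicator (facet_slice a (\<epsilon> m *\<^sub>R v)) x * u x \<partial>lborel) * norm (facet_normal a)) =
       ?r * (\<epsilon> m * \<bar>span_det a v\<bar> * (\<integral>x. indicator (facet_slab a) x * u (b m + g m x) \<partial>lborel))"
      by (simp only: mult_ac)
    then have "(\<integral>x. indicator (facet_slice a (\<epsilon> m *\<^sub>R v)) x * u x \<partial>lborel) * norm (facet_normal a) =
       \<epsilon> m * \<bar>span_det a v\<bar> * (\<integral>x. indicator (facet_slab a) x * u (b m + g m x) \<partial>lborel)"
      by (rule iffD1[OF mult_left_cancel[OF less_imp_neq[OF r, symmetric]]])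
    then show ?thesis using \<epsilon>(1)[of m] fn by (simp add: divide_simps)
  qed
  have lim: "(\<lambda>m. \<integral>x. indicator (facet_slab a) x * u (b m + g m x) \<partial>lborel) \<longlonglongrightarrow> facet_integral a u"
    unfolding facet_integral_def
  proof (rule integral_dominated_convergence[where w="\<lambda>x. indicator (facet_slab a) x * M"])
    have gm [measurable]: "(\<lambda>x. b m + g m x) \<in> borel_measurable borel" for m
      by (intro borel_measurable_continuous_onI continuous_intros linear_continuous_on linear_conv_bounded_linear[THEN iffD1] lg)
    have pm [measurable]: "facet_proj a \<in> borel_measurable borel" unfolding facet_proj_def[abs_def] by measurable
    show "(\<lambda>x. indicator (facet_slab a) x * u (facet_proj a x)) \<in> borel_measurable lborel" using sl(1) by simp
    show "(\<lambda>x. indicator (facet_slab a) x * u (b m + g m x)) \<in> borel_measurable lborel" for m using sl(1) by simp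
    show "integrable lborel (\<lambda>x. indicator (facet_slab a) x * M)"
      using emeasure_bounded_finite[OF sl(2)] sl(1) by (simp add: less_top)
    show "AE x in lborel. (\<lambda>m. indicator (facet_slab a) x * u (b m + g m x)) \<longlonglongrightarrow> indicator (facet_slab a) x * u (facet_proj a x)"
    proof (rule AE_I2)
      fix x
      have "(\<lambda>m. facet_proj a x - (\<epsilon> m * (?n \<bullet> x - ?\<alpha>)) *\<^sub>R v) \<longlonglongrightarrow> facet_proj a x - (0 * (?n \<bullet> x - ?\<alpha>)) *\<^sub>R v"
        by (intro tendsto_intros \<epsilon>(2))
      then have "(\<lambda>m. b m + g m x) \<longlonglongrightarrow> facet_proj a x" unfolding gb by simp
      then have "(\<lambda>m. u (b m + g m x)) \<longlonglongrightarrow> u (facet_proj a x)"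
        using u(1) by (intro isCont_tendsto_compose[of _ u]) (auto simp: continuous_on_eq_continuous_at)
      then show "(\<lambda>m. indicator (facet_slab a) x * u (b m + g m x)) \<longlonglongrightarrow> indicator (facet_slab a) x * u (facet_proj a x)"
        by (intro tendsto_intros)
    qed
    show "AE x in lborel. norm (indicator (facet_slab a) x * u (b m + g m x)) \<le> indicator (facet_slab a) x * M" for m
      using M by (intro AE_I2) (auto simp: indicator_def)
  qed
  show "(\<lambda>m. (\<integral>x. u x * (indicator (column a v) x - indicator (column a v) (x + \<epsilon> m *\<^sub>R v)) \<partial>lborel) / \<epsilon> m)
       \<longlonglongrightarrow> \<bar>span_det a v\<bar> / norm (facet_normal a) * facet_integral a u"
    unfolding int eq by (rule tendsto_mult_left[OF lim])
qed

text \<open>\<open>sided_indicator\<close> is applied at x and at the shifted point, which reduces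
  the claim to columns. Facets parallel to v carry the sign 0 in that formula, and \<open>h\<close>
  is set to 0 for them because a slice has no volume formula there.\<close>

theorem sided_difference_quotient:
  fixes A :: "'s \<Rightarrow> 'n::finite \<Rightarrow> real^'n"
  assumes sd: "sided J A \<sigma> I" and v: "v \<noteq> 0" and u: "continuous_on UNIV u" "bounded (range u)"
    and \<epsilon>: "\<And>m. 0 < \<epsilon> m" "\<epsilon> \<longlonglongrightarrow> 0" and I: "I \<in> sets borel"
  shows "(\<lambda>m. (\<integral>x. u x * (indicator I x - indicator I (x + \<epsilon> m *\<^sub>R v)) \<partial>lborel) / \<epsilon> m)
       \<longlonglongrightarrow> (\<Sum>j\<in>J. \<sigma> j * span_det (A j) v / norm (facet_normal (A j)) * facet_integral (A j) u)"
proof -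
  let ?D = "\<lambda>j. span_det (A j) v"
  let ?c = "\<lambda>j x. indicat_real (column (A j) v) x"
  have J: "finite J" using sd by (simp add: sided_def)
  have [measurable]: "u \<in> borel_measurable borel" by (intro borel_measurable_continuous_onI u)
  have [measurable]: "I \<in> sets borel" by fact
  have [measurable]: "column (A j) v \<in> sets borel" for j using closed_column by (rule borel_closed)
  have tm [measurable]: "(\<lambda>x. indicat_real S (x + w)) \<in> borel_measurable borel" if [measurable]: "S \<in> sets borel" for S :: "(real^'n) set" and w
    by (rule measurable_compose[of "\<lambda>x. x + w" borel borel]) (use that in \<open>auto intro!: borel_measurable_continuous_onI continuous_intros\<close>)
  have ae0: "AE x in lborel. indicat_real I x = (\<Sum>j\<in>J. \<sigma> j * sgn (?D j) * ?c j x)"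
    using sided_indicator[OF sd v] by (subst (asm) AE_completion_iff) auto
  have ae1: "AE x in lborel. indicat_real I (x + w) = (\<Sum>j\<in>J. \<sigma> j * sgn (?D j) * ?c j (x + w))" for w
  proof -
    have "AE x in distr lborel borel ((+) w). indicat_real I x = (\<Sum>j\<in>J. \<sigma> j * sgn (?D j) * ?c j x)"
      unfolding lborel_distr_translation by (rule ae0)
    then show ?thesis by (subst (asm) AE_distr_iff) (auto simp: add.commute)
  qed
  define h where "h m j x = (if ?D j = 0 then 0 else u x * (?c j x - ?c j (x + \<epsilon> m *\<^sub>R v)))" for m j x
  have hm [measurable]: "h m j \<in> borel_measurable borel" for m j unfolding h_def[abs_def] by measurable
  have hi: "integrable lborel (h m j)" for m j
    using column_difference_quotient(1)[of "A j" v u \<epsilon> m, OF _ u \<epsilon>] by (cases "?D j = 0") (simp_all add: h_def[abs_def])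
  have "(\<integral>x. u x * (indicator I x - indicator I (x + \<epsilon> m *\<^sub>R v)) \<partial>lborel) = (\<Sum>j\<in>J. \<sigma> j * sgn (?D j) * (\<integral>x. h m j x \<partial>lborel))" for m
  proof -
    have "(\<integral>x. u x * (indicator I x - indicator I (x + \<epsilon> m *\<^sub>R v)) \<partial>lborel) = (\<integral>x. (\<Sum>j\<in>J. \<sigma> j * sgn (?D j) * h m j x) \<partial>lborel)"
    proof (rule integral_cong_AE)
      show "AE x in lborel. u x * (indicator I x - indicator I (x + \<epsilon> m *\<^sub>R v)) = (\<Sum>j\<in>J. \<sigma> j * sgn (?D j) * h m j x)"
        using ae0 ae1[of "\<epsilon> m *\<^sub>R v"]
      proof eventually_elim
        fix x assume *: "indicat_real I x = (\<Sum>j\<in>J. \<sigma> j * sgn (?D j) * ?c j x)"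
          "indicat_real I (x + \<epsilon> m *\<^sub>R v) = (\<Sum>j\<in>J. \<sigma> j * sgn (?D j) * ?c j (x + \<epsilon> m *\<^sub>R v))"
        show "u x * (indicator I x - indicator I (x + \<epsilon> m *\<^sub>R v)) = (\<Sum>j\<in>J. \<sigma> j * sgn (?D j) * h m j x)"
          unfolding * sum_subtractf[symmetric] sum_distrib_left
          by (intro sum.cong) (auto simp: h_def algebra_simps)
      qed
    qed measurable
    also have "\<dots> = (\<Sum>j\<in>J. \<integral>x. \<sigma> j * sgn (?D j) * h m j x \<partial>lborel)"
      using hi by (intro Bochner_Integration.integral_sum) auto
    finally show ?thesis by simp
  qed
  moreover have "(\<lambda>m. (\<Sum>j\<in>J. \<sigma> j * sgn (?D j) * ((\<integral>x. h m j x \<partial>lborel) / \<epsilon> m))) \<longlonglongrightarrow>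
      (\<Sum>j\<in>J. \<sigma> j * ?D j / norm (facet_normal (A j)) * facet_integral (A j) u)"
  proof (rule tendsto_sum)
    fix j
    show "(\<lambda>m. \<sigma> j * sgn (?D j) * ((\<integral>x. h m j x \<partial>lborel) / \<epsilon> m)) \<longlonglongrightarrow> \<sigma> j * ?D j / norm (facet_normal (A j)) * facet_integral (A j) u"
    proof (cases "?D j = 0")
      case False
      have "(\<lambda>m. \<sigma> j * sgn (?D j) * ((\<integral>x. h m j x \<partial>lborel) / \<epsilon> m)) \<longlonglongrightarrow> \<sigma> j * sgn (?D j) * (\<bar>?D j\<bar> / norm (facet_normal (A j)) * facet_integral (A j) u)"
        using column_difference_quotient(2)[of "A j" v u \<epsilon>, OF False u \<epsilon>] False
        by (intro tendsto_mult_left) (simp add: h_def)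
      also have "\<sigma> j * sgn (?D j) * (\<bar>?D j\<bar> / norm (facet_normal (A j)) * facet_integral (A j) u) =
          \<sigma> j * (sgn (?D j) * \<bar>?D j\<bar>) / norm (facet_normal (A j)) * facet_integral (A j) u" by simp
      also have "sgn (?D j) * \<bar>?D j\<bar> = ?D j" by (rule sgn_mult_abs)
      finally show ?thesis .
    qed simp
  qed
  ultimately show ?thesis by (simp add: sum_divide_distrib)
qed

section \<open>Moving difference quotients from indicators to functions\<close>

lemma lborel_integral_translation:
  fixes f :: "'a::euclidean_space \<Rightarrow> real"
  assumes "f \<in> borel_measurable borel"
  shows "(\<integral>x. f (w + x) \<partial>lborel) = (\<integral>x. f x \<partial>lborel)"
  using assms by (subst (2) lborel_distr_translation[of w, symmetric]) (simp add: integral_distr)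

text \<open>Moves a difference quotient from the indicator function to the Sobolev function without
  differentiating the indicator.\<close>

definition segment_mean :: "('a::euclidean_space) set \<Rightarrow> 'a \<Rightarrow> real \<Rightarrow> 'a \<Rightarrow> real" where
  "segment_mean I e \<epsilon> x = (\<integral>\<theta>. indicator {0..1} \<theta> * indicator I (x + (\<theta> * \<epsilon>) *\<^sub>R e) \<partial>lborel)"

context
  fixes I :: "'a::euclidean_space set" and e :: 'a and \<epsilon> :: real
  assumes I [measurable]: "I \<in> sets borel"
begin

lemma measurable_segment_indicator: "(\<lambda>p. indicat_real {0..1} (snd p) * indicat_real I (fst p + (snd p * \<epsilon>) *\<^sub>R e)) \<in> borel_measurable (lborel \<Otimes>\<^sub>M lborel)"
  by measurable

lemma measurable_segment_mean [measurable]: "segment_mean I e \<epsilon> \<in> borel_measurable borel"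
proof -
  have "(\<lambda>x. \<integral>\<theta>. (\<lambda>p. indicat_real {0..1} (snd p) * indicat_real I (fst p + (snd p * \<epsilon>) *\<^sub>R e)) (x, \<theta>) \<partial>lborel) \<in> borel_measurable lborel"
    using measurable_segment_indicator by (intro lborel.borel_measurable_lebesgue_integral) simp
  then show ?thesis by (simp add: segment_mean_def[abs_def])
qed

lemma integrable_segment_mean: "integrable lborel (\<lambda>\<theta>. indicat_real {0..1} \<theta> * indicat_real I (x + (\<theta> * \<epsilon>) *\<^sub>R e))"
proof (rule Bochner_Integration.integrable_bound[of lborel "indicat_real {0..1}"])
  show "integrable lborel (indicat_real {0..1::real})" by simp
  show "(\<lambda>\<theta>. indicat_real {0..1} \<theta> * indicat_real I (x + (\<theta> * \<epsilon>) *\<^sub>R e)) \<in> borel_measurable lborel" by measurable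
qed (auto simp: indicator_def)

lemma segment_mean_bounds: "0 \<le> segment_mean I e \<epsilon> x" "segment_mean I e \<epsilon> x \<le> 1"
proof -
  show "0 \<le> segment_mean I e \<epsilon> x" unfolding segment_mean_def by (intro integral_nonneg_AE) simp
  have "segment_mean I e \<epsilon> x \<le> (\<integral>\<theta>. indicat_real {0..1::real} \<theta> \<partial>lborel)"
    unfolding segment_mean_def
  proof (rule integral_mono[OF integrable_segment_mean])
    show "integrable lborel (indicat_real {0..1::real})" by simp
  qed (auto simp: indicator_def)
  then show "segment_mean I e \<epsilon> x \<le> 1" by simp
qed

lemma segment_mean_const:
  assumes "\<And>\<theta>. 0 \<le> \<theta> \<Longrightarrow> \<theta> \<le> 1 \<Longrightarrow> indicat_real I (x + (\<theta> * \<epsilon>) *\<^sub>R e) = c"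
  shows "segment_mean I e \<epsilon> x = c"
proof -
  have "indicat_real {0..1} \<theta> * indicat_real I (x + (\<theta> * \<epsilon>) *\<^sub>R e) = indicat_real {0..1} \<theta> * c" for \<theta> :: real
    using assms[of \<theta>] by (cases "\<theta> \<in> {0..1}") auto
  then have "segment_mean I e \<epsilon> x = (\<integral>\<theta>. indicat_real {0..1::real} \<theta> * c \<partial>lborel)"
    unfolding segment_mean_def by (simp only:)
  then show ?thesis by simp
qed

text \<open>A translation moves the shift from the indicator to \<phi>, whose difference is the
  integral of \<psi> along a segment. Fubini and a translation back for each \<theta> gather the
  shifted indicators into the segment mean.\<close>

lemma integral_difference_segment_mean:
  fixes \<phi> \<psi> :: "'a \<Rightarrow> real"
  assumes d: "\<And>x. (\<phi> has_derivative D x) (at x)" "\<And>x. D x e = \<psi> x" and c: "continuous_on UNIV \<psi>"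
    and R: "\<And>x. R < norm x \<Longrightarrow> \<phi> x = 0 \<and> \<psi> x = 0" and \<epsilon>: "0 < \<epsilon>"
  shows "(\<integral>x. \<phi> x * (indicator I x - indicator I (x + \<epsilon> *\<^sub>R e)) \<partial>lborel) = \<epsilon> * (\<integral>x. segment_mean I e \<epsilon> x * \<psi> x \<partial>lborel)"
proof -
  have cp: "continuous_on UNIV \<phi>" using d(1) has_derivative_continuous by (blast intro: continuous_at_imp_continuous_on)
  have [measurable]: "\<phi> \<in> borel_measurable borel" "\<psi> \<in> borel_measurable borel" using cp c by (auto intro: borel_measurable_continuous_onI)
  obtain M where M: "\<And>x. \<bar>\<phi> x\<bar> \<le> M \<and> \<bar>\<psi> x\<bar> \<le> M"
  proof -
    have "bounded (\<phi> ` cball 0 R)" "bounded (\<psi> ` cball 0 R)"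
      by (rule compact_imp_bounded, rule compact_continuous_image, rule continuous_on_subset[OF cp], simp, simp)
         (rule compact_imp_bounded, rule compact_continuous_image, rule continuous_on_subset[OF c], simp, simp)
    then obtain M1 M2 where "\<forall>y\<in>\<phi> ` cball 0 R. norm y \<le> M1" "\<forall>y\<in>\<psi> ` cball 0 R. norm y \<le> M2"
      unfolding bounded_iff by blast
    then have *: "\<And>x. norm x \<le> R \<Longrightarrow> \<bar>\<phi> x\<bar> \<le> M1" "\<And>x. norm x \<le> R \<Longrightarrow> \<bar>\<psi> x\<bar> \<le> M2"
      by auto
    have "\<bar>\<phi> x\<bar> \<le> max 0 (max M1 M2) \<and> \<bar>\<psi> x\<bar> \<le> max 0 (max M1 M2)" for x
      using *[of x] R[of x] by (cases "norm x \<le> R") (auto simp: le_max_iff_disj)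
    then show ?thesis by (rule that)
  qed
  have M0: "0 \<le> M" using M[of 0] by (meson abs_ge_zero order_trans)
  have cf: "emeasure lborel (cball (0::'a) r) < top" for r
    using emeasure_bounded_finite[OF bounded_cball, of "0::'a" r] by simp
  have int_cpt: "integrable lborel f" if "f \<in> borel_measurable borel" "\<And>x. \<bar>f x\<bar> \<le> B" "\<And>x. r < norm x \<Longrightarrow> f x = 0" for f :: "'a \<Rightarrow> real" and B r
  proof (rule integrableI_bounded_set[of "cball 0 r" _ _ B])
    show "cball 0 r \<in> sets lborel" by simp
    show "f \<in> borel_measurable lborel" using that(1) by simp
    show "emeasure lborel (cball (0::'a) r) < \<infinity>" by (rule emeasure_bounded_finite[OF bounded_cball])
    show "AE x in lborel. x \<in> cball 0 r \<longrightarrow> norm (f x) \<le> B" using that(2) by (intro AE_I2) simp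
    show "AE x in lborel. x \<notin> cball 0 r \<longrightarrow> f x = 0" using that(3) by (intro AE_I2) simp
  qed
  have tm [measurable]: "(\<lambda>x. f (x + w)) \<in> borel_measurable borel" if [measurable]: "f \<in> borel_measurable borel" for f :: "'a \<Rightarrow> real" and w
    by measurable
  have i1: "integrable lborel (\<lambda>x. \<phi> x * indicat_real I x)"
    by (rule int_cpt[of _ M R]) (use M M0 R in \<open>auto simp: indicator_def\<close>)
  have i2: "integrable lborel (\<lambda>x. \<phi> x * indicat_real I (x + \<epsilon> *\<^sub>R e))"
    by (rule int_cpt[of _ M R]) (use M M0 R in \<open>auto simp: indicator_def\<close>)
  have i3: "integrable lborel (\<lambda>x. \<phi> (x - \<epsilon> *\<^sub>R e) * indicat_real I x)"
  proof (rule int_cpt[of _ M "R + norm (\<epsilon> *\<^sub>R e)"])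
    fix x :: 'a assume "R + norm (\<epsilon> *\<^sub>R e) < norm x"
    then have "R < norm (x - \<epsilon> *\<^sub>R e)" using norm_triangle_ineq2[of x "\<epsilon> *\<^sub>R e"] by linarith
    then show "\<phi> (x - \<epsilon> *\<^sub>R e) * indicat_real I x = 0" using R by simp
  qed (use M M0 in \<open>auto simp: indicator_def\<close>)
  have "(\<integral>x. \<phi> x * (indicator I x - indicator I (x + \<epsilon> *\<^sub>R e)) \<partial>lborel) =
      (\<integral>x. \<phi> x * indicat_real I x \<partial>lborel) - (\<integral>x. \<phi> x * indicat_real I (x + \<epsilon> *\<^sub>R e) \<partial>lborel)"
    using i1 i2 by (simp add: right_diff_distrib)
  also have "(\<integral>x. \<phi> x * indicat_real I (x + \<epsilon> *\<^sub>R e) \<partial>lborel) = (\<integral>x. \<phi> (x - \<epsilon> *\<^sub>R e) * indicat_real I x \<partial>lborel)"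
    using lborel_integral_translation[of "\<lambda>x. \<phi> (x - \<epsilon> *\<^sub>R e) * indicat_real I x" "\<epsilon> *\<^sub>R e"] by (simp add: add.commute)
  also have "(\<integral>x. \<phi> x * indicat_real I x \<partial>lborel) - (\<integral>x. \<phi> (x - \<epsilon> *\<^sub>R e) * indicat_real I x \<partial>lborel) =
      (\<integral>x. (\<phi> x - \<phi> (x - \<epsilon> *\<^sub>R e)) * indicat_real I x \<partial>lborel)"
    using i1 i3 by (simp add: left_diff_distrib)
  also have "\<dots> = (\<integral>x. (\<integral>\<theta>. \<epsilon> * (indicat_real {0..1} \<theta> * indicat_real I x * \<psi> (x - (\<theta> * \<epsilon>) *\<^sub>R e)) \<partial>lborel) \<partial>lborel)"
  proof (rule Bochner_Integration.integral_cong[OF refl])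
    fix x
    have der: "((\<lambda>\<theta>. - \<phi> (x - (\<theta> * \<epsilon>) *\<^sub>R e)) has_vector_derivative \<epsilon> * \<psi> (x - (\<theta> * \<epsilon>) *\<^sub>R e)) (at \<theta> within {0..1})" for \<theta>
    proof -
      have "((\<lambda>\<theta>. x - (\<theta> * \<epsilon>) *\<^sub>R e) has_derivative (\<lambda>h. - (h * \<epsilon>) *\<^sub>R e)) (at \<theta> within {0..1})"
        by (auto intro!: derivative_eq_intros)
      from has_derivative_compose[OF this d(1)]
      have "((\<lambda>\<theta>. \<phi> (x - (\<theta> * \<epsilon>) *\<^sub>R e)) has_derivative (\<lambda>h. D (x - (\<theta> * \<epsilon>) *\<^sub>R e) (- (h * \<epsilon>) *\<^sub>R e))) (at \<theta> within {0..1})" .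
      moreover have "D y (- (h * \<epsilon>) *\<^sub>R e) = - (h * \<epsilon> * \<psi> y)" for h y
        using linear_cmul[OF has_derivative_linear[OF d(1)], of y "- (h * \<epsilon>)" e] by (simp add: d(2))
      ultimately have "((\<lambda>\<theta>. \<phi> (x - (\<theta> * \<epsilon>) *\<^sub>R e)) has_derivative (\<lambda>h. - (h * \<epsilon> * \<psi> (x - (\<theta> * \<epsilon>) *\<^sub>R e)))) (at \<theta> within {0..1})"
        by simp
      from has_derivative_minus[OF this] show ?thesis by (simp add: has_vector_derivative_def mult_ac)
    qed
    have "(\<integral>\<theta>. indicator {0..1} \<theta> *\<^sub>R (\<epsilon> * \<psi> (x - (\<theta> * \<epsilon>) *\<^sub>R e)) \<partial>lborel) = - \<phi> (x - (1 * \<epsilon>) *\<^sub>R e) - (- \<phi> (x - (0 * \<epsilon>) *\<^sub>R e))"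
      by (rule integral_FTC_atLeastAtMost) (auto intro!: der continuous_intros continuous_on_compose2[OF c])
    then have "\<phi> x - \<phi> (x - \<epsilon> *\<^sub>R e) = (\<integral>\<theta>. indicator {0..1} \<theta> *\<^sub>R (\<epsilon> * \<psi> (x - (\<theta> * \<epsilon>) *\<^sub>R e)) \<partial>lborel)" by simp
    then have "(\<phi> x - \<phi> (x - \<epsilon> *\<^sub>R e)) * indicat_real I x = (\<integral>\<theta>. indicator {0..1} \<theta> *\<^sub>R (\<epsilon> * \<psi> (x - (\<theta> * \<epsilon>) *\<^sub>R e)) * indicat_real I x \<partial>lborel)"
      by simp
    also have "\<dots> = (\<integral>\<theta>. \<epsilon> * (indicat_real {0..1} \<theta> * indicat_real I x * \<psi> (x - (\<theta> * \<epsilon>) *\<^sub>R e)) \<partial>lborel)"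
      by (intro Bochner_Integration.integral_cong) (auto simp: mult_ac)
    finally show "(\<phi> x - \<phi> (x - \<epsilon> *\<^sub>R e)) * indicat_real I x =
        (\<integral>\<theta>. \<epsilon> * (indicat_real {0..1} \<theta> * indicat_real I x * \<psi> (x - (\<theta> * \<epsilon>) *\<^sub>R e)) \<partial>lborel)" .
  qed
  also have "\<dots> = \<epsilon> * (\<integral>x. (\<integral>\<theta>. indicat_real {0..1} \<theta> * indicat_real I x * \<psi> (x - (\<theta> * \<epsilon>) *\<^sub>R e) \<partial>lborel) \<partial>lborel)"
    by simp
  also have "(\<integral>x. (\<integral>\<theta>. indicat_real {0..1} \<theta> * indicat_real I x * \<psi> (x - (\<theta> * \<epsilon>) *\<^sub>R e) \<partial>lborel) \<partial>lborel) =
      (\<integral>\<theta>. (\<integral>x. indicat_real {0..1} \<theta> * indicat_real I x * \<psi> (x - (\<theta> * \<epsilon>) *\<^sub>R e) \<partial>lborel) \<partial>lborel)"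
  proof (rule lborel_pair.Fubini_integral[symmetric])
    let ?S = "cball (0::'a) (R + norm (\<epsilon> *\<^sub>R e)) \<times> {0..1::real}"
    show "integrable (lborel \<Otimes>\<^sub>M lborel) (\<lambda>(x, \<theta>). indicat_real {0..1} \<theta> * indicat_real I x * \<psi> (x - (\<theta> * \<epsilon>) *\<^sub>R e))"
    proof (rule integrableI_bounded_set[of ?S _ _ M])
      show "?S \<in> sets (lborel \<Otimes>\<^sub>M lborel)" by (intro pair_measureI) auto
      show "(\<lambda>(x, \<theta>). indicat_real {0..1} \<theta> * indicat_real I x * \<psi> (x - (\<theta> * \<epsilon>) *\<^sub>R e)) \<in> borel_measurable (lborel \<Otimes>\<^sub>M lborel)"
        by measurable
      show "emeasure (lborel \<Otimes>\<^sub>M lborel) ?S < \<infinity>"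
        by (subst lborel.emeasure_pair_measure_Times) (auto simp: cf ennreal_mult_less_top)
      show "AE p in lborel \<Otimes>\<^sub>M lborel. p \<in> ?S \<longrightarrow> norm (case p of (x, \<theta>) \<Rightarrow> indicat_real {0..1} \<theta> * indicat_real I x * \<psi> (x - (\<theta> * \<epsilon>) *\<^sub>R e)) \<le> M"
        using M M0 by (intro AE_I2) (auto simp: indicator_def)
      show "AE p in lborel \<Otimes>\<^sub>M lborel. p \<notin> ?S \<longrightarrow> (case p of (x, \<theta>) \<Rightarrow> indicat_real {0..1} \<theta> * indicat_real I x * \<psi> (x - (\<theta> * \<epsilon>) *\<^sub>R e)) = 0"
      proof (intro AE_I2 impI)
        fix p :: "'a \<times> real" assume p: "p \<notin> ?S"
        obtain x \<theta> where p': "p = (x, \<theta>)" by (cases p)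
        have "\<psi> (x - (\<theta> * \<epsilon>) *\<^sub>R e) = 0" if "0 \<le> \<theta>" "\<theta> \<le> 1"
        proof -
          have "norm ((\<theta> * \<epsilon>) *\<^sub>R e) \<le> norm (\<epsilon> *\<^sub>R e)" using that \<epsilon> by (simp add: mult_left_le_one_le mult.assoc)
          moreover have "R + norm (\<epsilon> *\<^sub>R e) < norm x" using p that p' by simp
          ultimately have "R < norm (x - (\<theta> * \<epsilon>) *\<^sub>R e)" using norm_triangle_ineq2[of x "(\<theta> * \<epsilon>) *\<^sub>R e"] by linarith
          then show ?thesis using R by blast
        qed
        then show "(case p of (x, \<theta>) \<Rightarrow> indicat_real {0..1} \<theta> * indicat_real I x * \<psi> (x - (\<theta> * \<epsilon>) *\<^sub>R e)) = 0"
          by (auto simp: p' indicator_def)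
      qed
    qed
  qed
  also have "\<dots> = (\<integral>\<theta>. (\<integral>x. indicat_real {0..1} \<theta> * indicat_real I (x + (\<theta> * \<epsilon>) *\<^sub>R e) * \<psi> x \<partial>lborel) \<partial>lborel)"
  proof (rule Bochner_Integration.integral_cong[OF refl])
    fix \<theta> :: real
    show "(\<integral>x. indicat_real {0..1} \<theta> * indicat_real I x * \<psi> (x - (\<theta> * \<epsilon>) *\<^sub>R e) \<partial>lborel) =
        (\<integral>x. indicat_real {0..1} \<theta> * indicat_real I (x + (\<theta> * \<epsilon>) *\<^sub>R e) * \<psi> x \<partial>lborel)"
      using lborel_integral_translation[of "\<lambda>x. indicat_real {0..1} \<theta> * indicat_real I x * \<psi> (x - (\<theta> * \<epsilon>) *\<^sub>R e)" "(\<theta> * \<epsilon>) *\<^sub>R e"]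
      by (simp add: add.commute)
  qed
  also have "\<dots> = (\<integral>x. (\<integral>\<theta>. indicat_real {0..1} \<theta> * indicat_real I (x + (\<theta> * \<epsilon>) *\<^sub>R e) * \<psi> x \<partial>lborel) \<partial>lborel)"
  proof (rule lborel_pair.Fubini_integral)
    let ?S = "cball (0::'a) R \<times> {0..1::real}"
    show "integrable (lborel \<Otimes>\<^sub>M lborel) (\<lambda>(x, \<theta>). indicat_real {0..1} \<theta> * indicat_real I (x + (\<theta> * \<epsilon>) *\<^sub>R e) * \<psi> x)"
    proof (rule integrableI_bounded_set[of ?S _ _ M])
      show "?S \<in> sets (lborel \<Otimes>\<^sub>M lborel)" by (intro pair_measureI) auto
      show "(\<lambda>(x, \<theta>). indicat_real {0..1} \<theta> * indicat_real I (x + (\<theta> * \<epsilon>) *\<^sub>R e) * \<psi> x) \<in> borel_measurable (lborel \<Otimes>\<^sub>M lborel)"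
        by measurable
      show "emeasure (lborel \<Otimes>\<^sub>M lborel) ?S < \<infinity>"
        by (subst lborel.emeasure_pair_measure_Times) (auto simp: cf ennreal_mult_less_top)
      show "AE p in lborel \<Otimes>\<^sub>M lborel. p \<in> ?S \<longrightarrow> norm (case p of (x, \<theta>) \<Rightarrow> indicat_real {0..1} \<theta> * indicat_real I (x + (\<theta> * \<epsilon>) *\<^sub>R e) * \<psi> x) \<le> M"
        using M M0 by (intro AE_I2) (auto simp: indicator_def)
      show "AE p in lborel \<Otimes>\<^sub>M lborel. p \<notin> ?S \<longrightarrow> (case p of (x, \<theta>) \<Rightarrow> indicat_real {0..1} \<theta> * indicat_real I (x + (\<theta> * \<epsilon>) *\<^sub>R e) * \<psi> x) = 0"
      proof -
        have "norm x \<le> R" if "\<psi> x \<noteq> 0" for x using R[of x] that by force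
        then show ?thesis by (intro AE_I2) (auto simp: indicator_def)
      qed
    qed
  qed
  also have "\<dots> = (\<integral>x. segment_mean I e \<epsilon> x * \<psi> x \<partial>lborel)"
    by (simp add: segment_mean_def)
  finally show ?thesis .
qed

end

text \<open>Off the frontier the indicator is constant near x, and short segments stay in that
  neighbourhood.\<close>

lemma segment_mean_tendsto:
  assumes I: "I \<in> sets borel" and x: "x \<notin> frontier I" and \<epsilon>: "\<And>m. 0 < \<epsilon> m" "\<epsilon> \<longlonglongrightarrow> 0"
  shows "(\<lambda>m. segment_mean I e (\<epsilon> m) x) \<longlonglongrightarrow> indicat_real I x"
proof -
  obtain r where r: "0 < r" "\<And>y. y \<in> ball x r \<Longrightarrow> indicat_real I y = indicat_real I x"
  proof (cases "x \<in> I")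
    case True
    then have "x \<in> interior I" using x closure_subset by (auto simp: frontier_def)
    then obtain r where "0 < r" "ball x r \<subseteq> I" by (auto simp: mem_interior)
    then show ?thesis using True by (intro that[of r]) (auto simp: indicator_def subset_eq)
  next
    case False
    then have "x \<in> - closure I" using x interior_subset by (auto simp: frontier_def)
    then obtain r where "0 < r" "ball x r \<subseteq> - closure I" using open_contains_ball[of "- closure I"] by blast
    moreover from this have "ball x r \<inter> I = {}" using closure_subset by blast
    ultimately show ?thesis using False by (intro that[of r]) (auto simp: indicator_def)
  qed
  have "(\<lambda>m. \<epsilon> m * norm e) \<longlonglongrightarrow> 0 * norm e" by (intro tendsto_intros \<epsilon>)
  then have "\<forall>\<^sub>F m in sequentially. \<epsilon> m * norm e < r" using r(1) by (auto dest: order_tendstoD)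
  then have "\<forall>\<^sub>F m in sequentially. segment_mean I e (\<epsilon> m) x = indicat_real I x"
  proof eventually_elim
    fix m assume m: "\<epsilon> m * norm e < r"
    show "segment_mean I e (\<epsilon> m) x = indicat_real I x"
    proof (rule segment_mean_const[OF I])
      fix \<theta> :: real assume \<theta>: "0 \<le> \<theta>" "\<theta> \<le> 1"
      have "norm ((\<theta> * \<epsilon> m) *\<^sub>R e) = \<theta> * (\<epsilon> m * norm e)" using \<theta> \<epsilon>(1)[of m] by (simp add: abs_mult)
      also have "\<dots> \<le> 1 * (\<epsilon> m * norm e)" using \<theta> \<epsilon>(1)[of m] by (intro mult_right_mono) auto
      also have "\<dots> < r" using m by simp
      finally have "x + (\<theta> * \<epsilon> m) *\<^sub>R e \<in> ball x r" by (simp add: dist_norm)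
      then show "indicat_real I (x + (\<theta> * \<epsilon> m) *\<^sub>R e) = indicat_real I x" by (rule r(2))
    qed
  qed
  then show ?thesis by (rule tendsto_eventually)
qed

section \<open>From test functions to Sobolev functions\<close>

lemma (in finite_measure) L1_of_L2:
  fixes f :: "nat \<Rightarrow> 'a \<Rightarrow> real"
  assumes m: "\<And>m. f m \<in> borel_measurable M" and i: "\<And>m. integrable M (\<lambda>x. (f m x)\<^sup>2)"
    and l: "(\<lambda>m. \<integral>x. (f m x)\<^sup>2 \<partial>M) \<longlonglongrightarrow> 0"
  shows "integrable M (f m)" "(\<lambda>m. \<integral>x. \<bar>f m x\<bar> \<partial>M) \<longlonglongrightarrow> 0"
proof -
  \<comment> \<open>Values up to s are bounded by s, larger ones by a^2 / s. The first part costs s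
    times the total measure, the second is small for small L2 norm; s is fixed below so that each
    stays within r / 2.\<close>
  have le: "\<bar>a\<bar> \<le> s + a\<^sup>2 / s" if "0 < s" for a s :: real
  proof (cases "\<bar>a\<bar> \<le> s")
    case True
    have "0 \<le> a\<^sup>2 / s" using that by simp
    with True show ?thesis by linarith
  next
    case False
    then have "\<bar>a\<bar> * s \<le> \<bar>a\<bar> * \<bar>a\<bar>" using that by (intro mult_left_mono) auto
    then have "\<bar>a\<bar> \<le> a\<^sup>2 / s" using that by (simp add: pos_le_divide_eq power2_eq_square)
    then show ?thesis using that by simp
  qed
  have ii: "integrable M (f m)" for m
  proof (rule Bochner_Integration.integrable_bound[of M "\<lambda>x. 1 + (f m x)\<^sup>2"])
    show "integrable M (\<lambda>x. 1 + (f m x)\<^sup>2)" using i by (intro Bochner_Integration.integrable_add) auto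
    show "AE x in M. norm (f m x) \<le> norm (1 + (f m x)\<^sup>2)" using le[of 1 "f m x" for x] by (intro AE_I2) (simp add: abs_of_nonneg)
  qed (rule m)
  then show "integrable M (f m)" .
  show "(\<lambda>m. \<integral>x. \<bar>f m x\<bar> \<partial>M) \<longlonglongrightarrow> 0"
  proof (rule LIMSEQ_I)
    fix r :: real assume r: "0 < r"
    define V where "V = measure M (space M)"
    define s where "s = r / (2 * (V + 1))"
    have V: "0 \<le> V" by (simp add: V_def)
    have s: "0 < s" using r V by (simp add: s_def)
    have "0 < s * (r / 2)" using s r by simp
    then obtain N where N: "\<And>m. m \<ge> N \<Longrightarrow> (\<integral>x. (f m x)\<^sup>2 \<partial>M) < s * (r / 2)"
      using LIMSEQ_D[OF l, of "s * (r / 2)"] by (auto simp: abs_less_iff)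
    show "\<exists>N. \<forall>m\<ge>N. norm ((\<integral>x. \<bar>f m x\<bar> \<partial>M) - 0) < r"
    proof (intro exI[of _ N] allI impI)
      fix m assume "N \<le> m"
      have "(\<integral>x. \<bar>f m x\<bar> \<partial>M) \<le> (\<integral>x. s + (f m x)\<^sup>2 / s \<partial>M)"
        using ii i le[OF s] by (intro integral_mono Bochner_Integration.integrable_add) auto
      also have "\<dots> = s * V + (\<integral>x. (f m x)\<^sup>2 \<partial>M) / s" using i by (simp add: V_def)
      also have "(\<integral>x. (f m x)\<^sup>2 \<partial>M) / s < r / 2" using N[OF \<open>N \<le> m\<close>] s by (simp add: pos_divide_less_eq mult.commute)
      also have "s * V \<le> r / 2"
      proof -
        have "s * V \<le> s * (V + 1)" using s by (intro mult_left_mono) auto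
        also have "\<dots> = r / 2" using V by (simp add: s_def divide_simps)
        finally show ?thesis .
      qed
      finally have "(\<integral>x. \<bar>f m x\<bar> \<partial>M) < r" by simp
      moreover have "0 \<le> (\<integral>x. \<bar>f m x\<bar> \<partial>M)" by (intro integral_nonneg_AE) simp
      ultimately show "norm ((\<integral>x. \<bar>f m x\<bar> \<partial>M) - 0) < r" by simp
    qed
  qed
qed

lemma tendsto_integral_bounded_weight:
  fixes f :: "nat \<Rightarrow> 'a \<Rightarrow> real"
  assumes i: "\<And>m. integrable M (f m)" "integrable M g" and l: "(\<lambda>m. \<integral>x. \<bar>f m x - g x\<bar> \<partial>M) \<longlonglongrightarrow> 0"
    and h: "h \<in> borel_measurable M" "\<And>x. \<bar>h x\<bar> \<le> 1"
  shows "(\<lambda>m. \<integral>x. f m x * h x \<partial>M) \<longlonglongrightarrow> (\<integral>x. g x * h x \<partial>M)"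
proof -
  have ih: "integrable M (\<lambda>x. k x * h x)" if "integrable M k" for k
  proof (rule Bochner_Integration.integrable_bound[OF that])
    show "(\<lambda>x. k x * h x) \<in> borel_measurable M" using that h by measurable
    show "AE x in M. norm (k x * h x) \<le> norm (k x)" using h(2) by (intro AE_I2) (simp add: abs_mult mult_left_le)
  qed
  have "\<bar>(\<integral>x. f m x * h x \<partial>M) - (\<integral>x. g x * h x \<partial>M)\<bar> \<le> (\<integral>x. \<bar>f m x - g x\<bar> \<partial>M)" for m
  proof -
    have "(\<integral>x. f m x * h x \<partial>M) - (\<integral>x. g x * h x \<partial>M) = (\<integral>x. (f m x - g x) * h x \<partial>M)"
      using ih[OF i(1)] ih[OF i(2)] by (simp add: left_diff_distrib)
    also have "\<bar>\<dots>\<bar> \<le> (\<integral>x. \<bar>(f m x - g x) * h x\<bar> \<partial>M)" by (rule integral_abs_bound)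
    also have "\<dots> \<le> (\<integral>x. \<bar>f m x - g x\<bar> \<partial>M)"
    proof (rule integral_mono)
      show "integrable M (\<lambda>x. \<bar>(f m x - g x) * h x\<bar>)" using i by (intro integrable_abs ih) auto
      show "integrable M (\<lambda>x. \<bar>f m x - g x\<bar>)" using i by auto
      show "\<bar>(f m x - g x) * h x\<bar> \<le> \<bar>f m x - g x\<bar>" for x using h(2)[of x] by (simp add: abs_mult mult_left_le)
    qed
    finally show ?thesis .
  qed
  then have "(\<lambda>m. (\<integral>x. f m x * h x \<partial>M) - (\<integral>x. g x * h x \<partial>M)) \<longlonglongrightarrow> 0"
    by (intro Lim_null_comparison[OF _ l]) (simp add: eventually_sequentiallyI)
  then show ?thesis by (simp add: LIM_zero_iff)
qed

lemma test_function_props: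
  fixes \<phi> :: "real^'n \<Rightarrow> real"
  assumes "\<phi> \<in> test_functions \<Omega>"
  shows "(\<phi> has_derivative frechet_derivative \<phi> (at x)) (at x)" "continuous_on UNIV (partial_deriv k \<phi>)"
    "continuous_on UNIV \<phi>"
    "x \<notin> \<Omega> \<Longrightarrow> \<phi> x = 0 \<and> partial_deriv k \<phi> x = 0" "\<exists>R. \<forall>x. R < norm x \<longrightarrow> \<phi> x = 0 \<and> partial_deriv k \<phi> x = 0"
proof -
  let ?K = "closure {x. \<phi> x \<noteq> 0}"
  have cd: "\<And>m. cont_diff m \<phi>" and K: "compact ?K" "?K \<subseteq> \<Omega>" using assms by (auto simp: test_functions_def)
  from cd[of "Suc 0"] have d: "\<And>x. \<phi> differentiable (at x)" and c: "\<forall>b\<in>Basis. continuous_on UNIV (\<lambda>x. frechet_derivative \<phi> (at x) b)"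
    by auto
  show D: "(\<phi> has_derivative frechet_derivative \<phi> (at x)) (at x)" for x using d frechet_derivative_works by blast
  show "continuous_on UNIV \<phi>" using cd[of 0] by simp
  have "axis k 1 \<in> (Basis :: (real^'n) set)" by (simp add: axis_in_Basis_iff)
  then show "continuous_on UNIV (partial_deriv k \<phi>)" using c by (simp add: partial_deriv_def[abs_def])
  have zK: "\<phi> y = 0" if "y \<notin> ?K" for y
    using subsetD[OF closure_subset[of "{x. \<phi> x \<noteq> 0}"], of y] that by blast
  have z: "\<phi> x = 0 \<and> partial_deriv k \<phi> x = 0" if "x \<notin> ?K" for x
  proof
    show "\<phi> x = 0" by (rule zK[OF that])
    have "((\<lambda>_. 0) has_derivative (\<lambda>_. 0)) (at x)" by simp
    then have "(\<phi> has_derivative (\<lambda>_. 0)) (at x)"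
    proof (rule has_derivative_transform_within_open)
      show "open (- ?K)" "x \<in> - ?K" using that by auto
      show "0 = \<phi> y" if "y \<in> - ?K" for y using zK[of y] that by simp
    qed
    then have "frechet_derivative \<phi> (at x) = (\<lambda>_. 0)" by (rule frechet_derivative_at[symmetric])
    then show "partial_deriv k \<phi> x = 0" by (simp add: partial_deriv_def)
  qed
  show "x \<notin> \<Omega> \<Longrightarrow> \<phi> x = 0 \<and> partial_deriv k \<phi> x = 0" using z K(2) by blast
  obtain R where "\<And>x. x \<in> ?K \<Longrightarrow> norm x \<le> R" using compact_imp_bounded[OF K(1)] by (auto simp: bounded_iff)
  then have "x \<notin> ?K" if "R < norm x" for x
    using that less_le_not_le by blast
  then show "\<exists>R. \<forall>x. R < norm x \<longrightarrow> \<phi> x = 0 \<and> partial_deriv k \<phi> x = 0" using z by blast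
qed

lemma lborel_integral_restrict:
  fixes f :: "'a::euclidean_space \<Rightarrow> real"
  assumes "f \<in> borel_measurable borel" "\<And>x. x \<notin> \<Omega> \<Longrightarrow> f x = 0" "\<Omega> \<in> sets borel"
  shows "(\<integral>x. f x \<partial>lborel) = (\<integral>x. f x \<partial>lebesgue_on \<Omega>)"
proof -
  have "(\<integral>x. f x \<partial>lebesgue_on \<Omega>) = (\<integral>x. indicator \<Omega> x *\<^sub>R f x \<partial>lebesgue)"
    using assms(3) by (intro integral_restrict_space) simp
  also have "\<dots> = (\<integral>x. f x \<partial>lebesgue)"
    by (intro Bochner_Integration.integral_cong refl) (use assms(2) in \<open>auto simp: indicator_def\<close>)
  also have "\<dots> = (\<integral>x. f x \<partial>lborel)" using assms(1) by (intro integral_completion) simp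
  finally show ?thesis by simp
qed

lemma square_integrable_diff:
  assumes "square_integrable \<Omega> f" "square_integrable \<Omega> g"
  shows "integrable (lebesgue_on \<Omega>) (\<lambda>x. (f x - g x)\<^sup>2)"
proof (rule Bochner_Integration.integrable_bound[of _ "\<lambda>x. 2 * (f x)\<^sup>2 + 2 * (g x)\<^sup>2"])
  show "integrable (lebesgue_on \<Omega>) (\<lambda>x. 2 * (f x)\<^sup>2 + 2 * (g x)\<^sup>2)"
    using assms by (auto simp: square_integrable_def)
  show "(\<lambda>x. (f x - g x)\<^sup>2) \<in> borel_measurable (lebesgue_on \<Omega>)"
    using assms unfolding square_integrable_def by (intro borel_measurable_power borel_measurable_diff) auto
  have "(a - b)\<^sup>2 \<le> 2 * a\<^sup>2 + 2 * b\<^sup>2" for a b :: real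
    using zero_le_power2[of "a + b"] by (simp add: power2_eq_square algebra_simps)
  then show "AE x in lebesgue_on \<Omega>. norm ((f x - g x)\<^sup>2) \<le> norm (2 * (f x)\<^sup>2 + 2 * (g x)\<^sup>2)"
    by (intro AE_I2) (simp add: abs_of_nonneg)
qed

lemma finite_measure_lebesgue_on_bounded:
  assumes "bounded \<Omega>" "\<Omega> \<in> sets borel"
  shows "finite_measure (lebesgue_on \<Omega>)"
proof (rule finite_measureI)
  have "emeasure lebesgue \<Omega> = emeasure lborel \<Omega>" using assms(2) by simp
  also have "\<dots> < \<infinity>" by (rule emeasure_bounded_finite[OF assms(1)])
  finally show "emeasure (lebesgue_on \<Omega>) (space (lebesgue_on \<Omega>)) \<noteq> \<infinity>"
    using assms(2) by (simp add: emeasure_restrict_space)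
qed

lemma square_integrable_continuous:
  fixes f :: "real^'n \<Rightarrow> real"
  assumes "continuous_on UNIV f" "bounded \<Omega>" "\<Omega> \<in> sets borel"
  shows "square_integrable \<Omega> f"
  unfolding square_integrable_def
proof
  interpret finite_measure "lebesgue_on \<Omega>" by (rule finite_measure_lebesgue_on_bounded[OF assms(2,3)])
  have "f \<in> borel_measurable lebesgue" using assms(1) by (intro measurable_completion) (simp add: borel_measurable_continuous_onI)
  then show m: "f \<in> borel_measurable (lebesgue_on \<Omega>)" by (rule measurable_restrict_space1)
  have "compact (f ` closure \<Omega>)" using assms(1,2) by (intro compact_continuous_image) (auto intro: continuous_on_subset simp: compact_closure)
  then obtain B where B: "\<And>x. x \<in> closure \<Omega> \<Longrightarrow> \<bar>f x\<bar> \<le> B" using compact_imp_bounded by (force simp: bounded_iff)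
  show "integrable (lebesgue_on \<Omega>) (\<lambda>x. (f x)\<^sup>2)"
  proof (rule integrable_const_bound[of _ "B\<^sup>2"])
    show "AE x in lebesgue_on \<Omega>. norm ((f x)\<^sup>2) \<le> B\<^sup>2"
    proof (rule AE_I2)
      fix x assume "x \<in> space (lebesgue_on \<Omega>)"
      then have "x \<in> closure \<Omega>" using closure_subset by (auto simp: space_restrict_space)
      then have "\<bar>f x\<bar>\<^sup>2 \<le> B\<^sup>2" using B by (intro power_mono) auto
      then show "norm ((f x)\<^sup>2) \<le> B\<^sup>2" by simp
    qed
  qed (use m in measurable)
qed

text \<open>For test functions this is \<open>integral_difference_segment_mean\<close>. The other
  factors on both sides are bounded by 1, so both sides pass to the limit under L1 convergence of
  the functions and of their derivatives; on a bounded domain this follows from convergence in the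
  H1 norm.\<close>

theorem H1_0_integral_identity:
  fixes v :: "real^'n \<Rightarrow> real"
  assumes \<Omega>: "open \<Omega>" "bounded \<Omega>" and v: "v \<in> H1_0 \<Omega>" and I: "I \<in> sets borel" and \<epsilon>: "0 < \<epsilon>"
  shows "integrable (lebesgue_on \<Omega>) (weak_partial \<Omega> k v)"
    "(\<integral>x. v x * (indicator I x - indicator I (x + \<epsilon> *\<^sub>R axis k 1)) \<partial>lebesgue_on \<Omega>) =
       \<epsilon> * (\<integral>x. weak_partial \<Omega> k v x * segment_mean I (axis k 1) \<epsilon> x \<partial>lebesgue_on \<Omega>)"
proof -
  let ?M = "lebesgue_on \<Omega>" and ?g = "\<lambda>k. weak_partial \<Omega> k v"
  have \<Omega>b: "\<Omega> \<in> sets borel" using \<Omega>(1) by simp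
  interpret finite_measure ?M by (rule finite_measure_lebesgue_on_bounded[OF \<Omega>(2) \<Omega>b])
  have sv: "square_integrable \<Omega> v" and ex: "\<And>k. \<exists>g. is_weak_partial \<Omega> k v g" using v by (auto simp: H1_0_def H1_def)
  have "is_weak_partial \<Omega> k v (?g k)" for k unfolding weak_partial_def using ex by (rule someI_ex)
  then have sg: "square_integrable \<Omega> (?g k)" for k by (simp add: is_weak_partial_def)
  obtain \<phi> where \<phi>: "\<And>m::nat. \<phi> m \<in> test_functions \<Omega>" and lim: "(\<lambda>m. (\<integral>x. (\<phi> m x - v x)\<^sup>2 \<partial>?M) +
          (\<Sum>k\<in>UNIV. \<integral>x. (partial_deriv k (\<phi> m) x - ?g k x)\<^sup>2 \<partial>?M)) \<longlonglongrightarrow> 0"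
    using v by (auto simp: H1_0_def)
  have s\<phi>: "square_integrable \<Omega> (\<phi> m)" "square_integrable \<Omega> (partial_deriv k (\<phi> m))" for m k
    using test_function_props[OF \<phi>] by (auto intro!: square_integrable_continuous \<Omega> \<Omega>b)
  have meas: "f \<in> borel_measurable ?M" if "square_integrable \<Omega> f" for f using that by (simp add: square_integrable_def)
  have nn: "0 \<le> (\<integral>x. (f x)\<^sup>2 \<partial>?M)" for f :: "real^'n \<Rightarrow> real" by (intro integral_nonneg_AE AE_I2) simp
  have l1: "(\<lambda>m. \<integral>x. (\<phi> m x - v x)\<^sup>2 \<partial>?M) \<longlonglongrightarrow> 0"
    by (rule tendsto_sandwich[OF _ _ tendsto_const lim]) (auto intro!: always_eventually nn sum_nonneg)
  have l2: "(\<lambda>m. \<integral>x. (partial_deriv k (\<phi> m) x - ?g k x)\<^sup>2 \<partial>?M) \<longlonglongrightarrow> 0"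
  proof (rule tendsto_sandwich[OF _ _ tendsto_const lim])
    show "\<forall>\<^sub>F m in sequentially. 0 \<le> (\<integral>x. (partial_deriv k (\<phi> m) x - ?g k x)\<^sup>2 \<partial>?M)" by (intro always_eventually allI nn)
    show "\<forall>\<^sub>F m in sequentially. (\<integral>x. (partial_deriv k (\<phi> m) x - ?g k x)\<^sup>2 \<partial>?M) \<le>
      (\<integral>x. (\<phi> m x - v x)\<^sup>2 \<partial>?M) + (\<Sum>k\<in>UNIV. \<integral>x. (partial_deriv k (\<phi> m) x - ?g k x)\<^sup>2 \<partial>?M)"
    proof (intro always_eventually allI)
      fix m
      have "(\<integral>x. (partial_deriv k (\<phi> m) x - ?g k x)\<^sup>2 \<partial>?M) \<le> (\<Sum>k\<in>UNIV. \<integral>x. (partial_deriv k (\<phi> m) x - ?g k x)\<^sup>2 \<partial>?M)"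
        by (rule member_le_sum) (auto intro: nn)
      then show "(\<integral>x. (partial_deriv k (\<phi> m) x - ?g k x)\<^sup>2 \<partial>?M) \<le>
        (\<integral>x. (\<phi> m x - v x)\<^sup>2 \<partial>?M) + (\<Sum>k\<in>UNIV. \<integral>x. (partial_deriv k (\<phi> m) x - ?g k x)\<^sup>2 \<partial>?M)"
        using nn[of "\<lambda>x. \<phi> m x - v x"] by linarith
    qed
  qed
  have L1: "(\<lambda>m. \<integral>x. \<bar>\<phi> m x - v x\<bar> \<partial>?M) \<longlonglongrightarrow> 0"
    by (rule L1_of_L2(2)[of "\<lambda>m x. \<phi> m x - v x"])
       (use meas[OF s\<phi>(1)] meas[OF sv] square_integrable_diff[OF s\<phi>(1) sv] l1 in auto)
  have L2: "(\<lambda>m. \<integral>x. \<bar>partial_deriv k (\<phi> m) x - ?g k x\<bar> \<partial>?M) \<longlonglongrightarrow> 0"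
    by (rule L1_of_L2(2)[of "\<lambda>m x. partial_deriv k (\<phi> m) x - ?g k x"])
       (use meas[OF s\<phi>(2)] meas[OF sg] square_integrable_diff[OF s\<phi>(2) sg] l2 in auto)
  have int: "integrable ?M f" if "square_integrable \<Omega> f" for f
  proof -
    have "\<bar>a\<bar> \<le> 1 + a\<^sup>2" for a :: real
      using zero_le_power2[of "\<bar>a\<bar> - 1"] by (simp add: power2_eq_square algebra_simps)
    then show ?thesis using that unfolding square_integrable_def
      by (intro Bochner_Integration.integrable_bound[of ?M "\<lambda>x. 1 + (f x)\<^sup>2" f]) (auto simp: abs_of_nonneg)
  qed
  show "integrable ?M (?g k)" by (rule int[OF sg])
  let ?h = "\<lambda>x. indicat_real I x - indicat_real I (x + \<epsilon> *\<^sub>R axis k 1)"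
  let ?s = "segment_mean I (axis k 1) \<epsilon>"
  note [measurable] = I
  have hb [measurable]: "?h \<in> borel_measurable borel" by measurable
  have sb [measurable]: "?s \<in> borel_measurable borel" by (rule measurable_segment_mean[OF I])
  have restr: "f \<in> borel_measurable ?M" if "f \<in> borel_measurable borel" for f :: "real^'n \<Rightarrow> real"
    using that by (intro measurable_restrict_space1 measurable_completion) simp
  have id: "(\<integral>x. \<phi> m x * ?h x \<partial>?M) = \<epsilon> * (\<integral>x. partial_deriv k (\<phi> m) x * ?s x \<partial>?M)" for m
  proof -
    note tp = test_function_props[OF \<phi>[of m]]
    have [measurable]: "\<phi> m \<in> borel_measurable borel" "partial_deriv k (\<phi> m) \<in> borel_measurable borel"
      using tp(2,3) by (auto intro: borel_measurable_continuous_onI)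
    obtain R where R: "\<And>x. R < norm x \<Longrightarrow> \<phi> m x = 0 \<and> partial_deriv k (\<phi> m) x = 0" using tp(5)[of k] by blast
    have "(\<integral>x. \<phi> m x * ?h x \<partial>lborel) = \<epsilon> * (\<integral>x. ?s x * partial_deriv k (\<phi> m) x \<partial>lborel)"
      by (rule integral_difference_segment_mean[OF I tp(1) _ tp(2) R \<epsilon>]) (simp add: partial_deriv_def)
    moreover have "(\<integral>x. \<phi> m x * ?h x \<partial>lborel) = (\<integral>x. \<phi> m x * ?h x \<partial>?M)"
      by (rule lborel_integral_restrict[OF _ _ \<Omega>b]) (use tp(4) in auto)
    moreover have "(\<integral>x. partial_deriv k (\<phi> m) x * ?s x \<partial>lborel) = (\<integral>x. partial_deriv k (\<phi> m) x * ?s x \<partial>?M)"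
      by (rule lborel_integral_restrict[OF _ _ \<Omega>b]) (use tp(4) in auto)
    ultimately show ?thesis by (simp add: mult.commute)
  qed
  have "(\<lambda>m. \<integral>x. \<phi> m x * ?h x \<partial>?M) \<longlonglongrightarrow> (\<integral>x. v x * ?h x \<partial>?M)"
    by (rule tendsto_integral_bounded_weight[OF int[OF s\<phi>(1)] int[OF sv] L1 restr[OF hb]]) (auto simp: indicator_def)
  moreover have "(\<lambda>m. \<epsilon> * (\<integral>x. partial_deriv k (\<phi> m) x * ?s x \<partial>?M)) \<longlonglongrightarrow> \<epsilon> * (\<integral>x. ?g k x * ?s x \<partial>?M)"
    by (intro tendsto_mult_left tendsto_integral_bounded_weight[OF int[OF s\<phi>(2)] int[OF sg] L2 restr[OF sb]])
       (simp add: abs_of_nonneg segment_mean_bounds[OF I])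
  ultimately show "(\<integral>x. v x * ?h x \<partial>?M) = \<epsilon> * (\<integral>x. ?g k x * ?s x \<partial>?M)"
    unfolding id by (rule LIMSEQ_unique)
qed

text \<open>With the whole space in the role of I the indicators cancel and the segment mean is
  1.\<close>

corollary H1_0_integral_weak_partial:
  fixes v :: "real^'n \<Rightarrow> real"
  assumes "open \<Omega>" "bounded \<Omega>" "v \<in> H1_0 \<Omega>"
  shows "(\<integral>x. weak_partial \<Omega> k v x \<partial>lebesgue_on \<Omega>) = 0"
proof -
  have "segment_mean UNIV (axis k 1) 1 x = 1" for x :: "real^'n" by (rule segment_mean_const) auto
  then show ?thesis using H1_0_integral_identity(2)[OF assms, of UNIV 1 k] by simp
qed

text \<open>\<open>H1_0_integral_identity\<close> divided by \<epsilon>, with v replaced by its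
  continuous extension u by zero. The left side tends to the facet integrals by
  \<open>sided_difference_quotient\<close>. The right side tends to the integral over I by dominated
  convergence, since the frontier of I is a null set.\<close>

theorem H1_0_divergence_sided:
  fixes v u :: "real^'n \<Rightarrow> real"
  assumes \<Omega>: "open \<Omega>" "bounded \<Omega>" and v: "v \<in> H1_0 \<Omega>" and u: "continuous_on UNIV u" "\<And>x. x \<in> \<Omega> \<Longrightarrow> u x = v x" "\<And>x. x \<notin> \<Omega> \<Longrightarrow> u x = 0"
    and sd: "sided J A \<sigma> I" and I: "I \<in> sets borel"
  shows "(\<integral>x. weak_partial \<Omega> k v x * indicator I x \<partial>lebesgue_on \<Omega>) =
    (\<Sum>j\<in>J. \<sigma> j * span_det (A j) (axis k 1) / norm (facet_normal (A j)) * facet_integral (A j) u)"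
proof -
  let ?M = "lebesgue_on \<Omega>" and ?g = "weak_partial \<Omega> k v" and ?e = "axis k 1 :: real^'n"
  define \<epsilon> where "\<epsilon> m = 1 / real (Suc m)" for m
  have \<epsilon>: "\<And>m. 0 < \<epsilon> m" "\<epsilon> \<longlonglongrightarrow> 0" unfolding \<epsilon>_def[abs_def] by (simp, rule LIMSEQ_Suc[OF lim_1_over_n])
  have \<Omega>b: "\<Omega> \<in> sets borel" using \<Omega>(1) by simp
  have ub [measurable]: "u \<in> borel_measurable borel" using u(1) by (rule borel_measurable_continuous_onI)
  note [measurable] = I
  have bu: "bounded (range u)"
  proof -
    have "compact (u ` closure \<Omega>)" using u(1) \<Omega>(2) by (intro compact_continuous_image) (auto intro: continuous_on_subset simp: compact_closure)
    then have "bounded (insert 0 (u ` closure \<Omega>))" using compact_imp_bounded by simp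
    moreover have "range u \<subseteq> insert 0 (u ` closure \<Omega>)" using u(3) closure_subset by fastforce
    ultimately show ?thesis by (rule bounded_subset)
  qed
  have eq: "(\<integral>x. u x * (indicator I x - indicator I (x + \<epsilon> m *\<^sub>R ?e)) \<partial>lborel) / \<epsilon> m = (\<integral>x. ?g x * segment_mean I ?e (\<epsilon> m) x \<partial>?M)" for m
  proof -
    have "(\<integral>x. u x * (indicator I x - indicator I (x + \<epsilon> m *\<^sub>R ?e)) \<partial>lborel) = (\<integral>x. u x * (indicat_real I x - indicator I (x + \<epsilon> m *\<^sub>R ?e)) \<partial>?M)"
      by (rule lborel_integral_restrict[OF _ _ \<Omega>b]) (use u(3) in auto)
    also have "\<dots> = (\<integral>x. v x * (indicat_real I x - indicator I (x + \<epsilon> m *\<^sub>R ?e)) \<partial>?M)"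
      by (intro Bochner_Integration.integral_cong refl) (use u(2) in \<open>auto simp: space_restrict_space\<close>)
    also have "\<dots> = \<epsilon> m * (\<integral>x. ?g x * segment_mean I ?e (\<epsilon> m) x \<partial>?M)"
      by (rule H1_0_integral_identity(2)[OF \<Omega> v I \<epsilon>(1)])
    finally show ?thesis using \<epsilon>(1)[of m] by simp
  qed
  have ig: "integrable ?M ?g" by (rule H1_0_integral_identity(1)[OF \<Omega> v I \<epsilon>(1)[of 0]])
  have e0: "?e \<noteq> 0" by (simp add: axis_eq_0_iff)
  from sided_difference_quotient[OF sd e0 u(1) bu \<epsilon> I]
  have "(\<lambda>m. \<integral>x. ?g x * segment_mean I ?e (\<epsilon> m) x \<partial>?M) \<longlonglongrightarrow>
    (\<Sum>j\<in>J. \<sigma> j * span_det (A j) ?e / norm (facet_normal (A j)) * facet_integral (A j) u)" unfolding eq .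
  moreover have "(\<lambda>m. \<integral>x. ?g x * segment_mean I ?e (\<epsilon> m) x \<partial>?M) \<longlonglongrightarrow> (\<integral>x. ?g x * indicator I x \<partial>?M)"
  proof (rule integral_dominated_convergence[where w="\<lambda>x. \<bar>?g x\<bar>"])
    have restr: "f \<in> borel_measurable ?M" if "f \<in> borel_measurable borel" for f :: "real^'n \<Rightarrow> real"
      using that by (intro measurable_restrict_space1 measurable_completion) simp
    show "(\<lambda>x. ?g x * indicator I x) \<in> borel_measurable ?M"
      by (rule borel_measurable_times[OF borel_measurable_integrable[OF ig] restr[OF borel_measurable_indicator[OF I]]])
    show "(\<lambda>x. ?g x * segment_mean I ?e (\<epsilon> m) x) \<in> borel_measurable ?M" for m
      by (rule borel_measurable_times[OF borel_measurable_integrable[OF ig] restr[OF measurable_segment_mean[OF I]]])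
    show "integrable ?M (\<lambda>x. \<bar>?g x\<bar>)" using ig by simp
    have "AE x in lebesgue. x \<notin> frontier I"
      using negligible_frontier_sided[OF sd] unfolding negligible_iff_null_sets by (rule AE_not_in)
    then have "AE x in ?M. x \<notin> frontier I"
      using \<Omega>b by (subst AE_restrict_space_iff) (auto elim: eventually_mono)
    then show "AE x in ?M. (\<lambda>m. ?g x * segment_mean I ?e (\<epsilon> m) x) \<longlonglongrightarrow> ?g x * indicator I x"
      by eventually_elim (intro tendsto_mult_left segment_mean_tendsto[OF I _ \<epsilon>])
    show "AE x in ?M. norm (?g x * segment_mean I ?e (\<epsilon> m) x) \<le> \<bar>?g x\<bar>" for m
      using segment_mean_bounds[OF I] by (intro AE_I2) (simp add: abs_mult abs_of_nonneg mult_left_le)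
  qed
  ultimately show ?thesis by (rule LIMSEQ_unique[symmetric])
qed

section \<open>Fluxes through polyhedral surfaces\<close>

lemma range_bij_betw_image:
  assumes "bij_betw e UNIV s"
  shows "range (\<lambda>i. p (e i)) = p ` s"
  using assms by (simp add: bij_betw_def image_image[symmetric])

text \<open>A relation between the rows loses its n-part when tested with n; the remaining relation
  between edges would be an affine dependence of the vertices.\<close>

lemma span_det_normal_nonzero:
  fixes a :: "'n::finite \<Rightarrow> real^'n"
  assumes a: "inj a" "\<not> affine_dependent (range a)" and n: "n \<noteq> 0" "\<And>i j. n \<bullet> (a i - a j) = 0"
  shows "span_det a n \<noteq> 0"
proof -
  define M :: "real^'n^'n" where "M = (\<chi> i. if i = undefined then n else a i - a undefined)"
  have rM: "row i M = (if i = undefined then n else a i - a undefined)" for i by (simp add: row_def M_def vec_eq_iff)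
  have "c i = 0" if c: "(\<Sum>i\<in>UNIV. c i *s row i M) = 0" for c i
  proof -
    have split: "(\<Sum>i\<in>UNIV. c i *s row i M) = c undefined *\<^sub>R n + (\<Sum>i\<in>UNIV-{undefined}. c i *\<^sub>R (a i - a undefined))"
      by (subst sum.remove[of _ undefined]) (auto simp: rM scalar_mult_eq_scaleR intro!: sum.cong)
    have "n \<bullet> (c undefined *\<^sub>R n + (\<Sum>i\<in>UNIV-{undefined}. c i *\<^sub>R (a i - a undefined))) = c undefined * (n \<bullet> n)"
      by (simp add: inner_add_right inner_sum_right n(2))
    then have c0: "c undefined = 0" using c n(1) unfolding split by simp
    define d where "d i = (if i = undefined then - (\<Sum>i\<in>UNIV-{undefined}. c i) else c i)" for i
    have d0: "sum d UNIV = 0" by (subst sum.remove[of _ undefined]) (auto simp: d_def)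
    have "(\<Sum>i\<in>UNIV. d i *\<^sub>R a i) = d undefined *\<^sub>R a undefined + (\<Sum>i\<in>UNIV-{undefined}. c i *\<^sub>R a i)"
      by (subst sum.remove[of _ undefined]) (auto simp: d_def intro!: sum.cong)
    also have "\<dots> = (\<Sum>i\<in>UNIV-{undefined}. c i *\<^sub>R (a i - a undefined))"
      by (simp add: d_def scaleR_diff_right sum_subtractf scaleR_sum_left)
    also have "\<dots> = 0" using c c0 unfolding split by simp
    finally have d1: "(\<Sum>i\<in>UNIV. d i *\<^sub>R a i) = 0" .
    have "\<not> (\<exists>v\<in>range a. d (inv a v) \<noteq> 0)"
    proof
      assume "\<exists>v\<in>range a. d (inv a v) \<noteq> 0"
      then have "affine_dependent (range a)"
        unfolding affine_dependent_explicit_finite[OF finite_imageI[OF finite]]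
        using d0 d1 by (intro exI[of _ "\<lambda>v. d (inv a v)"]) (simp add: sum.reindex[OF a(1)] o_def inv_f_f[OF a(1)])
      with a(2) show False ..
    qed
    then have "d i = 0" using inv_f_f[OF a(1)] by auto
    with c0 show "c i = 0" by (cases "i = undefined") (auto simp: d_def)
  qed
  then have "\<exists>B. M ** B = mat 1" unfolding matrix_right_invertible_independent_rows by blast
  then have "det M \<noteq> 0" by (simp add: invertible_right_inverse[symmetric] invertible_det_nz)
  then show ?thesis by (simp add: span_det_def M_def)
qed

text \<open>The difference of both sides is orthogonal to n and to all edges, that is, to the rows
  of an invertible matrix.\<close>

lemma facet_normal_unique:
  fixes a :: "'n::finite \<Rightarrow> real^'n"
  assumes D: "span_det a n \<noteq> 0" and n: "norm n = 1" "\<And>i j. n \<bullet> (a i - a j) = 0"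
  shows "facet_normal a = span_det a n *\<^sub>R n"
proof -
  define M :: "real^'n^'n" where "M = (\<chi> i. if i = undefined then n else a i - a undefined)"
  define z where "z = facet_normal a - span_det a n *\<^sub>R n"
  have "det M \<noteq> 0" using D by (simp add: span_det_def M_def)
  then have "\<exists>B. B ** M = mat 1" by (simp add: invertible_left_inverse[symmetric] invertible_det_nz)
  then have ker: "M *v z = 0 \<Longrightarrow> z = 0" unfolding matrix_left_invertible_ker by blast
  have nn: "n \<bullet> n = 1" using n(1) by (simp add: dot_square_norm)
  have "n \<bullet> z = 0" by (simp add: z_def inner_diff_right nn span_det_inner inner_commute)
  moreover have "(a i - a undefined) \<bullet> z = 0" for i
    using n(2)[of i undefined] span_det_diff_vertices[of a i undefined]
    by (simp add: z_def inner_diff_right span_det_inner inner_commute)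
  ultimately have "M *v z = 0"
    by (auto simp: matrix_vector_mult_def M_def vec_eq_iff inner_vec_def)
  from ker[OF this] show ?thesis by (simp add: z_def)
qed

lemma rel_interior_hull_range:
  fixes a :: "'n::finite \<Rightarrow> real^'n"
  assumes a: "inj a" "\<not> affine_dependent (range a)"
  shows "rel_interior (convex hull (range a)) = open_facet a" (is "?l = ?r")
proof -
  have l: "?l = {y. \<exists>u. (\<forall>x\<in>range a. 0 < u x) \<and> sum u (range a) = 1 \<and> (\<Sum>x\<in>range a. u x *\<^sub>R x) = y}"
    by (rule rel_interior_convex_hull_explicit[OF a(2)])
  show ?thesis unfolding l
  proof (intro set_eqI iffI)
    fix y assume "y \<in> {y. \<exists>u. (\<forall>x\<in>range a. 0 < u x) \<and> sum u (range a) = 1 \<and> (\<Sum>x\<in>range a. u x *\<^sub>R x) = y}"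
    then obtain u where "\<forall>x\<in>range a. 0 < u x" "sum u (range a) = 1" "(\<Sum>x\<in>range a. u x *\<^sub>R x) = y" by blast
    then show "y \<in> ?r" unfolding open_facet_def
      by (intro CollectI exI[of _ "\<lambda>i. u (a i)"]) (auto simp: sum.reindex[OF a(1)])
  next
    fix y assume "y \<in> ?r"
    then obtain u where "\<forall>i. 0 < u i" "sum u UNIV = 1" "y = (\<Sum>i\<in>UNIV. u i *\<^sub>R a i)" unfolding open_facet_def by blast
    then show "y \<in> {y. \<exists>u. (\<forall>x\<in>range a. 0 < u x) \<and> sum u (range a) = 1 \<and> (\<Sum>x\<in>range a. u x *\<^sub>R x) = y}"
      by (intro CollectI exI[of _ "\<lambda>v. u (inv a v)"]) (auto simp: sum.reindex[OF a(1)] inv_f_f[OF a(1)])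
  qed
qed

text \<open>\<open>unit_normal\<close> locates only the points reached along the normal itself. Near
  x the frontier is flat, so both half-balls have a definite side, and any direction with positive
  normal component leads into the same half-ball as the normal.\<close>

lemma two_sided_direction:
  fixes n :: "'a::euclidean_space"
  assumes G: "frontier I \<subseteq> G" and flat: "\<And>z. z \<in> ball x r \<Longrightarrow> z \<in> G \<Longrightarrow> n \<bullet> (z - x) = 0" and r: "0 < r"
    and ev: "\<forall>\<^sub>F \<epsilon> in at_right 0. x + \<epsilon> *\<^sub>R n \<notin> I" "\<forall>\<^sub>F \<epsilon> in at_right 0. x - \<epsilon> *\<^sub>R n \<in> I" and v: "0 < n \<bullet> v"
  shows "\<forall>\<^sub>F \<epsilon> in at_right 0. x + \<epsilon> *\<^sub>R v \<notin> I \<and> x - \<epsilon> *\<^sub>R v \<in> I"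
proof -
  have n0: "0 < n \<bullet> n" using v by auto
  have freq: "\<exists>\<^sub>F \<epsilon> in at_right (0::real). P \<epsilon>" if "\<forall>\<^sub>F \<epsilon> in at_right 0. P \<epsilon>" for P
    using that by (intro eventually_frequently) auto
  have up: "{z \<in> ball x r. 0 < n \<bullet> (z - x)} \<subseteq> - I"
    by (rule halfball_one_sided[where G=G and v=n]) (use G flat r n0 freq[OF ev(1)] in \<open>auto simp: frontier_complement\<close>)
  have dn: "{z \<in> ball x r. 0 < (- n) \<bullet> (z - x)} \<subseteq> I"
    by (rule halfball_one_sided[where G=G and v="- n"]) (use G flat r n0 freq[OF ev(2)] in auto)
  have "((\<lambda>\<epsilon>. x + \<epsilon> *\<^sub>R v) \<longlongrightarrow> x + 0 *\<^sub>R v) (at_right 0)" "((\<lambda>\<epsilon>. x - \<epsilon> *\<^sub>R v) \<longlongrightarrow> x - 0 *\<^sub>R v) (at_right 0)"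
    by (intro tendsto_intros)+
  moreover have "open (ball x r)" "x + 0 *\<^sub>R v \<in> ball x r" "x - 0 *\<^sub>R v \<in> ball x r" using r by simp_all
  ultimately have "\<forall>\<^sub>F \<epsilon> in at_right 0. x + \<epsilon> *\<^sub>R v \<in> ball x r" "\<forall>\<^sub>F \<epsilon> in at_right 0. x - \<epsilon> *\<^sub>R v \<in> ball x r"
    by (rule_tac [!] topological_tendstoD)
  moreover have "\<forall>\<^sub>F \<epsilon> in at_right (0::real). 0 < \<epsilon>" by (rule eventually_at_right_less)
  ultimately show ?thesis
  proof eventually_elim
    fix \<epsilon> :: real assume *: "x + \<epsilon> *\<^sub>R v \<in> ball x r" "x - \<epsilon> *\<^sub>R v \<in> ball x r" "0 < \<epsilon>"
    have "x + \<epsilon> *\<^sub>R v \<in> - I" by (rule subsetD[OF up]) (use * v in simp)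
    moreover have "x - \<epsilon> *\<^sub>R v \<in> I" by (rule subsetD[OF dn]) (use * v in simp)
    ultimately show "x + \<epsilon> *\<^sub>R v \<notin> I \<and> x - \<epsilon> *\<^sub>R v \<in> I" by simp
  qed
qed

lemma simplicial_surface_closed:
  fixes p :: "'k \<Rightarrow> real^'n"
  assumes "closed_polyhedral_surface F p"
  shows "simplicial_surface F p"
proof
  have cp: "finite F" "inj_on p (\<Union>F)" "\<And>s. s \<in> F \<Longrightarrow> card s = CARD('n)"
    "\<And>s. s \<in> F \<Longrightarrow> (int CARD('n) - 1) simplex (facet p s)" "triangulation (facet p ` F)"
    using assms unfolding closed_polyhedral_surface_def by blast+
  show "finite F" "inj_on p (\<Union>F)" by (rule cp)+
  show fin: "finite s" if "s \<in> F" for s using cp(3)[OF that] card.infinite by fastforce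
  show "\<not> affine_dependent (p ` s)" if "s \<in> F" for s
  proof -
    have "card (p ` s) = CARD('n)" using cp(3)[OF that] that cp(2) by (subst card_image) (auto intro: inj_on_subset)
    moreover have "aff_dim (p ` s) = int CARD('n) - 1"
      using aff_dim_simplex[OF cp(4)[OF that]] by (simp add: facet_def aff_dim_convex_hull)
    ultimately show ?thesis using fin[OF that] by (simp add: affine_independent_iff_card)
  qed
  show "(convex hull (p ` s) \<inter> convex hull (p ` t)) face_of (convex hull (p ` s))" if "s \<in> F" "t \<in> F" for s t
    using cp(5) that unfolding triangulation_def facet_def by blast
qed

text \<open>By \<open>barycentric_lipschitz\<close> a common point has the same weights in both
  facets. All vertices of r have positive weight, so r would be contained in s and, having the same
  cardinality, equal to it.\<close>

lemma (in simplicial_surface) open_facet_disjoint: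
  assumes "r \<in> F" "s \<in> F" "r \<noteq> s" "card r = card s" and c: "\<forall>i\<in>r. 0 < c i" "sum c r = 1" "\<forall>i. i \<notin> r \<longrightarrow> c i = 0"
  shows "(\<Sum>i\<in>r. c i *\<^sub>R p i) \<notin> convex hull (p ` s)"
proof
  assume "(\<Sum>i\<in>r. c i *\<^sub>R p i) \<in> convex hull (p ` s)"
  then obtain b where b: "b \<in> barycentric s" "(\<Sum>i\<in>r. c i *\<^sub>R p i) = (\<Sum>i\<in>s. b i *\<^sub>R p i)"
    using convex_hull_image_barycentric[OF finite_facet[OF assms(2)], of p] by auto
  have cb: "c \<in> barycentric r"
  proof -
    have "0 \<le> c k" for k using c(1,3) by (cases "k \<in> r") (simp_all add: less_imp_le)
    then show ?thesis using c(2,3) by (simp add: barycentric_def)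
  qed
  have eq: "c k = b k" for k
  proof (rule barycentric_lipschitz)
    fix C :: real
    assume C: "\<And>s t a b k. s \<in> F \<Longrightarrow> t \<in> F \<Longrightarrow> a \<in> barycentric s \<Longrightarrow> b \<in> barycentric t \<Longrightarrow>
      \<bar>a k - b k\<bar> \<le> C * dist (\<Sum>k\<in>s. a k *\<^sub>R p k) (\<Sum>k\<in>t. b k *\<^sub>R p k)"
    show "c k = b k" using C[OF assms(1,2) cb b(1), of k] b(2) by simp
  qed
  have "r \<subseteq> s"
  proof
    fix k assume "k \<in> r"
    then have "0 < b k" using c(1) eq[of k] by auto
    then show "k \<in> s" using b(1) unfolding barycentric_def by force
  qed
  then show False using card_subset_eq[OF finite_facet[OF assms(2)]] assms by blast
qed

text \<open>Translates a surface with its normal into the language of \<open>sided\<close>. The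
  numbering e of a facet is arbitrary and decides where \<open>facet_normal\<close> points; \<sigma>
  turns it into the outward direction, so the quotient in the last conclusion is the normal
  component of v for any numbering.\<close>

lemma surface_data:
  fixes p :: "'k \<Rightarrow> real^'n"
  assumes cp: "closed_polyhedral_surface F p" and un: "unit_normal F p \<nu>"
  obtains e :: "'k set \<Rightarrow> 'n \<Rightarrow> 'k" and n \<sigma>
  where "\<And>r. r \<in> F \<Longrightarrow> bij_betw (e r) UNIV r" "sided F (\<lambda>r i. p (e r i)) \<sigma> (inside (surface F p))"
    "\<And>r. r \<in> F \<Longrightarrow> facet p r = convex hull (range (\<lambda>i. p (e r i)))"
    "\<And>r. r \<in> F \<Longrightarrow> rel_interior (facet p r) = open_facet (\<lambda>i. p (e r i))"
    "\<And>r. r \<in> F \<Longrightarrow> facet_normal (\<lambda>i. p (e r i)) \<noteq> 0"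
    "\<And>r x. r \<in> F \<Longrightarrow> x \<in> rel_interior (facet p r) \<Longrightarrow> \<nu> x = n r"
    "\<And>r v. r \<in> F \<Longrightarrow> \<sigma> r * span_det (\<lambda>i. p (e r i)) v / norm (facet_normal (\<lambda>i. p (e r i))) = n r \<bullet> v"
proof -
  interpret simplicial_surface F p by (rule simplicial_surface_closed[OF cp])
  have card: "card r = CARD('n)" if "r \<in> F" for r using cp that unfolding closed_polyhedral_surface_def by blast
  have "\<forall>r\<in>F. \<exists>e. bij_betw e (UNIV :: 'n set) r"
    using card finite_facet by (auto intro!: finite_same_card_bij)
  from bchoice[OF this] obtain e where e: "\<And>r. r \<in> F \<Longrightarrow> bij_betw (e r) (UNIV :: 'n set) r" by blast
  let ?A = "\<lambda>r i. p (e r i)"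
  let ?I = "inside (surface F p)"
  have "\<forall>r\<in>F. \<exists>n. norm n = 1 \<and> (\<forall>x\<in>facet p r. \<forall>y\<in>facet p r. n \<bullet> (x - y) = 0) \<and>
        (\<forall>x\<in>rel_interior (facet p r). \<nu> x = n \<and>
           (\<forall>\<^sub>F \<epsilon> in at_right 0. x + \<epsilon> *\<^sub>R n \<in> outside (surface F p) \<and> x - \<epsilon> *\<^sub>R n \<in> ?I))"
    using un unfolding unit_normal_def by (rule conjunct1)
  from bchoice[OF this] obtain n where
    n1: "\<And>r. r \<in> F \<Longrightarrow> norm (n r) = 1" and
    n2: "\<And>r x y. r \<in> F \<Longrightarrow> x \<in> facet p r \<Longrightarrow> y \<in> facet p r \<Longrightarrow> n r \<bullet> (x - y) = 0" and
    n3: "\<And>r x. r \<in> F \<Longrightarrow> x \<in> rel_interior (facet p r) \<Longrightarrow> \<nu> x = n r" and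
    n4: "\<And>r x. r \<in> F \<Longrightarrow> x \<in> rel_interior (facet p r) \<Longrightarrow>
      (\<forall>\<^sub>F \<epsilon> in at_right 0. x + \<epsilon> *\<^sub>R n r \<in> outside (surface F p) \<and> x - \<epsilon> *\<^sub>R n r \<in> ?I)" by blast
  have hull: "facet p r = convex hull (range (?A r))" if "r \<in> F" for r
    using range_bij_betw_image[OF e[OF that], of p] by (simp add: facet_def)
  have ind: "inj (?A r)" "\<not> affine_dependent (range (?A r))" if "r \<in> F" for r
  proof -
    have "inj_on p r" using inj that by (auto intro: inj_on_subset)
    then show "inj (?A r)" using comp_inj_on[of "e r" UNIV p] e[OF that] by (auto simp: bij_betw_def comp_def)
    show "\<not> affine_dependent (range (?A r))" using indep[OF that] range_bij_betw_image[OF e[OF that], of p] by simp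
  qed
  have ri: "rel_interior (facet p r) = open_facet (?A r)" if "r \<in> F" for r
    unfolding hull[OF that] by (rule rel_interior_hull_range[OF ind[OF that]])
  have orth: "n r \<bullet> (?A r i - ?A r j) = 0" if "r \<in> F" for r i j
    by (rule n2[OF that]) (simp_all add: hull[OF that] hull_inc)
  have D: "span_det (?A r) (n r) \<noteq> 0" if "r \<in> F" for r
    using ind[OF that] n1[OF that] orth[OF that] by (intro span_det_normal_nonzero) auto
  have N: "facet_normal (?A r) = span_det (?A r) (n r) *\<^sub>R n r" if "r \<in> F" for r
    using D n1 orth that by (intro facet_normal_unique) auto
  define \<sigma> where "\<sigma> r = sgn (span_det (?A r) (n r))" for r
  have \<sigma>1: "\<sigma> r = 1 \<or> \<sigma> r = -1" if "r \<in> F" for r using D[OF that] by (simp add: \<sigma>_def sgn_if)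
  have N0: "facet_normal (?A r) \<noteq> 0" if "r \<in> F" for r using N[OF that] D[OF that] n1[OF that] by auto
  have sv: "\<sigma> r * span_det (?A r) v / norm (facet_normal (?A r)) = n r \<bullet> v" if "r \<in> F" for r v
    using D[OF that] n1[OF that] by (simp add: span_det_inner[of _ v] N[OF that] \<sigma>_def sgn_if)
  have clo: "closed (surface F p)"
    unfolding surface_def using finite_F hull by (intro closed_UN) (auto intro: compact_imp_closed compact_hull_range)
  have bo: "bounded (surface F p)"
    unfolding surface_def using finite_F hull by (intro bounded_UN) (auto intro: compact_imp_bounded compact_hull_range)
  have dis: "open_facet (?A r) \<inter> convex hull (range (?A s)) = {}" if rs: "r \<in> F" "s \<in> F" "r \<noteq> s" for r s
  proof (rule ccontr)
    assume "open_facet (?A r) \<inter> convex hull (range (?A s)) \<noteq> {}"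
    then obtain u where u: "\<forall>i. 0 < u i" "sum u UNIV = 1" "(\<Sum>i\<in>UNIV. u i *\<^sub>R p (e r i)) \<in> facet p s"
      using hull[OF rs(2)] unfolding open_facet_def by auto
    define c where "c k = (if k \<in> r then u (inv_into UNIV (e r) k) else 0)" for k
    have be: "inj (e r)" "range (e r) = r" using e[OF rs(1)] by (auto simp: bij_betw_def)
    have ce: "c (e r i) = u i" for i using be by (auto simp: c_def)
    have "(\<Sum>k\<in>r. c k *\<^sub>R p k) = (\<Sum>i\<in>UNIV. u i *\<^sub>R p (e r i))" "sum c r = sum u UNIV"
      by (simp_all add: sum.reindex_bij_betw[OF e[OF rs(1)], symmetric] ce)
    moreover have "(\<Sum>k\<in>r. c k *\<^sub>R p k) \<notin> convex hull (p ` s)"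
      using rs card u calculation by (intro open_facet_disjoint) (auto simp: c_def)
    ultimately show False using u(3) by (simp add: facet_def)
  qed
  have fr: "frontier ?I \<subseteq> (\<Union>r\<in>F. convex hull (range (?A r)))"
    using frontier_inside_subset[OF clo] hull by (auto simp: surface_def)
  have side: "\<forall>\<^sub>F \<epsilon> in at_right 0. x + \<epsilon> *\<^sub>R v \<notin> ?I \<and> x - \<epsilon> *\<^sub>R v \<in> ?I"
    if r: "r \<in> F" and x: "x \<in> open_facet (?A r)" and v: "0 < \<sigma> r * span_det (?A r) v" for r x v
  proof -
    let ?G = "\<Union>r\<in>F. convex hull (range (?A r))"
    have "closed (\<Union>s\<in>F-{r}. convex hull (range (?A s)))"
      using finite_F by (intro closed_UN) (auto intro: compact_imp_closed compact_hull_range)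
    moreover have "x \<notin> (\<Union>s\<in>F-{r}. convex hull (range (?A s)))" using dis[OF r] x by blast
    ultimately obtain \<rho> where \<rho>: "\<rho> > 0" "ball x \<rho> \<inter> (\<Union>s\<in>F-{r}. convex hull (range (?A s))) = {}"
      by (metis ComplI Int_commute disjoint_eq_subset_Compl open_Compl open_contains_ball)
    have xh: "x \<in> facet p r" using x open_facet_subset[of "?A r"] hull[OF r] by blast
    have ev: "\<forall>\<^sub>F \<epsilon> in at_right 0. x + \<epsilon> *\<^sub>R n r \<in> outside (surface F p) \<and> x - \<epsilon> *\<^sub>R n r \<in> ?I"
      using x ri[OF r] by (intro n4[OF r]) simp
    show ?thesis
    proof (rule two_sided_direction[OF fr])
      fix z assume "z \<in> ball x \<rho>" "z \<in> ?G"
      then have "z \<in> facet p r" using \<rho>(2) hull[OF r] by blast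
      then show "n r \<bullet> (z - x) = 0" using xh by (intro n2[OF r])
    next
      show "\<forall>\<^sub>F \<epsilon> in at_right 0. x + \<epsilon> *\<^sub>R n r \<notin> ?I"
        using ev by eventually_elim (use inside_Int_outside in blast)
      show "\<forall>\<^sub>F \<epsilon> in at_right 0. x - \<epsilon> *\<^sub>R n r \<in> ?I" using ev by eventually_elim simp
      show "0 < n r \<bullet> v" using v N0[OF r] by (simp add: sv[OF r, symmetric])
    qed (rule \<rho>)
  qed
  have "sided F ?A \<sigma> ?I"
    unfolding sided_def
  proof (intro conjI ballI impI)
    show "bounded ?I" using bo by (rule bounded_inside)
    show "\<exists>v. span_det (?A j) v \<noteq> 0" if "j \<in> F" for j using D[OF that] by blast
  qed (use finite_F fr dis \<sigma>1 side in blast)+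
  show ?thesis
    by (rule that[of e \<sigma> n]) (fact e hull ri N0 n3 sv \<open>sided F ?A \<sigma> ?I\<close>)+
qed

section \<open>Hausdorff integrals over facets\<close>

lemma facet_proj_continuous: "continuous_on UNIV (facet_proj a)"
  unfolding facet_proj_def[abs_def] by (intro continuous_intros)

text \<open>The slab over the part of the facet in B is the part of \<open>facet_slab\<close> that
  projects into B. So the proportionality of \<open>hausdorff_hyperplane\<close> holds as an
  identity of measures, which is the form required for integrals.\<close>

lemma hausdorff_facet:
  fixes a :: "'n::finite \<Rightarrow> real^'n"
  assumes c: "0 < c" "\<And>n a B. norm n = 1 \<Longrightarrow> B \<in> sets borel \<Longrightarrow> bounded B \<Longrightarrow> B \<subseteq> {x. n \<bullet> x = a} \<Longrightarrow>
      emeasure (hausdorff_measure (CARD('n) - 1)) B = ennreal (c * measure lebesgue (slab_over n a (B :: (real^'n) set)))"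
    and a: "facet_normal a \<noteq> 0"
  shows "density (hausdorff_measure (CARD('n) - 1)) (indicator (convex hull (range a))) =
    density (distr (density lborel (indicator (facet_slab a))) borel (facet_proj a)) (\<lambda>x. ennreal c)" (is "?L = ?R")
proof (rule measure_eqI)
  let ?h = "convex hull (range a)" and ?u = "facet_unit a"
  have hb [measurable]: "?h \<in> sets borel" using compact_hull_range[of a] by (simp add: borel_compact)
  have bdd: "bounded ?h" using compact_hull_range by (rule compact_imp_bounded)
  note sb [measurable] = facet_slab(1)[OF a]
  have pm [measurable]: "facet_proj a \<in> borel_measurable borel"
    by (rule borel_measurable_continuous_onI[OF facet_proj_continuous])
  show "sets ?L = sets ?R" by simp
  fix B assume "B \<in> sets ?L"
  then have B [measurable]: "B \<in> sets borel" by simp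
  have slab: "slab_over ?u (?u \<bullet> a undefined) (?h \<inter> B) = facet_slab a \<inter> facet_proj a -` B"
    by (auto simp: facet_slab_def slab_over_def facet_proj_def)
  have hB: "?h \<inter> B \<in> sets borel" by measurable
  have sub: "?h \<inter> B \<subseteq> {x. ?u \<bullet> x = ?u \<bullet> a undefined}" using facet_unit_props(4)[OF a] by blast
  have pB: "facet_proj a -` B \<in> sets borel" using measurable_sets[OF pm B] by simp
  have S: "facet_slab a \<inter> facet_proj a -` B \<in> sets borel" using sb pB by (rule sets.Int)
  have fin: "emeasure lborel (facet_slab a \<inter> facet_proj a -` B) \<noteq> \<infinity>"
    using bounded_subset[OF facet_slab(2)[OF a], of "facet_slab a \<inter> facet_proj a -` B"] emeasure_bounded_finite by fastforce
  have "emeasure ?L B = emeasure (hausdorff_measure (CARD('n) - 1)) (?h \<inter> B)"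
    by (subst emeasure_density) (simp_all add: nn_integral_indicator[symmetric] indicator_inter_arith[symmetric] ac_simps hB del: nn_integral_indicator)
  also have "\<dots> = ennreal (c * measure lebesgue (facet_slab a \<inter> facet_proj a -` B))"
    unfolding slab[symmetric] using bdd by (intro c(2) facet_unit_props(1)[OF a] hB sub) (auto intro: bounded_subset)
  also have "measure lebesgue (facet_slab a \<inter> facet_proj a -` B) = measure lborel (facet_slab a \<inter> facet_proj a -` B)"
    using S by simp
  also have "ennreal (c * measure lborel (facet_slab a \<inter> facet_proj a -` B)) = ennreal c * emeasure lborel (facet_slab a \<inter> facet_proj a -` B)"
    using c(1) fin by (simp add: ennreal_mult emeasure_eq_ennreal_measure)
  also have "emeasure lborel (facet_slab a \<inter> facet_proj a -` B) = emeasure (distr (density lborel (indicator (facet_slab a))) borel (facet_proj a)) B"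
  proof -
    have "emeasure (distr (density lborel (indicator (facet_slab a))) borel (facet_proj a)) B = emeasure (density lborel (indicator (facet_slab a))) (facet_proj a -` B)"
      by (subst emeasure_distr) auto
    also have "\<dots> = (\<integral>\<^sup>+x. indicator (facet_slab a \<inter> facet_proj a -` B) x \<partial>lborel)"
      using pB by (subst emeasure_density) (auto simp: indicator_inter_arith simp del: nn_integral_indicator intro!: nn_integral_cong)
    also have "\<dots> = emeasure lborel (facet_slab a \<inter> facet_proj a -` B)"
      using S by (intro nn_integral_indicator) simp
    finally show ?thesis ..
  qed
  also have "ennreal c * \<dots> = emeasure ?R B"
    by (simp add: emeasure_density nn_integral_cmult)
  finally show "emeasure ?L B = emeasure ?R B" .
qed

text \<open>The factor d * norm / d! is the area norm / (d - 1)! of the facet, and c is the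
  normalisation of Hausdorff measure.\<close>

lemma hausdorff_facet_measure:
  fixes a :: "'n::finite \<Rightarrow> real^'n"
  assumes c: "0 < c" "\<And>n a B. norm n = 1 \<Longrightarrow> B \<in> sets borel \<Longrightarrow> bounded B \<Longrightarrow> B \<subseteq> {x. n \<bullet> x = a} \<Longrightarrow>
      emeasure (hausdorff_measure (CARD('n) - 1)) B = ennreal (c * measure lebesgue (slab_over n a (B :: (real^'n) set)))"
    and a: "facet_normal a \<noteq> 0"
  shows "emeasure (hausdorff_measure (CARD('n) - 1)) (convex hull (range a)) = ennreal (c * (CARD('n) * norm (facet_normal a) / fact CARD('n)))"
proof -
  have hb: "convex hull (range a) \<in> sets borel" using compact_hull_range[of a] by (simp add: borel_compact)
  have "emeasure (hausdorff_measure (CARD('n) - 1)) (convex hull (range a)) = ennreal (c * measure lebesgue (facet_slab a))"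
    unfolding facet_slab_def
    by (intro c(2) facet_unit_props(1)[OF a] hb compact_imp_bounded compact_hull_range) (use facet_unit_props(4)[OF a] in blast)
  also have "measure lebesgue (facet_slab a) = CARD('n) * norm (facet_normal a) / fact CARD('n)"
    using facet_slab[OF a] by simp
  finally show ?thesis .
qed

text \<open>The exceptional points lie on normals through the relative boundary of the facet, a case
  of \<open>negligible_boundary_sweep\<close>.\<close>

lemma AE_facet_proj_open_facet:
  fixes a :: "'n::finite \<Rightarrow> real^'n"
  shows "AE x in lborel. x \<in> facet_slab a \<longrightarrow> facet_proj a x \<in> open_facet a"
proof -
  have "negligible {x. \<exists>\<tau>. x + \<tau> *\<^sub>R facet_unit a \<in> convex hull (range a) - open_facet a}"
    by (rule negligible_boundary_sweep)
  then have "AE x in lebesgue. x \<notin> {x. \<exists>\<tau>. x + \<tau> *\<^sub>R facet_unit a \<in> convex hull (range a) - open_facet a}"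
    unfolding negligible_iff_null_sets by (rule AE_not_in)
  then have "AE x in lebesgue. x \<in> facet_slab a \<longrightarrow> facet_proj a x \<in> open_facet a"
  proof eventually_elim
    fix x assume x: "x \<notin> {x. \<exists>\<tau>. x + \<tau> *\<^sub>R facet_unit a \<in> convex hull (range a) - open_facet a}"
    show "x \<in> facet_slab a \<longrightarrow> facet_proj a x \<in> open_facet a"
    proof
      assume "x \<in> facet_slab a"
      then have "facet_proj a x \<in> convex hull (range a)" by (simp add: facet_slab_def slab_over_def facet_proj_def)
      moreover have "facet_proj a x = x + (- (facet_unit a \<bullet> x - facet_unit a \<bullet> a undefined)) *\<^sub>R facet_unit a"
        by (simp add: facet_proj_def scaleR_minus_left[symmetric] del: scaleR_minus_left minus_diff_eq)
      ultimately show "facet_proj a x \<in> open_facet a" using x by (metis (mono_tags, lifting) DiffI mem_Collect_eq)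
    qed
  qed
  then show ?thesis by (simp add: AE_completion_iff)
qed

text \<open>Open facets are pairwise disjoint and have a constant normal, while
  \<open>facet_integral\<close> extends over the closed facet. The points of the slab that project
  to the difference form a null set.\<close>

lemma hausdorff_open_facet_integral:
  fixes a :: "'n::finite \<Rightarrow> real^'n"
  assumes c: "0 < c" "\<And>n a B. norm n = 1 \<Longrightarrow> B \<in> sets borel \<Longrightarrow> bounded B \<Longrightarrow> B \<subseteq> {x. n \<bullet> x = a} \<Longrightarrow>
      emeasure (hausdorff_measure (CARD('n) - 1)) B = ennreal (c * measure lebesgue (slab_over n a (B :: (real^'n) set)))"
    and a: "facet_normal a \<noteq> 0" and o [measurable]: "open_facet a \<in> sets borel"
    and g [measurable]: "g \<in> borel_measurable borel"
  shows "(\<integral>x. indicator (open_facet a) x * g x \<partial>hausdorff_measure (CARD('n) - 1)) = c * facet_integral a g"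
proof -
  let ?H = "hausdorff_measure (CARD('n) - 1) :: (real^'n) measure" and ?h = "convex hull (range a)"
  define k where "k x = indicator (open_facet a) x * g x" for x
  have [measurable]: "k \<in> borel_measurable borel" unfolding k_def[abs_def] by measurable
  have hb [measurable]: "?h \<in> sets borel" using compact_hull_range[of a] by (simp add: borel_compact)
  note sb [measurable] = facet_slab(1)[OF a]
  have pm [measurable]: "facet_proj a \<in> borel_measurable borel"
    by (rule borel_measurable_continuous_onI[OF facet_proj_continuous])
  have "(\<integral>x. k x \<partial>?H) = (\<integral>x. indicator ?h x *\<^sub>R k x \<partial>?H)"
    using open_facet_subset[of a] by (intro Bochner_Integration.integral_cong refl) (auto simp: k_def indicator_def)
  also have "\<dots> = (\<integral>x. k x \<partial>density ?H (\<lambda>x. ennreal (indicator ?h x)))"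
    by (rule integral_density[symmetric]) auto
  also have "\<dots> = (\<integral>x. k x \<partial>density (distr (density lborel (\<lambda>x. ennreal (indicator (facet_slab a) x))) borel (facet_proj a)) (\<lambda>x. ennreal c))"
    by (rule arg_cong[where f="\<lambda>M. integral\<^sup>L M k"]) (unfold ennreal_indicator, rule hausdorff_facet[OF c a])
  also have "\<dots> = (\<integral>x. c *\<^sub>R k x \<partial>distr (density lborel (\<lambda>x. ennreal (indicator (facet_slab a) x))) borel (facet_proj a))"
    using c(1) by (intro integral_density) auto
  also have "\<dots> = (\<integral>x. c *\<^sub>R k (facet_proj a x) \<partial>density lborel (\<lambda>x. ennreal (indicator (facet_slab a) x)))"
    by (intro integral_distr) auto
  also have "\<dots> = (\<integral>x. indicator (facet_slab a) x *\<^sub>R (c *\<^sub>R k (facet_proj a x)) \<partial>lborel)"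
    by (intro integral_density) auto
  also have "\<dots> = (\<integral>x. c * (indicator (facet_slab a) x * g (facet_proj a x)) \<partial>lborel)"
    using AE_facet_proj_open_facet[of a]
    by (intro integral_cong_AE) (auto simp: k_def indicator_def elim!: eventually_mono)
  also have "\<dots> = c * facet_integral a g" by (simp add: facet_integral_def)
  finally show ?thesis by (simp add: k_def)
qed

lemma integrable_hausdorff_open_facet:
  fixes a :: "'n::finite \<Rightarrow> real^'n"
  assumes c: "0 < c" "\<And>n a B. norm n = 1 \<Longrightarrow> B \<in> sets borel \<Longrightarrow> bounded B \<Longrightarrow> B \<subseteq> {x. n \<bullet> x = a} \<Longrightarrow>
      emeasure (hausdorff_measure (CARD('n) - 1)) B = ennreal (c * measure lebesgue (slab_over n a (B :: (real^'n) set)))"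
    and a: "facet_normal a \<noteq> 0" and o [measurable]: "open_facet a \<in> sets borel"
    and g: "continuous_on UNIV (g :: _ \<Rightarrow> real)"
  shows "integrable (hausdorff_measure (CARD('n) - 1)) (\<lambda>x. indicator (open_facet a) x * g x)"
proof -
  let ?H = "hausdorff_measure (CARD('n) - 1) :: (real^'n) measure" and ?h = "convex hull (range a)"
  have [measurable]: "g \<in> borel_measurable borel" using g by (rule borel_measurable_continuous_onI)
  have hb [measurable]: "?h \<in> sets borel" using compact_hull_range[of a] by (simp add: borel_compact)
  have "compact (g ` ?h)" using g compact_hull_range by (intro compact_continuous_image) (auto intro: continuous_on_subset)
  then obtain B where B: "\<And>x. x \<in> ?h \<Longrightarrow> norm (g x) \<le> B" using compact_imp_bounded bounded_iff by (metis imageI)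
  have "emeasure ?H (open_facet a) \<le> emeasure ?H ?h" by (intro emeasure_mono open_facet_subset) auto
  also have "emeasure ?H ?h = ennreal (c * (CARD('n) * norm (facet_normal a) / fact CARD('n)))"
    by (rule hausdorff_facet_measure[OF c a])
  also have "\<dots> < \<infinity>" by simp
  finally have "integrable ?H (\<lambda>x. indicator (open_facet a) x *\<^sub>R g x)"
    using B open_facet_subset[of a] by (intro integrableI_bounded_set_indicator[where B=B]) auto
  then show ?thesis by simp
qed

lemma borel_rel_interior: "rel_interior S \<in> sets borel" for S :: "'a::euclidean_space set"
proof -
  obtain T where "open T" "rel_interior S = T \<inter> affine hull S"
    using openin_rel_interior[of S] unfolding openin_open by blast
  then show ?thesis by (simp add: borel_closed)
qed

text \<open>The normal is 0 on lower-dimensional faces, so the integrand is a sum over disjoint open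
  facets with constant normals. The field u replaces U because it is continuous on the whole space;
  on the surface both agree.\<close>

lemma surface_flux:
  fixes p :: "'k \<Rightarrow> real^'n" and A :: "'k set \<Rightarrow> 'n \<Rightarrow> real^'n"
  assumes c: "0 < c" "\<And>n a B. norm n = 1 \<Longrightarrow> B \<in> sets borel \<Longrightarrow> bounded B \<Longrightarrow> B \<subseteq> {x. n \<bullet> x = a} \<Longrightarrow>
      emeasure (hausdorff_measure (CARD('n) - 1)) B = ennreal (c * measure lebesgue (slab_over n a (B :: (real^'n) set)))"
    and un: "unit_normal F p \<nu>" and sd: "sided F A \<sigma> I"
    and hull: "\<And>r. r \<in> F \<Longrightarrow> facet p r = convex hull (range (A r))"
    and ri: "\<And>r. r \<in> F \<Longrightarrow> rel_interior (facet p r) = open_facet (A r)"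
    and N0: "\<And>r. r \<in> F \<Longrightarrow> facet_normal (A r) \<noteq> 0"
    and nn: "\<And>r x. r \<in> F \<Longrightarrow> x \<in> rel_interior (facet p r) \<Longrightarrow> \<nu> x = n r"
    and u: "continuous_on UNIV u" "\<And>x. x \<in> surface F p \<Longrightarrow> U x = u x"
  shows "surface_inner F p U (\<lambda>x. 1 *\<^sub>R \<nu> x) = c * (\<Sum>r\<in>F. \<Sum>k\<in>UNIV. n r $ k * facet_integral (A r) (\<lambda>x. u x $ k))"
proof -
  let ?H = "hausdorff_measure (CARD('n) - 1) :: (real^'n) measure"
  have fF: "finite F" using sd by (simp add: sided_def)
  have dis: "open_facet (A r) \<inter> open_facet (A s) = {}" if "r \<in> F" "s \<in> F" "r \<noteq> s" for r s
  proof -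
    have "open_facet (A r) \<inter> convex hull (range (A s)) = {}"
      using sd that unfolding sided_def by (elim conjE) simp
    then show ?thesis using open_facet_subset[of "A s"] by blast
  qed
  have ob: "open_facet (A r) \<in> sets borel" if "r \<in> F" for r using borel_rel_interior[of "facet p r"] ri[OF that] by simp
  have uk: "continuous_on UNIV (\<lambda>x. u x $ k)" for k by (intro continuous_intros u)
  have eq: "indicator (surface F p) x *\<^sub>R (U x \<bullet> (1 *\<^sub>R \<nu> x)) =
      (\<Sum>r\<in>F. \<Sum>k\<in>UNIV. n r $ k * (indicator (open_facet (A r)) x * u x $ k))" for x
  proof (cases "\<exists>r\<in>F. x \<in> open_facet (A r)")
    case True
    then obtain r where r: "r \<in> F" "x \<in> open_facet (A r)" by blast
    have xs: "x \<in> surface F p" using r open_facet_subset[of "A r"] hull[OF r(1)] by (auto simp: surface_def)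
    have "(\<Sum>s\<in>F. \<Sum>k\<in>UNIV. n s $ k * (indicator (open_facet (A s)) x * u x $ k)) =
        (\<Sum>k\<in>UNIV. n r $ k * (indicator (open_facet (A r)) x * u x $ k))"
    proof -
      have "(\<Sum>k\<in>UNIV. n s $ k * (indicator (open_facet (A s)) x * u x $ k)) = 0" if s: "s \<in> F - {r}" for s
      proof -
        have "x \<notin> open_facet (A s)" using dis[OF r(1), of s] s r(2) by blast
        then show ?thesis by simp
      qed
      then show ?thesis unfolding sum.remove[OF fF r(1)] by simp
    qed
    also have "\<dots> = u x \<bullet> n r" using r(2) by (simp add: inner_vec_def mult.commute)
    finally show ?thesis using xs u(2)[OF xs] nn[OF r(1)] ri[OF r(1)] r(2) by simp
  next
    case False
    then have "\<nu> x = 0" using un ri unfolding unit_normal_def by blast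
    with False show ?thesis by (auto intro!: sum.neutral[symmetric] simp: indicator_def)
  qed
  have int: "integrable ?H (\<lambda>x. n r $ k * (indicator (open_facet (A r)) x * u x $ k))" if "r \<in> F" for r k
    by (intro integrable_mult_right integrable_hausdorff_open_facet[OF c N0[OF that] ob[OF that] uk])
  have "surface_inner F p U (\<lambda>x. 1 *\<^sub>R \<nu> x) =
      (\<integral>x. (\<Sum>r\<in>F. \<Sum>k\<in>UNIV. n r $ k * (indicator (open_facet (A r)) x * u x $ k)) \<partial>?H)"
    unfolding surface_inner_def set_lebesgue_integral_def eq ..
  also have "\<dots> = (\<Sum>r\<in>F. \<Sum>k\<in>UNIV. n r $ k * (c * facet_integral (A r) (\<lambda>x. u x $ k)))"
  proof -
    have I: "(\<integral>x. n r $ k * (indicator (open_facet (A r)) x * u x $ k) \<partial>?H) = n r $ k * (c * facet_integral (A r) (\<lambda>x. u x $ k))"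
      if "r \<in> F" for r k
      unfolding integral_mult_right_zero
      by (intro arg_cong2[where f="(*)"] refl hausdorff_open_facet_integral[OF c N0[OF that] ob[OF that]] borel_measurable_continuous_onI[OF uk])
    show ?thesis using int I
      by (subst Bochner_Integration.integral_sum) (auto intro!: sum.cong Bochner_Integration.integrable_sum simp del: integral_mult_right_zero mult_eq_0_iff)
  qed
  finally show ?thesis by (simp add: sum_distrib_left ac_simps)
qed

text \<open>Makes the \<open>Lim\<close> in the lumped product a genuine limit. In dimension 1 a
  facet would be a single point, equal to its own open facet, hence the bound on the
  dimension.\<close>

lemma vertex_islimpt_open_facet:
  fixes a :: "'n::finite \<Rightarrow> real^'n"
  assumes "rel_interior (convex hull (range a)) = open_facet a" "span_det a v \<noteq> 0" "CARD('n) \<ge> 2"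
  shows "a i islimpt open_facet a"
proof -
  have "a i \<notin> open_facet a"
  proof
    assume "a i \<in> open_facet a"
    then obtain u where u: "\<forall>j. 0 < u j" "sum u UNIV = 1" "a i = (\<Sum>j\<in>UNIV. u j *\<^sub>R a j)" unfolding open_facet_def by blast
    obtain j where j: "j \<noteq> i"
    proof -
      have "UNIV \<noteq> {i}" using assms(3) by (metis card_1_singleton_iff One_nat_def Suc_1 not_less_eq_eq order_refl)
      then show thesis using that by blast
    qed
    have "(\<Sum>j\<in>UNIV. (u j - (if j = i then 1 else 0)) *\<^sub>R a j) = 0 *\<^sub>R v"
      by (simp add: scaleR_diff_left sum_subtractf u(3)[symmetric] if_distrib[of "\<lambda>c. c *\<^sub>R _"] cong: if_cong)
    moreover have "(\<Sum>j\<in>UNIV. u j - (if j = i then 1 else 0)) = 0" by (simp add: sum_subtractf u(2))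
    ultimately have "u j - (if j = i then 1 else 0) = 0" using span_det_independent[OF assms(2)] by blast
    then show False using u(1) j by (metis diff_zero less_irrefl)
  qed
  moreover have "a i \<in> closure (open_facet a)"
  proof -
    have "closure (rel_interior (convex hull (range a))) = closure (convex hull (range a))"
      by (rule convex_closure_rel_interior) simp
    then show ?thesis using closure_subset[of "convex hull (range a)"] hull_inc[of "a i" "range a"] assms(1) by auto
  qed
  ultimately show ?thesis by (auto simp: closure_def)
qed

text \<open>Inside a facet the normal is constant, so the one-sided limit at a vertex is the normal
  component of V there. The weight, one d-th of the area, equals c * norm / d!; up to c this is the
  coefficient of the same vertex and facet in \<open>swept_volume_derivative\<close>.\<close>

lemma lumped_flux:
  fixes p :: "'k \<Rightarrow> real^'n" and e :: "'k set \<Rightarrow> 'n \<Rightarrow> 'k"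
  assumes c: "0 < c" "\<And>n a B. norm n = 1 \<Longrightarrow> B \<in> sets borel \<Longrightarrow> bounded B \<Longrightarrow> B \<subseteq> {x. n \<bullet> x = a} \<Longrightarrow>
      emeasure (hausdorff_measure (CARD('n) - 1)) B = ennreal (c * measure lebesgue (slab_over n a (B :: (real^'n) set)))"
    and d: "CARD('n) \<ge> 2" and e: "\<And>r. r \<in> F \<Longrightarrow> bij_betw (e r) UNIV r"
    and hull: "\<And>r. r \<in> F \<Longrightarrow> facet p r = convex hull (range (\<lambda>i. p (e r i)))"
    and ri: "\<And>r. r \<in> F \<Longrightarrow> rel_interior (facet p r) = open_facet (\<lambda>i. p (e r i))"
    and N0: "\<And>r. r \<in> F \<Longrightarrow> facet_normal (\<lambda>i. p (e r i)) \<noteq> 0"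
    and nn: "\<And>r x. r \<in> F \<Longrightarrow> x \<in> rel_interior (facet p r) \<Longrightarrow> \<nu> x = n r"
    and V: "V \<in> V_space F p"
  shows "lumped_inner F p V (\<lambda>x. 1 *\<^sub>R \<nu> x) =
    c * (\<Sum>r\<in>F. \<Sum>k\<in>r. norm (facet_normal (\<lambda>i. p (e r i))) / fact CARD('n) * (n r \<bullet> V (p k)))"
proof -
  let ?H = "hausdorff_measure (CARD('n) - 1) :: (real^'n) measure"
  let ?N = "\<lambda>r. norm (facet_normal (\<lambda>i. p (e r i)))"
  have Vc: "continuous_on (surface F p) V"
    using V unfolding V_space_def W_space_def by (auto intro!: continuous_on_vec_lambda[of "surface F p" "\<lambda>i x. V x $ i", unfolded vec_nth_inverse])
  have L: "Lim (at (p k) within rel_interior (facet p r)) (\<lambda>x. V x \<bullet> (1 *\<^sub>R \<nu> x)) = n r \<bullet> V (p k)" if r: "r \<in> F" and k: "k \<in> r" for r k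
  proof -
    let ?O = "rel_interior (facet p r)"
    obtain i where i: "k = e r i" using k e[OF r] by (auto simp: bij_betw_def)
    have "span_det (\<lambda>i. p (e r i)) (facet_normal (\<lambda>i. p (e r i))) \<noteq> 0" using N0[OF r] by (simp add: span_det_inner)
    then have "p k islimpt ?O"
      unfolding i ri[OF r] using ri[OF r] hull[OF r] d by (intro vertex_islimpt_open_facet[where a="\<lambda>i. p (e r i)"]) auto
    then have nt: "at (p k) within ?O \<noteq> bot" by (simp add: trivial_limit_within)
    have sub: "?O \<subseteq> surface F p" using rel_interior_subset[of "facet p r"] r by (auto simp: surface_def)
    have pk: "p k \<in> surface F p" unfolding surface_def facet_def using r k by (auto intro!: bexI[of _ r] hull_inc)
    have "(V \<longlongrightarrow> V (p k)) (at (p k) within ?O)"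
      using Vc pk sub by (meson continuous_on_def tendsto_within_subset)
    then have "((\<lambda>x. V x \<bullet> n r) \<longlongrightarrow> V (p k) \<bullet> n r) (at (p k) within ?O)" by (intro tendsto_intros)
    moreover have "\<forall>\<^sub>F x in at (p k) within ?O. V x \<bullet> n r = V x \<bullet> (1 *\<^sub>R \<nu> x)"
      unfolding eventually_at_filter using nn[OF r] by (intro always_eventually) simp
    ultimately have "((\<lambda>x. V x \<bullet> (1 *\<^sub>R \<nu> x)) \<longlongrightarrow> V (p k) \<bullet> n r) (at (p k) within ?O)"
      by (rule Lim_transform_eventually)
    then show ?thesis using tendsto_Lim[OF nt] by (simp only: inner_commute[of "V (p k)"])
  qed
  have M: "measure ?H (facet p r) = c * (CARD('n) * ?N r / fact CARD('n))" if "r \<in> F" for r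
  proof -
    have "emeasure ?H (facet p r) = ennreal (c * (CARD('n) * ?N r / fact CARD('n)))"
      unfolding hull[OF that] by (rule hausdorff_facet_measure[OF c N0[OF that]])
    moreover have "0 \<le> c * (CARD('n) * ?N r / fact CARD('n))" using c(1) by simp
    ultimately show ?thesis unfolding measure_def by (simp only: enn2real_ennreal)
  qed
  have "(\<Sum>r\<in>F. measure ?H (facet p r) * (\<Sum>k\<in>r. Lim (at (p k) within rel_interior (facet p r)) (\<lambda>x. V x \<bullet> (1 *\<^sub>R \<nu> x))))
      = (\<Sum>r\<in>F. c * (CARD('n) * ?N r / fact CARD('n)) * (\<Sum>k\<in>r. n r \<bullet> V (p k)))"
    by (intro sum.cong refl arg_cong2[where f="(*)"] M L)
  then have "lumped_inner F p V (\<lambda>x. 1 *\<^sub>R \<nu> x) = 1 / real CARD('n) * \<dots>" unfolding lumped_inner_def by simp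
  also have "\<dots> = c * (\<Sum>r\<in>F. \<Sum>k\<in>r. ?N r / fact CARD('n) * (n r \<bullet> V (p k)))"
    unfolding sum_distrib_left by (intro sum.cong refl) simp
  finally show ?thesis .
qed

section \<open>Conservation of the phase volumes\<close>

lemma (in finite_measure) integrable_of_square:
  fixes f :: "'a \<Rightarrow> real"
  assumes "f \<in> borel_measurable M" "integrable M (\<lambda>x. (f x)\<^sup>2)"
  shows "integrable M f"
proof (rule Bochner_Integration.integrable_bound[of M "\<lambda>x. 1 + (f x)\<^sup>2"])
  show "AE x in M. norm (f x) \<le> norm (1 + (f x)\<^sup>2)"
  proof (rule AE_I2)
    fix x
    have "0 \<le> (\<bar>f x\<bar> - 1/2)\<^sup>2" by simp
    then have "\<bar>f x\<bar> \<le> 1 + (f x)\<^sup>2" by (simp add: power2_diff power_divide)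
    then show "norm (f x) \<le> norm (1 + (f x)\<^sup>2)" by simp
  qed
qed (use assms in simp_all)

lemma finite_span_diff:
  assumes "finite_span V" "f \<in> V" "g \<in> V"
  shows "(\<lambda>x. f x - m *\<^sub>R g x) \<in> V"
proof -
  obtain B where B: "V = {(\<lambda>x. \<Sum>b\<in>B. c b *\<^sub>R b x) | c. True}" using assms(1) unfolding finite_span_def by blast
  obtain c d where cd: "f = (\<lambda>x. \<Sum>b\<in>B. c b *\<^sub>R b x)" "g = (\<lambda>x. \<Sum>b\<in>B. d b *\<^sub>R b x)" using assms(2,3) unfolding B mem_Collect_eq by (elim exE conjE)
  have "(\<lambda>x. f x - m *\<^sub>R g x) = (\<lambda>x. \<Sum>b\<in>B. (c b - m * d b) *\<^sub>R b x)"
    unfolding cd by (simp add: scaleR_diff_left sum_subtractf scaleR_sum_right)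
  then show ?thesis unfolding B by (intro CollectI exI conjI TrueI)
qed

text \<open>The pressure space contains the indicator and the constant 1 only up to null sets, so
  representatives p and p1 form the mean-free function p - m p1. The divergence itself has integral
  0 by \<open>H1_0_integral_weak_partial\<close>, so the subtracted mean does not change the
  integral.\<close>

lemma divergence_integral_over_indicator:
  fixes U :: "real^'n \<Rightarrow> real^'n"
  assumes \<Omega>: "open \<Omega>" "bounded \<Omega>" "\<Omega> \<noteq> {}" and U: "U \<in> H1_0_vec \<Omega>"
    and P: "finite_span P" "\<And>p. p \<in> P \<Longrightarrow> square_integrable \<Omega> p" "L2_mem \<Omega> (\<lambda>x. 1) P" "L2_mem \<Omega> (indicator A) P"
    and eq: "\<And>\<phi>. \<phi> \<in> zero_mean \<Omega> P \<Longrightarrow> L2_inner \<Omega> (divergence \<Omega> U) \<phi> = 0"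
    and A: "A \<in> sets borel"
  shows "(\<integral>x. divergence \<Omega> U x * indicator A x \<partial>lebesgue_on \<Omega>) = 0"
proof -
  let ?M = "lebesgue_on \<Omega>" and ?d = "divergence \<Omega> U"
  have \<Omega>b: "\<Omega> \<in> sets borel" using \<Omega>(1) by simp
  interpret finite_measure ?M by (rule finite_measure_lebesgue_on_bounded[OF \<Omega>(2) \<Omega>b])
  have Ui: "(\<lambda>x. U x $ i) \<in> H1_0 \<Omega>" for i using U by (simp add: H1_0_vec_def)
  have wi: "integrable ?M (weak_partial \<Omega> i (\<lambda>x. U x $ i))" for i
    using H1_0_integral_identity(1)[OF \<Omega>(1,2) Ui A, of 1] by simp
  have di: "integrable ?M ?d" unfolding divergence_def[abs_def] by (intro Bochner_Integration.integrable_sum wi)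
  have d0: "(\<integral>x. ?d x \<partial>?M) = 0"
    unfolding divergence_def[abs_def] using wi H1_0_integral_weak_partial[OF \<Omega>(1,2) Ui] by (simp add: Bochner_Integration.integral_sum)
  obtain p1 where p1: "p1 \<in> P" "AE x in ?M. 1 = p1 x" using P(3) unfolding L2_mem_def by blast
  obtain p where p: "p \<in> P" "AE x in ?M. indicator A x = p x" using P(4) unfolding L2_mem_def by blast
  have int: "integrable ?M r" if "r \<in> P" for r using P(2)[OF that] integrable_of_square unfolding square_integrable_def by blast
  define L where "L = measure ?M \<Omega>"
  have L: "L \<noteq> 0"
  proof
    assume "L = 0"
    then have "measure lebesgue \<Omega> = 0" using \<Omega>b by (simp add: L_def measure_restrict_space)
    moreover have "\<Omega> \<in> lmeasurable" using \<Omega>(1,2) by (rule lmeasurable_open[rotated])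
    ultimately have "negligible \<Omega>" by (simp add: negligible_iff_measure)
    with open_not_negligible[OF \<Omega>(1,3)] show False by simp
  qed
  have i1: "(\<integral>x. p1 x \<partial>?M) = L"
  proof -
    have "(\<integral>x. p1 x \<partial>?M) = (\<integral>x. 1 \<partial>?M)"
      using p1(2) int[OF p1(1)] by (intro integral_cong_AE) (auto elim: eventually_mono)
    then show ?thesis by (simp add: L_def)
  qed
  define m where "m = (\<integral>x. p x \<partial>?M) / L"
  define \<phi> where "\<phi> x = p x - m *\<^sub>R p1 x" for x
  have \<phi>P: "\<phi> \<in> P" unfolding \<phi>_def[abs_def] by (rule finite_span_diff[OF P(1) p(1) p1(1)])
  have "(\<integral>x. \<phi> x \<partial>?M) = (\<integral>x. p x \<partial>?M) - m * L" using int[OF p(1)] int[OF p1(1)] by (simp add: \<phi>_def i1)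
  then have "\<phi> \<in> zero_mean \<Omega> P" using \<phi>P L by (simp add: zero_mean_def m_def)
  then have "0 = (\<integral>x. ?d x * \<phi> x \<partial>?M)" using eq[of \<phi>] by (simp add: L2_inner_def)
  also have "\<dots> = (\<integral>x. ?d x * indicator A x - m * ?d x \<partial>?M)"
  proof (rule integral_cong_AE)
    have "indicat_real A \<in> borel_measurable lebesgue" using A by (intro borel_measurable_indicator) simp
    then have [measurable]: "indicat_real A \<in> borel_measurable ?M" by (rule measurable_restrict_space1)
    have [measurable]: "?d \<in> borel_measurable ?M" "\<phi> \<in> borel_measurable ?M" using di int[OF \<phi>P] by auto
    show "(\<lambda>x. ?d x * \<phi> x) \<in> borel_measurable ?M" "(\<lambda>x. ?d x * indicator A x - m * ?d x) \<in> borel_measurable ?M" by measurable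
    show "AE x in ?M. ?d x * \<phi> x = ?d x * indicator A x - m * ?d x"
      using p1(2) p(2)
    proof eventually_elim
      fix x assume *: "1 = p1 x" "indicator A x = p x"
      show "?d x * \<phi> x = ?d x * indicator A x - m * ?d x"
        unfolding \<phi>_def *(1)[symmetric] *(2)[symmetric] by (simp add: algebra_simps)
    qed
  qed
  also have "\<dots> = (\<integral>x. ?d x * indicator A x \<partial>?M) - m * (\<integral>x. ?d x \<partial>?M)"
  proof (subst Bochner_Integration.integral_diff)
    have "indicat_real A \<in> borel_measurable lebesgue" using A by (intro borel_measurable_indicator) simp
    then have [measurable]: "indicat_real A \<in> borel_measurable ?M" by (rule measurable_restrict_space1)
    show "integrable ?M (\<lambda>x. ?d x * indicator A x)"
    proof (rule Bochner_Integration.integrable_bound[OF di])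
      show "(\<lambda>x. ?d x * indicator A x) \<in> borel_measurable ?M"
        by (intro borel_measurable_times borel_measurable_integrable[OF di]) fact
    qed (auto simp: indicator_def)
  qed (use di in simp_all)
  finally show ?thesis by (simp add: d0)
qed

text \<open>The maps of \<open>swept_volume_derivative\<close> carry the surface at time t to the
  surface at time s, hence interior to interior. Both conclusions follow from this: the volume is
  that of an image, and a point off the surface has a neighbourhood of constant membership that
  small displacements do not leave.\<close>

lemma inside_evolution:
  fixes q :: "real \<Rightarrow> 'k \<Rightarrow> real^'n"
  assumes surf: "simplicial_surface F (q t)" and e: "\<And>r. r \<in> F \<Longrightarrow> bij_betw (e r) UNIV r"
    and sd: "sided F (\<lambda>r i. q t (e r i)) \<sigma> (inside (surface F (q t)))"
    and q: "\<And>k. k \<in> \<Union>F \<Longrightarrow> ((\<lambda>s. q s k) has_vector_derivative w k) (at t within S)"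
  shows "((\<lambda>s. measure lebesgue (inside (surface F (q s)))) has_real_derivative
       (\<Sum>k\<in>\<Union>F. \<Sum>r\<in>{r\<in>F. k \<in> r}. \<sigma> r * span_det (\<lambda>i. q t (e r i)) (w k) / fact CARD('n))) (at t within S)"
    and "x \<notin> surface F (q t) \<Longrightarrow>
      \<forall>\<^sub>F s in at t within S. x \<in> inside (surface F (q s)) \<longleftrightarrow> x \<in> inside (surface F (q t))"
proof -
  interpret simplicial_surface F "q t" by fact
  obtain f where f: "\<forall>\<^sub>F s in at t within S. \<exists>L. near_identity L (f s)"
    "\<And>s r. r \<in> F \<Longrightarrow> f s ` (convex hull (q t ` r)) = convex hull (q s ` r)"
    "\<And>x. ((\<lambda>s. f s x) \<longlongrightarrow> x) (at t within S)" "f t = id"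
    "((\<lambda>s. measure lebesgue (f s ` inside (surface F (q t)))) has_real_derivative
       (\<Sum>k\<in>\<Union>F. \<Sum>r\<in>{r\<in>F. k \<in> r}. \<sigma> r * span_det (\<lambda>i. q t (e r i)) (w k) / fact CARD('n))) (at t within S)"
  proof (rule swept_volume_derivative[OF surf e sd q])
    fix f :: "real \<Rightarrow> real^'n \<Rightarrow> real^'n"
    assume f: "\<forall>\<^sub>F s in at t within S. \<exists>L. near_identity L (f s)"
      "\<And>s r. r \<in> F \<Longrightarrow> f s ` (convex hull (q t ` r)) = convex hull (q s ` r)"
      "\<And>x. ((\<lambda>s. f s x) \<longlongrightarrow> x) (at t within S)" "f t = id"
      "((\<lambda>s. measure lebesgue (f s ` inside (surface F (q t)))) has_real_derivative
         (\<Sum>k\<in>\<Union>F. \<Sum>r\<in>{r\<in>F. k \<in> r}. \<sigma> r * span_det (\<lambda>i. q t (e r i)) (w k) / fact CARD('n))) (at t within S)"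
    show thesis by (rule that[OF f])
  qed
  have fs: "f s ` surface F (q t) = surface F (q s)" for s
    unfolding surface_def facet_def image_UN using f(2) by simp
  have ev: "\<forall>\<^sub>F s in at t within S. f s ` inside (surface F (q t)) = inside (surface F (q s))"
    using f(1)
  proof eventually_elim
    fix s assume "\<exists>L. near_identity L (f s)"
    then obtain L where "near_identity L (f s)" by blast
    from inside_image_near_identity[OF this, of "surface F (q t)"] show "f s ` inside (surface F (q t)) = inside (surface F (q s))"
      by (simp add: fs)
  qed
  show "((\<lambda>s. measure lebesgue (inside (surface F (q s)))) has_real_derivative
       (\<Sum>k\<in>\<Union>F. \<Sum>r\<in>{r\<in>F. k \<in> r}. \<sigma> r * span_det (\<lambda>i. q t (e r i)) (w k) / fact CARD('n))) (at t within S)"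
    by (rule iffD1[OF has_field_derivative_cong_eventually f(5)]) (use ev in \<open>auto elim: eventually_mono simp: f(4)\<close>)
  assume x: "x \<notin> surface F (q t)"
  let ?I = "inside (surface F (q t))"
  have clo: "closed (surface F (q t))"
    unfolding surface_def facet_def using finite_F finite_facet
    by (intro closed_UN) (auto intro!: compact_imp_closed finite_imp_compact_convex_hull)
  have "x \<notin> frontier ?I" using x frontier_inside_subset[OF clo] by blast
  then have "x \<in> interior ?I \<or> x \<in> - closure ?I" by (auto simp: frontier_def)
  then obtain \<rho> where \<rho>: "0 < \<rho>" "ball x \<rho> \<subseteq> ?I \<or> ball x \<rho> \<inter> ?I = {}"
  proof
    assume "x \<in> interior ?I"
    then obtain \<rho> where "0 < \<rho>" "ball x \<rho> \<subseteq> ?I" by (auto simp: mem_interior)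
    then show thesis using that by blast
  next
    assume "x \<in> - closure ?I"
    then obtain \<rho> where "0 < \<rho>" "ball x \<rho> \<subseteq> - closure ?I"
      by (metis closed_closure open_Compl open_contains_ball)
    then show thesis using that closure_subset by blast
  qed
  have "((\<lambda>s. 2 * norm (f s x - x)) \<longlongrightarrow> 2 * norm (x - x)) (at t within S)" by (intro tendsto_intros f(3))
  then have "\<forall>\<^sub>F s in at t within S. 2 * norm (f s x - x) < \<rho>" using \<rho>(1) by (intro order_tendstoD) auto
  with f(1) ev show "\<forall>\<^sub>F s in at t within S. x \<in> inside (surface F (q s)) \<longleftrightarrow> x \<in> ?I"
  proof eventually_elim
    fix s assume *: "\<exists>L. near_identity L (f s)" "f s ` ?I = inside (surface F (q s))" "2 * norm (f s x - x) < \<rho>"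
    then obtain L where "near_identity L (f s)" by blast
    from mem_image_near_identity_iff[OF this \<rho>(2) *(3)] show "x \<in> inside (surface F (q s)) \<longleftrightarrow> x \<in> ?I"
      unfolding *(2) .
  qed
qed

lemma negligible_frontier_polyhedral_domain:
  fixes \<Omega> :: "(real^'n) set"
  assumes "polyhedral_domain \<Omega>"
  shows "negligible (frontier \<Omega>)"
proof -
  obtain \<F> where F: "finite \<F>" "\<And>B. B \<in> \<F> \<Longrightarrow> polytope B \<and> aff_dim B = int CARD('n) - 1" "frontier \<Omega> = \<Union>\<F>"
    using assms unfolding polyhedral_domain_def by blast
  have "negligible B" if "B \<in> \<F>" for B
  proof -
    have "interior B = {}" using aff_dim_nonempty_interior[of B] F(2)[OF that] by auto
    then show ?thesis using F(2)[OF that] polytope_imp_convex negligible_convex_interior by blast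
  qed
  then show ?thesis unfolding F(3) using F(1) by (intro negligible_Union)
qed

text \<open>The interior of the surface can reach into holes of the domain, so its volume splits
  into the inner phase and an excess. The frontier of the domain is null, hence the excess may be
  taken outside the closure, where the surface never passes.\<close>

lemma phase_volumes:
  fixes \<Omega> :: "(real^'n) set"
  assumes \<Omega>: "open \<Omega>" "bounded \<Omega>" "negligible (frontier \<Omega>)" and G: "closed (surface F p)" "bounded (surface F p)" "negligible (surface F p)"
  shows "measure lebesgue (inner_phase \<Omega> F p) = measure lebesgue (inside (surface F p)) - measure lebesgue (inside (surface F p) - closure \<Omega>)"
    and "measure lebesgue (outer_phase \<Omega> F p) = measure lebesgue \<Omega> - measure lebesgue (inner_phase \<Omega> F p)"
proof -
  let ?I = "inside (surface F p)"
  have I: "?I \<in> lmeasurable" by (intro lmeasurable_open bounded_inside open_inside G)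
  have O: "\<Omega> \<in> lmeasurable" using \<Omega> by (intro lmeasurable_open)
  have IO: "?I \<inter> \<Omega> \<in> lmeasurable" using I O by (rule fmeasurable.Int)
  have ID: "?I - \<Omega> \<in> lmeasurable" using I O by (rule fmeasurable.Diff)
  have "measure lebesgue ?I = measure lebesgue ((?I \<inter> \<Omega>) \<union> (?I - \<Omega>))" by (simp add: Int_Diff_Un)
  also have "\<dots> = measure lebesgue (?I \<inter> \<Omega>) + measure lebesgue (?I - \<Omega>)"
    using fmeasurableD2[OF IO] fmeasurableD2[OF ID] fmeasurableD[OF IO] fmeasurableD[OF ID]
    by (intro measure_Union) (simp_all add: Diff_Int_distrib Int_Diff)
  also have "measure lebesgue (?I - \<Omega>) = measure lebesgue (?I - closure \<Omega>)"
  proof (rule measure_negligible_symdiff[OF ID, symmetric])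
    show "negligible (?I - \<Omega> - (?I - closure \<Omega>) \<union> (?I - closure \<Omega> - (?I - \<Omega>)))"
      by (rule negligible_subset[OF \<Omega>(3)]) (use closure_subset \<Omega>(1) in \<open>auto simp: frontier_def interior_open\<close>)
  qed
  finally show "measure lebesgue (inner_phase \<Omega> F p) = measure lebesgue ?I - measure lebesgue (?I - closure \<Omega>)"
    by (simp add: inner_phase_def)
  have OI: "\<Omega> - ?I \<inter> \<Omega> \<in> lmeasurable" using O IO by (rule fmeasurable.Diff)
  have "measure lebesgue (outer_phase \<Omega> F p) = measure lebesgue (\<Omega> - ?I \<inter> \<Omega>)"
  proof (rule measure_negligible_symdiff[OF OI])
    have "\<Omega> - ?I \<inter> \<Omega> - outer_phase \<Omega> F p \<union> (outer_phase \<Omega> F p - (\<Omega> - ?I \<inter> \<Omega>)) \<subseteq> surface F p"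
      unfolding outer_phase_def using inside_Un_outside[of "surface F p"] inside_Int_outside[of "surface F p"] by blast
    then show "negligible (\<Omega> - ?I \<inter> \<Omega> - outer_phase \<Omega> F p \<union> (outer_phase \<Omega> F p - (\<Omega> - ?I \<inter> \<Omega>)))"
      by (rule negligible_subset[OF G(3)])
  qed
  also have "\<dots> = measure lebesgue \<Omega> - measure lebesgue (?I \<inter> \<Omega>)"
    using fmeasurableD2[OF O] fmeasurableD[OF O] fmeasurableD[OF IO] by (intro measure_Diff) simp_all
  finally show "measure lebesgue (outer_phase \<Omega> F p) = measure lebesgue \<Omega> - measure lebesgue (inner_phase \<Omega> F p)"
    by (simp add: inner_phase_def)
qed

lemma closed_bounded_negligible_surface:
  fixes p :: "'k \<Rightarrow> real^'n"
  assumes cp: "closed_polyhedral_surface F p" and un: "unit_normal F p \<nu>"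
  shows "closed (surface F p)" "bounded (surface F p)" "negligible (surface F p)"
proof (rule_tac [!] surface_data[OF cp un])
  fix e :: "'k set \<Rightarrow> 'n \<Rightarrow> 'k" and n \<sigma>
  assume hull: "\<And>r. r \<in> F \<Longrightarrow> facet p r = convex hull (range (\<lambda>i. p (e r i)))"
  have F: "finite F" using cp unfolding closed_polyhedral_surface_def by blast
  show "closed (surface F p)"
    unfolding surface_def using F hull by (intro closed_UN) (auto intro: compact_imp_closed compact_hull_range)
  show "bounded (surface F p)"
    unfolding surface_def using F hull by (intro bounded_UN) (auto intro: compact_imp_bounded compact_hull_range)
  show "negligible (surface F p)"
    unfolding surface_def using F hull by (intro negligible_Union) (auto simp: negligible_hull_range)
qed

text \<open>A point off the closed domain is never on the surface, so by
  \<open>inside_evolution\<close> its membership is locally constant in time, hence constant on the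
  connected set S.\<close>

lemma inside_minus_closure_constant:
  fixes q :: "real \<Rightarrow> 'k \<Rightarrow> real^'n"
  assumes S: "connected S" "s \<in> S" "s' \<in> S"
    and cp: "\<And>t. t \<in> S \<Longrightarrow> closed_polyhedral_surface F (q t)" and un: "\<And>t. t \<in> S \<Longrightarrow> unit_normal F (q t) (\<nu> t)"
    and q: "\<And>t k. t \<in> S \<Longrightarrow> k \<in> \<Union>F \<Longrightarrow> (\<lambda>s. q s k) differentiable (at t within S)"
    and sub: "\<And>t. t \<in> S \<Longrightarrow> surface F (q t) \<subseteq> closure \<Omega>"
  shows "inside (surface F (q s)) - closure \<Omega> = inside (surface F (q s')) - closure \<Omega>"
proof -
  have "x \<in> inside (surface F (q s)) \<longleftrightarrow> x \<in> inside (surface F (q s'))" if x: "x \<notin> closure \<Omega>" for x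
  proof -
    have "(\<lambda>s. x \<in> inside (surface F (q s))) constant_on S"
    proof (rule locally_constant_imp_constant[OF S(1)])
      fix t assume t: "t \<in> S"
      have "\<forall>\<^sub>F s in at t within S. x \<in> inside (surface F (q s)) \<longleftrightarrow> x \<in> inside (surface F (q t))"
      proof (rule surface_data[OF cp[OF t] un[OF t]])
        fix e :: "'k set \<Rightarrow> 'n \<Rightarrow> 'k" and n \<sigma>
        assume e: "\<And>r. r \<in> F \<Longrightarrow> bij_betw (e r) UNIV r" and sd: "sided F (\<lambda>r i. q t (e r i)) \<sigma> (inside (surface F (q t)))"
        have d: "((\<lambda>s. q s k) has_vector_derivative vector_derivative (\<lambda>s. q s k) (at t within S)) (at t within S)"
          if "k \<in> \<Union>F" for k using q[OF t that] by (simp add: vector_derivative_works)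
        have xs: "x \<notin> surface F (q t)" using x sub[OF t] by blast
        show "\<forall>\<^sub>F s in at t within S. x \<in> inside (surface F (q s)) \<longleftrightarrow> x \<in> inside (surface F (q t))"
          by (rule inside_evolution(2)[where q=q and t=t, OF simplicial_surface_closed[OF cp[OF t]]]) (fact e sd d xs)+
      qed
      then obtain d where d: "d > 0" "\<And>s. s \<in> S \<Longrightarrow> s \<noteq> t \<Longrightarrow> dist s t < d \<Longrightarrow> x \<in> inside (surface F (q s)) \<longleftrightarrow> x \<in> inside (surface F (q t))"
        unfolding eventually_at by blast
      have "openin (top_of_set S) (S \<inter> ball t d)" by (simp add: openin_open_Int)
      moreover have "t \<in> S \<inter> ball t d" using t d(1) by simp
      moreover have "\<forall>s\<in>S \<inter> ball t d. (x \<in> inside (surface F (q s))) = (x \<in> inside (surface F (q t)))"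
      proof
        fix s assume "s \<in> S \<inter> ball t d"
        then show "(x \<in> inside (surface F (q s))) = (x \<in> inside (surface F (q t)))"
          using d(2)[of s] by (cases "s = t") (simp_all add: dist_commute)
      qed
      ultimately show "\<exists>T. openin (top_of_set S) T \<and> t \<in> T \<and> (\<forall>s\<in>T. (x \<in> inside (surface F (q s))) = (x \<in> inside (surface F (q t))))"
        by blast
    qed
    then show ?thesis using S(2,3) unfolding constant_on_def by blast
  qed
  then show ?thesis by blast
qed

lemma enclosed_volume_derivative_zero:
  fixes \<Omega> :: "(real^'n) set" and q :: "real \<Rightarrow> 'k \<Rightarrow> real^'n"
  assumes d: "CARD('n) \<ge> 2" and \<Omega>: "open \<Omega>" "bounded \<Omega>"
    and cp: "closed_polyhedral_surface F (q t)" and un: "unit_normal F (q t) \<nu>" and sub: "surface F (q t) \<subseteq> closure \<Omega>"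
    and q: "\<And>k. k \<in> \<Union>F \<Longrightarrow> ((\<lambda>s. q s k) has_vector_derivative V (q t k)) (at t within S)"
    and V: "V \<in> V_space F (q t)"
    and U: "U \<in> H1_0_vec \<Omega>" "continuous_on (closure \<Omega>) U" "\<And>x. x \<in> frontier \<Omega> \<Longrightarrow> U x = 0"
    and eq: "lumped_inner F (q t) V (\<lambda>x. 1 *\<^sub>R \<nu> x) = surface_inner F (q t) U (\<lambda>x. 1 *\<^sub>R \<nu> x)"
    and div: "(\<integral>x. divergence \<Omega> U x * indicator (inner_phase \<Omega> F (q t)) x \<partial>lebesgue_on \<Omega>) = 0"
  shows "((\<lambda>s. measure lebesgue (inside (surface F (q s)))) has_real_derivative 0) (at t within S)"
proof (rule surface_data[OF cp un])
  fix e :: "'k set \<Rightarrow> 'n \<Rightarrow> 'k" and n \<sigma>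
  let ?A = "\<lambda>r i. q t (e r i)" and ?I = "inside (surface F (q t))" and ?M = "lebesgue_on \<Omega>"
  assume e: "\<And>r. r \<in> F \<Longrightarrow> bij_betw (e r) UNIV r" and sd: "sided F ?A \<sigma> ?I"
    and hull: "\<And>r. r \<in> F \<Longrightarrow> facet (q t) r = convex hull (range (?A r))"
    and ri: "\<And>r. r \<in> F \<Longrightarrow> rel_interior (facet (q t) r) = open_facet (?A r)"
    and N0: "\<And>r. r \<in> F \<Longrightarrow> facet_normal (?A r) \<noteq> 0"
    and nn: "\<And>r x. r \<in> F \<Longrightarrow> x \<in> rel_interior (facet (q t) r) \<Longrightarrow> \<nu> x = n r"
    and sv: "\<And>r v. r \<in> F \<Longrightarrow> \<sigma> r * span_det (?A r) v / norm (facet_normal (?A r)) = n r \<bullet> v"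
  note surf = simplicial_surface_closed[OF cp]
  obtain c where c0: "0 < c" and c1: "\<forall>n a. \<forall>B::(real^'n) set. norm n = 1 \<longrightarrow> B \<in> sets borel \<longrightarrow> bounded B \<longrightarrow> B \<subseteq> {x. n \<bullet> x = a} \<longrightarrow>
      emeasure (hausdorff_measure (CARD('n) - 1)) B = ennreal (c * measure lebesgue (slab_over n a B))"
    using hausdorff_hyperplane by (elim exE conjE)
  have c: "emeasure (hausdorff_measure (CARD('n) - 1)) B = ennreal (c * measure lebesgue (slab_over n a B))"
    if "norm n = 1" "B \<in> sets borel" "bounded B" "B \<subseteq> {x. n \<bullet> x = a}" for n a and B :: "(real^'n) set"
    using c1[rule_format, OF that] .
  \<comment> \<open>The values of U outside the closed domain are arbitrary. The extension by zero
    is continuous because U vanishes on the frontier, and it agrees with U on the surface.\<close>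
  define u where "u x = (if x \<in> \<Omega> then U x else 0)" for x
  have uc: "continuous_on UNIV u"
  proof -
    have "continuous_on (closure \<Omega> \<union> - \<Omega>) u" unfolding u_def[abs_def]
      by (rule continuous_on_cases) (use \<Omega> U in \<open>auto simp: frontier_def interior_open\<close>)
    moreover have "closure \<Omega> \<union> - \<Omega> = UNIV" using closure_subset by blast
    ultimately show ?thesis by simp
  qed
  have uU: "U x = u x" if "x \<in> closure \<Omega>" for x
    using that U(3)[of x] \<Omega>(1) by (auto simp: u_def frontier_def interior_open)
  have I: "?I \<in> sets borel"
    using open_inside[OF closed_bounded_negligible_surface(1)[OF cp un]] by simp
  let ?D = "\<lambda>k. weak_partial \<Omega> k (\<lambda>x. U x $ k)"
  have Uk: "(\<lambda>x. U x $ k) \<in> H1_0 \<Omega>" for k using U(1) by (simp add: H1_0_vec_def)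
  have iD: "integrable ?M (?D k)" for k
    using H1_0_integral_identity(1)[OF \<Omega> Uk I, of 1] by simp
  have part: "(\<integral>x. ?D k x * indicator ?I x \<partial>?M) = (\<Sum>r\<in>F. n r $ k * facet_integral (?A r) (\<lambda>x. u x $ k))" for k
  proof -
    have "(\<integral>x. ?D k x * indicator ?I x \<partial>?M) =
        (\<Sum>r\<in>F. \<sigma> r * span_det (?A r) (axis k 1) / norm (facet_normal (?A r)) * facet_integral (?A r) (\<lambda>x. u x $ k))"
      by (rule H1_0_divergence_sided[OF \<Omega> Uk _ _ _ sd I]) (intro continuous_intros uc, simp_all add: u_def)
    also have "\<dots> = (\<Sum>r\<in>F. n r $ k * facet_integral (?A r) (\<lambda>x. u x $ k))"
      by (intro sum.cong refl) (simp add: sv inner_axis)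
    finally show ?thesis .
  qed
  have "0 = (\<integral>x. divergence \<Omega> U x * indicator (inner_phase \<Omega> F (q t)) x \<partial>?M)" using div by simp
  \<comment> \<open>On the domain the indicators of \<open>inner_phase\<close> and
    \<open>inside\<close> coincide, and the integral does not see the rest.\<close>
  also have "\<dots> = (\<integral>x. (\<Sum>k\<in>UNIV. ?D k x * indicator ?I x) \<partial>?M)"
    by (intro Bochner_Integration.integral_cong refl)
      (simp add: divergence_def inner_phase_def indicator_def sum_distrib_right)
  also have "\<dots> = (\<Sum>k\<in>UNIV. \<integral>x. ?D k x * indicator ?I x \<partial>?M)"
  proof (rule Bochner_Integration.integral_sum)
    fix k
    have "indicat_real ?I \<in> borel_measurable lebesgue" using I by (intro borel_measurable_indicator) simp
    then have "indicat_real ?I \<in> borel_measurable ?M" by (rule measurable_restrict_space1)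
    then have "(\<lambda>x. ?D k x * indicator ?I x) \<in> borel_measurable ?M"
      by (intro borel_measurable_times borel_measurable_integrable[OF iD])
    then show "integrable ?M (\<lambda>x. ?D k x * indicator ?I x)"
      by (rule Bochner_Integration.integrable_bound[OF iD]) (auto simp: indicator_def)
  qed
  also have "\<dots> = (\<Sum>r\<in>F. \<Sum>k\<in>UNIV. n r $ k * facet_integral (?A r) (\<lambda>x. u x $ k))"
    unfolding part by (rule sum.swap)
  finally have "surface_inner F (q t) U (\<lambda>x. 1 *\<^sub>R \<nu> x) = 0"
    using surface_flux[where U=U, OF c0 c un sd hull ri N0 nn uc uU[OF subsetD[OF sub]]] by (simp only: mult_zero_right)
  then have "c * (\<Sum>r\<in>F. \<Sum>k\<in>r. norm (facet_normal (?A r)) / fact CARD('n) * (n r \<bullet> V (q t k))) = 0"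
    unfolding eq[symmetric] by (simp only: lumped_flux[where e=e and n=n, OF c0 c d e hull ri N0 nn V])
  then have z: "(\<Sum>r\<in>F. \<Sum>k\<in>r. norm (facet_normal (?A r)) / fact CARD('n) * (n r \<bullet> V (q t k))) = 0"
    using c0 by simp
  have fin: "finite (\<Union>F)" "finite F"
    using simplicial_surface.finite_vertices[OF surf] simplicial_surface.finite_F[OF surf] .
  \<comment> \<open>The volume derivative is summed vertex by vertex over adjacent facets, the
    lumped product facet by facet over vertices; exchanging the order matches them term by
    term.\<close>
  have "(\<Sum>k\<in>\<Union>F. \<Sum>r\<in>{r\<in>F. k \<in> r}. \<sigma> r * span_det (?A r) (V (q t k)) / fact CARD('n)) =
      (\<Sum>r\<in>F. \<Sum>k\<in>{k\<in>\<Union>F. k \<in> r}. \<sigma> r * span_det (?A r) (V (q t k)) / fact CARD('n))"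
    using fin by (rule sum.swap_restrict)
  also have "\<dots> = (\<Sum>r\<in>F. \<Sum>k\<in>r. norm (facet_normal (?A r)) / fact CARD('n) * (n r \<bullet> V (q t k)))"
  proof (intro sum.cong refl)
    fix r assume r: "r \<in> F"
    then show "{k\<in>\<Union>F. k \<in> r} = r" by blast
    fix k
    show "\<sigma> r * span_det (?A r) (V (q t k)) / fact CARD('n) = norm (facet_normal (?A r)) / fact CARD('n) * (n r \<bullet> V (q t k))"
      using N0[OF r] by (simp add: sv[OF r, symmetric])
  qed
  finally have "(\<Sum>k\<in>\<Union>F. \<Sum>r\<in>{r\<in>F. k \<in> r}. \<sigma> r * span_det (?A r) (V (q t k)) / fact CARD('n)) = 0"
    unfolding z .
  then show ?thesis using inside_evolution(1)[where q=q and t=t and w="\<lambda>k. V (q t k)", OF surf e sd q] by simp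
qed

theorem mainTheorem4:
  fixes \<Omega> :: "(real^'n) set"
    and T \<gamma> \<mu>\<^sub>m \<mu>\<^sub>p :: real
    and \<T> :: "real \<Rightarrow> (real^'n) set set"
    and \<U> :: "real \<Rightarrow> (real^'n \<Rightarrow> real^'n) set"
    and \<P> :: "real \<Rightarrow> (real^'n \<Rightarrow> real) set"
    and F :: "'k set set"
    and q :: "real \<Rightarrow> 'k \<Rightarrow> real^'n"
    and \<nu> f f\<^sub>h U X X\<^sub>t :: "real \<Rightarrow> real^'n \<Rightarrow> real^'n"
    and P \<kappa> :: "real \<Rightarrow> real^'n \<Rightarrow> real"
  assumes dim: "CARD('n) \<in> {2, 3}"
    and domain: "polyhedral_domain \<Omega>"
    and pos: "T > 0" "\<gamma> > 0" "\<mu>\<^sub>m > 0" "\<mu>\<^sub>p > 0"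
    and mesh: "\<And>t. t \<in> {0..T} \<Longrightarrow> mesh_of \<Omega> (\<T> t)"
    and velocity: "\<And>t. t \<in> {0..T} \<Longrightarrow> velocity_space \<Omega> (\<T> t) (\<U> t)"
    and pressure: "\<And>t. t \<in> {0..T} \<Longrightarrow>
      pressure_space \<Omega> (\<T> t) (inner_phase \<Omega> F (q t)) (\<P> t)"
    and forcing: "\<And>t. t \<in> {0..T} \<Longrightarrow> quadratic_interpolant (\<T> t) (f t) (f\<^sub>h t)"
    and surf: "\<And>t. t \<in> {0..T} \<Longrightarrow> closed_polyhedral_surface F (q t)"
    and surf_subset: "\<And>t. t \<in> {0..T} \<Longrightarrow> surface F (q t) \<subseteq> closure \<Omega>"
    and diff: "\<And>t k. t \<in> {0..T} \<Longrightarrow> k \<in> \<Union>F \<Longrightarrow>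
      (\<lambda>s. q s k) differentiable (at t within {0..T})"
    and normal: "\<And>t. t \<in> {0..T} \<Longrightarrow> unit_normal F (q t) (\<nu> t)"
    and U_mem: "\<And>t. t \<in> {0<..T} \<Longrightarrow> U t \<in> \<U> t"
    and P_mem: "\<And>t. t \<in> {0<..T} \<Longrightarrow> P t \<in> zero_mean \<Omega> (\<P> t)"
    and X_id: "\<And>t. t \<in> {0<..T} \<Longrightarrow> X t \<in> V_space F (q t) \<and> (\<forall>x\<in>surface F (q t). X t x = x)"
    and Xt: "\<And>t. t \<in> {0<..T} \<Longrightarrow> X\<^sub>t t \<in> V_space F (q t) \<and>
      (\<forall>k\<in>\<Union>F. X\<^sub>t t (q t k) = vector_derivative (\<lambda>s. q s k) (at t within {0..T}))"
    and kappa_mem: "\<And>t. t \<in> {0<..T} \<Longrightarrow> \<kappa> t \<in> W_space F (q t)"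
    and eq_a: "\<And>t \<xi>. t \<in> {0<..T} \<Longrightarrow> \<xi> \<in> \<U> t \<Longrightarrow>
      2 * L2_inner \<Omega>
            (\<lambda>x. viscosity (\<T> t) (inner_phase \<Omega> F (q t)) (outer_phase \<Omega> F (q t)) \<mu>\<^sub>m \<mu>\<^sub>p x
                   *\<^sub>R sym_grad \<Omega> (U t) x)
            (sym_grad \<Omega> \<xi>)
        - L2_inner \<Omega> (P t) (divergence \<Omega> \<xi>)
        - \<gamma> * surface_inner F (q t) (\<lambda>x. \<kappa> t x *\<^sub>R \<nu> t x) \<xi>
      = L2_inner \<Omega> (f\<^sub>h t) \<xi>"
    and eq_b: "\<And>t \<phi>. t \<in> {0<..T} \<Longrightarrow> \<phi> \<in> zero_mean \<Omega> (\<P> t) \<Longrightarrow>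
      L2_inner \<Omega> (divergence \<Omega> (U t)) \<phi> = 0"
    and eq_c: "\<And>t \<phi>. t \<in> {0<..T} \<Longrightarrow> \<phi> \<in> W_space F (q t) \<Longrightarrow>
      lumped_inner F (q t) (X\<^sub>t t) (\<lambda>x. \<phi> x *\<^sub>R \<nu> t x)
        - surface_inner F (q t) (U t) (\<lambda>x. \<phi> x *\<^sub>R \<nu> t x) = 0"
    and eq_d: "\<And>t \<eta>. t \<in> {0<..T} \<Longrightarrow> \<eta> \<in> V_space F (q t) \<Longrightarrow>
      lumped_inner F (q t) (\<lambda>x. \<kappa> t x *\<^sub>R \<nu> t x) \<eta>
        + surface_inner F (q t) (surface_grad_vec F (q t) (X t)) (surface_grad_vec F (q t) \<eta>) = 0"
    and char_fun: "\<And>t. t \<in> {0<..T} \<Longrightarrow> L2_mem \<Omega> (indicator (inner_phase \<Omega> F (q t))) (\<P> t)"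
  shows "\<forall>t\<in>{0<..T}.
      ((\<lambda>s. measure lebesgue (inner_phase \<Omega> F (q s))) has_real_derivative 0) (at t within {0..T}) \<and>
      ((\<lambda>s. measure lebesgue (outer_phase \<Omega> F (q s))) has_real_derivative 0) (at t within {0..T})"
proof
  fix t assume t: "t \<in> {0<..T}"
  then have tS: "t \<in> {0..T}" by simp
  let ?S = "{0..T}" and ?I = "\<lambda>s. inside (surface F (q s))"
  have d: "CARD('n) \<ge> 2" using dim by auto
  have \<Omega>: "open \<Omega>" "bounded \<Omega>" "\<Omega> \<noteq> {}" using domain unfolding polyhedral_domain_def by blast+
  note fr = negligible_frontier_polyhedral_domain[OF domain]
  have vel: "U t \<in> H1_0_vec \<Omega>" "continuous_on (closure \<Omega>) (U t)" "\<And>x. x \<in> frontier \<Omega> \<Longrightarrow> U t x = 0"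
    using velocity[OF tS] U_mem[OF t] unfolding velocity_space_def by blast+
  have pr: "finite_span (\<P> t)" "\<And>p. p \<in> \<P> t \<Longrightarrow> square_integrable \<Omega> p" "L2_mem \<Omega> (\<lambda>x. 1) (\<P> t)"
    using pressure[OF tS] unfolding pressure_space_def by blast+
  have "open (inner_phase \<Omega> F (q t))" unfolding inner_phase_def
    using \<Omega>(1) open_inside[OF closed_bounded_negligible_surface(1)[OF surf[OF tS] normal[OF tS]]] by (rule open_Int[rotated])
  then have A: "inner_phase \<Omega> F (q t) \<in> sets borel" by simp
  have div: "(\<integral>x. divergence \<Omega> (U t) x * indicator (inner_phase \<Omega> F (q t)) x \<partial>lebesgue_on \<Omega>) = 0"
    by (rule divergence_integral_over_indicator[OF \<Omega> vel(1) pr char_fun[OF t] eq_b[OF t] A])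
  have one: "(\<lambda>x. 1) \<in> W_space F (q t)"
    unfolding W_space_def by (auto intro: exI[of _ "0 :: real^'n"])
  have eq: "lumped_inner F (q t) (X\<^sub>t t) (\<lambda>x. 1 *\<^sub>R \<nu> t x) = surface_inner F (q t) (U t) (\<lambda>x. 1 *\<^sub>R \<nu> t x)"
    using eq_c[OF t one] by simp
  have V: "X\<^sub>t t \<in> V_space F (q t)" using Xt[OF t] by blast
  have der: "((\<lambda>s. q s k) has_vector_derivative X\<^sub>t t (q t k)) (at t within ?S)" if "k \<in> \<Union>F" for k
  proof -
    have "X\<^sub>t t (q t k) = vector_derivative (\<lambda>s. q s k) (at t within ?S)" using Xt[OF t] that by blast
    then show ?thesis using diff[OF tS that] by (simp add: vector_derivative_works)
  qed
  have dI: "((\<lambda>s. measure lebesgue (?I s)) has_real_derivative 0) (at t within ?S)"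
    by (rule enclosed_volume_derivative_zero[OF d \<Omega>(1,2) surf[OF tS] normal[OF tS] surf_subset[OF tS] der V vel eq div])
  \<comment> \<open>The volume of the excess beyond the closed domain, the same at all times. With
    it the inner volume is that of \<open>inside\<close> up to a constant, and the outer volume is
    its negative up to a constant.\<close>
  define m where "m = measure lebesgue (?I t - closure \<Omega>)"
  have m: "measure lebesgue (?I s - closure \<Omega>) = m" if "s \<in> ?S" for s
    unfolding m_def
    by (rule arg_cong[where f="measure lebesgue"], rule inside_minus_closure_constant[where S="?S" and \<nu>=\<nu>])
      (use that tS surf normal diff surf_subset in auto)
  have vol: "measure lebesgue (inner_phase \<Omega> F (q s)) = measure lebesgue (?I s) - m"
    "measure lebesgue (outer_phase \<Omega> F (q s)) = measure lebesgue \<Omega> - (measure lebesgue (?I s) - m)" if "s \<in> ?S" for s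
    using phase_volumes[OF \<Omega>(1,2) fr closed_bounded_negligible_surface[OF surf[OF that] normal[OF that]]] m[OF that] by simp_all
  have "((\<lambda>s. measure lebesgue (?I s) - m) has_real_derivative 0) (at t within ?S)"
    using DERIV_diff[OF dI DERIV_const[of m]] by simp
  then have inner: "((\<lambda>s. measure lebesgue (inner_phase \<Omega> F (q s))) has_real_derivative 0) (at t within ?S)"
    \<comment> \<open>The identities \<open>vol\<close> hold on the whole time interval, so the
      radius 1 is arbitrary.\<close>
    by (rule has_field_derivative_transform_within[where d=1]) (use tS vol in auto)
  have "((\<lambda>s. measure lebesgue \<Omega> - (measure lebesgue (?I s) - m)) has_real_derivative 0) (at t within ?S)"
    using DERIV_diff[OF DERIV_const[of "measure lebesgue \<Omega>"] DERIV_diff[OF dI DERIV_const[of m]]] by simp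
  then have "((\<lambda>s. measure lebesgue (outer_phase \<Omega> F (q s))) has_real_derivative 0) (at t within ?S)"
    by (rule has_field_derivative_transform_within[where d=1]) (use tS vol in auto)
  with inner show "((\<lambda>s. measure lebesgue (inner_phase \<Omega> F (q s))) has_real_derivative 0) (at t within ?S) \<and>
      ((\<lambda>s. measure lebesgue (outer_phase \<Omega> F (q s))) has_real_derivative 0) (at t within ?S)" ..
qed

end
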